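(* Assume that for every $a>0$: (i) $\mathbb E[e^{a\ell(Z^{(1)})}]<+\infty$, $\mathbb E[e^{aZ^{(1)}}]<+\infty$, $\mathbb E[e^{aZ^{(2)}}]<+\infty$; and (ii) $\mathbb E[e^{a\int_0^Tq^{u_M}_t\,dt}]<+\infty$. Let $U=[u_M,u_N]\subset\overline{\mathbb R}$ and let $\Phi(z,u)$ be increasing in $u$. Suppose that $\Phi(z,u)$ is differentiable in $u\in[u_M,u_N]$ for almost every $z\in(0,+\infty)$ and that $$\widetilde f(t,\omega,w,\theta(\cdot),u)=-w\,\eta e^{r(T-t)}q(t,\omega,u)-\int_0^{+\infty}(w+\theta(z))\big(e^{-\eta e^{r(T-t)}(z-\Phi(z,u))}-1\big)\pi_{t^-}(\lambda)(\omega)F^{(1)}(dz)$$ is strictly concave in $u\in[u_M,u_N]$. Then the optimal reinsurance strategy is $u^*_t=\hat u(t,W^N_{t^-},\Theta^{W^N}_t(\cdot))$, $t\in[0,T]$, where $$\hat u(t,\omega,w,\theta(\cdot))=\begin{cases}u_M&\text{if }(t,\omega,w,\theta(\cdot))\in R_0,\\ \bar u(t,\omega,w,\theta(\cdot))&\text{if }(t,\omega,w,\theta(\cdot))\in\mathbb M\setminus(R_0\cup R_1),\\ u_N&\text{if }(t,\omega,w,\theta(\cdot))\in R_1,\end{cases}$$ with the two regions $$R_0=\Big\{(t,\omega,w,\theta(\cdot))\in\mathbb M:\frac{\partial\widetilde f(t,\omega,w,\theta(\cdot),u_M)}{\partial u}<0\Big\},\qquad R_1=\Big\{(t,\omega,w,\theta(\cdot))\in\mathbb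 M:\frac{\partial\widetilde f(t,\omega,w,\theta(\cdot),u_N)}{\partial u}>0\Big\},$$ and $\bar u=\bar u(t,\omega,w,\theta(\cdot))\in(u_M,u_N)$ solves the following equation in $u$: $$-w\,\frac{\partial q(t,\omega,u)}{\partial u}=\int_0^{+\infty}[w+\theta(z)]\,e^{-\eta e^{r(T-t)}(z-\Phi(z,u))}\,\frac{\partial\Phi(z,u)}{\partial u}\,\pi_{t^-}(\lambda)(\omega)F^{(1)}(dz).$$
   Context: Model. Fix $T>0$, constants $\alpha,\beta,\lambda_0,\rho>0$, a measurable function $\ell:[0,+\infty)\to[0,+\infty)$ and distribution functions $F^{(1)},F^{(2)}$ on $(0,+\infty)$. Let $(\Omega,\mathcal F,\mathbf P;\mathbb F)$ be a filtered probability space satisfying the usual hypotheses. For $i=1,2$, $N^{(i)}$ is a counting process with jump times $\{T^{(i)}_n\}_{n\ge1}$, and $\{Z^{(i)}_n\}_{n\ge1}$ are i.i.d. positive marks with distribution $F^{(i)}$ ($Z^{(i)}$ is a generic one). $N^{(2)}$ is Poisson with intensity $\rho$, and $N^{(2)},\{Z^{(1)}_n\},\{Z^{(2)}_n\}$ are independent of each other. Put $$\lambda_t=\beta+(\lambda_0-\beta)e^{-\alpha t}+\sum_{j=1}^{N^{(1)}_t}e^{-\alpha(t-T^{(1)}_j)}\ell(Z^{(1)}_j)+\sum_{j=1}^{N^{(2)}_t}e^{-\alpha(t-T^{(2)}_j)}Z^{(2)}_j ,$$ $m^{(i)}(dt,dz)=\sum_{n\ge1}\delta_{(T^{(i)}_n,Z^{(i)}_n)}(dt,dz)\mathbf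 1_{\{T^{(i)}_n<+\infty\}}$; the $(\mathbf P,\mathbb F)$-compensators of $m^{(1)},m^{(2)}$ are $\lambda_{t^-}F^{(1)}(dz)dt$ and $\rho F^{(2)}(dz)dt$. $C_t=\sum_{j=1}^{N^{(1)}_t}Z^{(1)}_j$, $\mathbb H=\{\mathcal H_t\}$ is the natural filtration of $C$, $\pi_t(\lambda)=\mathbb E[\lambda_t\mid\mathcal H_t]$ (càdlàg version), and $\widetilde m^{(1)}(dt,dz)=m^{(1)}(dt,dz)-\pi_{t^-}(\lambda)F^{(1)}(dz)dt$. Reinsurance. $\overline{\mathbb R}$ is the compactification of $\mathbb R$. The retention function $\Phi(z,u)$, $(z,u)\in[0,+\infty)\times U$, is continuous in $u$, with $0\le\Phi(z,u_M)\le\Phi(z,u)\le\Phi(z,u_N)=z$ ($u_N$ is null reinsurance, $u_M$ maximum reinsurance). The reinsurance premium is $q^u_t(\omega)=q(t,\omega,u_t(\omega))$, with $q:[0,T]\times\Omega\times U\to[0,+\infty)$ $\mathbb H$-predictable in $(t,\omega)$, continuous in $u$ with continuous derivative in $u$, $q(t,\omega,u_N)=0$, $q(t,\omega,u)\le q(t,\omega,u_M)$, and $\mathbb E[\int_0^Tq^{u_M}_tdt]<+\infty$. The insurance premium rate $c$ is $\mathbb H$-predictable with $\mathbb E[\int_0^Tc_tdt]<+\infty$. Given $r>0$, $\eta>0$, $R_0\in\mathbb R^+$, wealth is $$X^u_t=R_0e^{rt}+\int_0^te^{r(t-s)}(c_s-q^u_s)ds-\int_0^t\int_0^{+\infty}e^{r(t-s)}\Phi(z,u_s)m^{(1)}(ds,dz).$$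 $\mathcal U$ is the set of $U$-valued $\mathbb H$-predictable processes $u$ on $[0,T]$ with $\mathbb E[e^{-\eta X^u_T}]<+\infty$; a strategy is optimal if it attains $\inf_{u\in\mathcal U}\mathbb E[e^{-\eta X^u_T}]$. $X^N$ is the wealth for $u\equiv u_N$, and $$W^N_t=\operatorname*{ess\,inf}\big\{\mathbb E[e^{-\eta X^{\bar u}_T}\mid\mathcal H_t]:\bar u\in\mathcal U,\ \bar u_s=u_N\text{ a.s. for all }s\le t\big\}.$$ $\mathbb M$ is the set of all $(t,\omega,w,\theta(\cdot))$ with $(t,\omega,w)\in[0,T]\times\Omega\times[0,+\infty)$ and $\theta:[0,+\infty)\to\mathbb R$ measurable; $\widetilde f$ is a real-valued function of $(t,\omega,w,\theta(\cdot))\in\mathbb M$ and $u\in U$. $(W^N,\Theta^{W^N})$ is the unique solution in $\mathcal L^2\times\widehat{\mathcal L}^2$ of the BSDE $$W^N_t=e^{-\eta X^N_T}-\int_t^T\int_0^{+\infty}\Theta^{W^N}_s(z)\widetilde m^{(1)}(ds,dz)-\int_t^T\operatorname*{ess\,sup}_{u\in\mathcal U}\widetilde f(s,W^N_{s^-},\Theta^{W^N}_s(\cdot),u_s)ds ,$$ where the argument $\omega$ of $\widetilde f$ is suppressed, and any $u^*\in\mathcal U$ attaining the essential supremum in the driver for all $t$ is optimal. Here $\mathcal L^2$ is the space of càdlàg $\mathbb H$-adapted $Y$ with $\mathbb E[\int_0^T|Y_t|^2dt]<+\infty$, and $\widehat{\mathcal L}^2$ the space of $\mathbb H$-predictable random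 fields $\Theta_t(z)$ with $\mathbb E[\int_0^T\int_0^{+\infty}\Theta_t^2(z)\pi_{t^-}(\lambda)F^{(1)}(dz)dt]<+\infty$.
   Formalization: Differentiation of f̃ in u under the integral is assumed where used; ū lies in [u_M,u_N], and in the open interval only if ∂f̃/∂u is nonzero at both ends; strict concavity is assumed only along (t,ω,W_{t-},Θ_t) and at the points where ū is described, as it fails on all of M. *)

theory Defs
  imports "HOL-Probability.Probability"
begin

section \<open>General notions\<close>

definition left_lim :: "(real \<Rightarrow> real) \<Rightarrow> real \<Rightarrow> real" where
  "left_lim f t = (if t \<le> 0 then f 0 else Lim (at_left t) f)"

definition cadlag_on :: "real \<Rightarrow> (real \<Rightarrow> real) \<Rightarrow> bool" where
  "cadlag_on T f \<longleftrightarrow>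
     (\<forall>t\<in>{0..<T}. (f \<longlongrightarrow> f t) (at_right t)) \<and>
     (\<forall>t\<in>{0<..T}. \<exists>l. (f \<longlongrightarrow> l) (at_left t))"

definition generated_sigma :: "'a measure \<Rightarrow> 'i set \<Rightarrow> ('i \<Rightarrow> 'a \<Rightarrow> real) \<Rightarrow> 'a measure" where
  "generated_sigma M I X =
     sigma (space M) {X i -` A \<inter> space M | i A. i \<in> I \<and> A \<in> sets borel}"

definition usual_hypotheses :: "'a measure \<Rightarrow> (real \<Rightarrow> 'a measure) \<Rightarrow> bool" where
  "usual_hypotheses M F \<longleftrightarrow>
     complete_measure M \<and>
     (\<forall>t\<ge>0. subalgebra M (F t)) \<and>
     (\<forall>s t. 0 \<le> s \<and> s \<le> t \<longrightarrow> sets (F s) \<subseteq> sets (F t)) \<and>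
     null_sets M \<subseteq> sets (F 0) \<and>
     (\<forall>t\<ge>0. sets (F t) = (\<Inter>s\<in>{t<..}. sets (F s)))"

text \<open>Predictable \<open>\<sigma>\<close>-algebra on \<open>I \<times> \<Omega>\<close>, where \<open>I\<close> is \<open>[0,\<infinity>)\<close> or \<open>[0,T]\<close>.\<close>

definition predictable :: "real set \<Rightarrow> 'a measure \<Rightarrow> (real \<Rightarrow> 'a measure) \<Rightarrow> (real \<times> 'a) measure" where
  "predictable I M F = sigma (I \<times> space M)
     ({{0} \<times> A | A. A \<in> sets (F 0)} \<union>
      {({s<..t} \<inter> I) \<times> A | s t A. 0 \<le> s \<and> s < t \<and> A \<in> sets (F s)})"

text \<open>Essential infimum and supremum of a family of random variables. The library's
  \<open>esssup\<close> is that of a single function. A real-valued essential infimum of the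
  empty family does not exist.\<close>

definition is_ess_inf :: "'a measure \<Rightarrow> ('a \<Rightarrow> real) set \<Rightarrow> ('a \<Rightarrow> real) \<Rightarrow> bool" where
  "is_ess_inf M XX Y \<longleftrightarrow>
     Y \<in> borel_measurable M \<and> (\<forall>X\<in>XX. AE x in M. Y x \<le> X x) \<and>
     (\<forall>Y'\<in>borel_measurable M. (\<forall>X\<in>XX. AE x in M. Y' x \<le> X x) \<longrightarrow> (AE x in M. Y' x \<le> Y x))"

definition is_ess_sup :: "'a measure \<Rightarrow> ('a \<Rightarrow> real) set \<Rightarrow> ('a \<Rightarrow> real) \<Rightarrow> bool" where
  "is_ess_sup M XX Y \<longleftrightarrow>
     Y \<in> borel_measurable M \<and> (\<forall>X\<in>XX. AE x in M. X x \<le> Y x) \<and>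
     (\<forall>Y'\<in>borel_measurable M. (\<forall>X\<in>XX. AE x in M. X x \<le> Y' x) \<longrightarrow> (AE x in M. Y x \<le> Y' x))"


section \<open>Calculus in a control variable ranging over an extended real interval\<close>

text \<open>At a finite endpoint of \<open>U\<close> the derivative is one-sided; at an infinite one it is the
  limit of the derivatives at nearby real points, i.e. the continuous extension of the
  derivative to the compactified line.\<close>

definition has_deriv_in :: "ereal set \<Rightarrow> (ereal \<Rightarrow> real) \<Rightarrow> real \<Rightarrow> ereal \<Rightarrow> bool" where
  "has_deriv_in U g D u \<longleftrightarrow> (case u of
       ereal x \<Rightarrow> ((\<lambda>y. g (ereal y)) has_real_derivative D) (at x within {y. ereal y \<in> U})
     | PInfty \<Rightarrow> (\<exists>g'. (\<forall>\<^sub>F y in at_top. ((\<lambda>y. g (ereal y)) has_real_derivative g' y) (at y)) \<and>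
                       (g' \<longlongrightarrow> D) at_top)
     | MInfty \<Rightarrow> (\<exists>g'. (\<forall>\<^sub>F y in at_bot. ((\<lambda>y. g (ereal y)) has_real_derivative g' y) (at y)) \<and>
                       (g' \<longlongrightarrow> D) at_bot))"

definition deriv_in :: "ereal set \<Rightarrow> (ereal \<Rightarrow> real) \<Rightarrow> ereal \<Rightarrow> real" where
  "deriv_in U g u = (THE D. has_deriv_in U g D u)"

text \<open>Strict concavity, tested on the real points of \<open>U\<close>.\<close>

definition strictly_concave_in :: "ereal set \<Rightarrow> (ereal \<Rightarrow> real) \<Rightarrow> bool" where
  "strictly_concave_in U g \<longleftrightarrow>
     (\<forall>x y s. ereal x \<in> U \<longrightarrow> ereal y \<in> U \<longrightarrow> x \<noteq> y \<longrightarrow> 0 < s \<longrightarrow> s < 1 \<longrightarrow>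
        s * g (ereal x) + (1 - s) * g (ereal y) < g (ereal (s * x + (1 - s) * y)))"


section \<open>Marked point processes\<close>

text \<open>Jump times and marks are indexed by \<open>n \<ge> 1\<close>; a jump time \<open>\<infinity>\<close> means that the
  jump does not occur.\<close>

definition counting :: "(nat \<Rightarrow> 'a \<Rightarrow> ereal) \<Rightarrow> real \<Rightarrow> 'a \<Rightarrow> nat" where
  "counting \<tau> t \<omega> = card {n. 1 \<le> n \<and> \<tau> n \<omega> \<le> ereal t}"

definition jump_times :: "'a measure \<Rightarrow> (nat \<Rightarrow> 'a \<Rightarrow> ereal) \<Rightarrow> bool" where
  "jump_times M \<tau> \<longleftrightarrow> (\<forall>\<omega>\<in>space M.
     0 < \<tau> 1 \<omega> \<and>
     (\<forall>n\<ge>1. \<tau> n \<omega> \<le> \<tau> (Suc n) \<omega> \<and> (\<tau> n \<omega> < \<infinity> \<longrightarrow> \<tau> n \<omega> < \<tau> (Suc n) \<omega>)) \<and>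
     (\<forall>t. finite {n. 1 \<le> n \<and> \<tau> n \<omega> \<le> ereal t}))"

text \<open>The random measure that puts a unit mass at each \<open>(\<tau>\<^sub>n, \<zeta>\<^sub>n)\<close> with \<open>\<tau>\<^sub>n < \<infinity>\<close>.\<close>

definition jump_measure ::
    "(nat \<Rightarrow> 'a \<Rightarrow> ereal) \<Rightarrow> (nat \<Rightarrow> 'a \<Rightarrow> real) \<Rightarrow> 'a \<Rightarrow> (real \<times> real) measure" where
  "jump_measure \<tau> \<zeta> \<omega> =
     distr (count_space {n. 1 \<le> n \<and> \<tau> n \<omega> < \<infinity>}) (borel \<Otimes>\<^sub>M borel)
       (\<lambda>n. (real_of_ereal (\<tau> n \<omega>), \<zeta> n \<omega>))"

text \<open>\<open>m\<close> is adapted and \<open>k\<^sub>t F(dz) dt\<close> is its compensator, in the usual sense of equality of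
  expected integrals of all nonnegative predictable random fields.\<close>

definition has_compensator ::
    "'a measure \<Rightarrow> (real \<Rightarrow> 'a measure) \<Rightarrow> ('a \<Rightarrow> (real \<times> real) measure) \<Rightarrow>
     (real \<Rightarrow> 'a \<Rightarrow> real) \<Rightarrow> real measure \<Rightarrow> bool" where
  "has_compensator M FF m k F \<longleftrightarrow>
     (\<forall>t\<ge>0. \<forall>B\<in>sets borel. (\<lambda>\<omega>. emeasure (m \<omega>) ({0<..t} \<times> B)) \<in> borel_measurable (FF t)) \<and>
     (\<forall>\<Gamma> \<in> borel_measurable (predictable {0..} M FF \<Otimes>\<^sub>M borel).
        (\<integral>\<^sup>+\<omega>. (\<integral>\<^sup>+x. (case x of (t, z) \<Rightarrow> \<Gamma> ((t, \<omega>), z) * indicator {0<..} t) \<partial>m \<omega>) \<partial>M) =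
        (\<integral>\<^sup>+\<omega>. (\<integral>\<^sup>+t\<in>{0<..}. (\<integral>\<^sup>+z. \<Gamma> ((t, \<omega>), z) * ennreal (k t \<omega>) \<partial>F) \<partial>lborel) \<partial>M))"

definition poisson_process :: "'a measure \<Rightarrow> real \<Rightarrow> (real \<Rightarrow> 'a \<Rightarrow> nat) \<Rightarrow> bool" where
  "poisson_process M \<rho> N \<longleftrightarrow>
     (\<forall>\<omega>\<in>space M. N 0 \<omega> = 0) \<and>
     (\<forall>s t. 0 \<le> s \<and> s < t \<longrightarrow>
        (\<lambda>\<omega>. N t \<omega> - N s \<omega>) \<in> measurable M (count_space UNIV) \<and>
        distr M (count_space UNIV) (\<lambda>\<omega>. N t \<omega> - N s \<omega>) = measure_pmf (poisson_pmf (\<rho> * (t - s))) \<and>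
        prob_space.indep_set M
          (sets (generated_sigma M {0..s} (\<lambda>r \<omega>. real (N r \<omega>))))
          (sets (generated_sigma M {()} (\<lambda>_ \<omega>. real (N t \<omega> - N s \<omega>)))))"

definition iid_marks :: "'a measure \<Rightarrow> real measure \<Rightarrow> (nat \<Rightarrow> 'a \<Rightarrow> real) \<Rightarrow> bool" where
  "iid_marks M F \<zeta> \<longleftrightarrow>
     prob_space.indep_vars M (\<lambda>_. borel) \<zeta> {1..} \<and>
     (\<forall>n\<ge>1. distr M borel (\<zeta> n) = F \<and> (\<forall>\<omega>\<in>space M. 0 < \<zeta> n \<omega>))"


section \<open>The contagion model with reinsurance\<close>

text \<open>\<open>PP\<close>, \<open>FF\<close>: filtered probability space; \<open>F1\<close>, \<open>F2\<close>: mark distributions, as measures;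
  \<open>J1\<close>, \<open>J2\<close>: jump times; \<open>Z1\<close>, \<open>Z2\<close>: marks; \<open>filt\<close>: the filtered intensity \<open>\<pi>(\<lambda>)\<close>;
  \<open>wealth0\<close>, \<open>rate\<close>, \<open>eta\<close>: initial wealth, interest rate, risk aversion; \<open>prem\<close>, \<open>rprem\<close>:
  insurance premium rate \<open>c\<close> and reinsurance premium \<open>q\<close>; \<open>Phi\<close>: retention function; \<open>uM\<close>, \<open>uN\<close>:
  maximum and null reinsurance.\<close>

record 'a reinsurance_model =
  PP :: "'a measure"
  FF :: "real \<Rightarrow> 'a measure"
  horizon :: real
  alpha :: real
  beta :: real
  lambda0 :: real
  rho :: real
  ell :: "real \<Rightarrow> real"
  F1 :: "real measure"
  F2 :: "real measure"
  J1 :: "nat \<Rightarrow> 'a \<Rightarrow> ereal"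
  J2 :: "nat \<Rightarrow> 'a \<Rightarrow> ereal"
  Z1 :: "nat \<Rightarrow> 'a \<Rightarrow> real"
  Z2 :: "nat \<Rightarrow> 'a \<Rightarrow> real"
  filt :: "real \<Rightarrow> 'a \<Rightarrow> real"
  wealth0 :: real
  rate :: real
  eta :: real
  prem :: "real \<Rightarrow> 'a \<Rightarrow> real"
  rprem :: "real \<Rightarrow> 'a \<Rightarrow> ereal \<Rightarrow> real"
  Phi :: "real \<Rightarrow> ereal \<Rightarrow> real"
  uM :: ereal
  uN :: ereal

definition intensity :: "'a reinsurance_model \<Rightarrow> real \<Rightarrow> 'a \<Rightarrow> real" where
  "intensity S t \<omega> =
     beta S + (lambda0 S - beta S) * exp (- alpha S * t)
     + (\<Sum>j = 1..counting (J1 S) t \<omega>.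
          exp (- alpha S * (t - real_of_ereal (J1 S j \<omega>))) * ell S (Z1 S j \<omega>))
     + (\<Sum>j = 1..counting (J2 S) t \<omega>.
          exp (- alpha S * (t - real_of_ereal (J2 S j \<omega>))) * Z2 S j \<omega>)"

definition loss :: "'a reinsurance_model \<Rightarrow> real \<Rightarrow> 'a \<Rightarrow> real" where
  "loss S t \<omega> = (\<Sum>j = 1..counting (J1 S) t \<omega>. Z1 S j \<omega>)"

definition HH :: "'a reinsurance_model \<Rightarrow> real \<Rightarrow> 'a measure" where
  "HH S t = generated_sigma (PP S) {0..t} (loss S)"

abbreviation m1 :: "'a reinsurance_model \<Rightarrow> 'a \<Rightarrow> (real \<times> real) measure" where
  "m1 S \<equiv> jump_measure (J1 S) (Z1 S)"

abbreviation m2 :: "'a reinsurance_model \<Rightarrow> 'a \<Rightarrow> (real \<times> real) measure" where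
  "m2 S \<equiv> jump_measure (J2 S) (Z2 S)"

abbreviation predH :: "'a reinsurance_model \<Rightarrow> (real \<times> 'a) measure" where
  "predH S \<equiv> predictable {0..horizon S} (PP S) (HH S)"

abbreviation filt_left :: "'a reinsurance_model \<Rightarrow> real \<Rightarrow> 'a \<Rightarrow> real" where
  "filt_left S t \<omega> \<equiv> left_lim (\<lambda>s. filt S s \<omega>) t"

abbreviation UU :: "'a reinsurance_model \<Rightarrow> ereal set" where
  "UU S \<equiv> {uM S..uN S}"

text \<open>The intensity is nonnegative, so its conditional expectation is taken with
  \<open>nn_cond_exp\<close>.\<close>

definition contagion_model :: "'a reinsurance_model \<Rightarrow> bool" where
  "contagion_model S \<longleftrightarrow>
     prob_space (PP S) \<and> usual_hypotheses (PP S) (FF S) \<and>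
     0 < horizon S \<and> 0 < alpha S \<and> 0 < beta S \<and> 0 < lambda0 S \<and> 0 < rho S \<and>
     ell S \<in> borel_measurable (restrict_space borel {0..}) \<and> (\<forall>z\<ge>0. 0 \<le> ell S z) \<and>
     real_distribution (F1 S) \<and> (AE z in F1 S. 0 < z) \<and>
     real_distribution (F2 S) \<and> (AE z in F2 S. 0 < z) \<and>
     jump_times (PP S) (J1 S) \<and> jump_times (PP S) (J2 S) \<and>
     iid_marks (PP S) (F1 S) (Z1 S) \<and> iid_marks (PP S) (F2 S) (Z2 S) \<and>
     poisson_process (PP S) (rho S) (counting (J2 S)) \<and>
     prob_space.indep_sets (PP S)
       (\<lambda>k::nat. [sets (generated_sigma (PP S) {0..} (\<lambda>t \<omega>. real (counting (J2 S) t \<omega>))),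
                  sets (generated_sigma (PP S) {1..} (Z1 S)),
                  sets (generated_sigma (PP S) {1..} (Z2 S))] ! k) {..<3} \<and>
     has_compensator (PP S) (FF S) (m1 S) (\<lambda>t \<omega>. left_lim (\<lambda>s. intensity S s \<omega>) t) (F1 S) \<and>
     has_compensator (PP S) (FF S) (m2 S) (\<lambda>t \<omega>. rho S) (F2 S) \<and>
     (\<forall>\<omega>\<in>space (PP S). cadlag_on (horizon S) (\<lambda>t. filt S t \<omega>)) \<and>
     (\<forall>t\<in>{0..horizon S}. filt S t \<in> borel_measurable (HH S t) \<and>
        (AE \<omega> in PP S. ennreal (filt S t \<omega>) =
           nn_cond_exp (PP S) (HH S t) (\<lambda>\<omega>. ennreal (intensity S t \<omega>)) \<omega>) \<and>
        (AE \<omega> in PP S. 0 \<le> filt S t \<omega>))"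

definition reinsurance_market :: "'a reinsurance_model \<Rightarrow> bool" where
  "reinsurance_market S \<longleftrightarrow>
     0 \<le> wealth0 S \<and> 0 < rate S \<and> 0 < eta S \<and> uM S < uN S \<and>
     (\<forall>u\<in>UU S. (\<lambda>z. Phi S z u) \<in> borel_measurable (restrict_space borel {0..})) \<and>
     (\<forall>z\<ge>0. continuous_on (UU S) (Phi S z) \<and> Phi S z (uN S) = z \<and> 0 \<le> Phi S z (uM S) \<and>
        (\<forall>u\<in>UU S. Phi S z (uM S) \<le> Phi S z u \<and> Phi S z u \<le> Phi S z (uN S))) \<and>
     (\<forall>u\<in>UU S. (\<lambda>(t, \<omega>). rprem S t \<omega> u) \<in> borel_measurable (predH S)) \<and>
     (\<forall>t\<in>{0..horizon S}. \<forall>\<omega>\<in>space (PP S).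
        continuous_on (UU S) (rprem S t \<omega>) \<and>
        (\<forall>u\<in>UU S. \<exists>D. has_deriv_in (UU S) (rprem S t \<omega>) D u) \<and>
        continuous_on (UU S) (deriv_in (UU S) (rprem S t \<omega>)) \<and>
        rprem S t \<omega> (uN S) = 0 \<and>
        (\<forall>u\<in>UU S. 0 \<le> rprem S t \<omega> u \<and> rprem S t \<omega> u \<le> rprem S t \<omega> (uM S))) \<and>
     (\<integral>\<^sup>+\<omega>. (\<integral>\<^sup>+t\<in>{0..horizon S}. ennreal (rprem S t \<omega> (uM S)) \<partial>lborel) \<partial>PP S) < \<infinity> \<and>
     (\<lambda>(t, \<omega>). prem S t \<omega>) \<in> borel_measurable (predH S) \<and>
     (\<integral>\<^sup>+\<omega>. (\<integral>\<^sup>+t\<in>{0..horizon S}. ennreal \<bar>prem S t \<omega>\<bar> \<partial>lborel) \<partial>PP S) < \<infinity>"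

definition wealth :: "'a reinsurance_model \<Rightarrow> (real \<Rightarrow> 'a \<Rightarrow> ereal) \<Rightarrow> real \<Rightarrow> 'a \<Rightarrow> real" where
  "wealth S u t \<omega> =
     wealth0 S * exp (rate S * t)
     + (LBINT s:{0..t}. exp (rate S * (t - s)) * (prem S s \<omega> - rprem S s \<omega> (u s \<omega>)))
     - set_lebesgue_integral (m1 S \<omega>) ({0<..t} \<times> {0<..})
         (\<lambda>(s, z). exp (rate S * (t - s)) * Phi S z (u s \<omega>))"

definition disutility :: "'a reinsurance_model \<Rightarrow> (real \<Rightarrow> 'a \<Rightarrow> ereal) \<Rightarrow> 'a \<Rightarrow> real" where
  "disutility S u \<omega> = exp (- eta S * wealth S u (horizon S) \<omega>)"

definition admissible :: "'a reinsurance_model \<Rightarrow> (real \<Rightarrow> 'a \<Rightarrow> ereal) set" where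
  "admissible S = {u.
     (\<lambda>(t, \<omega>). u t \<omega>) \<in> borel_measurable (predH S) \<and>
     (\<forall>t\<in>{0..horizon S}. \<forall>\<omega>\<in>space (PP S). u t \<omega> \<in> UU S) \<and>
     integrable (PP S) (disutility S u)}"

definition optimal :: "'a reinsurance_model \<Rightarrow> (real \<Rightarrow> 'a \<Rightarrow> ereal) \<Rightarrow> bool" where
  "optimal S u \<longleftrightarrow> u \<in> admissible S \<and>
     (\<integral>\<omega>. disutility S u \<omega> \<partial>PP S) = (INF v\<in>admissible S. \<integral>\<omega>. disutility S v \<omega> \<partial>PP S)"

definition value_process :: "'a reinsurance_model \<Rightarrow> (real \<Rightarrow> 'a \<Rightarrow> real) \<Rightarrow> bool" where
  "value_process S W \<longleftrightarrow> (\<forall>t\<in>{0..horizon S}.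
     (\<forall>\<omega>\<in>space (PP S). 0 \<le> W t \<omega>) \<and>
     is_ess_inf (PP S)
       {real_cond_exp (PP S) (HH S t) (disutility S u) | u.
          u \<in> admissible S \<and> (\<forall>s\<in>{0..t}. AE \<omega> in PP S. u s \<omega> = uN S)}
       (W t))"


section \<open>The BSDE\<close>

type_synonym 'a point = "real \<times> 'a \<times> real \<times> (real \<Rightarrow> real)"

definition MM :: "'a reinsurance_model \<Rightarrow> 'a point set" where
  "MM S = {(t, \<omega>, w, \<theta>). t \<in> {0..horizon S} \<and> \<omega> \<in> space (PP S) \<and> 0 \<le> w \<and>
     \<theta> \<in> borel_measurable (restrict_space borel {0..})}"

definition discount :: "'a reinsurance_model \<Rightarrow> real \<Rightarrow> real" where
  "discount S t = eta S * exp (rate S * (horizon S - t))"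

fun f_tilde :: "'a reinsurance_model \<Rightarrow> 'a point \<Rightarrow> ereal \<Rightarrow> real" where
  "f_tilde S (t, \<omega>, w, \<theta>) u =
     - w * discount S t * rprem S t \<omega> u
     - (LINT z:{0<..}|F1 S. (w + \<theta> z) * (exp (- discount S t * (z - Phi S z u)) - 1) * filt_left S t \<omega>)"

definition point_at ::
    "(real \<Rightarrow> 'a \<Rightarrow> real) \<Rightarrow> (real \<Rightarrow> 'a \<Rightarrow> real \<Rightarrow> real) \<Rightarrow> real \<Rightarrow> 'a \<Rightarrow> 'a point" where
  "point_at Y \<Theta> t \<omega> = (t, \<omega>, left_lim (\<lambda>s. Y s \<omega>) t, \<Theta> t \<omega>)"

definition L2_space :: "'a reinsurance_model \<Rightarrow> (real \<Rightarrow> 'a \<Rightarrow> real) set" where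
  "L2_space S = {Y.
     (\<forall>\<omega>\<in>space (PP S). cadlag_on (horizon S) (\<lambda>t. Y t \<omega>)) \<and>
     (\<forall>t\<in>{0..horizon S}. Y t \<in> borel_measurable (HH S t)) \<and>
     (\<integral>\<^sup>+\<omega>. (\<integral>\<^sup>+t\<in>{0..horizon S}. ennreal (\<bar>Y t \<omega>\<bar>\<^sup>2) \<partial>lborel) \<partial>PP S) < \<infinity>}"

definition L2_hat :: "'a reinsurance_model \<Rightarrow> (real \<Rightarrow> 'a \<Rightarrow> real \<Rightarrow> real) set" where
  "L2_hat S = {\<Theta>.
     (\<lambda>((t, \<omega>), z). \<Theta> t \<omega> z) \<in> borel_measurable (predH S \<Otimes>\<^sub>M restrict_space borel {0..}) \<and>
     (\<integral>\<^sup>+\<omega>. (\<integral>\<^sup>+t\<in>{0..horizon S}. (\<integral>\<^sup>+z\<in>{0<..}. ennreal ((\<Theta> t \<omega> z)\<^sup>2 * filt_left S t \<omega>) \<partial>F1 S)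
        \<partial>lborel) \<partial>PP S) < \<infinity>}"

definition compensated_integral ::
    "'a reinsurance_model \<Rightarrow> (real \<Rightarrow> 'a \<Rightarrow> real \<Rightarrow> real) \<Rightarrow> real \<Rightarrow> real \<Rightarrow> 'a \<Rightarrow> real" where
  "compensated_integral S \<Theta> a b \<omega> =
     set_lebesgue_integral (m1 S \<omega>) ({a<..b} \<times> {0<..}) (\<lambda>(s, z). \<Theta> s \<omega> z)
     - (LBINT s:{a..b}. (LINT z:{0<..}|F1 S. \<Theta> s \<omega> z * filt_left S s \<omega>))"

text \<open>The driver is a jointly measurable version \<open>G\<close> of the essential supremum.\<close>

definition driver ::
    "'a reinsurance_model \<Rightarrow> (real \<Rightarrow> 'a \<Rightarrow> real) \<Rightarrow> (real \<Rightarrow> 'a \<Rightarrow> real \<Rightarrow> real) \<Rightarrow>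
     (real \<Rightarrow> 'a \<Rightarrow> real) \<Rightarrow> bool" where
  "driver S Y \<Theta> G \<longleftrightarrow>
     (\<lambda>(s, \<omega>). G s \<omega>) \<in> borel_measurable (restrict_space borel {0..horizon S} \<Otimes>\<^sub>M PP S) \<and>
     (\<forall>s\<in>{0..horizon S}.
        is_ess_sup (PP S) {\<lambda>\<omega>. f_tilde S (point_at Y \<Theta> s \<omega>) (u s \<omega>) | u. u \<in> admissible S} (G s)) \<and>
     (AE \<omega> in PP S. set_integrable lborel {0..horizon S} (\<lambda>s. G s \<omega>))"

definition bsde_solution ::
    "'a reinsurance_model \<Rightarrow> (real \<Rightarrow> 'a \<Rightarrow> real) \<Rightarrow> (real \<Rightarrow> 'a \<Rightarrow> real \<Rightarrow> real) \<Rightarrow> bool" where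
  "bsde_solution S Y \<Theta> \<longleftrightarrow>
     Y \<in> L2_space S \<and> \<Theta> \<in> L2_hat S \<and>
     (\<exists>G. driver S Y \<Theta> G \<and>
        (\<forall>t\<in>{0..horizon S}. AE \<omega> in PP S.
           Y t \<omega> = disutility S (\<lambda>_ _. uN S) \<omega>
             - compensated_integral S \<Theta> t (horizon S) \<omega>
             - (LBINT s:{t..horizon S}. G s \<omega>)))"


section \<open>The candidate strategy\<close>

definition R0 :: "'a reinsurance_model \<Rightarrow> 'a point set" where
  "R0 S = {m \<in> MM S. deriv_in (UU S) (f_tilde S m) (uM S) < 0}"

definition R1 :: "'a reinsurance_model \<Rightarrow> 'a point set" where
  "R1 S = {m \<in> MM S. deriv_in (UU S) (f_tilde S m) (uN S) > 0}"

fun marginal_retention :: "'a reinsurance_model \<Rightarrow> 'a point \<Rightarrow> ereal \<Rightarrow> real" where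
  "marginal_retention S (t, \<omega>, w, \<theta>) u =
     (LINT z:{0<..}|F1 S. (w + \<theta> z) * exp (- discount S t * (z - Phi S z u))
        * deriv_in (UU S) (Phi S z) u * filt_left S t \<omega>)"

fun first_order_condition :: "'a reinsurance_model \<Rightarrow> 'a point \<Rightarrow> ereal \<Rightarrow> bool" where
  "first_order_condition S (t, \<omega>, w, \<theta>) u \<longleftrightarrow>
     - w * deriv_in (UU S) (rprem S t \<omega>) u = marginal_retention S (t, \<omega>, w, \<theta>) u"

text \<open>The closed interval is needed: outside \<open>R0\<close> and \<open>R1\<close> the derivative of \<open>f_tilde\<close> may vanish
  at an endpoint, and that endpoint is then the only solution.\<close>

definition u_bar :: "'a reinsurance_model \<Rightarrow> 'a point \<Rightarrow> ereal" where
  "u_bar S m = (THE u. u \<in> UU S \<and> first_order_condition S m u)"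

definition u_hat :: "'a reinsurance_model \<Rightarrow> 'a point \<Rightarrow> ereal" where
  "u_hat S m = (if m \<in> R0 S then uM S else if m \<in> R1 S then uN S else u_bar S m)"

text \<open>Differentiation of \<open>f_tilde\<close> in \<open>u\<close> under the integral sign is legitimate. Pointwise
  differentiability of \<open>Phi\<close> does not imply this.\<close>

fun differentiable_under_integral :: "'a reinsurance_model \<Rightarrow> 'a point \<Rightarrow> bool" where
  "differentiable_under_integral S (t, \<omega>, w, \<theta>) \<longleftrightarrow> (\<forall>u\<in>UU S.
     has_deriv_in (UU S) (f_tilde S (t, \<omega>, w, \<theta>))
       (- w * discount S t * deriv_in (UU S) (rprem S t \<omega>) u
        - discount S t * marginal_retention S (t, \<omega>, w, \<theta>) u) u)"

end

theory Submission
  imports Defs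
begin

text \<open>
  Outside \<open>R0\<close> and \<open>R1\<close> strict concavity makes the derivative of \<open>f_tilde\<close> strictly decreasing,
  so it has exactly one zero by the intermediate value property of derivatives, and \<open>u_hat\<close> is
  the maximizer of \<open>f_tilde\<close> in the control. For \<open>x\<close> in the interior, \<open>x < u_hat\<close> iff the derivative
  at \<open>x\<close> is positive; hence \<open>u_hat\<close> along the BSDE solution is predictable.

  For optimality let \<open>E\<close> be the density of the wealth under this strategy against null reinsurance,
  \<open>exp (- \<eta> e\<^bsup>r(T-t)\<^esup> (X\<^sub>t - X\<^sup>N\<^sub>t))\<close>. Integration by parts along each path, together with the fact that the
  driver is at most \<open>f_tilde\<close> at the maximizer, shows that \<open>E W\<close> is dominated by \<open>W\<^sub>0\<close> plus a
  compensated jump integral. Multiplying by \<open>exp (- \<epsilon> A)\<close>, where \<open>A\<close> is an increasing predictable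
  process dominating the variation of the compensator, makes this integral a true martingale
  without stopping times, because \<open>\<integral> exp (- \<epsilon> A) dA \<le> 1 / \<epsilon>\<close>, and does not spoil the inequality, because
  \<open>W \<ge> 0\<close>. Taking expectations and letting \<open>\<epsilon> \<rightarrow> 0\<close> with Fatou's lemma bounds the expected disutility of the
  strategy by \<open>W\<^sub>0\<close>, which is a lower bound for every admissible strategy by the definition of
  the value process.
\<close>

section \<open>Strictly concave functions on an extended real interval\<close>

text \<open>The driver is an essential supremum over admissible strategies, while admissibility of
  the candidate is part of the conclusion, so the candidate cannot be inserted into that supremum.
  One inequality remains: by pointwise maximality its \<open>f_tilde\<close> bounds the family
  almost surely, hence bounds the driver. This suffices, because the resulting estimate of the
  expected disutility yields integrability and optimality together. The compensator is given for the
  full filtration, whereas \<open>W\<close>, \<open>\<Theta>\<close> and the strategy are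
  predictable for the natural filtration of the loss, which is neither completed nor made
  right-continuous by construction. Hence the measurability work: jump times and marks are recovered
  from the loss path and the intensity is projected to its filter. The compensator identity concerns
  fields with values in \<open>[0,\<infinity>]\<close>, so the jumps of the product are split by
  sign and placed on the two sides of an inequality. The density grows only through reinsurance
  premiums, since its jump factors are at most 1; this is why \<open>A\<close> carries the
  exponential of the accumulated discounted premiums.\<close>

lemma real_points_connected: "connected {y. ereal y \<in> {a..b}}"
proof -
  have "is_interval {y. ereal y \<in> {a..b}}"
    unfolding is_interval_1 by (auto intro: order_trans) (metis ereal_less_eq(3) order_trans)+
  then show ?thesis by (rule is_interval_connected)
qed

text \<open>A connected set of reals with two points has no isolated point. That the filter is
  nontrivial makes one-sided derivatives at finite endpoints unique.\<close>

lemma at_within_real_points_neq_bot: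
  assumes "a < b" "ereal x \<in> {a..b}"
  shows "at x within {y. ereal y \<in> {a..b}} \<noteq> bot"
proof -
  let ?S = "{y. ereal y \<in> {a..b}}"
  obtain y where y: "a < ereal y" "ereal y < b"
    using ereal_dense2[OF assms(1)] by auto
  have "\<exists>z\<in>?S. z \<noteq> x"
  proof (cases "x = y")
    case True
    then obtain z where "ereal x < ereal z" "ereal z < b" using ereal_dense2[OF y(2)] by auto
    then show ?thesis using y True less_imp_le[OF less_trans[OF y(1), of "ereal z"]] by (intro bexI[of _ z]) auto
  next
    case False
    then show ?thesis using y by (intro bexI[of _ y]) auto
  qed
  then have "\<nexists>y. ?S = {y}" using assms(2) by (metis mem_Collect_eq singletonD)
  then have "x islimpt ?S"
    using assms(2) by (intro connected_imp_perfect real_points_connected) simp_all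
  then show ?thesis by (simp add: trivial_limit_within)
qed

text \<open>\<open>deriv_in\<close> is a definite description, so uniqueness is what gives it a
  value. At an infinite endpoint two candidate derivative functions agree eventually and so have the
  same limit.\<close>

lemma has_deriv_in_unique:
  assumes ab: "a < b" and u: "u \<in> {a..b}"
    and D: "has_deriv_in {a..b} g D u" and D': "has_deriv_in {a..b} g D' u"
  shows "D = D'"
proof (cases u)
  case (real x)
  then show ?thesis
    using D D' at_within_real_points_neq_bot[OF ab, of x] u
    by (auto simp: has_deriv_in_def has_field_derivative_iff intro: tendsto_unique)
next
  case PInf
  then obtain g1 g2 where
      "\<forall>\<^sub>F y in at_top. ((\<lambda>y. g (ereal y)) has_real_derivative g1 y) (at y)" "(g1 \<longlongrightarrow> D) at_top"
      "\<forall>\<^sub>F y in at_top. ((\<lambda>y. g (ereal y)) has_real_derivative g2 y) (at y)" "(g2 \<longlongrightarrow> D') at_top"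
    using D D' by (auto simp: has_deriv_in_def)
  moreover from this have "\<forall>\<^sub>F y in at_top. g1 y = g2 y"
    by (auto elim: eventually_elim2 dest: DERIV_unique)
  ultimately show ?thesis
    by (metis tendsto_cong tendsto_unique trivial_limit_at_top_linorder)
next
  case MInf
  then obtain g1 g2 where
      "\<forall>\<^sub>F y in at_bot. ((\<lambda>y. g (ereal y)) has_real_derivative g1 y) (at y)" "(g1 \<longlongrightarrow> D) at_bot"
      "\<forall>\<^sub>F y in at_bot. ((\<lambda>y. g (ereal y)) has_real_derivative g2 y) (at y)" "(g2 \<longlongrightarrow> D') at_bot"
    using D D' by (auto simp: has_deriv_in_def)
  moreover from this have "\<forall>\<^sub>F y in at_bot. g1 y = g2 y"
    by (auto elim: eventually_elim2 dest: DERIV_unique)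
  ultimately show ?thesis
    by (metis tendsto_cong tendsto_unique trivial_limit_at_bot_linorder)
qed

lemma deriv_in_eqI:
  assumes "a < b" "u \<in> {a..b}" "has_deriv_in {a..b} g D u"
  shows "deriv_in {a..b} g u = D"
  unfolding deriv_in_def using assms has_deriv_in_unique[OF assms(1,2)] by blast

text \<open>The one-variable problem at a fixed point of \<open>MM\<close>. The derivative is an
  arbitrary function \<open>D\<close> rather than \<open>deriv_in\<close>, so that the explicit
  formula \<open>slope\<close> can be plugged in. Concavity speaks of real points only; infinite
  endpoints are reached by limits.\<close>

locale concave_control =
  fixes a b :: ereal and g :: "ereal \<Rightarrow> real" and D :: "ereal \<Rightarrow> real"
  assumes ab: "a < b"
    and concave: "strictly_concave_in {a..b} g"
    and deriv: "\<And>u. u \<in> {a..b} \<Longrightarrow> has_deriv_in {a..b} g (D u) u"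
begin

lemma derivI:
  assumes "a \<le> ereal x" "ereal x \<le> b"
  shows "((\<lambda>y. g (ereal y)) has_real_derivative D (ereal x)) (at x within {y. ereal y \<in> {a..b}})"
  using deriv[of "ereal x"] assms by (simp add: has_deriv_in_def)

lemma derivI_Icc:
  assumes "a \<le> ereal x" "ereal y \<le> b" "x \<le> p" "p \<le> y"
  shows "((\<lambda>y. g (ereal y)) has_real_derivative D (ereal p)) (at p within {x..y})"
proof -
  have "a \<le> ereal p" "ereal p \<le> b"
    using assms by (auto intro: order_trans[of a "ereal x"] order_trans[of _ "ereal y" b])
  then show ?thesis
    using assms by (intro DERIV_subset[OF derivI])
      (auto intro: order_trans[of a "ereal x"] order_trans[of _ "ereal y" b])
qed

lemma deriv_interior:
  assumes "a < ereal x" "ereal x < b"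
  shows "((\<lambda>y. g (ereal y)) has_real_derivative D (ereal x)) (at x)"
proof -
  obtain l where l: "a < ereal l" "ereal l < ereal x" using ereal_dense2[OF assms(1)] by auto
  obtain r where r: "ereal x < ereal r" "ereal r < b" using ereal_dense2[OF assms(2)] by auto
  have "at x within {l..r} = at x" using l r by (intro at_within_Icc_at) auto
  then show ?thesis using derivI_Icc[of l r x] l r by auto
qed

text \<open>Difference quotients of a concave function are monotone, so comparing with the midpoint
  \<open>m\<close> gives weak tangent inequalities on half the interval. Strict concavity at
  \<open>m\<close> makes them strict on the whole interval.\<close>

lemma slope_bounds:
  assumes "a \<le> ereal x" "ereal y \<le> b" "x < y"
  shows "D (ereal y) * (y - x) < g (ereal y) - g (ereal x)"
    and "g (ereal y) - g (ereal x) < D (ereal x) * (y - x)"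
proof -
  define m where "m = (x + y) / 2"
  have m: "x < m" "m < y" "m - x = (y - x)/2" "y - m = (y - x)/2"
    using assms by (auto simp: m_def field_simps)
  have memb: "ereal p \<in> {a..b}" if "x \<le> p" "p \<le> y" for p
    using that assms by (auto intro: order_trans[of a "ereal x"] order_trans[of _ "ereal y" b])
  have conc: "(1 - h) * g (ereal p) + h * g (ereal r) < g (ereal (p + h * (r - p)))"
    if "0 < h" "h < 1" "x \<le> p" "p < r" "r \<le> y" for h p r
  proof -
    have "(1 - h) * p + (1 - (1 - h)) * r = p + h * (r - p)" by (simp add: algebra_simps)
    then show ?thesis
      using concave[unfolded strictly_concave_in_def, rule_format, of p r "1 - h"] memb[of p] memb[of r] that
      by simp
  qed
  have mid: "(g (ereal x) + g (ereal y)) / 2 < g (ereal m)"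
    using conc[of "1/2" x y] assms by (simp add: m_def field_simps)
  have "(g (ereal m) - g (ereal x)) / (m - x) \<le> D (ereal x)"
  proof (rule tendsto_lowerbound)
    show "((\<lambda>p. (g (ereal p) - g (ereal x)) / (p - x)) \<longlongrightarrow> D (ereal x)) (at_right x)"
      using derivI_Icc[of x m x] m assms memb[of m]
      by (simp add: has_field_derivative_iff at_within_Icc_at_right)
    show "\<forall>\<^sub>F p in at_right x. (g (ereal m) - g (ereal x)) / (m - x) \<le> (g (ereal p) - g (ereal x)) / (p - x)"
      unfolding eventually_at_right_field
    proof (intro exI[of _ m] conjI allI impI)
      fix p assume p: "x < p" "p < m"
      define h where "h = (p - x) / (m - x)"
      have h: "0 < h" "h < 1" "p = x + h * (m - x)" using p m by (auto simp: h_def)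
      have "(1 - h) * g (ereal x) + h * g (ereal m) < g (ereal p)"
        using conc[of h x m] h m by simp
      then have "h * (g (ereal m) - g (ereal x)) \<le> g (ereal p) - g (ereal x)"
        by (simp add: algebra_simps)
      then have "h * (g (ereal m) - g (ereal x)) / (h * (m - x)) \<le> (g (ereal p) - g (ereal x)) / (h * (m - x))"
        using h m by (intro divide_right_mono) auto
      then show "(g (ereal m) - g (ereal x)) / (m - x) \<le> (g (ereal p) - g (ereal x)) / (p - x)"
        using h by simp
    qed (use m in auto)
  qed simp
  then have "g (ereal m) - g (ereal x) \<le> D (ereal x) * (m - x)"
    using m(1) by (simp add: pos_divide_le_eq)
  then show "g (ereal y) - g (ereal x) < D (ereal x) * (y - x)"
    using mid m by (simp add: field_simps)
  have "D (ereal y) \<le> (g (ereal m) - g (ereal y)) / (m - y)"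
  proof (rule tendsto_upperbound)
    show "((\<lambda>p. (g (ereal p) - g (ereal y)) / (p - y)) \<longlongrightarrow> D (ereal y)) (at_left y)"
      using derivI_Icc[of m y y] m assms memb[of m]
      by (simp add: has_field_derivative_iff at_within_Icc_at_left)
    show "\<forall>\<^sub>F p in at_left y. (g (ereal p) - g (ereal y)) / (p - y) \<le> (g (ereal m) - g (ereal y)) / (m - y)"
      unfolding eventually_at_left_field
    proof (intro exI[of _ m] conjI allI impI)
      fix p assume p: "m < p" "p < y"
      define h where "h = (p - m) / (y - m)"
      have h: "0 < h" "h < 1" "p = m + h * (y - m)" using p m by (auto simp: h_def)
      have py: "p - y = (1 - h) * (m - y)" using h(3) by (simp add: algebra_simps)
      have "(1 - h) * g (ereal m) + h * g (ereal y) < g (ereal p)"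
        using conc[of h m y] h m by simp
      then have "(1 - h) * (g (ereal m) - g (ereal y)) \<le> g (ereal p) - g (ereal y)"
        by (simp add: algebra_simps)
      then have "(g (ereal p) - g (ereal y)) / ((1 - h) * (m - y)) \<le> (1 - h) * (g (ereal m) - g (ereal y)) / ((1 - h) * (m - y))"
        using h m by (intro divide_right_mono_neg) (auto simp: mult_nonneg_nonpos)
      then show "(g (ereal p) - g (ereal y)) / (p - y) \<le> (g (ereal m) - g (ereal y)) / (m - y)"
        using h py by simp
    qed (use m in auto)
  qed simp
  then have "D (ereal y) * (y - m) \<le> g (ereal y) - g (ereal m)"
    using m(2) by (simp add: neg_le_divide_eq algebra_simps)
  then show "D (ereal y) * (y - x) < g (ereal y) - g (ereal x)"
    using mid m by (simp add: field_simps)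
qed

lemma deriv_real_less:
  assumes "a \<le> ereal x" "ereal y \<le> b" "x < y"
  shows "D (ereal y) < D (ereal x)"
proof -
  have "D (ereal y) * (y - x) < D (ereal x) * (y - x)"
    using slope_bounds[OF assms] by simp
  then show ?thesis using assms by simp
qed

text \<open>At \<open>\<infinity>\<close> the definition speaks of some function that is eventually
  the derivative. It coincides with \<open>D\<close> at interior reals, so \<open>D\<close> itself
  is continuous at the infinite endpoint.\<close>

lemma tendsto_deriv_PInf:
  assumes "b = \<infinity>"
  shows "((\<lambda>y. D (ereal y)) \<longlongrightarrow> D \<infinity>) at_top"
proof -
  obtain g' where g': "\<forall>\<^sub>F y in at_top. ((\<lambda>y. g (ereal y)) has_real_derivative g' y) (at y)"
      "(g' \<longlongrightarrow> D \<infinity>) at_top"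
    using deriv[of b] assms ab by (auto simp: has_deriv_in_def)
  obtain l where l: "a < ereal l" using ereal_dense2[OF ab] by auto
  have "\<forall>\<^sub>F y in at_top. g' y = D (ereal y)"
    using g'(1) eventually_gt_at_top[of l]
  proof eventually_elim
    case (elim y)
    then have "a < ereal y" using l by (metis less_ereal.simps(1) less_trans)
    then show ?case using elim deriv_interior[of y] assms by (auto intro: DERIV_unique)
  qed
  then show ?thesis using g'(2) by (rule Lim_transform_eventually[rotated])
qed

lemma tendsto_deriv_MInf:
  assumes "a = -\<infinity>"
  shows "((\<lambda>y. D (ereal y)) \<longlongrightarrow> D (-\<infinity>)) at_bot"
proof -
  obtain g' where g': "\<forall>\<^sub>F y in at_bot. ((\<lambda>y. g (ereal y)) has_real_derivative g' y) (at y)"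
      "(g' \<longlongrightarrow> D (-\<infinity>)) at_bot"
    using deriv[of a] assms ab by (auto simp: has_deriv_in_def)
  obtain l where l: "ereal l < b" using ereal_dense2[OF ab] by auto
  have "\<forall>\<^sub>F y in at_bot. g' y = D (ereal y)"
    using g'(1) eventually_gt_at_bot[of l]
  proof eventually_elim
    case (elim y)
    then have "ereal y < b" using l by (metis less_ereal.simps(1) less_trans)
    then show ?case using elim deriv_interior[of y] assms by (auto intro: DERIV_unique)
  qed
  then show ?thesis using g'(2) by (rule Lim_transform_eventually[rotated])
qed

lemma deriv_PInf_less:
  assumes "b = \<infinity>" "a \<le> ereal x"
  shows "D \<infinity> < D (ereal x)"
proof -
  \<comment> \<open>A limit preserves only weak inequalities; the detour through
    \<open>x + 1\<close> restores strictness.\<close>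
  have "D \<infinity> \<le> D (ereal (x + 1))"
  proof (rule tendsto_upperbound[OF tendsto_deriv_PInf[OF assms(1)]])
    show "\<forall>\<^sub>F y in at_top. D (ereal y) \<le> D (ereal (x + 1))"
      using eventually_gt_at_top[of "x + 1"]
      by eventually_elim (use assms in \<open>auto intro!: less_imp_le deriv_real_less order_trans[OF assms(2)]\<close>)
  qed simp
  also have "\<dots> < D (ereal x)" using assms by (intro deriv_real_less) auto
  finally show ?thesis .
qed

lemma deriv_MInf_less:
  assumes "a = -\<infinity>" "ereal x \<le> b"
  shows "D (ereal x) < D (-\<infinity>)"
proof -
  have *: "D (ereal x) < D (ereal (x - 1))" using assms by (intro deriv_real_less) auto
  have "D (ereal (x - 1)) \<le> D (-\<infinity>)"
  proof (rule tendsto_lowerbound[OF tendsto_deriv_MInf[OF assms(1)]])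
    show "\<forall>\<^sub>F y in at_bot. D (ereal (x - 1)) \<le> D (ereal y)"
      using eventually_gt_at_bot[of "x - 1"]
      by eventually_elim
        (use assms in \<open>auto intro!: less_imp_le deriv_real_less order_trans[OF _ assms(2)]\<close>)
  qed simp
  with * show ?thesis by simp
qed

lemma deriv_strict_antimono:
  assumes "a \<le> u" "u < v" "v \<le> b"
  shows "D v < D u"
proof -
  obtain x where x: "u < ereal x" "ereal x < v" using ereal_dense2[OF assms(2)] by auto
  have xab: "a \<le> ereal x" "ereal x \<le> b" using x assms by auto
  have "D v \<le> D (ereal x)"
  proof (cases v)
    case (real y) then show ?thesis using x xab assms deriv_real_less[of x y] by auto
  next
    case PInf then show ?thesis using deriv_PInf_less[OF _ xab(1)] assms by auto
  qed (use x in auto)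
  also have "D (ereal x) < D u"
  proof (cases u)
    case (real y) then show ?thesis using x xab assms deriv_real_less[of y x] by auto
  next
    case MInf then show ?thesis using deriv_MInf_less[OF _ xab(2)] assms by auto
  qed (use x in auto)
  finally show ?thesis .
qed

lemma deriv_zero_unique:
  assumes "u \<in> {a..b}" "v \<in> {a..b}" "D u = 0" "D v = 0"
  shows "u = v"
  using deriv_strict_antimono[of u v] deriv_strict_antimono[of v u] assms
  by (cases u v rule: linorder_cases) auto

text \<open>\<open>D\<close> is not assumed continuous, so this is Darboux's argument: on a compact
  interval with \<open>D\<close> positive at the left end and negative at the right end,
  \<open>g\<close> attains its maximum inside, and the derivative vanishes there. At an infinite
  endpoint the sign of \<open>D\<close> carries over to nearby real points.\<close>

lemma ex_deriv_zero:
  assumes "0 < D a" "D b < 0"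
  shows "\<exists>u. a < u \<and> u < b \<and> D u = 0"
proof -
  have "\<exists>x. a \<le> ereal x \<and> ereal x \<le> b \<and> 0 < D (ereal x)"
  proof (cases a)
    case (real x) then show ?thesis using assms ab by (intro exI[of _ x]) auto
  next
    case MInf
    obtain l where l: "ereal l < b" using ereal_dense2[OF ab] by auto
    have "\<forall>\<^sub>F y in at_bot. 0 < D (ereal y)"
      using order_tendstoD(1)[OF tendsto_deriv_MInf] assms MInf by auto
    then have "\<forall>\<^sub>F y in at_bot. 0 < D (ereal y) \<and> y \<le> l"
      using eventually_le_at_bot by (rule eventually_conj)
    then obtain y where "0 < D (ereal y)" "y \<le> l"
      using eventually_happens by fastforce
    moreover from this l have "ereal y \<le> b"
      by (metis ereal_less_eq(3) order_trans less_imp_le)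
    ultimately show ?thesis using MInf by auto
  qed (use ab in auto)
  then obtain x where x: "a \<le> ereal x" "ereal x \<le> b" "0 < D (ereal x)" by blast
  have "\<exists>y. a \<le> ereal y \<and> ereal y \<le> b \<and> D (ereal y) < 0"
  proof (cases b)
    case (real y) then show ?thesis using assms ab by (intro exI[of _ y]) auto
  next
    case PInf
    have "\<forall>\<^sub>F y in at_top. D (ereal y) < 0"
      using order_tendstoD(2)[OF tendsto_deriv_PInf] assms PInf by auto
    then have "\<forall>\<^sub>F y in at_top. D (ereal y) < 0 \<and> x \<le> y"
      using eventually_ge_at_top by (rule eventually_conj)
    then obtain y where "D (ereal y) < 0" "x \<le> y"
      using eventually_happens by fastforce
    moreover from this x have "a \<le> ereal y" by (metis ereal_less_eq(3) order_trans)
    ultimately show ?thesis using PInf by auto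
  qed (use ab in auto)
  then obtain y where y: "a \<le> ereal y" "ereal y \<le> b" "D (ereal y) < 0" by blast
  have xy: "x < y"
  proof (rule ccontr)
    assume "\<not> x < y"
    then have "D (ereal x) \<le> D (ereal y)"
      using deriv_real_less[of y x] x y by (cases "x = y") auto
    then show False using x y by simp
  qed
  have "continuous_on {x..y} (\<lambda>y. g (ereal y))"
    by (rule DERIV_continuous_on) (use derivI_Icc[OF x(1) y(2)] in auto)
  then obtain c where c: "c \<in> {x..y}" "\<And>p. p \<in> {x..y} \<Longrightarrow> g (ereal p) \<le> g (ereal c)"
    using continuous_attains_sup[of "{x..y}" "\<lambda>y. g (ereal y)"] xy by auto
  have dc: "((\<lambda>y. g (ereal y)) has_real_derivative D (ereal c)) (at c within {x..y})"
    using c derivI_Icc[OF x(1) y(2)] by auto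
  have "\<not> 0 < D (ereal c)"
  proof
    assume pos: "0 < D (ereal c)"
    then have "c < y" using c y by (cases "c = y") auto
    from has_real_derivative_pos_inc_right[OF dc pos] obtain d where d: "0 < d"
      "\<And>h. 0 < h \<Longrightarrow> c + h \<in> {x..y} \<Longrightarrow> h < d \<Longrightarrow> g (ereal c) < g (ereal (c + h))" by auto
    define h where "h = min (d / 2) (y - c)"
    have "0 < h" "h < d" "c + h \<in> {x..y}" using d \<open>c < y\<close> c by (auto simp: h_def min_def)
    then show False using d(2)[of h] c(2)[of "c + h"] by auto
  qed
  moreover have "\<not> D (ereal c) < 0"
  proof
    assume neg: "D (ereal c) < 0"
    then have "x < c" using c x by (cases "c = x") auto
    from has_real_derivative_neg_dec_left[OF dc neg] obtain d where d: "0 < d"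
      "\<And>h. 0 < h \<Longrightarrow> c - h \<in> {x..y} \<Longrightarrow> h < d \<Longrightarrow> g (ereal c) < g (ereal (c - h))" by auto
    define h where "h = min (d / 2) (c - x)"
    have "0 < h" "h < d" "c - h \<in> {x..y}" using d \<open>x < c\<close> c by (auto simp: h_def min_def)
    then show False using d(2)[of h] c(2)[of "c - h"] by auto
  qed
  ultimately have D0: "D (ereal c) = 0" by auto
  have "a \<le> ereal c" "ereal c \<le> b"
    using c x(1) y(2) by (auto intro: order_trans[of a "ereal x"] order_trans[of _ "ereal y" b])
  moreover have "ereal c \<noteq> a" "ereal c \<noteq> b" using D0 assms by auto
  ultimately show ?thesis using D0 by (intro exI[of _ "ereal c"]) auto
qed

lemma ex1_deriv_zero:
  assumes "0 \<le> D a" "D b \<le> 0"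
  shows "\<exists>!u. u \<in> {a..b} \<and> D u = 0"
proof -
  have "\<exists>u. u \<in> {a..b} \<and> D u = 0"
  proof (cases "D a = 0 \<or> D b = 0")
    case True then show ?thesis using ab less_imp_le[OF ab] by (metis atLeastAtMost_iff order_refl)
  next
    case False
    then obtain u where "a < u" "u < b" "D u = 0" using ex_deriv_zero assms by force
    then show ?thesis by (intro exI[of _ u]) auto
  qed
  then show ?thesis using deriv_zero_unique by blast
qed

text \<open>The three cases are those of \<open>u_hat\<close>, with \<open>D\<close> in place of
  \<open>deriv_in\<close> and of the first-order condition, so that the two agree by
  rewriting.\<close>

definition maximizer :: ereal where
  "maximizer = (if D a < 0 then a else if D b > 0 then b else (THE u. u \<in> {a..b} \<and> D u = 0))"

lemma maximizer_cases:
  obtains "D a < 0" "maximizer = a" | "D b > 0" "maximizer = b"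
  | "maximizer \<in> {a..b}" "D maximizer = 0" "0 \<le> D a" "D b \<le> 0"
proof (cases "D a < 0 \<or> D b > 0")
  case True then show ?thesis using that(1,2) by (cases "D a < 0") (simp_all add: maximizer_def)
next
  case False
  then have "maximizer = (THE u. u \<in> {a..b} \<and> D u = 0)" by (simp add: maximizer_def)
  then show ?thesis using that(3) theI'[OF ex1_deriv_zero] False by auto
qed

lemma maximizer_in: "maximizer \<in> {a..b}"
  using ab by (cases rule: maximizer_cases) auto

lemma deriv_pos_if_less_maximizer:
  assumes "a \<le> u" "u < maximizer"
  shows "0 < D u"
  using maximizer_in deriv_strict_antimono[OF assms] assms
  by (cases rule: maximizer_cases) auto

lemma deriv_neg_if_greater_maximizer:
  assumes "maximizer < u" "u \<le> b"
  shows "D u < 0"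
  using maximizer_in deriv_strict_antimono[OF _ assms] assms
  by (cases rule: maximizer_cases) auto

text \<open>Turns a superlevel set of the maximizer into a sign condition on the derivative at a
  fixed control, from which predictability of the candidate follows. At \<open>u = b\<close> the
  equivalence would fail: if \<open>D b\<close> is positive, the maximizer is \<open>b\<close> and
  not above it.\<close>

lemma less_maximizer_iff:
  assumes "a \<le> u" "u < b"
  shows "u < maximizer \<longleftrightarrow> 0 < D u"
proof
  assume pos: "0 < D u"
  show "u < maximizer"
  proof (rule ccontr)
    assume n: "\<not> u < maximizer"
    then have "maximizer = u"
      using deriv_neg_if_greater_maximizer[of u] assms pos by force
    with pos assms show False by (cases rule: maximizer_cases) auto
  qed
qed (use deriv_pos_if_less_maximizer assms in auto)

text \<open>Slopes compare values at real points only. An interior \<open>y\<close> is compared with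
  the points strictly between it and the maximizer; continuity passes to the closure, first to the
  maximizer and then from the open interval to its endpoints, finite or not.\<close>

lemma maximizer_max:
  assumes cont: "continuous_on {a..b} g" and v: "v \<in> {a..b}"
  shows "g v \<le> g maximizer"
proof -
  have interior: "g y \<le> g maximizer" if y: "a < y" "y < b" for y
  proof (cases y maximizer rule: linorder_cases)
    case less
    obtain y' where y': "y = ereal y'" using y by (cases y) auto
    have "closed {v\<in>{a..b}. g y \<le> g v}"
      by (intro continuous_on_closed_Collect_le cont continuous_intros closed_atLeastAtMost)
    moreover have "{y<..<maximizer} \<subseteq> {v\<in>{a..b}. g y \<le> g v}"
    proof clarify
      fix x assume x: "x \<in> {y<..<maximizer}"
      then obtain x' where x': "x = ereal x'" using y' by (cases x) auto
      have xab: "a \<le> x" "x \<le> b" using x y maximizer_in by auto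
      have "0 < D x" using x xab by (intro deriv_pos_if_less_maximizer) auto
      moreover have "D (ereal x') * (x' - y') < g x - g y"
        using slope_bounds(1)[of y' x'] x xab y by (simp add: x' y')
      ultimately have "g y < g x"
        using x by (smt (verit) x' y' greaterThanLessThan_iff less_ereal.simps(1) mult_pos_pos)
      then show "x \<in> {a..b} \<and> g y \<le> g x" using xab by auto
    qed
    ultimately have "closure {y<..<maximizer} \<subseteq> {v\<in>{a..b}. g y \<le> g v}"
      by (rule closure_minimal[rotated])
    then show ?thesis using less by (simp add: subset_eq)
  next
    case greater
    obtain y' where y': "y = ereal y'" using y by (cases y) auto
    have "closed {v\<in>{a..b}. g y \<le> g v}"
      by (intro continuous_on_closed_Collect_le cont continuous_intros closed_atLeastAtMost)
    moreover have "{maximizer<..<y} \<subseteq> {v\<in>{a..b}. g y \<le> g v}"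
    proof clarify
      fix x assume x: "x \<in> {maximizer<..<y}"
      then obtain x' where x': "x = ereal x'" using y' by (cases x) auto
      have xab: "a \<le> x" "x \<le> b" using x y maximizer_in by auto
      have "D x < 0" using x xab by (intro deriv_neg_if_greater_maximizer) auto
      moreover have "g y - g x < D (ereal x') * (y' - x')"
        using slope_bounds(2)[of x' y'] x xab y by (simp add: x' y')
      ultimately have "g y < g x"
        using x by (smt (verit) x' y' greaterThanLessThan_iff less_ereal.simps(1) mult_neg_pos)
      then show "x \<in> {a..b} \<and> g y \<le> g x" using xab by auto
    qed
    ultimately have "closure {maximizer<..<y} \<subseteq> {v\<in>{a..b}. g y \<le> g v}"
      by (rule closure_minimal[rotated])
    then show ?thesis using greater by (simp add: subset_eq)
  qed auto
  have "closed {v\<in>{a..b}. g v \<le> g maximizer}"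
    by (intro continuous_on_closed_Collect_le cont continuous_intros closed_atLeastAtMost)
  moreover have "{a<..<b} \<subseteq> {v\<in>{a..b}. g v \<le> g maximizer}"
    using interior by auto
  ultimately have "closure {a<..<b} \<subseteq> {v\<in>{a..b}. g v \<le> g maximizer}"
    by (rule closure_minimal[rotated])
  then show ?thesis using v ab by auto
qed

end

section \<open>Pathwise integration by parts\<close>

text \<open>Cutting \<open>[s,t]\<close> into \<open>N\<close> pieces on which \<open>\<psi>\<close>
  grows by equal amounts bounds the total change by \<open>N * K * (\<Delta> / N)\<^sup>2\<close>,
  which tends to 0. The integral formulas below, with merely integrable densities, are proved this
  way instead of by differentiation almost everywhere.\<close>

lemma constant_if_quadratic_increments:
  fixes g \<psi> :: "real \<Rightarrow> real"
  assumes st: "s \<le> t" and cont: "continuous_on {s..t} \<psi>"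
    and incr: "\<And>p q. s \<le> p \<Longrightarrow> p \<le> q \<Longrightarrow> q \<le> t \<Longrightarrow> \<bar>g q - g p\<bar> \<le> K * (\<psi> q - \<psi> p)\<^sup>2"
    and mono: "\<And>p q. s \<le> p \<Longrightarrow> p \<le> q \<Longrightarrow> q \<le> t \<Longrightarrow> \<psi> p \<le> \<psi> q"
  shows "g t = g s"
proof -
  define \<Delta> where "\<Delta> = \<psi> t - \<psi> s"
  have \<Delta>0: "0 \<le> \<Delta>" using mono[of s t] st by (simp add: \<Delta>_def)
  have bound: "\<bar>g t - g s\<bar> \<le> (K * \<Delta>\<^sup>2) * inverse (real (Suc n))" for n
  proof (cases "\<Delta> = 0")
    case True then show ?thesis using incr[of s t] st by (simp add: \<Delta>_def)
  next
    case False
    define N where "N = Suc n"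
    have N_pos: "0 < real N" by (simp add: N_def)
    define y where "y i = \<psi> s + real i / real N * \<Delta>" for i
    have "\<exists>p. s \<le> p \<and> p \<le> t \<and> \<psi> p = y i" if "i \<le> N" for i
    proof -
      have "real i / real N * \<Delta> \<le> 1 * \<Delta>" using that \<Delta>0 by (intro mult_right_mono) (auto simp: N_def)
      then have "\<psi> s \<le> y i" "y i \<le> \<psi> t" using \<Delta>0 by (auto simp: y_def \<Delta>_def)
      then show ?thesis using IVT'[OF _ _ st cont] by blast
    qed
    then obtain p0 where p0: "\<And>i. i \<le> N \<Longrightarrow> s \<le> p0 i \<and> p0 i \<le> t \<and> \<psi> (p0 i) = y i" by metis
    \<comment> \<open>The intermediate value theorem finds some point at each level, not necessarily
      \<open>s\<close> and \<open>t\<close> at the extreme levels; these are put in by hand so that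
      the sum telescopes to \<open>g t - g s\<close>.\<close>
    define p where "p i = (if i = 0 then s else if i = N then t else p0 i)" for i
    have p: "s \<le> p i \<and> p i \<le> t \<and> \<psi> (p i) = y i" if "i \<le> N" for i
      using p0[OF that] st by (auto simp: p_def y_def \<Delta>_def N_def)
    \<comment> \<open>The points were chosen independently of each other. As \<open>\<Delta>\<close>
      is not 0 the levels increase strictly, so a reversed pair would contradict monotonicity of
      \<open>\<psi>\<close>.\<close>
    have p_mono: "p i \<le> p (Suc i)" if "i < N" for i
    proof (rule ccontr)
      assume "\<not> ?thesis"
      then have "\<psi> (p (Suc i)) \<le> \<psi> (p i)" using p[of i] p[of "Suc i"] that by (intro mono) auto
      then have "y (Suc i) \<le> y i" using p[of i] p[of "Suc i"] that by auto
      moreover have "y (Suc i) = y i + \<Delta> / real N"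
        by (simp add: y_def add_divide_distrib algebra_simps)
      ultimately show False using \<Delta>0 False by (auto simp: N_def field_simps)
    qed
    have "\<bar>g t - g s\<bar> = \<bar>\<Sum>i<N. g (p (Suc i)) - g (p i)\<bar>"
      by (subst sum_lessThan_telescope) (simp add: p_def N_def)
    also have "\<dots> \<le> (\<Sum>i<N. \<bar>g (p (Suc i)) - g (p i)\<bar>)" by (rule sum_abs)
    also have "\<dots> \<le> (\<Sum>i<N. K * (\<Delta> / real N)\<^sup>2)"
    proof (rule sum_mono)
      fix i assume "i \<in> {..<N}"
      then have i: "i < N" by simp
      have "\<psi> (p (Suc i)) - \<psi> (p i) = \<Delta> / real N"
        using p[of i] p[of "Suc i"] i by (simp add: y_def add_divide_distrib algebra_simps)
      then show "\<bar>g (p (Suc i)) - g (p i)\<bar> \<le> K * (\<Delta> / real N)\<^sup>2"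
        using incr[of "p i" "p (Suc i)"] p[of i] p[of "Suc i"] p_mono[OF i] i by simp
    qed
    also have "\<dots> = (K * \<Delta>\<^sup>2) * inverse (real N)"
      using N_pos by (simp add: power2_eq_square field_simps)
    finally show ?thesis by (simp add: N_def)
  qed
  have "(\<lambda>n. (K * \<Delta>\<^sup>2) * inverse (real (Suc n))) \<longlonglongrightarrow> (K * \<Delta>\<^sup>2) * 0"
    by (intro tendsto_intros LIMSEQ_inverse_real_of_nat)
  then have "\<bar>g t - g s\<bar> \<le> 0"
    using bound by (intro LIMSEQ_le_const[of _ 0]) auto
  then show ?thesis by simp
qed

lemma LBINT_combine:
  fixes f :: "real \<Rightarrow> real"
  assumes "set_integrable lborel {s..t} f" "s \<le> p" "p \<le> q" "q \<le> t"
  shows "(LBINT x:{s..q}. f x) = (LBINT x:{s..p}. f x) + (LBINT x:{p..q}. f x)"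
proof -
  have i: "set_integrable lborel {u..v} f" if "s \<le> u" "v \<le> t" for u v
    using that by (intro set_integrable_subset[OF assms(1)]) auto
  show ?thesis
    using assms Henstock_Kurzweil_Integration.integral_combine[of s p q f]
      set_borel_integral_eq_integral[OF i[of s q]] set_borel_integral_eq_integral(2)[OF i[of s p]]
      set_borel_integral_eq_integral(2)[OF i[of p q]] by simp
qed

lemma continuous_on_LBINT:
  fixes f :: "real \<Rightarrow> real"
  assumes "set_integrable lborel {s..t} f"
  shows "continuous_on {s..t} (\<lambda>r. LBINT x:{s..r}. f x)"
proof -
  have i: "set_integrable lborel {s..v} f" if "v \<le> t" for v
    using that by (intro set_integrable_subset[OF assms(1)]) auto
  show ?thesis
    using indefinite_integral_continuous_1[OF set_borel_integral_eq_integral(1)[OF assms]]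
    by (rule continuous_on_eq) (simp add: set_borel_integral_eq_integral(2)[OF i])
qed

lemma set_integrable_mult_continuous:
  fixes f g :: "real \<Rightarrow> real"
  assumes f: "set_integrable lborel {s..t} f" and g: "continuous_on {s..t} g"
  shows "set_integrable lborel {s..t} (\<lambda>x. f x * g x)"
proof -
  obtain B where B: "\<And>x. x \<in> {s..t} \<Longrightarrow> \<bar>g x\<bar> \<le> B"
    using compact_imp_bounded[OF compact_continuous_image[OF g compact_Icc]]
    by (force simp: bounded_iff)
  have gm: "(\<lambda>x. indicator {s..t} x *\<^sub>R g x) \<in> borel_measurable borel"
    using borel_measurable_continuous_on_indicator[OF _ g] by simp
  have *: "(\<lambda>x. indicator {s..t} x *\<^sub>R (f x * g x)) =
      (\<lambda>x. (indicator {s..t} x *\<^sub>R f x) * (indicator {s..t} x *\<^sub>R g x))"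
    by (auto simp: indicator_def)
  show ?thesis
    unfolding set_integrable_def
  proof (rule Bochner_Integration.integrable_bound)
    show "integrable lborel (\<lambda>x. B * (indicator {s..t} x *\<^sub>R f x))"
      using f by (simp add: set_integrable_def)
    show "(\<lambda>x. indicator {s..t} x *\<^sub>R (f x * g x)) \<in> borel_measurable lborel"
      unfolding * using borel_measurable_integrable[OF f[unfolded set_integrable_def]] gm by measurable
    show "AE x in lborel. norm (indicator {s..t} x *\<^sub>R (f x * g x)) \<le> norm (B * (indicator {s..t} x *\<^sub>R f x))"
    proof (intro AE_I2)
      fix x
      have "\<bar>f x\<bar> * \<bar>g x\<bar> \<le> \<bar>f x\<bar> * \<bar>B\<bar>" if "x \<in> {s..t}"
        using B[OF that] by (intro mult_left_mono) auto
      then show "norm (indicator {s..t} x *\<^sub>R (f x * g x)) \<le> norm (B * (indicator {s..t} x *\<^sub>R f x))"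
        by (cases "x \<in> {s..t}") (simp_all add: abs_mult mult.commute)
    qed
  qed
qed

lemma abs_LBINT_mult_le:
  fixes f g :: "real \<Rightarrow> real"
  assumes f: "set_integrable lborel {p..q} f" and fg: "set_integrable lborel {p..q} (\<lambda>x. f x * g x)"
    and B: "\<And>x. x \<in> {p..q} \<Longrightarrow> \<bar>g x\<bar> \<le> B"
  shows "\<bar>LBINT x:{p..q}. f x * g x\<bar> \<le> (LBINT x:{p..q}. \<bar>f x\<bar>) * B"
proof -
  have "\<bar>LBINT x:{p..q}. f x * g x\<bar> \<le> (LBINT x:{p..q}. \<bar>f x * g x\<bar>)"
    using set_integral_norm_bound[OF fg] by simp
  also have "\<dots> \<le> (LBINT x:{p..q}. \<bar>f x\<bar> * B)"
    using B by (intro set_integral_mono set_integrable_abs[OF fg] set_integrable_mult_left set_integrable_abs[OF f])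
      (auto simp: abs_mult intro: mult_left_mono)
  finally show ?thesis by simp
qed

lemma abs_LBINT_le:
  fixes f :: "real \<Rightarrow> real"
  assumes "set_integrable lborel {p..q} f"
  shows "\<bar>LBINT x:{p..q}. f x\<bar> \<le> (LBINT x:{p..q}. \<bar>f x\<bar>)"
  using set_integral_norm_bound[OF assms] by simp

lemma LBINT_abs_mono:
  fixes f :: "real \<Rightarrow> real"
  assumes "set_integrable lborel {s..t} f" "s \<le> p" "p \<le> q" "q \<le> t"
  shows "(LBINT x:{s..p}. \<bar>f x\<bar>) \<le> (LBINT x:{s..q}. \<bar>f x\<bar>)"
proof -
  have "0 \<le> (LBINT x:{p..q}. \<bar>f x\<bar>)"
    unfolding set_lebesgue_integral_def by (intro Bochner_Integration.integral_nonneg) auto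
  then show ?thesis using LBINT_combine[OF set_integrable_abs[OF assms(1)] assms(2-4)] by simp
qed

text \<open>Over \<open>[p,q]\<close> the defect of the formula consists of the product of the two
  increments and two integrals against increments. Each is at most
  \<open>\<alpha> * \<beta>\<close>, the product of the masses of \<open>\<bar>f\<bar>\<close> and
  \<open>\<bar>g\<bar>\<close>; hence the constant 3, and \<open>\<alpha> * \<beta>\<close> is at
  most the squared increment of \<open>\<psi>\<close>.\<close>

lemma LBINT_product:
  fixes f g :: "real \<Rightarrow> real" and x y :: "real \<Rightarrow> real"
  assumes st: "s \<le> t" and f: "set_integrable lborel {s..t} f" and g: "set_integrable lborel {s..t} g"
    and x: "\<And>r. r \<in> {s..t} \<Longrightarrow> x r = x s + (LBINT v:{s..r}. f v)"
    and y: "\<And>r. r \<in> {s..t} \<Longrightarrow> y r = y s + (LBINT v:{s..r}. g v)"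
  shows "set_integrable lborel {s..t} (\<lambda>r. f r * y r + g r * x r)"
    and "x t * y t = x s * y s + (LBINT r:{s..t}. f r * y r + g r * x r)"
proof -
  have cx: "continuous_on {s..t} x"
    by (rule continuous_on_eq[of _ "\<lambda>r. x s + (LBINT v:{s..r}. f v)"])
      (intro continuous_intros continuous_on_LBINT f, rule x[symmetric])
  have cy: "continuous_on {s..t} y"
    by (rule continuous_on_eq[of _ "\<lambda>r. y s + (LBINT v:{s..r}. g v)"])
      (intro continuous_intros continuous_on_LBINT g, rule y[symmetric])
  note int1 = set_integrable_mult_continuous[OF f cy] and int2 = set_integrable_mult_continuous[OF g cx]
  show int: "set_integrable lborel {s..t} (\<lambda>r. f r * y r + g r * x r)"
    by (intro set_integral_add int1 int2)
  define G where "G r = x r * y r - (LBINT v:{s..r}. f v * y v + g v * x v)" for r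
  define \<psi> where "\<psi> r = (LBINT v:{s..r}. \<bar>f v\<bar>) + (LBINT v:{s..r}. \<bar>g v\<bar>)" for r
  have "G t = G s"
  proof (rule constant_if_quadratic_increments[of s t \<psi> G 3])
    show "continuous_on {s..t} \<psi>"
      unfolding \<psi>_def by (intro continuous_intros continuous_on_LBINT set_integrable_abs f g)
  next
    fix p q assume pq: "s \<le> p" "p \<le> q" "q \<le> t"
    show "\<psi> p \<le> \<psi> q"
      unfolding \<psi>_def by (intro add_mono LBINT_abs_mono[OF f pq] LBINT_abs_mono[OF g pq])
    have sub: "set_integrable lborel {p..q} h" if "set_integrable lborel {s..t} h" for h :: "real \<Rightarrow> real"
      using pq by (intro set_integrable_subset[OF that]) auto
    define \<alpha> where "\<alpha> = (LBINT v:{p..q}. \<bar>f v\<bar>)"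
    define \<beta> where "\<beta> = (LBINT v:{p..q}. \<bar>g v\<bar>)"
    have nn: "0 \<le> \<alpha>" "0 \<le> \<beta>"
      by (auto simp: \<alpha>_def \<beta>_def set_lebesgue_integral_def intro!: Bochner_Integration.integral_nonneg)
    have \<psi>pq: "\<psi> q - \<psi> p = \<alpha> + \<beta>"
      unfolding \<psi>_def \<alpha>_def \<beta>_def
      using LBINT_combine[OF set_integrable_abs[OF f] pq] LBINT_combine[OF set_integrable_abs[OF g] pq] by simp
    have incx: "x r - x p = (LBINT v:{p..r}. f v)" and incy: "y r - y p = (LBINT v:{p..r}. g v)"
      if "r \<in> {p..q}" for r
      using x[of r] x[of p] y[of r] y[of p] LBINT_combine[OF f, of p r] LBINT_combine[OF g, of p r] pq that by auto
    have incx_le: "\<bar>x r - x p\<bar> \<le> \<alpha>" and incy_le: "\<bar>y r - y p\<bar> \<le> \<beta>" if r: "r \<in> {p..q}" for r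
    proof -
      have "set_integrable lborel {p..r} f" "set_integrable lborel {p..r} g"
        using r by (auto intro: set_integrable_subset[OF sub[OF f]] set_integrable_subset[OF sub[OF g]])
      then show "\<bar>x r - x p\<bar> \<le> \<alpha>" "\<bar>y r - y p\<bar> \<le> \<beta>"
        unfolding incx[OF r] incy[OF r] \<alpha>_def \<beta>_def
        using r by (auto intro!: order_trans[OF abs_LBINT_le] LBINT_abs_mono[OF sub[OF f]] LBINT_abs_mono[OF sub[OF g]])
    qed
    have c1: "set_integrable lborel {p..q} (\<lambda>r. f r * (y r - y p))"
      by (intro sub set_integrable_mult_continuous f continuous_intros cy)
    have c2: "set_integrable lborel {p..q} (\<lambda>r. g r * (x r - x p))"
      by (intro sub set_integrable_mult_continuous g continuous_intros cx)
    \<comment> \<open>Freezing \<open>x\<close> and \<open>y\<close> at \<open>p\<close> splits off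
      the part linear in the increments, which cancels against the increment of the product.\<close>
    have "(LBINT v:{p..q}. f v * y v + g v * x v) =
        (LBINT v:{p..q}. (f v * (y v - y p) + g v * (x v - x p)) + (f v * y p + g v * x p))"
      by (simp add: algebra_simps)
    also have "\<dots> = (LBINT v:{p..q}. f v * (y v - y p)) + (LBINT v:{p..q}. g v * (x v - x p))
        + ((LBINT v:{p..q}. f v * y p) + (LBINT v:{p..q}. g v * x p))"
      by (simp add: set_integral_add c1 c2 sub[OF f] sub[OF g])
    also have "(LBINT v:{p..q}. f v * y p) + (LBINT v:{p..q}. g v * x p) = (x q - x p) * y p + (y q - y p) * x p"
      using incx[of q] incy[of q] pq by simp
    finally have eq: "G q - G p = (x q - x p) * (y q - y p)
        - (LBINT v:{p..q}. f v * (y v - y p)) - (LBINT v:{p..q}. g v * (x v - x p))"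
      unfolding G_def using LBINT_combine[OF int pq] by (simp add: algebra_simps)
    have "\<bar>(x q - x p) * (y q - y p)\<bar> \<le> \<alpha> * \<beta>"
      unfolding abs_mult using incx_le[of q] incy_le[of q] pq nn by (intro mult_mono) auto
    moreover have "\<bar>LBINT v:{p..q}. f v * (y v - y p)\<bar> \<le> \<alpha> * \<beta>"
      unfolding \<alpha>_def by (rule abs_LBINT_mult_le[OF sub[OF f] c1 incy_le])
    moreover have "\<bar>LBINT v:{p..q}. g v * (x v - x p)\<bar> \<le> \<beta> * \<alpha>"
      unfolding \<beta>_def by (rule abs_LBINT_mult_le[OF sub[OF g] c2 incx_le])
    ultimately have "\<bar>G q - G p\<bar> \<le> 3 * (\<alpha> * \<beta>)" unfolding eq by (simp add: mult.commute)
    also have "\<alpha> * \<beta> \<le> (\<alpha> + \<beta>)\<^sup>2" using nn by (simp add: power2_eq_square algebra_simps)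
    finally show "\<bar>G q - G p\<bar> \<le> 3 * (\<psi> q - \<psi> p)\<^sup>2" unfolding \<psi>pq by simp
  qed (rule st)
  moreover have "(LBINT v:{s..s}. f v * y v + g v * x v) = 0"
  proof -
    have "integral {s..s} (\<lambda>v. f v * y v + g v * x v) = 0" by simp
    then show ?thesis
      using set_borel_integral_eq_integral(2)[OF set_integrable_subset[OF int, of "{s..s}"]] st by simp
  qed
  ultimately show "x t * y t = x s * y s + (LBINT r:{s..t}. f r * y r + g r * x r)"
    by (simp add: G_def)
qed

text \<open>The defect over \<open>[p,q]\<close> is the second-order Taylor remainder of
  \<open>exp\<close> plus an integral of \<open>c\<close> against an increment of
  \<open>exp\<close>. With \<open>B\<close> bounding the primitive, each is at most
  \<open>exp B\<close> times the squared mass of \<open>\<bar>c\<bar>\<close>, which gives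
  \<open>2 * exp B\<close>.\<close>

lemma LBINT_exp:
  fixes c :: "real \<Rightarrow> real"
  assumes st: "s \<le> t" and c: "set_integrable lborel {s..t} c"
  shows "exp (LBINT v:{s..t}. c v) = 1 + (LBINT r:{s..t}. c r * exp (LBINT v:{s..r}. c v))"
proof -
  define C where "C r = (LBINT v:{s..r}. c v)" for r
  have cC: "continuous_on {s..t} C" unfolding C_def by (rule continuous_on_LBINT[OF c])
  obtain B where B: "\<And>r. r \<in> {s..t} \<Longrightarrow> \<bar>C r\<bar> \<le> B"
    using compact_imp_bounded[OF compact_continuous_image[OF cC compact_Icc]] by (force simp: bounded_iff)
  have eb: "exp u \<le> exp B" if "\<bar>u\<bar> \<le> B" for u using that by auto
  have lip: "\<bar>exp v - exp u\<bar> \<le> exp B * \<bar>v - u\<bar>" if "\<bar>u\<bar> \<le> B" "\<bar>v\<bar> \<le> B" for u v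
  proof -
    have "norm (exp v - exp u) \<le> exp B * norm (v - u)"
      by (rule field_differentiable_bound[of "{-B..B}" exp exp])
        (use that in \<open>auto intro: DERIV_subset[OF DERIV_exp] eb\<close>)
    then show ?thesis by simp
  qed
  have int: "set_integrable lborel {s..t} (\<lambda>r. c r * exp (C r))"
    by (intro set_integrable_mult_continuous c continuous_intros cC)
  define G where "G r = exp (C r) - (LBINT v:{s..r}. c v * exp (C v))" for r
  have "G t = G s"
  proof (rule constant_if_quadratic_increments[of s t "\<lambda>r. LBINT v:{s..r}. \<bar>c v\<bar>" G "2 * exp B"])
    show "continuous_on {s..t} (\<lambda>r. LBINT v:{s..r}. \<bar>c v\<bar>)"
      by (intro continuous_on_LBINT set_integrable_abs c)
  next
    fix p q assume pq: "s \<le> p" "p \<le> q" "q \<le> t"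
    show "(LBINT v:{s..p}. \<bar>c v\<bar>) \<le> (LBINT v:{s..q}. \<bar>c v\<bar>)" by (rule LBINT_abs_mono[OF c pq])
    have sub: "set_integrable lborel {p..q} h" if "set_integrable lborel {s..t} h" for h :: "real \<Rightarrow> real"
      using pq by (intro set_integrable_subset[OF that]) auto
    define \<gamma> where "\<gamma> = (LBINT v:{p..q}. \<bar>c v\<bar>)"
    have incC: "\<bar>C r - C p\<bar> \<le> \<gamma>" if r: "r \<in> {p..q}" for r
    proof -
      have "set_integrable lborel {p..r} c"
        using r by (auto intro: set_integrable_subset[OF sub[OF c]])
      moreover have "C r - C p = (LBINT v:{p..r}. c v)"
        using LBINT_combine[OF c, of p r] pq r by (auto simp: C_def)
      ultimately show ?thesis
        unfolding \<gamma>_def using r by (auto intro!: order_trans[OF abs_LBINT_le] LBINT_abs_mono[OF sub[OF c]])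
    qed
    have \<gamma>0: "0 \<le> \<gamma>" using incC[of p] pq by simp
    have c1: "set_integrable lborel {p..q} (\<lambda>r. c r * (exp (C r) - exp (C p)))"
      by (intro sub set_integrable_mult_continuous c continuous_intros cC)
    have "(LBINT v:{p..q}. c v * exp (C v)) = (LBINT v:{p..q}. c v * (exp (C v) - exp (C p)) + c v * exp (C p))"
      by (simp add: algebra_simps)
    also have "\<dots> = (LBINT v:{p..q}. c v * (exp (C v) - exp (C p))) + (C q - C p) * exp (C p)"
    proof -
      have "C q - C p = (LBINT v:{p..q}. c v)" using LBINT_combine[OF c pq] by (simp add: C_def)
      then show ?thesis by (simp add: set_integral_add c1 sub[OF c])
    qed
    finally have eq: "G q - G p = (exp (C q) - exp (C p) - (C q - C p) * exp (C p))
        - (LBINT v:{p..q}. c v * (exp (C v) - exp (C p)))"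
      unfolding G_def using LBINT_combine[OF int pq] by simp
    have CB: "\<bar>C r\<bar> \<le> B" if "r \<in> {p..q}" for r using B[of r] that pq by auto
    have taylor: "\<bar>exp v - exp u - (v - u) * exp u\<bar> \<le> exp B * \<bar>v - u\<bar>\<^sup>2" if uv: "\<bar>u\<bar> \<le> B" "\<bar>v\<bar> \<le> B" for u v
    proof -
      have ex: "\<exists>\<xi>. \<bar>\<xi>\<bar> \<le> B \<and> \<bar>\<xi> - u\<bar> \<le> \<bar>v - u\<bar> \<and> exp v - exp u = (v - u) * exp \<xi>"
      proof (cases u v rule: linorder_cases)
        case less
        then obtain z where "z > u" "z < v" "exp v - exp u = (v - u) * exp z"
          using MVT2[of u v exp exp] by (auto intro: DERIV_exp)
        then show ?thesis using uv by (intro exI[of _ z]) auto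
      next
        case greater
        then obtain z where z: "z > v" "z < u" "exp u - exp v = (u - v) * exp z"
          using MVT2[of v u exp exp] by (auto intro: DERIV_exp)
        then show ?thesis using uv by (intro exI[of _ z]) (auto simp: algebra_simps)
      qed (use uv in \<open>auto intro: exI[of _ u]\<close>)
      then obtain \<xi> where \<xi>: "\<bar>\<xi>\<bar> \<le> B" "\<bar>\<xi> - u\<bar> \<le> \<bar>v - u\<bar>" "exp v - exp u = (v - u) * exp \<xi>" by blast
      have "\<bar>exp v - exp u - (v - u) * exp u\<bar> = \<bar>v - u\<bar> * \<bar>exp \<xi> - exp u\<bar>"
        unfolding \<xi>(3) by (simp flip: abs_mult add: algebra_simps)
      also have "\<dots> \<le> \<bar>v - u\<bar> * (exp B * \<bar>v - u\<bar>)"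
        using lip[OF uv(1) \<xi>(1)] \<xi>(2) by (intro mult_left_mono order_trans[OF lip[OF uv(1) \<xi>(1)]]) auto
      finally show ?thesis by (simp add: power2_eq_square algebra_simps)
    qed
    have "\<bar>exp (C q) - exp (C p) - (C q - C p) * exp (C p)\<bar> \<le> exp B * \<bar>C q - C p\<bar>\<^sup>2"
      using pq by (intro taylor CB) auto
    also have "\<dots> \<le> exp B * \<gamma>\<^sup>2"
      using incC[of q] pq by (intro mult_left_mono power_mono) auto
    finally have "\<bar>exp (C q) - exp (C p) - (C q - C p) * exp (C p)\<bar> \<le> exp B * \<gamma>\<^sup>2" .
    moreover have "\<bar>LBINT v:{p..q}. c v * (exp (C v) - exp (C p))\<bar> \<le> \<gamma> * (exp B * \<gamma>)"
      unfolding \<gamma>_def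
    proof (rule abs_LBINT_mult_le[OF sub[OF c] c1])
      fix r assume r: "r \<in> {p..q}"
      have "\<bar>exp (C r) - exp (C p)\<bar> \<le> exp B * \<bar>C r - C p\<bar>" using r pq by (intro lip CB) auto
      also have "\<dots> \<le> exp B * (LBINT v:{p..q}. \<bar>c v\<bar>)" using incC[OF r] by (simp add: \<gamma>_def)
      finally show "\<bar>exp (C r) - exp (C p)\<bar> \<le> exp B * (LBINT v:{p..q}. \<bar>c v\<bar>)" .
    qed
    ultimately have "\<bar>G q - G p\<bar> \<le> 2 * exp B * \<gamma>\<^sup>2"
      unfolding eq by (simp add: power2_eq_square algebra_simps)
    then show "\<bar>G q - G p\<bar> \<le> 2 * exp B * ((LBINT v:{s..q}. \<bar>c v\<bar>) - (LBINT v:{s..p}. \<bar>c v\<bar>))\<^sup>2"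
      using LBINT_combine[OF set_integrable_abs[OF c] pq] by (simp add: \<gamma>_def)
  qed (rule st)
  moreover have z: "(LBINT v:{s..s}. h v) = 0" if "set_integrable lborel {s..t} h" for h :: "real \<Rightarrow> real"
    using set_borel_integral_eq_integral(2)[OF set_integrable_subset[OF that, of "{s..s}"]] st by simp
  ultimately show ?thesis using z[OF int] z[OF c] by (simp add: G_def C_def)
qed

text \<open>Between jumps the density solves a linear equation with rate \<open>c\<close>. The
  product rule for such a factor is stated from an arbitrary starting time \<open>s\<close>, so that
  pieces between jumps can be glued.\<close>

lemma LBINT_product_exp:
  fixes a c x :: "real \<Rightarrow> real"
  assumes st: "s \<le> t" and a: "set_integrable lborel {s..t} a" and c: "set_integrable lborel {s..t} c"
    and x: "\<And>r. r \<in> {s..t} \<Longrightarrow> x r = x s + (LBINT v:{s..r}. a v)"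
    and l: "\<And>r. r \<in> {s..t} \<Longrightarrow> l r = l s * exp (LBINT v:{s..r}. c v)"
  shows "set_integrable lborel {s..t} (\<lambda>r. l r * (a r + c r * x r))"
    and "l t * x t = l s * x s + (LBINT r:{s..t}. l r * (a r + c r * x r))"
proof -
  define l0 where "l0 = l s"
  have l: "l r = l0 * exp (LBINT v:{s..r}. c v)" if "r \<in> {s..t}" for r
    using l[OF that] by (simp add: l0_def)
  have cE: "continuous_on {s..t} (\<lambda>r. exp (LBINT v:{s..r}. c v))"
    by (intro continuous_intros continuous_on_LBINT[OF c])
  have cl: "set_integrable lborel {s..t} (\<lambda>r. c r * l r)"
    by (rule set_integrable_mult_continuous[OF c])
      (rule continuous_on_eq[of _ "\<lambda>r. l0 * exp (LBINT v:{s..r}. c v)"], intro continuous_intros cE, simp add: l)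
  have l': "l r = l s + (LBINT v:{s..r}. c v * l v)" if r: "r \<in> {s..t}" for r
  proof -
    have "set_integrable lborel {s..r} c" using r by (intro set_integrable_subset[OF c]) auto
    then have "l r = l0 * (1 + (LBINT v:{s..r}. c v * exp (LBINT v:{s..v}. c v)))"
      using l[OF r] LBINT_exp[of s r c] r by simp
    also have "\<dots> = l0 + (LBINT v:{s..r}. l0 * (c v * exp (LBINT v:{s..v}. c v)))"
      by (simp add: algebra_simps)
    also have "(LBINT v:{s..r}. l0 * (c v * exp (LBINT v:{s..v}. c v))) = (LBINT v:{s..r}. c v * l v)"
      using r by (intro set_lebesgue_integral_cong) (auto simp: l mult_ac)
    finally show ?thesis by (simp add: l0_def)
  qed
  have *: "(\<lambda>r. a r * l r + c r * l r * x r) = (\<lambda>r. l r * (a r + c r * x r))"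
    by (simp add: algebra_simps)
  show "set_integrable lborel {s..t} (\<lambda>r. l r * (a r + c r * x r))"
    using LBINT_product(1)[OF st a cl x l'] unfolding * .
  show "l t * x t = l s * x s + (LBINT r:{s..t}. l r * (a r + c r * x r))"
    using LBINT_product(2)[OF st a cl x l'] unfolding * by (simp add: mult.commute)
qed

text \<open>The product formula for a process with drift \<open>a\<close> and jumps \<open>\<theta>\<close> and a multiplicative
  functional with rate \<open>c\<close> and jump factors \<open>e\<close>; \<open>Wm\<close> and \<open>Lm\<close> are their left limits.\<close>

lemma product_formula_jumps:
  fixes a c Wm Lm :: "real \<Rightarrow> real" and \<tau> \<theta> e :: "nat \<Rightarrow> real"
  assumes a: "set_integrable lborel {0..T} a" and c: "set_integrable lborel {0..T} c"
    and \<tau>0: "\<tau> 0 = 0" and \<tau>: "\<And>k. k < N \<Longrightarrow> \<tau> k < \<tau> (Suc k)" and \<tau>N: "\<tau> N \<le> T"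
    and Wm: "\<And>k r. k \<le> N \<Longrightarrow> \<tau> k < r \<Longrightarrow> r \<le> T \<Longrightarrow> (k < N \<Longrightarrow> r \<le> \<tau> (Suc k)) \<Longrightarrow>
      Wm r = w0 + (\<Sum>n=1..k. \<theta> n) + (LBINT v:{0..r}. a v)"
    and Lm: "\<And>k r. k \<le> N \<Longrightarrow> \<tau> k < r \<Longrightarrow> r \<le> T \<Longrightarrow> (k < N \<Longrightarrow> r \<le> \<tau> (Suc k)) \<Longrightarrow>
      Lm r = exp (LBINT v:{0..r}. c v) * (\<Prod>n=1..k. e n)"
  shows "set_integrable lborel {0..T} (\<lambda>r. Lm r * (a r + c r * Wm r))" (is ?int)
    and "(exp (LBINT v:{0..T}. c v) * (\<Prod>n=1..N. e n)) * (w0 + (\<Sum>n=1..N. \<theta> n) + (LBINT v:{0..T}. a v)) =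
      w0 + (\<Sum>n=1..N. Lm (\<tau> n) * ((Wm (\<tau> n) + \<theta> n) * e n - Wm (\<tau> n)))
      + (LBINT r:{0..T}. Lm r * (a r + c r * Wm r))" (is ?eq)
proof -
  define h where "h r = Lm r * (a r + c r * Wm r)" for r
  \<comment> \<open>\<open>WW k\<close> and \<open>LL k\<close> are the branches after
    \<open>k\<close> jumps, continued to all times. They agree with the left limits strictly after
    \<open>\<tau> k\<close> and up to and including the next jump time.\<close>
  define WW where "WW k r = w0 + (\<Sum>n=1..k. \<theta> n) + (LBINT v:{0..r}. a v)" for k r
  define LL where "LL k r = exp (LBINT v:{0..r}. c v) * (\<Prod>n=1..k. e n)" for k r
  have \<tau>mono: "\<tau> j \<le> \<tau> k" if "j \<le> k" "k \<le> N" for j k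
    using that
  proof (induction k rule: dec_induct)
    case (step k) then show ?case using \<tau>[of k] by simp
  qed simp
  have sub: "set_integrable lborel {p..q} f" if "set_integrable lborel {0..T} f" "0 \<le> p" "q \<le> T" for f :: "real \<Rightarrow> real" and p q
    using that by (intro set_integrable_subset[OF that(1)]) auto
  have piece: "set_integrable lborel {\<tau> k..r} h \<and>
      LL k r * WW k r = LL k (\<tau> k) * WW k (\<tau> k) + (LBINT v:{\<tau> k..r}. h v)"
    if k: "k \<le> N" and r: "\<tau> k \<le> r" "r \<le> T" "k < N \<Longrightarrow> r \<le> \<tau> (Suc k)" for k r
  proof -
    have \<tau>k: "0 \<le> \<tau> k" using \<tau>mono[of 0 k] \<tau>0 k by simp
    have x: "WW k v = WW k (\<tau> k) + (LBINT v:{\<tau> k..v}. a v)" if "v \<in> {\<tau> k..r}" for v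
      using LBINT_combine[OF a, of "\<tau> k" v] that r \<tau>k by (auto simp: WW_def)
    have l: "LL k v = LL k (\<tau> k) * exp (LBINT v:{\<tau> k..v}. c v)" if "v \<in> {\<tau> k..r}" for v
      using LBINT_combine[OF c, of "\<tau> k" v] that r \<tau>k by (auto simp: LL_def exp_add)
    note pr = LBINT_product_exp[OF r(1) sub[OF a \<tau>k r(2)] sub[OF c \<tau>k r(2)] x l]
    define h' where "h' v = LL k v * (a v + c v * WW k v)" for v
    \<comment> \<open>At \<open>\<tau> k\<close> itself the left limits still show the previous
      branch; a single point is a null set.\<close>
    have ae: "AE v in lborel. indicator {\<tau> k..r} v *\<^sub>R h' v = indicator {\<tau> k..r} v *\<^sub>R h v"
    proof -
      have "AE v in lborel. v \<noteq> \<tau> k" by (rule AE_lborel_singleton)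
      then show ?thesis
      proof eventually_elim
        case (elim v)
        show ?case
        proof (cases "v \<in> {\<tau> k..r}")
          case True
          then have "\<tau> k < v" "v \<le> T" "k < N \<Longrightarrow> v \<le> \<tau> (Suc k)" using elim r by auto
          then have "Wm v = WW k v" "Lm v = LL k v"
            unfolding WW_def LL_def by (intro Wm[OF k] Lm[OF k]; simp)+
          then show ?thesis by (simp add: h_def h'_def)
        qed simp
      qed
    qed
    have h'int: "set_integrable lborel {\<tau> k..r} h'" using pr(1) by (simp add: h'_def[abs_def])
    \<comment> \<open>Almost everywhere equality does not transfer measurability by itself; on this
      piece \<open>h\<close> is \<open>h'\<close> with its value changed at one point.\<close>
    have hm: "(\<lambda>v. indicator {\<tau> k..r} v *\<^sub>R h v) \<in> borel_measurable lborel"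
    proof -
      have eq: "(\<lambda>v. indicator {\<tau> k..r} v *\<^sub>R h v) =
          (\<lambda>v. if v = \<tau> k then indicator {\<tau> k..r} v *\<^sub>R h (\<tau> k) else indicator {\<tau> k..r} v *\<^sub>R h' v)"
      proof
        fix v
        show "indicator {\<tau> k..r} v *\<^sub>R h v =
          (if v = \<tau> k then indicator {\<tau> k..r} v *\<^sub>R h (\<tau> k) else indicator {\<tau> k..r} v *\<^sub>R h' v)"
        proof (cases "v \<in> {\<tau> k..r} \<and> v \<noteq> \<tau> k")
          case True
          then have "\<tau> k < v" "v \<le> T" "k < N \<Longrightarrow> v \<le> \<tau> (Suc k)" using r by auto
          then have "Wm v = WW k v" "Lm v = LL k v"
            unfolding WW_def LL_def by (intro Wm[OF k] Lm[OF k]; simp)+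
          then show ?thesis using True by (simp add: h_def h'_def)
        qed auto
      qed
      have "(\<lambda>v. indicator {\<tau> k..r} v *\<^sub>R h' v) \<in> borel_measurable lborel"
        using borel_measurable_integrable[OF h'int[unfolded set_integrable_def]] .
      then show ?thesis unfolding eq by measurable
    qed
    have h'm: "(\<lambda>v. indicator {\<tau> k..r} v *\<^sub>R h' v) \<in> borel_measurable lborel"
      using borel_measurable_integrable[OF h'int[unfolded set_integrable_def]] .
    have "set_integrable lborel {\<tau> k..r} h"
      unfolding set_integrable_def
      using integrable_cong_AE[OF h'm hm ae] h'int by (simp add: set_integrable_def)
    moreover have "(LBINT v:{\<tau> k..r}. h v) = (LBINT v:{\<tau> k..r}. h' v)"
      unfolding set_lebesgue_integral_def using integral_cong_AE[OF h'm hm ae] by simp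
    ultimately show ?thesis using pr(2) by (simp add: h'_def)
  qed
  have main: "set_integrable lborel {0..r} h \<and>
      LL k r * WW k r = w0 + (\<Sum>n=1..k. Lm (\<tau> n) * ((Wm (\<tau> n) + \<theta> n) * e n - Wm (\<tau> n)))
        + (LBINT v:{0..r}. h v)"
    if "k \<le> N" "\<tau> k \<le> r" "r \<le> T" "k < N \<Longrightarrow> r \<le> \<tau> (Suc k)" for k r
    using that
  proof (induction k arbitrary: r)
    case 0
    have "(LBINT v:{0..0}. f v) = 0" if "set_integrable lborel {0..T} f" for f :: "real \<Rightarrow> real"
      using set_borel_integral_eq_integral(2)[OF set_integrable_subset[OF that, of "{0..0}"]] 0 \<tau>0 by simp
    then have "LL 0 0 * WW 0 0 = w0" using a c by (simp add: LL_def WW_def)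
    then show ?case using piece[of 0 r] 0 \<tau>0 by simp
  next
    case (Suc k)
    define t where "t = \<tau> (Suc k)"
    have kN: "k < N" and tT: "t \<le> T" and t0: "0 \<le> t" and kt: "\<tau> k < t"
      using Suc.prems \<tau>mono[of 0 "Suc k"] \<tau>0 \<tau>[of k] \<tau>mono[of "Suc k" N] \<tau>N by (auto simp: t_def)
    have IH: "set_integrable lborel {0..t} h"
      "LL k t * WW k t = w0 + (\<Sum>n=1..k. Lm (\<tau> n) * ((Wm (\<tau> n) + \<theta> n) * e n - Wm (\<tau> n))) + (LBINT v:{0..t}. h v)"
      using Suc.IH[of t] kN tT kt by (auto simp: t_def)
    have left: "Wm t = WW k t" "Lm t = LL k t"
      using Wm[of k t] Lm[of k t] kN tT kt by (auto simp: t_def WW_def LL_def)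
    have right: "WW (Suc k) t = WW k t + \<theta> (Suc k)" "LL (Suc k) t = LL k t * e (Suc k)"
      by (auto simp: WW_def LL_def)
    have p: "set_integrable lborel {t..r} h"
      "LL (Suc k) r * WW (Suc k) r = LL (Suc k) t * WW (Suc k) t + (LBINT v:{t..r}. h v)"
      using piece[of "Suc k" r] Suc.prems by (auto simp: t_def)
    have tr: "t \<le> r" using Suc.prems by (simp add: t_def)
    have "set_integrable lborel ({0..t} \<union> {t..r}) h" by (intro set_integrable_Un IH p) auto
    moreover have "{0..t} \<union> {t..r} = {0..r}" using t0 tr by auto
    ultimately have int: "set_integrable lborel {0..r} h" by simp
    \<comment> \<open>Both factors jump at the same time, so the bracket contains the changed value
      times the changed factor, weighted by the left limit of the density.\<close>
    have "LL (Suc k) t * WW (Suc k) t =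
        LL k t * WW k t + Lm t * ((Wm t + \<theta> (Suc k)) * e (Suc k) - Wm t)"
      unfolding left right by (simp add: algebra_simps)
    then show ?case
      using int p IH LBINT_combine[OF int t0 tr] by (simp add: t_def)
  qed
  show ?int ?eq
    using main[of N T] \<tau>N by (auto simp: h_def[abs_def] LL_def WW_def)
qed

section \<open>Predictable processes\<close>

text \<open>Meant for the natural filtration of the loss, which by construction is neither completed
  nor made right-continuous: sets have to be measurable exactly, not up to null sets.\<close>

locale filtered_space =
  fixes M :: "'a measure" and F :: "real \<Rightarrow> 'a measure" and T :: real
  assumes space_F: "\<And>t. 0 \<le> t \<Longrightarrow> space (F t) = space M"
    and F_mono: "\<And>s t. 0 \<le> s \<Longrightarrow> s \<le> t \<Longrightarrow> sets (F s) \<subseteq> sets (F t)"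
    and F_sub: "\<And>t. 0 \<le> t \<Longrightarrow> sets (F t) \<subseteq> sets M"
    and T_pos: "0 < T"
begin

abbreviation "P \<equiv> predictable {0..T} M F"

lemma F_into_space: "0 \<le> t \<Longrightarrow> A \<in> sets (F t) \<Longrightarrow> A \<subseteq> space M"
  using sets.sets_into_space space_F by metis

lemma generator_P:
  "{{0} \<times> A | A. A \<in> sets (F 0)} \<union> {({s<..t} \<inter> {0..T}) \<times> A | s t A. 0 \<le> s \<and> s < t \<and> A \<in> sets (F s)}
    \<subseteq> Pow ({0..T} \<times> space M)"
  using F_into_space[of 0] F_into_space T_pos by fastforce

lemma space_P: "space P = {0..T} \<times> space M"
  unfolding predictable_def by (rule space_measure_of[OF generator_P])

lemma zero_in_P: "A \<in> sets (F 0) \<Longrightarrow> {0} \<times> A \<in> sets P"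
  unfolding predictable_def sets_measure_of[OF generator_P] by (rule sigma_sets.Basic) blast

lemma rect_in_P:
  assumes "0 \<le> s" "A \<in> sets (F s)"
  shows "{s<..T} \<times> A \<in> sets P"
proof -
  \<comment> \<open>A right end beyond \<open>T\<close> is cut off by the intersection;
    \<open>max s T + 1\<close> exceeds \<open>s\<close> even when \<open>s\<close> lies beyond
    \<open>T\<close>.\<close>
  have "({s<..max s T + 1} \<inter> {0..T}) \<times> A \<in> sets P"
    unfolding predictable_def sets_measure_of[OF generator_P]
    using assms by (intro sigma_sets.Basic UnI2 CollectI exI[of _ s] exI[of _ "max s T + 1"] exI[of _ A]) auto
  moreover have "{s<..max s T + 1} \<inter> {0..T} = {s<..T}" using assms by auto
  ultimately show ?thesis by simp
qed

lemma all_time_in_P: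
  assumes "A \<in> sets (F 0)"
  shows "{0..T} \<times> A \<in> sets P"
proof -
  have "{0..T} \<times> A = {0} \<times> A \<union> {0<..T} \<times> A" using T_pos by auto
  then show ?thesis using zero_in_P[OF assms] rect_in_P[OF _ assms] by simp
qed

lemma measurable_into_P:
  assumes "f \<in> space N \<rightarrow> {0..T} \<times> space M"
    and "\<And>A. A \<in> sets (F 0) \<Longrightarrow> f -` ({0} \<times> A) \<inter> space N \<in> sets N"
    and "\<And>s t A. 0 \<le> s \<Longrightarrow> s < t \<Longrightarrow> A \<in> sets (F s) \<Longrightarrow>
      f -` (({s<..t} \<inter> {0..T}) \<times> A) \<inter> space N \<in> sets N"
  shows "f \<in> measurable N P"
  unfolding predictable_def using assms by (intro measurable_measure_of generator_P) auto

lemma measurable_fst_P [measurable]: "fst \<in> borel_measurable P"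
proof (rule borel_measurableI_greater)
  fix a
  have "{w \<in> space P. a < fst w} = (if a < 0 then space P else {a<..T} \<times> space M)"
    using T_pos by (auto simp: space_P)
  moreover have "space M \<in> sets (F a)" if "0 \<le> a" using space_F[OF that] sets.top by metis
  ultimately show "{w \<in> space P. a < fst w} \<in> sets P"
    using rect_in_P[of a "space M"] by auto
qed

lemma measurable_section:
  assumes "Y \<in> measurable P N" "0 \<le> t" "t \<le> T"
  shows "(\<lambda>\<omega>. Y (t, \<omega>)) \<in> measurable (F t) N"
proof -
  have "(\<lambda>\<omega>. (t, \<omega>)) \<in> measurable (F t) P"
  proof (rule measurable_into_P)
    show "(\<lambda>\<omega>. (t, \<omega>)) \<in> space (F t) \<rightarrow> {0..T} \<times> space M" using assms space_F by auto
    show "(\<lambda>\<omega>. (t, \<omega>)) -` ({0} \<times> A) \<inter> space (F t) \<in> sets (F t)" if "A \<in> sets (F 0)" for A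
    proof (cases "t = 0")
      case True
      then have "(\<lambda>\<omega>. (t, \<omega>)) -` ({0} \<times> A) \<inter> space (F t) = A \<inter> space (F t)" by auto
      then show ?thesis using that True by auto
    next
      case False
      then have "(\<lambda>\<omega>. (t, \<omega>)) -` ({0} \<times> A) \<inter> space (F t) = {}" by auto
      then show ?thesis by simp
    qed
    show "(\<lambda>\<omega>. (t, \<omega>)) -` (({s<..r} \<inter> {0..T}) \<times> A) \<inter> space (F t) \<in> sets (F t)"
      if "0 \<le> s" "s < r" "A \<in> sets (F s)" for s r A
    proof (cases "t \<in> {s<..r}")
      case True
      then have "(\<lambda>\<omega>. (t, \<omega>)) -` (({s<..r} \<inter> {0..T}) \<times> A) \<inter> space (F t) = A \<inter> space (F t)"
        using assms by auto
      moreover have "A \<in> sets (F t)" using F_mono[of s t] that True by auto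
      ultimately show ?thesis by auto
    next
      case False
      then have "(\<lambda>\<omega>. (t, \<omega>)) -` (({s<..r} \<inter> {0..T}) \<times> A) \<inter> space (F t) = {}" by auto
      then show ?thesis by simp
    qed
  qed
  then show ?thesis using assms(1) by (rule measurable_compose)
qed

lemma measurable_path:
  assumes "\<omega> \<in> space M"
  shows "(\<lambda>t. (t, \<omega>)) \<in> measurable (restrict_space borel {0..T}) P"
proof (rule measurable_into_P)
  show "(\<lambda>t. (t, \<omega>)) \<in> space (restrict_space borel {0..T}) \<rightarrow> {0..T} \<times> space M"
    using assms by (auto simp: space_restrict_space)
  show "(\<lambda>t. (t, \<omega>)) -` ({0} \<times> A) \<inter> space (restrict_space borel {0..T}) \<in> sets (restrict_space borel {0..T})" for A
  proof -
    have "(\<lambda>t. (t, \<omega>)) -` ({0} \<times> A) \<inter> space (restrict_space borel {0..T}) = (if \<omega> \<in> A then {0} else {})"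
      using T_pos by (auto simp: space_restrict_space)
    then show ?thesis using T_pos by (auto simp: sets_restrict_space_iff)
  qed
  show "(\<lambda>t. (t, \<omega>)) -` (({s<..r} \<inter> {0..T}) \<times> A) \<inter> space (restrict_space borel {0..T})
      \<in> sets (restrict_space borel {0..T})" for s r A
  proof -
    have "(\<lambda>t. (t, \<omega>)) -` (({s<..r} \<inter> {0..T}) \<times> A) \<inter> space (restrict_space borel {0..T}) =
        (if \<omega> \<in> A then {s<..r} \<inter> {0..T} else {})"
      by (auto simp: space_restrict_space)
    then show ?thesis by (auto simp: sets_restrict_space_iff)
  qed
qed

text \<open>The predictable \<sigma>-algebra is coarser than the product one; this is the bridge to
  Fubini arguments.\<close>

lemma measurable_id_P: "(\<lambda>x. x) \<in> measurable (restrict_space borel {0..T} \<Otimes>\<^sub>M M) P"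
proof (rule measurable_into_P)
  let ?N = "restrict_space borel {0..T} \<Otimes>\<^sub>M M"
  have sp: "space ?N = {0..T} \<times> space M" by (simp add: space_pair_measure space_restrict_space)
  show "(\<lambda>x. x) \<in> space ?N \<rightarrow> {0..T} \<times> space M" by (auto simp: sp)
  show "(\<lambda>x. x) -` ({0} \<times> A) \<inter> space ?N \<in> sets ?N" if "A \<in> sets (F 0)" for A
  proof -
    have "(\<lambda>x. x) -` ({0} \<times> A) \<inter> space ?N = {0} \<times> A"
      using F_into_space[OF _ that] T_pos by (auto simp: sp)
    moreover have "A \<in> sets M" using that F_sub[of 0] by auto
    moreover have "{0} \<in> sets (restrict_space borel {0..T})" using T_pos by (auto simp: sets_restrict_space_iff)
    ultimately show ?thesis by auto
  qed
  show "(\<lambda>x. x) -` (({s<..r} \<inter> {0..T}) \<times> A) \<inter> space ?N \<in> sets ?N"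
    if "0 \<le> s" "s < r" "A \<in> sets (F s)" for s r A
  proof -
    have "(\<lambda>x. x) -` (({s<..r} \<inter> {0..T}) \<times> A) \<inter> space ?N = ({s<..r} \<inter> {0..T}) \<times> A"
      using F_into_space[OF that(1,3)] by (auto simp: sp)
    moreover have "A \<in> sets M" using that F_sub[of s] by auto
    moreover have "{s<..r} \<inter> {0..T} \<in> sets (restrict_space borel {0..T})" by (auto simp: sets_restrict_space_iff)
    ultimately show ?thesis by auto
  qed
qed

text \<open>\<open>Y s\<close> is approximated by \<open>X\<close> at the last grid point strictly
  before \<open>s\<close>. On each grid interval, open on the left and closed on the right, that
  value is known at the left end, so the level sets of an approximation are countable unions of
  predictable sets.\<close>

lemma predictable_left_limit:
  fixes X Y :: "real \<Rightarrow> 'a \<Rightarrow> real"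
  assumes X: "\<And>r. 0 \<le> r \<Longrightarrow> r \<le> T \<Longrightarrow> X r \<in> borel_measurable (F r)"
    and Y0: "\<And>\<omega>. \<omega> \<in> space M \<Longrightarrow> Y 0 \<omega> = X 0 \<omega>"
    and lim: "\<And>s \<omega>. \<omega> \<in> space M \<Longrightarrow> 0 < s \<Longrightarrow> s \<le> T \<Longrightarrow> ((\<lambda>r. X r \<omega>) \<longlongrightarrow> Y s \<omega>) (at_left s)"
  shows "(\<lambda>(s, \<omega>). Y s \<omega>) \<in> borel_measurable P"
proof -
  \<comment> \<open>Ceiling minus one, rather than floor, keeps the grid point strictly below
    \<open>s\<close> even if \<open>s\<close> lies on the grid; time 0 has no past and is set by
    hand.\<close>
  define d where "d n s = (if s = 0 then 0 else (real_of_int \<lceil>s * real (Suc n)\<rceil> - 1) / real (Suc n))"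
    for n :: nat and s :: real
  have d: "0 \<le> d n s \<and> d n s < s \<and> s - 1 / real (Suc n) \<le> d n s" if "0 < s" for n s
  proof -
    define m where "m = real (Suc n)"
    define C where "C = real_of_int \<lceil>s * m\<rceil>"
    have m: "0 < m" by (simp add: m_def)
    have "1 \<le> \<lceil>s * m\<rceil>" using that m by simp
    then have C1: "1 \<le> C" by (simp add: C_def)
    have C: "s * m \<le> C" "C - 1 < s * m" unfolding C_def by linarith+
    have "d n s = (C - 1) / m" using that by (simp add: d_def C_def m_def)
    moreover have "(s - 1 / m) * m = s * m - 1" using m by (simp add: algebra_simps)
    ultimately show ?thesis
      unfolding m_def[symmetric] using C C1 m by (simp add: pos_divide_less_eq pos_le_divide_eq)
  qed
  have "(\<lambda>w. X (d n (fst w)) (snd w)) \<in> borel_measurable P" for n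
  proof (rule borel_measurableI_greater)
    fix a
    let ?E = "\<lambda>r. {\<omega>\<in>space M. a < X r \<omega>}"
    have E: "?E r \<in> sets (F r)" if "0 \<le> r" "r \<le> T" for r
    proof -
      have "{\<omega>\<in>space (F r). a < X r \<omega>} \<in> sets (F r)" using X[OF that] by measurable
      then show ?thesis using space_F that by simp
    qed
    have "{w \<in> space P. a < X (d n (fst w)) (snd w)} =
      {0} \<times> ?E 0 \<union> (\<Union>k\<in>{k::nat. real k / real (Suc n) \<le> T}.
        {real k / real (Suc n)<..T} \<times> ?E (real k / real (Suc n)) \<inter> {w\<in>space P. fst w \<le> real (Suc k) / real (Suc n)})"
      (is "?L = ?R")
    proof (intro set_eqI iffI)
      fix w assume "w \<in> ?L"
      then obtain s \<omega> where w: "w = (s, \<omega>)" "s \<in> {0..T}" "\<omega> \<in> space M" "a < X (d n s) \<omega>"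
        by (auto simp: space_P)
      show "w \<in> ?R"
      proof (cases "s = 0")
        case True then show ?thesis using w by (auto simp: d_def)
      next
        case False
        define k where "k = nat (\<lceil>s * real (Suc n)\<rceil> - 1)"
        have "1 \<le> \<lceil>s * real (Suc n)\<rceil>" using False w by auto
        then have rk: "real k = real_of_int \<lceil>s * real (Suc n)\<rceil> - 1" by (simp add: k_def)
        then have dk: "d n s = real k / real (Suc n)" using False by (simp add: d_def)
        have "s * real (Suc n) \<le> real (Suc k)" using rk by linarith
        then have "s \<le> real (Suc k) / real (Suc n)" by (simp add: field_simps)
        then show ?thesis using d[of s n] w False unfolding dk by (auto simp: space_P intro!: exI[of _ k])
      qed
    next
      fix w assume "w \<in> ?R"
      then show "w \<in> ?L"
      proof
        assume "w \<in> {0} \<times> ?E 0" then show ?thesis using T_pos by (auto simp: space_P d_def)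
      next
        assume "w \<in> (\<Union>k\<in>{k::nat. real k / real (Suc n) \<le> T}.
          {real k / real (Suc n)<..T} \<times> ?E (real k / real (Suc n)) \<inter> {w\<in>space P. fst w \<le> real (Suc k) / real (Suc n)})"
        then obtain k s \<omega> where k: "w = (s, \<omega>)" "real k / real (Suc n) < s" "s \<le> T" "\<omega> \<in> ?E (real k / real (Suc n))"
          "s \<le> real (Suc k) / real (Suc n)" by auto
        have "0 < s" using k(2) by (meson divide_nonneg_nonneg le_less_trans of_nat_0_le_iff)
        have "real k < s * real (Suc n)" "s * real (Suc n) \<le> real k + 1"
          using k(2,5) by (auto simp: field_simps)
        then have "\<lceil>s * real (Suc n)\<rceil> = int k + 1"
          by (intro ceiling_unique) auto
        then have "d n s = real k / real (Suc n)" using \<open>0 < s\<close> by (simp add: d_def)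
        then show ?thesis using k \<open>0 < s\<close> by (auto simp: space_P)
      qed
    qed
    moreover have "?R \<in> sets P"
      using E T_pos by (intro sets.Un zero_in_P sets.countable_UN'' sets.Int rect_in_P) auto
    ultimately show "{w \<in> space P. a < X (d n (fst w)) (snd w)} \<in> sets P" by simp
  qed
  moreover have "(\<lambda>n. X (d n (fst w)) (snd w)) \<longlonglongrightarrow> Y (fst w) (snd w)" if "w \<in> space P" for w
  proof (cases "fst w = 0")
    case True then show ?thesis using Y0[of "snd w"] that by (auto simp: d_def space_P)
  next
    case False
    define s where "s = fst w"
    have s: "0 < s" "s \<le> T" "snd w \<in> space M" using False that by (auto simp: s_def space_P)
    have "filterlim (\<lambda>n. d n s) (at_left s) sequentially"
      unfolding filterlim_at
    proof
      show "\<forall>\<^sub>F n in sequentially. d n s \<in> {..<s} \<and> d n s \<noteq> s" using d[OF s(1)] by (intro always_eventually) (metis lessThan_iff less_irrefl)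
      show "(\<lambda>n. d n s) \<longlonglongrightarrow> s"
      proof (rule tendsto_sandwich)
        show "(\<lambda>n. s - 1 / real (Suc n)) \<longlonglongrightarrow> s"
          using tendsto_diff[OF tendsto_const LIMSEQ_inverse_real_of_nat, of s] by (simp add: divide_inverse)
      qed (use d[OF s(1)] in \<open>auto intro!: always_eventually less_imp_le tendsto_const\<close>)
    qed
    then show ?thesis
      using lim[OF s(3,1,2)] unfolding s_def by (rule filterlim_compose[rotated])
  qed
  ultimately have "(\<lambda>w. Y (fst w) (snd w)) \<in> borel_measurable P"
    by (rule borel_measurable_LIMSEQ_metric)
  then show ?thesis by (simp add: case_prod_beta')
qed

text \<open>Lets a predictable process be evaluated at an earlier time \<open>r\<close> inside a
  process predictable in \<open>s\<close>: if \<open>A\<close> is known at \<open>a\<close> and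
  \<open>a < r < s\<close>, then \<open>s\<close> lies beyond \<open>a\<close>, where
  \<open>A\<close> is still known. All other \<open>r\<close> are sent to time 0, where only sets of
  \<open>F 0\<close> occur.\<close>

lemma measurable_before:
  "(\<lambda>((s, \<omega>), r). (if 0 \<le> r \<and> r < s then r else 0, \<omega>)) \<in> measurable (P \<Otimes>\<^sub>M borel) P"
proof (rule measurable_into_P)
  let ?f = "\<lambda>((s::real, \<omega>::'a), r::real). (if 0 \<le> r \<and> r < s then r else 0, \<omega>)"
  have sp: "space (P \<Otimes>\<^sub>M borel) = ({0..T} \<times> space M) \<times> UNIV" by (simp add: space_pair_measure space_P)
  have f1 [measurable]: "(\<lambda>x. fst (fst x)) \<in> borel_measurable (P \<Otimes>\<^sub>M borel)"
    using measurable_compose[OF measurable_fst measurable_fst_P] by simp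
  show "?f \<in> space (P \<Otimes>\<^sub>M borel) \<rightarrow> {0..T} \<times> space M" using T_pos by (auto simp: sp)
  show "?f -` ({0} \<times> A) \<inter> space (P \<Otimes>\<^sub>M borel) \<in> sets (P \<Otimes>\<^sub>M borel)" if A: "A \<in> sets (F 0)" for A
  proof -
    have "?f -` ({0} \<times> A) \<inter> space (P \<Otimes>\<^sub>M borel) =
      (({0..T} \<times> A) \<times> UNIV) \<inter> {x\<in>space (P \<Otimes>\<^sub>M borel). snd x = 0 \<or> \<not> (0 \<le> snd x \<and> snd x < fst (fst x))}"
      using F_into_space[OF _ A] by (auto simp: sp split: if_splits)
    moreover have "({0..T} \<times> A) \<times> UNIV \<in> sets (P \<Otimes>\<^sub>M (borel :: real measure))" using all_time_in_P[OF A] by auto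
    moreover have "{x\<in>space (P \<Otimes>\<^sub>M borel). snd x = 0 \<or> \<not> (0 \<le> snd x \<and> snd x < fst (fst x))} \<in> sets (P \<Otimes>\<^sub>M borel)"
      by measurable
    ultimately show ?thesis by auto
  qed
  show "?f -` (({a<..b} \<inter> {0..T}) \<times> A) \<inter> space (P \<Otimes>\<^sub>M borel) \<in> sets (P \<Otimes>\<^sub>M borel)"
    if A: "0 \<le> a" "a < b" "A \<in> sets (F a)" for a b A
  proof -
    have "?f -` (({a<..b} \<inter> {0..T}) \<times> A) \<inter> space (P \<Otimes>\<^sub>M borel) =
      (({a<..T} \<times> A) \<times> UNIV) \<inter> {x\<in>space (P \<Otimes>\<^sub>M borel). snd x < fst (fst x) \<and> a < snd x \<and> snd x \<le> b}"
      using F_into_space[OF A(1,3)] A by (auto simp: sp split: if_splits)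
    moreover have "({a<..T} \<times> A) \<times> UNIV \<in> sets (P \<Otimes>\<^sub>M (borel :: real measure))" using rect_in_P[OF A(1,3)] by auto
    moreover have "{x\<in>space (P \<Otimes>\<^sub>M borel). snd x < fst (fst x) \<and> a < snd x \<and> snd x \<le> b} \<in> sets (P \<Otimes>\<^sub>M borel)"
      by measurable
    ultimately show ?thesis by auto
  qed
qed

lemma predictable_time_integral:
  assumes h: "h \<in> borel_measurable P"
  shows "(\<lambda>(s, \<omega>). \<integral>\<^sup>+r. (if 0 \<le> r \<and> r < s then h (r, \<omega>) else 0) \<partial>lborel) \<in> borel_measurable P"
proof -
  have f1 [measurable]: "(\<lambda>x. fst (fst x)) \<in> borel_measurable (P \<Otimes>\<^sub>M lborel)"
    using measurable_compose[OF measurable_fst measurable_fst_P] by simp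
  have "(\<lambda>x. h (case x of ((s, \<omega>), r) \<Rightarrow> (if 0 \<le> r \<and> r < s then r else 0, \<omega>)))
      \<in> borel_measurable (P \<Otimes>\<^sub>M lborel)"
    using measurable_compose[OF measurable_before h] by (simp add: case_prod_beta' cong: measurable_cong_sets)
  then have "(\<lambda>x. if 0 \<le> snd x \<and> snd x < fst (fst x)
      then h (case x of ((s, \<omega>), r) \<Rightarrow> (if 0 \<le> r \<and> r < s then r else 0, \<omega>)) else 0)
      \<in> borel_measurable (P \<Otimes>\<^sub>M lborel)"
    by measurable
  also have "(\<lambda>x. if 0 \<le> snd x \<and> snd x < fst (fst x)
      then h (case x of ((s, \<omega>), r) \<Rightarrow> (if 0 \<le> r \<and> r < s then r else 0, \<omega>)) else 0) =
      (\<lambda>(w, r). if 0 \<le> r \<and> r < fst w then h (r, snd w) else 0)"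
    by (auto simp: fun_eq_iff)
  finally have "(\<lambda>w. \<integral>\<^sup>+r. (if 0 \<le> r \<and> r < fst w then h (r, snd w) else 0) \<partial>lborel) \<in> borel_measurable P"
    by (intro lborel.borel_measurable_nn_integral) simp
  then show ?thesis by (simp add: case_prod_beta')
qed

end

section \<open>Marked jumps strictly in the past\<close>

locale marked_jump = filtered_space M F T
  for M :: "'a measure" and F :: "real \<Rightarrow> 'a measure" and T :: real +
  fixes \<tau> :: "'a \<Rightarrow> ereal" and \<zeta> :: "'a \<Rightarrow> real"
  assumes \<tau>_pos: "\<And>\<omega>. \<omega> \<in> space M \<Longrightarrow> 0 < \<tau> \<omega>"
    and mark: "\<And>q B. 0 \<le> q \<Longrightarrow> B \<in> sets borel \<Longrightarrow> {\<omega>\<in>space M. \<tau> \<omega> \<le> ereal q \<and> \<zeta> \<omega> \<in> B} \<in> sets (F q)"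
begin

lemma stopping: "0 \<le> q \<Longrightarrow> {\<omega>\<in>space M. \<tau> \<omega> \<le> ereal q} \<in> sets (F q)"
  using mark[of q UNIV] by simp

text \<open>A jump strictly before \<open>s\<close> is followed by a rational time
  \<open>q < s\<close> at which the jump and its mark are already known; this leaves countably many
  rectangles.\<close>

lemma mark_before_in_P:
  assumes "B \<in> sets borel"
  shows "{w\<in>space P. \<tau> (snd w) < ereal (fst w) \<and> \<zeta> (snd w) \<in> B} \<in> sets P"
proof -
  have "{w\<in>space P. \<tau> (snd w) < ereal (fst w) \<and> \<zeta> (snd w) \<in> B} =
      (\<Union>q\<in>{q\<in>\<rat>. 0 \<le> q}. {q<..T} \<times> {\<omega>\<in>space M. \<tau> \<omega> \<le> ereal q \<and> \<zeta> \<omega> \<in> B})" (is "?L = ?R")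
  proof (intro set_eqI iffI)
    fix w assume "w \<in> ?L"
    then obtain s \<omega> where w: "w = (s, \<omega>)" "s \<in> {0..T}" "\<omega> \<in> space M" "\<tau> \<omega> < ereal s" "\<zeta> \<omega> \<in> B"
      by (auto simp: space_P)
    then obtain t where t: "\<tau> \<omega> = ereal t" "0 < t" using \<tau>_pos[of \<omega>] by (cases "\<tau> \<omega>") auto
    then obtain q where "q \<in> \<rat>" "t < q" "q < s" using w Rats_dense_in_real[of t s] by auto
    then show "w \<in> ?R" using w t by (auto intro!: bexI[of _ q])
  next
    fix w assume "w \<in> ?R"
    then show "w \<in> ?L" by (auto simp: space_P intro: le_less_trans)
  qed
  moreover have "?R \<in> sets P"
    using assms countable_subset[OF _ countable_rat, of "{q\<in>\<rat>. 0 \<le> q}"]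
    by (intro sets.countable_UN'' rect_in_P mark) auto
  ultimately show ?thesis by simp
qed

lemma before_in_P: "{w\<in>space P. \<tau> (snd w) < ereal (fst w)} \<in> sets P"
  using mark_before_in_P[of UNIV] by simp

lemma measurable_mark_before:
  "(\<lambda>w. if \<tau> (snd w) < ereal (fst w) then \<zeta> (snd w) else 0) \<in> borel_measurable P"
proof (rule measurableI)
  fix B :: "real set" assume B: "B \<in> sets borel"
  let ?E = "{w\<in>space P. \<tau> (snd w) < ereal (fst w)}"
  have "(\<lambda>w. if \<tau> (snd w) < ereal (fst w) then \<zeta> (snd w) else 0) -` B \<inter> space P =
      {w\<in>space P. \<tau> (snd w) < ereal (fst w) \<and> \<zeta> (snd w) \<in> B} \<union> (if 0 \<in> B then space P - ?E else {})"
    by (auto split: if_splits)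
  then show "(\<lambda>w. if \<tau> (snd w) < ereal (fst w) then \<zeta> (snd w) else 0) -` B \<inter> space P \<in> sets P"
    using mark_before_in_P[OF B] before_in_P by auto
qed simp

text \<open>Until the jump lies in the past the default is time 0. Jump times are positive, so the
  value 0 singles out exactly that part, and sets of \<open>F 0\<close> are known at all times. For
  later times a rational between the jump and \<open>s\<close> again produces predictable
  rectangles.\<close>

lemma measurable_jump_before:
  "(\<lambda>w. (if \<tau> (snd w) < ereal (fst w) then real_of_ereal (\<tau> (snd w)) else 0, snd w)) \<in> measurable P P"
proof (rule measurable_into_P)
  let ?f = "\<lambda>w. (if \<tau> (snd w) < ereal (fst w) then real_of_ereal (\<tau> (snd w)) else 0, snd w)"
  let ?E = "{w\<in>space P. \<tau> (snd w) < ereal (fst w)}"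
  have fin: "\<exists>t. \<tau> \<omega> = ereal t \<and> 0 < t" if "\<tau> \<omega> < ereal s" "\<omega> \<in> space M" for \<omega> s
    using that \<tau>_pos[of \<omega>] by (cases "\<tau> \<omega>") auto
  show "?f \<in> space P \<rightarrow> {0..T} \<times> space M" using T_pos fin by (force simp: space_P)
  show "?f -` ({0} \<times> A) \<inter> space P \<in> sets P" if A: "A \<in> sets (F 0)" for A
  proof -
    have "?f -` ({0} \<times> A) \<inter> space P = {0..T} \<times> A - ?E"
      using F_into_space[OF _ A] fin by (fastforce simp: space_P split: if_splits)
    then show ?thesis using all_time_in_P[OF A] before_in_P by auto
  qed
  show "?f -` (({a<..b} \<inter> {0..T}) \<times> A) \<inter> space P \<in> sets P"
    if A: "0 \<le> a" "a < b" "A \<in> sets (F a)" for a b A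
  proof -
    have "?f -` (({a<..b} \<inter> {0..T}) \<times> A) \<inter> space P =
      (\<Union>q\<in>{q\<in>\<rat>. a < q}. {q<..T} \<times>
        (A \<inter> {\<omega>\<in>space M. \<tau> \<omega> \<le> ereal (min q b)} - {\<omega>\<in>space M. \<tau> \<omega> \<le> ereal a}))" (is "?L = ?R")
    proof (intro set_eqI iffI)
      fix w assume wL: "w \<in> ?L"
      obtain s \<omega> where w: "w = (s, \<omega>)" by (cases w)
      have w2: "s \<in> {0..T}" "\<omega> \<in> space M" "\<omega> \<in> A" "\<tau> \<omega> < ereal s"
        using wL A by (auto simp: w space_P split: if_splits)
      obtain t where t: "\<tau> \<omega> = ereal t" "0 < t" using fin[OF w2(4,2)] by auto
      have tab: "a < t" "t \<le> b" using wL w2 t by (auto simp: w)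
      obtain q where "q \<in> \<rat>" "t < q" "q < s" using w2 t Rats_dense_in_real[of t s] by auto
      then show "w \<in> ?R" using w w2 t tab by (auto intro!: bexI[of _ q])
    next
      fix w assume "w \<in> ?R"
      then obtain q where q: "a < q" "w \<in> {q<..T} \<times>
        (A \<inter> {\<omega>\<in>space M. \<tau> \<omega> \<le> ereal (min q b)} - {\<omega>\<in>space M. \<tau> \<omega> \<le> ereal a})" by blast
      obtain s \<omega> where w: "w = (s, \<omega>)" by (cases w)
      have w: "w = (s, \<omega>)" "a < q" "q < s" "s \<le> T" "\<omega> \<in> A" "\<omega> \<in> space M"
        "\<tau> \<omega> \<le> ereal (min q b)" "\<not> \<tau> \<omega> \<le> ereal a" using q by (simp_all add: w)
      then have "\<tau> \<omega> < ereal s" by (auto intro: le_less_trans)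
      then obtain t where t: "\<tau> \<omega> = ereal t" "0 < t" using fin w by auto
      then show "w \<in> ?L" using w A \<open>\<tau> \<omega> < ereal s\<close> by (auto simp: space_P)
    qed
    moreover have "?R \<in> sets P"
    proof (intro sets.countable_UN'' rect_in_P)
      show "countable {q\<in>\<rat>. a < q}" by (rule countable_subset[OF _ countable_rat]) auto
      fix q assume q: "q \<in> {q\<in>\<rat>. a < q}"
      then show "0 \<le> q" using A by auto
      have "A \<in> sets (F q)" using F_mono[OF A(1), of q] A(3) q by auto
      moreover have "{\<omega>\<in>space M. \<tau> \<omega> \<le> ereal (min q b)} \<in> sets (F q)"
        using stopping[of "min q b"] F_mono[of "min q b" q] A q by auto
      moreover have "{\<omega>\<in>space M. \<tau> \<omega> \<le> ereal a} \<in> sets (F q)"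
        using stopping[OF A(1)] F_mono[OF A(1), of q] q by auto
      ultimately show "A \<inter> {\<omega>\<in>space M. \<tau> \<omega> \<le> ereal (min q b)} - {\<omega>\<in>space M. \<tau> \<omega> \<le> ereal a} \<in> sets (F q)"
        by auto
    qed
    ultimately show ?thesis by simp
  qed
qed

lemma predictable_jump_before:
  fixes g :: "(real \<times> 'a) \<times> real \<Rightarrow> real"
  assumes g: "g \<in> borel_measurable (P \<Otimes>\<^sub>M borel)"
  shows "(\<lambda>(s, \<omega>). if \<tau> \<omega> < ereal s then g ((real_of_ereal (\<tau> \<omega>), \<omega>), \<zeta> \<omega>) else 0) \<in> borel_measurable P"
proof -
  have "(\<lambda>w. g ((if \<tau> (snd w) < ereal (fst w) then real_of_ereal (\<tau> (snd w)) else 0, snd w),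
      if \<tau> (snd w) < ereal (fst w) then \<zeta> (snd w) else 0)) \<in> borel_measurable P" (is "?h \<in> _")
    by (intro measurable_compose[OF _ g] measurable_Pair measurable_mark_before measurable_jump_before)
  then have "(\<lambda>w. if \<tau> (snd w) < ereal (fst w) then ?h w else 0) \<in> borel_measurable P"
    using before_in_P by (intro measurable_If) auto
  also have "(\<lambda>w. if \<tau> (snd w) < ereal (fst w) then ?h w else 0) =
      (\<lambda>(s, \<omega>). if \<tau> \<omega> < ereal s then g ((real_of_ereal (\<tau> \<omega>), \<omega>), \<zeta> \<omega>) else 0)"
    by (auto simp: fun_eq_iff)
  finally show ?thesis .
qed

end

section \<open>Cadlag paths and jump measures\<close>

lemma left_lim_tendsto:
  assumes "cadlag_on T f" "0 < t" "t \<le> T"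
  shows "(f \<longlongrightarrow> left_lim f t) (at_left t)"
proof -
  obtain l where l: "(f \<longlongrightarrow> l) (at_left t)"
    using assms unfolding cadlag_on_def by (metis greaterThanAtMost_iff)
  then have "Lim (at_left t) f = l" by (intro tendsto_Lim) simp
  then show ?thesis using l assms by (simp add: left_lim_def)
qed

lemma left_lim_0 [simp]: "left_lim f 0 = f 0"
  by (simp add: left_lim_def)

lemma left_lim_eqI: "0 < t \<Longrightarrow> (f \<longlongrightarrow> l) (at_left t) \<Longrightarrow> left_lim f t = l"
  by (simp add: left_lim_def tendsto_Lim)

lemma left_lim_lower:
  assumes "cadlag_on T f" "0 \<le> t" "t \<le> T" "\<And>r. 0 \<le> r \<Longrightarrow> r \<le> T \<Longrightarrow> c \<le> f r"
  shows "c \<le> left_lim f t"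
proof (cases "t = 0")
  case False
  then have "(f \<longlongrightarrow> left_lim f t) (at_left t)" using assms by (intro left_lim_tendsto) auto
  moreover have "\<forall>\<^sub>F r in at_left t. c \<le> f r"
    unfolding eventually_at_left_field using False assms by (intro exI[of _ 0]) auto
  ultimately show ?thesis by (rule tendsto_lowerbound) simp
qed (use assms in auto)

lemma left_lim_upper:
  assumes "cadlag_on T f" "0 \<le> t" "t \<le> T" "\<And>r. 0 \<le> r \<Longrightarrow> r \<le> T \<Longrightarrow> f r \<le> c"
  shows "left_lim f t \<le> c"
proof (cases "t = 0")
  case False
  then have "(f \<longlongrightarrow> left_lim f t) (at_left t)" using assms by (intro left_lim_tendsto) auto
  moreover have "\<forall>\<^sub>F r in at_left t. f r \<le> c"
    unfolding eventually_at_left_field using False assms by (intro exI[of _ 0]) auto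
  ultimately show ?thesis by (rule tendsto_upperbound) simp
qed (use assms in auto)

lemma cadlag_local:
  assumes f: "cadlag_on T f" and t: "0 \<le> t" "t \<le> T" and e: "0 < e"
  obtains d l where "0 < d"
    "\<And>r. 0 \<le> r \<Longrightarrow> r \<le> T \<Longrightarrow> t - d < r \<Longrightarrow> r < t \<Longrightarrow> \<bar>f r - l\<bar> < e"
    "\<And>r. 0 \<le> r \<Longrightarrow> r \<le> T \<Longrightarrow> t < r \<Longrightarrow> r < t + d \<Longrightarrow> \<bar>f r - f t\<bar> < e"
proof -
  have "\<exists>d>0. \<exists>l. \<forall>r. 0 \<le> r \<longrightarrow> t - d < r \<longrightarrow> r < t \<longrightarrow> \<bar>f r - l\<bar> < e"
  proof (cases "t = 0")
    case False
    then have "\<forall>\<^sub>F r in at_left t. dist (f r) (left_lim f t) < e"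
      using left_lim_tendsto[OF f] t e by (intro tendstoD) auto
    then obtain b where "b < t" "\<And>r. b < r \<Longrightarrow> r < t \<Longrightarrow> \<bar>f r - left_lim f t\<bar> < e"
      unfolding eventually_at_left_field by (auto simp: dist_real_def)
    then show ?thesis by (intro exI[of _ "t - b"] conjI exI[of _ "left_lim f t"]) auto
  qed (auto intro: exI[of _ 1])
  moreover have "\<exists>d>0. \<forall>r. r \<le> T \<longrightarrow> t < r \<longrightarrow> r < t + d \<longrightarrow> \<bar>f r - f t\<bar> < e"
  proof (cases "t = T")
    case False
    then have "\<forall>\<^sub>F r in at_right t. dist (f r) (f t) < e"
      using f t e unfolding cadlag_on_def by (intro tendstoD) auto
    then obtain b where "t < b" "\<And>r. t < r \<Longrightarrow> r < b \<Longrightarrow> \<bar>f r - f t\<bar> < e"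
      unfolding eventually_at_right_field by (auto simp: dist_real_def)
    then show ?thesis by (intro exI[of _ "b - t"]) auto
  qed (auto intro: exI[of _ 1])
  ultimately obtain d1 l d2 where "0 < d1" "0 < d2"
    "\<forall>r. 0 \<le> r \<longrightarrow> t - d1 < r \<longrightarrow> r < t \<longrightarrow> \<bar>f r - l\<bar> < e"
    "\<forall>r. r \<le> T \<longrightarrow> t < r \<longrightarrow> r < t + d2 \<longrightarrow> \<bar>f r - f t\<bar> < e" by blast
  then show ?thesis by (intro that[of "min d1 d2" l]) auto
qed

lemma cadlag_bounded:
  assumes f: "cadlag_on T f"
  obtains B where "\<And>t. 0 \<le> t \<Longrightarrow> t \<le> T \<Longrightarrow> \<bar>f t\<bar> \<le> B"
proof -
  have "\<exists>d>0. \<exists>B. \<forall>r\<in>ball t d. 0 \<le> r \<longrightarrow> r \<le> T \<longrightarrow> \<bar>f r\<bar> \<le> B" if "t \<in> {0..T}" for t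
  proof -
    have t: "0 \<le> t" "t \<le> T" using that by auto
    obtain d l where d: "0 < d" "\<And>r. 0 \<le> r \<Longrightarrow> r \<le> T \<Longrightarrow> t - d < r \<Longrightarrow> r < t \<Longrightarrow> \<bar>f r - l\<bar> < 1"
      "\<And>r. 0 \<le> r \<Longrightarrow> r \<le> T \<Longrightarrow> t < r \<Longrightarrow> r < t + d \<Longrightarrow> \<bar>f r - f t\<bar> < 1"
      by (rule cadlag_local[OF f t zero_less_one]) blast
    have "\<bar>f r\<bar> \<le> \<bar>l\<bar> + \<bar>f t\<bar> + 1" if r: "r \<in> ball t d" "0 \<le> r" "r \<le> T" for r
      using d(2)[of r] d(3)[of r] r by (cases r t rule: linorder_cases) (auto simp: dist_real_def)
    then show ?thesis using d(1) by blast
  qed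
  then obtain d B where dB: "\<And>t. t \<in> {0..T} \<Longrightarrow> 0 < d t"
    "\<And>t r. t \<in> {0..T} \<Longrightarrow> r \<in> ball t (d t) \<Longrightarrow> 0 \<le> r \<Longrightarrow> r \<le> T \<Longrightarrow> \<bar>f r\<bar> \<le> B t" by metis
  have cover: "{0..T} \<subseteq> (\<Union>t\<in>{0..T}. ball t (d t))" using dB(1) by fastforce
  obtain C where C: "C \<subseteq> {0..T}" "finite C" "{0..T} \<subseteq> (\<Union>t\<in>C. ball t (d t))"
    by (rule compactE_image[OF compact_Icc _ cover]) blast+
  show ?thesis
  proof
    fix t assume "0 \<le> t" "t \<le> T"
    then obtain c where c: "c \<in> C" "t \<in> ball c (d c)" using C(3) by fastforce
    then have "\<bar>f t\<bar> \<le> B c" using dB(2)[of c t] C \<open>0 \<le> t\<close> \<open>t \<le> T\<close> by auto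
    also have "\<dots> \<le> (\<Sum>c\<in>C. \<bar>B c\<bar>)"
      using member_le_sum[of c C "\<lambda>c. \<bar>B c\<bar>"] c C by auto
    finally show "\<bar>f t\<bar> \<le> (\<Sum>c\<in>C. \<bar>B c\<bar>)" .
  qed
qed

text \<open>Jumps above a fixed threshold do not accumulate: near any \<open>z\<close> the path
  stays, on each side, within half the threshold of one constant, so a jump at any other nearby time
  is below the threshold.\<close>

lemma cadlag_countable_jumps:
  assumes f: "cadlag_on T f"
  shows "countable {t\<in>{0..T}. f t \<noteq> left_lim f t}"
proof -
  define D where "D n = {t\<in>{0..T}. inverse (real (Suc n)) < \<bar>f t - left_lim f t\<bar>}" for n
  have fin: "finite ({0..T} \<inter> D n)" for n
  proof (rule finite_not_islimpt_in_compact)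
    fix z assume z: "z \<in> {0..T}"
    define e where "e = inverse (real (Suc n)) / 2"
    have e: "0 < e" by (simp add: e_def)
    obtain d l where d: "0 < d" "\<And>r. 0 \<le> r \<Longrightarrow> r \<le> T \<Longrightarrow> z - d < r \<Longrightarrow> r < z \<Longrightarrow> \<bar>f r - l\<bar> < e"
      "\<And>r. 0 \<le> r \<Longrightarrow> r \<le> T \<Longrightarrow> z < r \<Longrightarrow> r < z + d \<Longrightarrow> \<bar>f r - f z\<bar> < e"
      using cadlag_local[OF f _ _ e, of z] z by auto
    have close: "\<bar>left_lim f t - c\<bar> \<le> e"
      if "0 < t" "t \<le> T" "s < t" "0 \<le> s" "\<And>r. s < r \<Longrightarrow> r < t \<Longrightarrow> \<bar>f r - c\<bar> < e" for t s c
    proof (rule tendsto_upperbound)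
      show "((\<lambda>r. \<bar>f r - c\<bar>) \<longlongrightarrow> \<bar>left_lim f t - c\<bar>) (at_left t)"
        by (intro tendsto_intros left_lim_tendsto[OF f]) (use that in auto)
      show "\<forall>\<^sub>F r in at_left t. \<bar>f r - c\<bar> \<le> e"
        unfolding eventually_at_left_field using that by (intro exI[of _ s]) (auto intro: less_imp_le)
    qed simp
    have "D n \<inter> ball z d \<subseteq> {z}"
    proof
      fix t assume t: "t \<in> D n \<inter> ball z d"
      then have t': "0 \<le> t" "t \<le> T" "2 * e < \<bar>f t - left_lim f t\<bar>" by (auto simp: D_def e_def)
      then have t0: "0 < t" by (cases "t = 0") (use e in auto)
      show "t \<in> {z}"
      proof (cases t z rule: linorder_cases)
        case less
        have "\<bar>f t - l\<bar> < e" using t t' less by (intro d) (auto simp: dist_real_def)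
        moreover have "\<bar>left_lim f t - l\<bar> \<le> e"
          using t t' less t0 z by (intro close[of t "max 0 (z - d)"] d) (auto simp: dist_real_def)
        ultimately show ?thesis using t'(3) by linarith
      next
        case greater
        have "\<bar>f t - f z\<bar> < e" using t t' greater by (intro d) (auto simp: dist_real_def)
        moreover have "\<bar>left_lim f t - f z\<bar> \<le> e"
          using t t' greater t0 z by (intro close[of t z] d) (auto simp: dist_real_def)
        ultimately show ?thesis using t'(3) by linarith
      qed auto
    qed
    then show "\<not> z islimpt D n"
      using d(1) by (auto simp: islimpt_approachable dist_commute mem_ball subset_iff)
  qed simp
  have "{t\<in>{0..T}. f t \<noteq> left_lim f t} \<subseteq> (\<Union>n. {0..T} \<inter> D n)"
  proof
    fix t assume t: "t \<in> {t\<in>{0..T}. f t \<noteq> left_lim f t}"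
    then obtain n where "inverse (real (Suc n)) < \<bar>f t - left_lim f t\<bar>"
      using reals_Archimedean[of "\<bar>f t - left_lim f t\<bar>"] by auto
    then show "t \<in> (\<Union>n. {0..T} \<inter> D n)" using t by (auto simp: D_def)
  qed
  moreover have "countable (\<Union>n. {0..T} \<inter> D n)" using fin by (intro countable_UN) (auto intro: countable_finite)
  ultimately show ?thesis by (rule countable_subset)
qed

text \<open>Left limits and values can be exchanged under \<open>dt\<close>; needed because the
  filter is a conditional expectation at fixed times, not at left limits.\<close>

lemma cadlag_AE_left_lim:
  assumes "cadlag_on T f"
  shows "AE t in lborel. t \<in> {0..T} \<longrightarrow> left_lim f t = f t"
proof (rule AE_I')
  show "{t\<in>{0..T}. f t \<noteq> left_lim f t} \<in> null_sets lborel"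
    by (rule countable_imp_null_set_lborel[OF cadlag_countable_jumps[OF assms]])
qed auto

text \<open>The BSDE holds almost surely at each single time, hence simultaneously only at countably
  many. Right-continuity extends equality from the rationals to all times before \<open>T\<close>;
  the time \<open>T\<close>, with nothing to its right, is supplied separately.\<close>

lemma cadlag_eqI:
  fixes f g :: "real \<Rightarrow> real"
  assumes f: "cadlag_on T f" and g: "\<And>t. 0 \<le> t \<Longrightarrow> t < T \<Longrightarrow> (g \<longlongrightarrow> g t) (at_right t)"
    and eq: "\<And>t. t \<in> \<rat> \<Longrightarrow> 0 \<le> t \<Longrightarrow> t \<le> T \<Longrightarrow> f t = g t" and eqT: "f T = g T"
    and t: "0 \<le> t" "t \<le> T"
  shows "f t = g t"
proof (cases "t = T")
  case False
  define d where "d r = f r - g r" for r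
  have lim: "(d \<longlongrightarrow> d t) (at_right t)"
    unfolding d_def using f g t False by (intro tendsto_diff) (auto simp: cadlag_on_def)
  show ?thesis
  proof (rule ccontr)
    assume "f t \<noteq> g t"
    then have "\<forall>\<^sub>F r in at_right t. d r \<noteq> 0"
      using tendsto_imp_eventually_ne[OF lim, of 0] by (simp add: d_def)
    then obtain b where b: "t < b" "\<And>r. t < r \<Longrightarrow> r < b \<Longrightarrow> d r \<noteq> 0"
      unfolding eventually_at_right_field by auto
    have "t < min b T" using b False t by auto
    then obtain q where "q \<in> \<rat>" "t < q" "q < min b T" using Rats_dense_in_real by blast
    then show False using b(2)[of q] eq[of q] t by (auto simp: d_def)
  qed
qed (use eqT in simp)


section \<open>Jump times, counting and sums over jumps\<close>

lemma jump_times_mono: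
  assumes "jump_times M \<tau>" "\<omega> \<in> space M" "1 \<le> m" "m \<le> n"
  shows "\<tau> m \<omega> \<le> \<tau> n \<omega>"
  using assms(4)
proof (induction n rule: dec_induct)
  case (step n)
  then have "\<tau> n \<omega> \<le> \<tau> (Suc n) \<omega>" using assms by (auto simp: jump_times_def)
  then show ?case using step by simp
qed simp

lemma jump_times_strict:
  assumes "jump_times M \<tau>" "\<omega> \<in> space M" "1 \<le> m" "m < n" "\<tau> m \<omega> < \<infinity>"
  shows "\<tau> m \<omega> < \<tau> n \<omega>"
proof -
  have "\<tau> m \<omega> < \<tau> (Suc m) \<omega>" using assms by (auto simp: jump_times_def)
  also have "\<dots> \<le> \<tau> n \<omega>" using assms by (intro jump_times_mono) auto
  finally show ?thesis .
qed

lemma jump_times_pos: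
  assumes "jump_times M \<tau>" "\<omega> \<in> space M" "1 \<le> n"
  shows "0 < \<tau> n \<omega>"
  using jump_times_mono[OF assms(1,2), of 1 n] assms by (auto simp: jump_times_def)

text \<open>\<open>counting\<close> is a cardinality. Since jump times are ordered, the jumps up to
  \<open>t\<close> form an initial segment of the indices, so sums up to \<open>counting\<close> run
  over exactly these jumps.\<close>

lemma jump_set_eq:
  assumes "jump_times M \<tau>" "\<omega> \<in> space M"
  shows "{n. 1 \<le> n \<and> \<tau> n \<omega> \<le> ereal t} = {1..counting \<tau> t \<omega>}"
proof -
  let ?A = "{n. 1 \<le> n \<and> \<tau> n \<omega> \<le> ereal t}"
  have fin: "finite ?A" using assms by (auto simp: jump_times_def)
  have "\<exists>k. ?A = {1..k}"
  proof (cases "?A = {}")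
    case True then show ?thesis by (intro exI[of _ 0]) auto
  next
    case False
    have "Max ?A \<in> ?A" by (rule Max_in[OF fin False])
    then have "?A = {1..Max ?A}"
      using Max_ge[OF fin] by (auto intro: order_trans[OF jump_times_mono[OF assms]])
    then show ?thesis ..
  qed
  then obtain k where "?A = {1..k}" ..
  then show ?thesis by (simp only: counting_def) simp
qed

lemma le_counting_iff:
  assumes "jump_times M \<tau>" "\<omega> \<in> space M" "1 \<le> n"
  shows "n \<le> counting \<tau> t \<omega> \<longleftrightarrow> \<tau> n \<omega> \<le> ereal t"
  using jump_set_eq[OF assms(1,2), of t] assms(3) by (auto simp: set_eq_iff)

lemma counting_mono:
  assumes "jump_times M \<tau>" "\<omega> \<in> space M" "s \<le> t"
  shows "counting \<tau> s \<omega> \<le> counting \<tau> t \<omega>"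
proof (cases "counting \<tau> s \<omega> = 0")
  case False
  then have "1 \<le> counting \<tau> s \<omega>" by simp
  from le_counting_iff[OF assms(1,2) this] show ?thesis
    using assms(3) by (metis dual_order.trans ereal_less_eq(3) order_refl)
qed simp

lemma nn_integral_jump_measure:
  assumes "f \<in> borel_measurable (borel \<Otimes>\<^sub>M borel)"
  shows "(\<integral>\<^sup>+x. f x \<partial>jump_measure \<tau> \<zeta> \<omega>) =
    (\<integral>\<^sup>+n. (if 1 \<le> n \<and> \<tau> n \<omega> < \<infinity> then f (real_of_ereal (\<tau> n \<omega>), \<zeta> n \<omega>) else 0) \<partial>count_space UNIV)"
proof -
  have "(\<integral>\<^sup>+x. f x \<partial>jump_measure \<tau> \<zeta> \<omega>) =
    (\<integral>\<^sup>+n. f (real_of_ereal (\<tau> n \<omega>), \<zeta> n \<omega>) \<partial>count_space {n. 1 \<le> n \<and> \<tau> n \<omega> < \<infinity>})"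
    unfolding jump_measure_def using assms by (intro nn_integral_distr) (auto simp: space_pair_measure)
  also have "\<dots> = (\<integral>\<^sup>+n. f (real_of_ereal (\<tau> n \<omega>), \<zeta> n \<omega>) * indicator {n. 1 \<le> n \<and> \<tau> n \<omega> < \<infinity>} n \<partial>count_space UNIV)"
    by (rule nn_integral_count_space_indicator) simp
  also have "\<dots> = (\<integral>\<^sup>+n. (if 1 \<le> n \<and> \<tau> n \<omega> < \<infinity> then f (real_of_ereal (\<tau> n \<omega>), \<zeta> n \<omega>) else 0) \<partial>count_space UNIV)"
    by (intro nn_integral_cong) (auto simp: indicator_def)
  finally show ?thesis .
qed

lemma emeasure_jump_measure:
  assumes J: "jump_times M \<tau>" "\<omega> \<in> space M" and B: "B \<in> sets borel"
  shows "emeasure (jump_measure \<tau> \<zeta> \<omega>) ({0<..t} \<times> B) =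
    (\<integral>\<^sup>+n. (if 1 \<le> n \<and> \<tau> n \<omega> \<le> ereal t then indicator B (\<zeta> n \<omega>) else 0) \<partial>count_space UNIV)"
proof -
  have BB: "{0<..t} \<times> B \<in> sets (borel \<Otimes>\<^sub>M borel)" using B by auto
  have "emeasure (jump_measure \<tau> \<zeta> \<omega>) ({0<..t} \<times> B) = (\<integral>\<^sup>+x. indicator ({0<..t} \<times> B) x \<partial>jump_measure \<tau> \<zeta> \<omega>)"
    using BB by (subst nn_integral_indicator) (auto simp: jump_measure_def)
  also have "\<dots> = (\<integral>\<^sup>+n. (if 1 \<le> n \<and> \<tau> n \<omega> < \<infinity> then indicator ({0<..t} \<times> B) (real_of_ereal (\<tau> n \<omega>), \<zeta> n \<omega>) else 0) \<partial>count_space UNIV)"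
    using BB by (intro nn_integral_jump_measure) auto
  also have "\<dots> = (\<integral>\<^sup>+n. (if 1 \<le> n \<and> \<tau> n \<omega> \<le> ereal t then indicator B (\<zeta> n \<omega>) else 0) \<partial>count_space UNIV)"
  proof (intro nn_integral_cong)
    fix n
    show "(if 1 \<le> n \<and> \<tau> n \<omega> < \<infinity> then indicator ({0<..t} \<times> B) (real_of_ereal (\<tau> n \<omega>), \<zeta> n \<omega>) else 0) =
      (if 1 \<le> n \<and> \<tau> n \<omega> \<le> ereal t then indicator B (\<zeta> n \<omega>) else (0::ennreal))"
      using jump_times_pos[OF J, of n] by (cases "\<tau> n \<omega>") (auto simp: indicator_def)
  qed
  finally show ?thesis .
qed

lemma set_integral_jump_measure:
  fixes f :: "real \<times> real \<Rightarrow> real"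
  assumes J: "jump_times M \<tau>" "\<omega> \<in> space M" and \<zeta>: "\<And>n. 1 \<le> n \<Longrightarrow> 0 < \<zeta> n \<omega>" and a: "0 \<le> a"
    and f: "(\<lambda>x. indicator ({a<..b} \<times> {0<..}) x *\<^sub>R f x) \<in> borel_measurable (borel \<Otimes>\<^sub>M borel)"
  shows "set_lebesgue_integral (jump_measure \<tau> \<zeta> \<omega>) ({a<..b} \<times> {0<..}) f =
    (\<Sum>n\<in>{1..counting \<tau> b \<omega>}. if ereal a < \<tau> n \<omega> then f (real_of_ereal (\<tau> n \<omega>), \<zeta> n \<omega>) else 0)"
proof -
  let ?A = "{n. 1 \<le> n \<and> \<tau> n \<omega> < \<infinity>}"
  let ?g = "\<lambda>n. (real_of_ereal (\<tau> n \<omega>), \<zeta> n \<omega>)"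
  let ?h = "\<lambda>x. indicator ({a<..b} \<times> {0<..}) x *\<^sub>R f x"
  have sub: "{n\<in>?A. ?h (?g n) \<noteq> 0} \<subseteq> {1..counting \<tau> b \<omega>}"
    unfolding jump_set_eq[OF J, symmetric]
  proof
    fix n assume "n \<in> {n\<in>?A. ?h (?g n) \<noteq> 0}"
    then have n: "1 \<le> n" "\<tau> n \<omega> < \<infinity>" "real_of_ereal (\<tau> n \<omega>) \<le> b"
      by (auto simp: indicator_def split: if_splits)
    then show "n \<in> {n. 1 \<le> n \<and> \<tau> n \<omega> \<le> ereal b}"
      using jump_times_pos[OF J n(1)] by (cases "\<tau> n \<omega>") auto
  qed
  have "set_lebesgue_integral (jump_measure \<tau> \<zeta> \<omega>) ({a<..b} \<times> {0<..}) f = (LINT n|count_space ?A. ?h (?g n))"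
    unfolding set_lebesgue_integral_def jump_measure_def
    using f by (intro integral_distr) (auto simp: space_pair_measure)
  also have "\<dots> = (\<Sum>n\<in>{n\<in>?A. ?h (?g n) \<noteq> 0}. ?h (?g n))"
  proof (rule lebesgue_integral_count_space_finite_support)
    show "finite {n\<in>?A. ?h (?g n) \<noteq> 0}" by (rule finite_subset[OF sub]) simp
  qed
  also have "\<dots> = (\<Sum>n\<in>{1..counting \<tau> b \<omega>}. ?h (?g n))"
  proof (rule sum.mono_neutral_left)
    show "{n\<in>?A. ?h (?g n) \<noteq> 0} \<subseteq> {1..counting \<tau> b \<omega>}" by (rule sub)
    show "\<forall>n\<in>{1..counting \<tau> b \<omega>} - {n\<in>?A. ?h (?g n) \<noteq> 0}. ?h (?g n) = 0"
    proof
      fix n assume n: "n \<in> {1..counting \<tau> b \<omega>} - {n\<in>?A. ?h (?g n) \<noteq> 0}"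
      then have "\<tau> n \<omega> \<le> ereal b" using le_counting_iff[OF J, of n b] by auto
      then have "n \<in> ?A" using n by auto
      then show "?h (?g n) = 0" using n by blast
    qed
  qed simp
  also have "\<dots> = (\<Sum>n\<in>{1..counting \<tau> b \<omega>}. if ereal a < \<tau> n \<omega> then f (?g n) else 0)"
  proof (rule sum.cong)
    fix n assume n: "n \<in> {1..counting \<tau> b \<omega>}"
    then have "\<tau> n \<omega> \<le> ereal b" "0 < \<tau> n \<omega>" "0 < \<zeta> n \<omega>"
      using le_counting_iff[OF J, of n b] jump_times_pos[OF J, of n] \<zeta>[of n] by auto
    then show "?h (?g n) = (if ereal a < \<tau> n \<omega> then f (?g n) else 0)"
      by (cases "\<tau> n \<omega>") (auto simp: indicator_def)
  qed simp
  finally show ?thesis .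
qed

lemma nn_integral_jumps_until:
  assumes "jump_times M \<tau>" "\<omega> \<in> space M"
  shows "(\<integral>\<^sup>+n. (if 1 \<le> n \<and> \<tau> n \<omega> \<le> ereal t then f n else 0) \<partial>count_space UNIV) = (\<Sum>n=1..counting \<tau> t \<omega>. f n)"
proof -
  have iff: "1 \<le> n \<and> \<tau> n \<omega> \<le> ereal t \<longleftrightarrow> n \<in> {1..counting \<tau> t \<omega>}" for n
    using jump_set_eq[OF assms, of t] by (auto simp: set_eq_iff)
  have "(\<integral>\<^sup>+n. (if 1 \<le> n \<and> \<tau> n \<omega> \<le> ereal t then f n else 0) \<partial>count_space UNIV) =
      (\<Sum>n=1..counting \<tau> t \<omega>. if 1 \<le> n \<and> \<tau> n \<omega> \<le> ereal t then f n else 0)"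
    by (rule nn_integral_count_space') (auto simp: iff simp del: One_nat_def)
  also have "\<dots> = (\<Sum>n=1..counting \<tau> t \<omega>. f n)"
    by (intro sum.cong refl) (simp only: iff if_True)
  finally show ?thesis .
qed

text \<open>Adaptedness of a random measure is given only on products of \<open>{0<..t}\<close> with
  a set of marks; induction over measurable functions extends it to sums of \<open>f\<close> over
  the marks up to \<open>t\<close>. With \<open>f = ennreal\<close> this yields the loss, with a
  constant the number of jumps.\<close>

lemma measurable_jump_kernel:
  assumes J: "jump_times M \<tau>" and sp: "space G = space M"
    and adapted: "\<And>B. B \<in> sets borel \<Longrightarrow>
      (\<lambda>\<omega>. emeasure (jump_measure \<tau> \<zeta> \<omega>) ({0<..t} \<times> B)) \<in> borel_measurable G"
    and f: "f \<in> borel_measurable borel"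
  shows "(\<lambda>\<omega>. \<integral>\<^sup>+n. (if 1 \<le> n \<and> \<tau> n \<omega> \<le> ereal t then f (\<zeta> n \<omega>) else 0) \<partial>count_space UNIV) \<in> borel_measurable G"
  using f
proof (induction rule: borel_measurable_induct)
  case (cong f g)
  then show ?case by (simp cong: if_cong)
next
  case (set A)
  then have "(\<lambda>\<omega>. emeasure (jump_measure \<tau> \<zeta> \<omega>) ({0<..t} \<times> A)) \<in> borel_measurable G" by (intro adapted) auto
  then show ?case
    using set by (subst measurable_cong) (auto simp: sp emeasure_jump_measure[OF J, symmetric] simp del: One_nat_def)
next
  case (mult v u)
  have "(\<lambda>\<omega>. u * (\<integral>\<^sup>+n. (if 1 \<le> n \<and> \<tau> n \<omega> \<le> ereal t then v (\<zeta> n \<omega>) else 0) \<partial>count_space UNIV)) \<in> borel_measurable G"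
    using mult by auto
  then show ?case
    by (subst (asm) nn_integral_cmult[symmetric]) (simp_all add: if_distrib cong: if_cong)
next
  case (add u v)
  have "(\<lambda>\<omega>. (\<integral>\<^sup>+n. (if 1 \<le> n \<and> \<tau> n \<omega> \<le> ereal t then v (\<zeta> n \<omega>) else 0) \<partial>count_space UNIV)
     + (\<integral>\<^sup>+n. (if 1 \<le> n \<and> \<tau> n \<omega> \<le> ereal t then u (\<zeta> n \<omega>) else 0) \<partial>count_space UNIV)) \<in> borel_measurable G"
    using add by auto
  also have "(\<lambda>\<omega>. (\<integral>\<^sup>+n. (if 1 \<le> n \<and> \<tau> n \<omega> \<le> ereal t then v (\<zeta> n \<omega>) else 0) \<partial>count_space UNIV)
     + (\<integral>\<^sup>+n. (if 1 \<le> n \<and> \<tau> n \<omega> \<le> ereal t then u (\<zeta> n \<omega>) else 0) \<partial>count_space UNIV)) =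
     (\<lambda>\<omega>. \<integral>\<^sup>+n. (if 1 \<le> n \<and> \<tau> n \<omega> \<le> ereal t then v (\<zeta> n \<omega>) + u (\<zeta> n \<omega>) else 0) \<partial>count_space UNIV)"
    by (subst nn_integral_add[symmetric]) (auto intro!: nn_integral_cong ext)
  finally show ?case .
next
  case (seq U)
  have inc: "incseq U" using seq by auto
  have "(\<lambda>\<omega>. \<integral>\<^sup>+n. (if 1 \<le> n \<and> \<tau> n \<omega> \<le> ereal t then (SUP i. U i) (\<zeta> n \<omega>) else 0) \<partial>count_space UNIV) =
    (\<lambda>\<omega>. SUP i. \<integral>\<^sup>+n. (if 1 \<le> n \<and> \<tau> n \<omega> \<le> ereal t then U i (\<zeta> n \<omega>) else 0) \<partial>count_space UNIV)"
  proof
    fix \<omega>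
    have "(\<integral>\<^sup>+n. (if 1 \<le> n \<and> \<tau> n \<omega> \<le> ereal t then (SUP i. U i) (\<zeta> n \<omega>) else 0) \<partial>count_space UNIV) =
      (\<integral>\<^sup>+n. (SUP i. if 1 \<le> n \<and> \<tau> n \<omega> \<le> ereal t then U i (\<zeta> n \<omega>) else 0) \<partial>count_space UNIV)"
      by (intro nn_integral_cong) (auto simp: image_comp)
    also have "\<dots> = (SUP i. \<integral>\<^sup>+n. (if 1 \<le> n \<and> \<tau> n \<omega> \<le> ereal t then U i (\<zeta> n \<omega>) else 0) \<partial>count_space UNIV)"
      using inc by (intro nn_integral_monotone_convergence_SUP) (auto simp: incseq_def le_fun_def)
    finally show "(\<integral>\<^sup>+n. (if 1 \<le> n \<and> \<tau> n \<omega> \<le> ereal t then (SUP i. U i) (\<zeta> n \<omega>) else 0) \<partial>count_space UNIV) =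
      (SUP i. \<integral>\<^sup>+n. (if 1 \<le> n \<and> \<tau> n \<omega> \<le> ereal t then U i (\<zeta> n \<omega>) else 0) \<partial>count_space UNIV)" .
  qed
  then show ?case using seq by simp
qed

text \<open>Off the jump times the number of jumps is locally constant, trapped between the last
  jump before \<open>t\<close> and the next one.\<close>

lemma isCont_jump_sum:
  fixes \<phi> :: "nat \<Rightarrow> real \<Rightarrow> real"
  assumes J: "jump_times M \<tau>" "\<omega> \<in> space M" and ne: "\<And>n. 1 \<le> n \<Longrightarrow> \<tau> n \<omega> \<noteq> ereal t"
    and \<phi>: "\<And>j. isCont (\<phi> j) t"
  shows "isCont (\<lambda>s. \<Sum>j=1..counting \<tau> s \<omega>. \<phi> j s) t"
proof -
  define N where "N = counting \<tau> t \<omega>"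
  have lim: "((\<lambda>s. ereal s) \<longlongrightarrow> ereal t) (nhds t)"
    by (rule tendsto_ereal[OF filterlim_ident])
  have "ereal t < \<tau> (Suc N) \<omega>"
    using le_counting_iff[OF J, of "Suc N" t] by (auto simp: N_def)
  then have "\<forall>\<^sub>F s in nhds t. ereal s < \<tau> (Suc N) \<omega>"
    by (rule order_tendstoD(2)[OF lim])
  moreover have "\<forall>\<^sub>F s in nhds t. N = 0 \<or> \<tau> N \<omega> < ereal s"
  proof (cases "N = 0")
    case False
    then have N1: "1 \<le> N" by simp
    have "\<tau> N \<omega> \<le> ereal t" using le_counting_iff[OF J N1, of t] by (simp flip: N_def)
    then have "\<tau> N \<omega> < ereal t" using ne[OF N1] by (simp add: less_le)
    then have "\<forall>\<^sub>F s in nhds t. \<tau> N \<omega> < ereal s" by (rule order_tendstoD(1)[OF lim])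
    then show ?thesis by eventually_elim simp
  qed simp
  ultimately have "\<forall>\<^sub>F s in nhds t. counting \<tau> s \<omega> = N"
  proof eventually_elim
    case (elim s)
    then have "\<not> Suc N \<le> counting \<tau> s \<omega>" using le_counting_iff[OF J, of "Suc N" s] by auto
    moreover have "N \<le> counting \<tau> s \<omega>" using elim le_counting_iff[OF J, of N s] by (cases "N = 0") auto
    ultimately show ?case by simp
  qed
  then have ev: "\<forall>\<^sub>F s in nhds t. (\<Sum>j=1..counting \<tau> s \<omega>. \<phi> j s) = (\<Sum>j=1..N. \<phi> j s)"
    by eventually_elim simp
  have "isCont (\<lambda>s. \<Sum>j=1..N. \<phi> j s) t" using \<phi> by (intro continuous_intros)
  then show ?thesis using isCont_cong[OF ev] by simp
qed

section \<open>Observed jumps and their compensator\<close>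

locale contagion =
  fixes S :: "'a reinsurance_model"
  assumes model: "contagion_model S"
begin

abbreviation "M \<equiv> PP S"
abbreviation "T \<equiv> horizon S"
abbreviation "J \<equiv> J1 S"
abbreviation "Z \<equiv> Z1 S"
abbreviation "N \<equiv> counting (J1 S)"

sublocale prob_space "PP S"
  using model by (simp add: contagion_model_def)

lemma T_pos: "0 < T" and J: "jump_times M J" and J2: "jump_times M (J2 S)"
  using model by (auto simp: contagion_model_def)

lemma Z_pos: "1 \<le> n \<Longrightarrow> \<omega> \<in> space M \<Longrightarrow> 0 < Z n \<omega>"
  using model by (auto simp: contagion_model_def iid_marks_def)

lemma Z_measurable: "1 \<le> n \<Longrightarrow> Z n \<in> borel_measurable M"
  and Z2_measurable: "1 \<le> n \<Longrightarrow> Z2 S n \<in> borel_measurable M"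
  using model by (auto simp: contagion_model_def iid_marks_def indep_vars_def)

lemma F1_prob: "prob_space (F1 S)" and sets_F1 [measurable_cong]: "sets (F1 S) = sets borel"
  using model by (auto simp: contagion_model_def real_distribution_def real_distribution_axioms_def)

lemma F1_pos: "AE z in F1 S. 0 < z"
  using model by (simp add: contagion_model_def)

lemma subalgebra_FF: "0 \<le> t \<Longrightarrow> subalgebra M (FF S t)"
  and FF_mono: "0 \<le> s \<Longrightarrow> s \<le> t \<Longrightarrow> sets (FF S s) \<subseteq> sets (FF S t)"
proof -
  have uh: "usual_hypotheses M (FF S)" using model unfolding contagion_model_def by (elim conjE)
  have "\<forall>t\<ge>0. subalgebra M (FF S t)" using uh unfolding usual_hypotheses_def by (elim conjE)
  moreover have "\<forall>s t. 0 \<le> s \<and> s \<le> t \<longrightarrow> sets (FF S s) \<subseteq> sets (FF S t)"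
    using uh unfolding usual_hypotheses_def by (elim conjE)
  ultimately show "0 \<le> t \<Longrightarrow> subalgebra M (FF S t)" "0 \<le> s \<Longrightarrow> s \<le> t \<Longrightarrow> sets (FF S s) \<subseteq> sets (FF S t)"
    by simp_all
qed

lemma space_FF: "0 \<le> t \<Longrightarrow> space (FF S t) = space M" and sets_FF: "0 \<le> t \<Longrightarrow> sets (FF S t) \<subseteq> sets M"
  using subalgebra_FF by (auto simp: subalgebra_def)

lemma m1_adapted:
  "0 \<le> t \<Longrightarrow> B \<in> sets borel \<Longrightarrow> (\<lambda>\<omega>. emeasure (m1 S \<omega>) ({0<..t} \<times> B)) \<in> borel_measurable (FF S t)"
  and m2_adapted:
  "0 \<le> t \<Longrightarrow> B \<in> sets borel \<Longrightarrow> (\<lambda>\<omega>. emeasure (m2 S \<omega>) ({0<..t} \<times> B)) \<in> borel_measurable (FF S t)"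
proof -
  have *: "has_compensator M (FF S) (m1 S) (\<lambda>t \<omega>. left_lim (\<lambda>s. intensity S s \<omega>) t) (F1 S)"
    using model unfolding contagion_model_def by (elim conjE)
  have **: "has_compensator M (FF S) (m2 S) (\<lambda>t \<omega>. rho S) (F2 S)"
    using model unfolding contagion_model_def by (elim conjE)
  have "\<forall>t\<ge>0. \<forall>B\<in>sets borel. (\<lambda>\<omega>. emeasure (m1 S \<omega>) ({0<..t} \<times> B)) \<in> borel_measurable (FF S t)"
    using * unfolding has_compensator_def by (elim conjE)
  then show "0 \<le> t \<Longrightarrow> B \<in> sets borel \<Longrightarrow> (\<lambda>\<omega>. emeasure (m1 S \<omega>) ({0<..t} \<times> B)) \<in> borel_measurable (FF S t)"
    by simp
  have "\<forall>t\<ge>0. \<forall>B\<in>sets borel. (\<lambda>\<omega>. emeasure (m2 S \<omega>) ({0<..t} \<times> B)) \<in> borel_measurable (FF S t)"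
    using ** unfolding has_compensator_def by (elim conjE)
  then show "0 \<le> t \<Longrightarrow> B \<in> sets borel \<Longrightarrow> (\<lambda>\<omega>. emeasure (m2 S \<omega>) ({0<..t} \<times> B)) \<in> borel_measurable (FF S t)"
    by simp
qed

lemma m1_compensator:
  "\<Gamma> \<in> borel_measurable (predictable {0..} M (FF S) \<Otimes>\<^sub>M borel) \<Longrightarrow>
    (\<integral>\<^sup>+\<omega>. (\<integral>\<^sup>+x. (case x of (t, z) \<Rightarrow> \<Gamma> ((t, \<omega>), z) * indicator {0<..} t) \<partial>m1 S \<omega>) \<partial>M) =
    (\<integral>\<^sup>+\<omega>. (\<integral>\<^sup>+t\<in>{0<..}. (\<integral>\<^sup>+z. \<Gamma> ((t, \<omega>), z) * ennreal (left_lim (\<lambda>s. intensity S s \<omega>) t) \<partial>F1 S) \<partial>lborel) \<partial>M)"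
proof -
  have *: "has_compensator M (FF S) (m1 S) (\<lambda>t \<omega>. left_lim (\<lambda>s. intensity S s \<omega>) t) (F1 S)"
    using model unfolding contagion_model_def by (elim conjE)
  assume "\<Gamma> \<in> borel_measurable (predictable {0..} M (FF S) \<Otimes>\<^sub>M borel)"
  with * show ?thesis unfolding has_compensator_def by (elim conjE) (erule bspec)
qed

lemma counting_eq_nn_integral:
  assumes "jump_times M \<tau>" "\<omega> \<in> space M"
  shows "(\<integral>\<^sup>+n. (if 1 \<le> n \<and> \<tau> n \<omega> \<le> ereal t then 1 else 0) \<partial>count_space UNIV) = ennreal (real (counting \<tau> t \<omega>))"
  by (subst nn_integral_jumps_until[OF assms]) (simp add: ennreal_of_nat_eq_real_of_nat)

lemma loss_measurable_FF: "0 \<le> t \<Longrightarrow> loss S t \<in> borel_measurable (FF S t)"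
proof -
  assume t: "0 \<le> t"
  have "(\<lambda>\<omega>. \<integral>\<^sup>+n. (if 1 \<le> n \<and> J n \<omega> \<le> ereal t then ennreal (Z n \<omega>) else 0) \<partial>count_space UNIV)
      \<in> borel_measurable (FF S t)"
    by (rule measurable_jump_kernel[OF J space_FF[OF t] m1_adapted[OF t]]) auto
  then have "(\<lambda>\<omega>. enn2real (\<integral>\<^sup>+n. (if 1 \<le> n \<and> J n \<omega> \<le> ereal t then ennreal (Z n \<omega>) else 0) \<partial>count_space UNIV))
      \<in> borel_measurable (FF S t)" by measurable
  moreover have "enn2real (\<integral>\<^sup>+n. (if 1 \<le> n \<and> J n \<omega> \<le> ereal t then ennreal (Z n \<omega>) else 0) \<partial>count_space UNIV) = loss S t \<omega>"
    if "\<omega> \<in> space M" for \<omega>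
  proof -
    have "(\<integral>\<^sup>+n. (if 1 \<le> n \<and> J n \<omega> \<le> ereal t then ennreal (Z n \<omega>) else 0) \<partial>count_space UNIV) = ennreal (loss S t \<omega>)"
      unfolding nn_integral_jumps_until[OF J that] loss_def
      using Z_pos[OF _ that] by (intro sum_ennreal) (auto intro: less_imp_le)
    moreover have "0 \<le> loss S t \<omega>"
      unfolding loss_def using Z_pos[OF _ that] by (intro sum_nonneg) (auto intro: less_imp_le)
    ultimately show ?thesis by simp
  qed
  ultimately show "loss S t \<in> borel_measurable (FF S t)"
    using space_FF[OF t] by (subst measurable_cong) auto
qed

section \<open>The natural filtration of the loss and what it reveals\<close>

lemma generator_HH: "{loss S i -` A \<inter> space M | i A. i \<in> {0..t} \<and> A \<in> sets borel} \<subseteq> Pow (space M)"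
  by auto

lemma space_HH: "space (HH S t) = space M"
  unfolding HH_def generated_sigma_def by (rule space_measure_of[OF generator_HH])

lemma HH_basic:
  assumes "0 \<le> r" "r \<le> t" "A \<in> sets borel"
  shows "loss S r -` A \<inter> space M \<in> sets (HH S t)"
  unfolding HH_def generated_sigma_def sets_measure_of[OF generator_HH]
  using assms by (intro sigma_sets.Basic) auto

lemma HH_least:
  assumes "space G = space M" "\<And>r. 0 \<le> r \<Longrightarrow> r \<le> t \<Longrightarrow> loss S r \<in> borel_measurable G"
  shows "sets (HH S t) \<subseteq> sets G"
  unfolding HH_def generated_sigma_def sets_measure_of[OF generator_HH]
proof -
  have "{loss S i -` A \<inter> space M | i A. i \<in> {0..t} \<and> A \<in> sets borel} \<subseteq> sets G"
    using measurable_sets[OF assms(2)] by (auto simp: assms(1)[symmetric])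
  from sets.sigma_sets_subset[OF this]
  show "sigma_sets (space M) {loss S i -` A \<inter> space M | i A. i \<in> {0..t} \<and> A \<in> sets borel} \<subseteq> sets G"
    by (simp add: assms(1))
qed

lemma loss_measurable_HH: "0 \<le> r \<Longrightarrow> r \<le> t \<Longrightarrow> loss S r \<in> borel_measurable (HH S t)"
  using HH_basic by (intro measurableI) (auto simp: space_HH)

lemma HH_mono: "0 \<le> s \<Longrightarrow> s \<le> t \<Longrightarrow> sets (HH S s) \<subseteq> sets (HH S t)"
  using loss_measurable_HH by (intro HH_least) (auto simp: space_HH)

lemma HH_FF: "0 \<le> t \<Longrightarrow> sets (HH S t) \<subseteq> sets (FF S t)"
proof (rule HH_least)
  assume t: "0 \<le> t"
  show "space (FF S t) = space M" by (rule space_FF[OF t])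
  fix r assume r: "0 \<le> r" "r \<le> t"
  show "loss S r \<in> borel_measurable (FF S t)"
    using measurable_mono[of borel borel "FF S r" "FF S t"] loss_measurable_FF[OF r(1)] FF_mono[OF r] space_FF r by auto
qed

lemma HH_sub: "0 \<le> t \<Longrightarrow> sets (HH S t) \<subseteq> sets M"
  using HH_FF sets_FF by blast

sublocale filtered_space "PP S" "HH S" "horizon S"
  by unfold_locales (auto simp: space_HH T_pos dest: HH_mono HH_sub)

lemma subalgebra_HH: "0 \<le> t \<Longrightarrow> subalgebra M (HH S t)"
  using HH_sub by (simp add: subalgebra_def space_HH)

definition psum :: "nat \<Rightarrow> 'a \<Rightarrow> real" where
  "psum n \<omega> = (\<Sum>j=1..n. Z j \<omega>)"

lemma loss_eq_psum: "loss S t \<omega> = psum (N t \<omega>) \<omega>"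
  by (simp add: loss_def psum_def)

lemma psum_strict_mono:
  assumes "\<omega> \<in> space M" "m < n"
  shows "psum m \<omega> < psum n \<omega>"
  using assms(2)
proof (induction n)
  case (Suc n)
  have "psum n \<omega> < psum (Suc n) \<omega>" using Z_pos[of "Suc n" \<omega>] assms by (simp add: psum_def)
  then show ?case using Suc by (cases "m = n") auto
qed simp

lemma psum_mono: "\<omega> \<in> space M \<Longrightarrow> m \<le> n \<Longrightarrow> psum m \<omega> \<le> psum n \<omega>"
  using psum_strict_mono[of \<omega> m n] by (cases "m = n") auto

text \<open>Marks are positive, so the path of the loss determines the jump times and the partial sums
  of the marks: the \<open>(n+1)\<close>-st jump has occurred iff the loss exceeds the \<open>n\<close>-th partial sum.\<close>

lemma jump_in_HH:
  assumes "0 \<le> q"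
  shows "{\<omega>\<in>space M. n \<le> N q \<omega>} \<in> sets (HH S q) \<and> (\<forall>x. {\<omega>\<in>space M. n \<le> N q \<omega> \<and> psum n \<omega> \<le> x} \<in> sets (HH S q))"
  using assms
proof (induction n arbitrary: q)
  case 0
  have "{\<omega>\<in>space M. 0 \<le> N q \<omega> \<and> psum 0 \<omega> \<le> x} = (if 0 \<le> x then space M else {})" for x
    by (auto simp: psum_def)
  then show ?case using sets.top[of "HH S q"] by (auto simp: space_HH)
next
  case (Suc n)
  have loss_sets: "{\<omega>\<in>space M. x < loss S r \<omega>} \<in> sets (HH S r)" "{\<omega>\<in>space M. loss S r \<omega> \<le> x} \<in> sets (HH S r)"
    if "0 \<le> r" for r x
    using loss_measurable_HH[OF that order_refl] unfolding space_HH[of r, symmetric] by measurable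
  have jump: "{\<omega>\<in>space M. Suc n \<le> N r \<omega>} \<in> sets (HH S r)" if r: "0 \<le> r" for r
  proof -
    \<comment> \<open>A rational \<open>x\<close> separates the partial sum from the larger loss,
      and turns one comparison of random quantities into countably many observable events.\<close>
    have "{\<omega>\<in>space M. Suc n \<le> N r \<omega>} =
      (\<Union>x\<in>\<rat>. {\<omega>\<in>space M. n \<le> N r \<omega> \<and> psum n \<omega> \<le> x} \<inter> {\<omega>\<in>space M. x < loss S r \<omega>})" (is "?L = ?R")
    proof (intro set_eqI iffI)
      fix \<omega> assume w: "\<omega> \<in> ?L"
      then have "psum n \<omega> < loss S r \<omega>" unfolding loss_eq_psum by (intro psum_strict_mono) auto
      then obtain x where "x \<in> \<rat>" "psum n \<omega> < x" "x < loss S r \<omega>" using Rats_dense_in_real by blast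
      then show "\<omega> \<in> ?R" using w by (auto intro!: bexI[of _ x])
    next
      fix \<omega> assume "\<omega> \<in> ?R"
      then have w: "\<omega> \<in> space M" "n \<le> N r \<omega>" "psum n \<omega> < psum (N r \<omega>) \<omega>" unfolding loss_eq_psum by auto
      then have "n \<noteq> N r \<omega>" by auto
      then show "\<omega> \<in> ?L" using w by auto
    qed
    moreover have "?R \<in> sets (HH S r)"
      using Suc.IH[OF r] loss_sets[OF r] by (intro sets.countable_UN'' countable_rat sets.Int) auto
    ultimately show ?thesis by simp
  qed
  have "{\<omega>\<in>space M. Suc n \<le> N q \<omega> \<and> psum (Suc n) \<omega> \<le> x} \<in> sets (HH S q)" for x
  proof -
    \<comment> \<open>The partial sum is the loss at a time when exactly \<open>Suc n\<close> jumps
      have occurred. If the next jump comes by \<open>q\<close>, such a time can be chosen rational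
      between the two jumps; otherwise \<open>q\<close> itself serves.\<close>
    let ?Q = "insert q {r\<in>\<rat>. 0 \<le> r \<and> r \<le> q}"
    have "{\<omega>\<in>space M. Suc n \<le> N q \<omega> \<and> psum (Suc n) \<omega> \<le> x} =
      (\<Union>r\<in>?Q. {\<omega>\<in>space M. Suc n \<le> N r \<omega>} \<inter> {\<omega>\<in>space M. loss S r \<omega> \<le> x})" (is "?L = ?R")
    proof (intro set_eqI iffI)
      fix \<omega> assume w: "\<omega> \<in> ?L"
      have "\<exists>r\<in>?Q. N r \<omega> = Suc n"
      proof (cases "N q \<omega> = Suc n")
        case False
        then have "Suc (Suc n) \<le> N q \<omega>" using w by auto
        then have j2: "J (Suc (Suc n)) \<omega> \<le> ereal q" using le_counting_iff[OF J, of \<omega> "Suc (Suc n)" q] w by auto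
        have j1: "J (Suc n) \<omega> \<le> ereal q" using le_counting_iff[OF J, of \<omega> "Suc n" q] w by auto
        have lt: "J (Suc n) \<omega> < J (Suc (Suc n)) \<omega>"
          using j1 w by (intro jump_times_strict[OF J]) auto
        have p: "0 < J (Suc n) \<omega>" using jump_times_pos[OF J, of \<omega> "Suc n"] w by auto
        obtain a b where ab: "J (Suc n) \<omega> = ereal a" "J (Suc (Suc n)) \<omega> = ereal b"
          using j1 j2 p lt by (cases "J (Suc n) \<omega>"; cases "J (Suc (Suc n)) \<omega>") auto
        then obtain r where r: "r \<in> \<rat>" "a < r" "r < b" using lt Rats_dense_in_real[of a b] by auto
        have "Suc n \<le> N r \<omega>" "\<not> Suc (Suc n) \<le> N r \<omega>"
          using le_counting_iff[OF J, of \<omega> "Suc n" r] le_counting_iff[OF J, of \<omega> "Suc (Suc n)" r] w r ab by auto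
        then have "N r \<omega> = Suc n" by simp
        moreover have "r \<in> ?Q" using r ab j2 p by auto
        ultimately show ?thesis by blast
      qed auto
      then obtain r where "r \<in> ?Q" "N r \<omega> = Suc n" by blast
      then show "\<omega> \<in> ?R" using w by (intro UN_I[of r]) (auto simp: loss_eq_psum)
    next
      fix \<omega> assume "\<omega> \<in> ?R"
      then obtain r where r: "r \<in> ?Q" "\<omega> \<in> space M" "Suc n \<le> N r \<omega>" "psum (N r \<omega>) \<omega> \<le> x"
        unfolding loss_eq_psum by blast
      have "N r \<omega> \<le> N q \<omega>" using r by (intro counting_mono[OF J]) auto
      moreover have "psum (Suc n) \<omega> \<le> psum (N r \<omega>) \<omega>" using r by (intro psum_mono) auto
      ultimately show "\<omega> \<in> ?L" using r by auto
    qed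
    moreover have "?R \<in> sets (HH S q)"
    proof (intro sets.countable_UN'')
      show "countable ?Q" by (rule countable_subset[of _ "insert q \<rat>"]) (auto intro: countable_rat)
      fix r assume "r \<in> ?Q"
      then have r: "0 \<le> r" "r \<le> q" using Suc.prems by auto
      show "{\<omega>\<in>space M. Suc n \<le> N r \<omega>} \<inter> {\<omega>\<in>space M. loss S r \<omega> \<le> x} \<in> sets (HH S q)"
        using jump[OF r(1)] loss_sets(2)[OF r(1)] HH_mono[OF r] by auto
    qed
    ultimately show ?thesis by simp
  qed
  then show ?case using jump[OF Suc.prems] by auto
qed

lemma stopping_HH:
  assumes "0 \<le> q" "1 \<le> n"
  shows "{\<omega>\<in>space M. J n \<omega> \<le> ereal q} \<in> sets (HH S q)"
proof -
  have "{\<omega>\<in>space M. J n \<omega> \<le> ereal q} = {\<omega>\<in>space M. n \<le> N q \<omega>}"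
    using le_counting_iff[OF J _ assms(2)] by auto
  then show ?thesis using jump_in_HH[OF assms(1)] by simp
qed

lemma psum_measurable_HH:
  assumes "0 \<le> q"
  shows "(\<lambda>\<omega>. if n \<le> N q \<omega> then psum n \<omega> else 0) \<in> borel_measurable (HH S q)"
proof (rule borel_measurableI_le)
  fix x
  have "{\<omega>\<in>space (HH S q). (if n \<le> N q \<omega> then psum n \<omega> else 0) \<le> x} =
    {\<omega>\<in>space M. n \<le> N q \<omega> \<and> psum n \<omega> \<le> x} \<union> (if 0 \<le> x then space M - {\<omega>\<in>space M. n \<le> N q \<omega>} else {})"
    by (auto simp: space_HH)
  moreover have "space M \<in> sets (HH S q)" using sets.top[of "HH S q"] by (simp add: space_HH)
  ultimately show "{\<omega>\<in>space (HH S q). (if n \<le> N q \<omega> then psum n \<omega> else 0) \<le> x} \<in> sets (HH S q)"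
    using jump_in_HH[OF assms, of n] by auto
qed

text \<open>The mark is the difference of two consecutive partial sums, both revealed by the loss
  once jump \<open>n\<close> has occurred.\<close>

lemma mark_in_HH:
  assumes q: "0 \<le> q" and n: "1 \<le> n" and B: "B \<in> sets borel"
  shows "{\<omega>\<in>space M. J n \<omega> \<le> ereal q \<and> Z n \<omega> \<in> B} \<in> sets (HH S q)"
proof -
  obtain m where m: "n = Suc m" using n by (cases n) auto
  let ?d = "\<lambda>\<omega>. (if n \<le> N q \<omega> then psum n \<omega> else 0) - (if m \<le> N q \<omega> then psum m \<omega> else 0)"
  have "?d \<in> borel_measurable (HH S q)" by (intro borel_measurable_diff psum_measurable_HH q)
  then have "?d -` B \<inter> space (HH S q) \<in> sets (HH S q)" using B by (rule measurable_sets)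
  then have "(?d -` B \<inter> space M) \<inter> {\<omega>\<in>space M. n \<le> N q \<omega>} \<in> sets (HH S q)"
    using jump_in_HH[OF q, of n] by (auto simp: space_HH)
  moreover have "(?d -` B \<inter> space M) \<inter> {\<omega>\<in>space M. n \<le> N q \<omega>} = {\<omega>\<in>space M. n \<le> N q \<omega> \<and> Z n \<omega> \<in> B}"
    by (auto simp: m psum_def)
  moreover have "\<dots> = {\<omega>\<in>space M. J n \<omega> \<le> ereal q \<and> Z n \<omega> \<in> B}"
    using le_counting_iff[OF J _ n] by auto
  ultimately show ?thesis by simp
qed

lemma marked_jump_HH: "1 \<le> n \<Longrightarrow> marked_jump M (HH S) T (J n) (Z n)"
  by unfold_locales (auto intro: jump_times_pos[OF J] mark_in_HH)

lemma jump_time_measurable: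
  assumes J: "jump_times M \<tau>" and n: "1 \<le> n"
    and meas: "\<And>q. 0 \<le> q \<Longrightarrow> {\<omega>\<in>space M. \<tau> n \<omega> \<le> ereal q} \<in> sets M"
  shows "\<tau> n \<in> borel_measurable M"
proof (rule borel_measurableI_le)
  fix y :: ereal
  show "{\<omega>\<in>space M. \<tau> n \<omega> \<le> y} \<in> sets M"
  proof (cases y)
    case (real q)
    show ?thesis
    proof (cases "0 \<le> q")
      case False
      then have "y \<le> 0" using real by simp
      then have "\<not> \<tau> n \<omega> \<le> y" if "\<omega> \<in> space M" for \<omega>
        using jump_times_pos[OF J that n] by (meson leD order_trans)
      then have "{\<omega>\<in>space M. \<tau> n \<omega> \<le> y} = {}" by auto
      then show ?thesis by (simp only: sets.empty_sets)
    qed (use meas real in simp)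
  next
    case MInf
    then have "{\<omega>\<in>space M. \<tau> n \<omega> \<le> y} = {}" using jump_times_pos[OF J _ n] by fastforce
    then show ?thesis by (simp only: sets.empty_sets)
  qed simp
qed

lemma J_measurable: "1 \<le> n \<Longrightarrow> J n \<in> borel_measurable M"
  using stopping_HH HH_sub by (intro jump_time_measurable[OF J]) blast+

text \<open>These jumps are not read off the loss; their measurability comes from the adaptedness of
  the second jump measure to the full filtration, through the number of jumps.\<close>

lemma J2_measurable:
  assumes n: "1 \<le> n"
  shows "J2 S n \<in> borel_measurable M"
proof (rule jump_time_measurable[OF J2 n])
  fix q :: real assume q: "0 \<le> q"
  have "(\<lambda>\<omega>. \<integral>\<^sup>+n. (if 1 \<le> n \<and> J2 S n \<omega> \<le> ereal q then (\<lambda>_. 1) (Z2 S n \<omega>) else 0) \<partial>count_space UNIV)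
      \<in> borel_measurable (FF S q)"
    by (rule measurable_jump_kernel[OF J2 space_FF[OF q] m2_adapted[OF q]]) auto
  then have "(\<lambda>\<omega>. \<integral>\<^sup>+n. (if 1 \<le> n \<and> J2 S n \<omega> \<le> ereal q then 1 else 0) \<partial>count_space UNIV) \<in> borel_measurable M"
    using measurable_from_subalg[OF subalgebra_FF[OF q]] by simp
  then have "(\<lambda>\<omega>. ennreal (real (counting (J2 S) q \<omega>))) \<in> borel_measurable M"
    by (rule measurable_cong[THEN iffD1, rotated]) (rule counting_eq_nn_integral[OF J2])
  then have "{\<omega>\<in>space M. ennreal (real n) \<le> ennreal (real (counting (J2 S) q \<omega>))} \<in> sets M" by measurable
  also have "{\<omega>\<in>space M. ennreal (real n) \<le> ennreal (real (counting (J2 S) q \<omega>))} = {\<omega>\<in>space M. J2 S n \<omega> \<le> ereal q}"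
    using le_counting_iff[OF J2 _ n] by auto
  finally show "{\<omega>\<in>space M. J2 S n \<omega> \<le> ereal q} \<in> sets M" .
qed

section \<open>Joint measurability of the intensity and the filter\<close>

lemma measurable_clamp:
  "(\<lambda>x. (if 0 \<le> fst x \<and> fst x \<le> T then fst x else 0, snd x)) \<in> measurable (borel \<Otimes>\<^sub>M M) P"
proof -
  have "(\<lambda>x::real \<times> 'a. (if 0 \<le> fst x \<and> fst x \<le> T then fst x else 0, snd x))
      \<in> measurable (borel \<Otimes>\<^sub>M M) (restrict_space borel {0..T} \<Otimes>\<^sub>M M)"
    using T_pos by (intro measurable_Pair measurable_restrict_space2) auto
  from measurable_compose[OF this measurable_id_P] show ?thesis by simp
qed

text \<open>The random upper limit is replaced by a fixed \<open>m\<close> together with an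
  indicator; at each point the sums are eventually constant in \<open>m\<close>.\<close>

lemma measurable_jump_sum:
  assumes Jm: "jump_times M \<tau>" and meas: "\<And>n. 1 \<le> n \<Longrightarrow> \<tau> n \<in> borel_measurable M"
    and f: "\<And>j. 1 \<le> j \<Longrightarrow> (\<lambda>x. f j (fst x) (snd x)) \<in> borel_measurable (borel \<Otimes>\<^sub>M M)"
  shows "(\<lambda>x. \<Sum>j=1..counting \<tau> (fst x) (snd x). f j (fst x) (snd x) :: real) \<in> borel_measurable (borel \<Otimes>\<^sub>M M)"
proof (rule borel_measurable_LIMSEQ_metric)
  fix m :: nat
  have "(\<lambda>x. if \<tau> j (snd x) \<le> ereal (fst x) then f j (fst x) (snd x) else 0) \<in> borel_measurable (borel \<Otimes>\<^sub>M M)" if "1 \<le> j" for j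
    using f[OF that] meas[OF that] by measurable
  then show "(\<lambda>x. \<Sum>j=1..m. if \<tau> j (snd x) \<le> ereal (fst x) then f j (fst x) (snd x) else 0) \<in> borel_measurable (borel \<Otimes>\<^sub>M M)"
    by (intro borel_measurable_sum) auto
next
  fix x :: "real \<times> 'a" assume "x \<in> space (borel \<Otimes>\<^sub>M M)"
  then have x: "snd x \<in> space M" by (auto simp: space_pair_measure)
  let ?k = "counting \<tau> (fst x) (snd x)"
  have "(\<Sum>j=1..m. if \<tau> j (snd x) \<le> ereal (fst x) then f j (fst x) (snd x) else 0) = (\<Sum>j=1..?k. f j (fst x) (snd x))"
    if "?k \<le> m" for m
  proof -
    have "(\<Sum>j=1..m. if \<tau> j (snd x) \<le> ereal (fst x) then f j (fst x) (snd x) else 0) =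
      (\<Sum>j=1..?k. if \<tau> j (snd x) \<le> ereal (fst x) then f j (fst x) (snd x) else 0)"
      using that le_counting_iff[OF Jm x] by (intro sum.mono_neutral_right) auto
    also have "\<dots> = (\<Sum>j=1..?k. f j (fst x) (snd x))"
      using le_counting_iff[OF Jm x] by (intro sum.cong) auto
    finally show ?thesis .
  qed
  then show "(\<lambda>m. \<Sum>j=1..m. if \<tau> j (snd x) \<le> ereal (fst x) then f j (fst x) (snd x) else 0)
      \<longlonglongrightarrow> (\<Sum>j=1..?k. f j (fst x) (snd x))"
    by (intro tendsto_eventually eventually_sequentiallyI[of ?k]) auto
qed

lemma ell_Z_measurable: "1 \<le> n \<Longrightarrow> (\<lambda>\<omega>. ell S (Z n \<omega>)) \<in> borel_measurable M"
proof -
  assume n: "1 \<le> n"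
  have "ell S \<in> borel_measurable (restrict_space borel {0..})" using model by (simp add: contagion_model_def)
  moreover have "Z n \<in> measurable M (restrict_space borel {0..})"
    using Z_measurable[OF n] Z_pos[OF n] by (intro measurable_restrict_space2) (auto intro: less_imp_le)
  ultimately show ?thesis by (rule measurable_compose[rotated])
qed

lemma intensity_measurable: "(\<lambda>x. intensity S (fst x) (snd x)) \<in> borel_measurable (borel \<Otimes>\<^sub>M M)"
proof -
  have 1: "(\<lambda>x. exp (- alpha S * (fst x - real_of_ereal (J j (snd x)))) * ell S (Z j (snd x))) \<in> borel_measurable (borel \<Otimes>\<^sub>M M)"
    if "1 \<le> j" for j
    using J_measurable[OF that] measurable_compose[OF measurable_snd ell_Z_measurable[OF that], of borel] by measurable
  have 2: "(\<lambda>x. exp (- alpha S * (fst x - real_of_ereal (J2 S j (snd x)))) * Z2 S j (snd x)) \<in> borel_measurable (borel \<Otimes>\<^sub>M M)"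
    if "1 \<le> j" for j
    using J2_measurable[OF that] Z2_measurable[OF that] by measurable
  note s1 = measurable_jump_sum[OF J J_measurable, of "\<lambda>j t \<omega>. exp (- alpha S * (t - real_of_ereal (J j \<omega>))) * ell S (Z j \<omega>)"]
  note s2 = measurable_jump_sum[OF J2 J2_measurable, of "\<lambda>j t \<omega>. exp (- alpha S * (t - real_of_ereal (J2 S j \<omega>))) * Z2 S j \<omega>"]
  show ?thesis unfolding intensity_def
    by (intro borel_measurable_add s1 s2 1 2) auto
qed

text \<open>The intensity is continuous off the countably many jump times, so the left limits in the
  compensator may be replaced by values under \<open>dt\<close>.\<close>

lemma intensity_AE_left_lim:
  assumes "\<omega> \<in> space M"
  shows "AE t in lborel. 0 < t \<longrightarrow> left_lim (\<lambda>s. intensity S s \<omega>) t = intensity S t \<omega>"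
proof -
  let ?D = "{t. \<exists>n. J n \<omega> = ereal t} \<union> {t. \<exists>n. J2 S n \<omega> = ereal t}"
  have "?D \<subseteq> (\<lambda>n. real_of_ereal (J n \<omega>)) ` UNIV \<union> (\<lambda>n. real_of_ereal (J2 S n \<omega>)) ` UNIV"
    by (auto simp: image_iff) (metis real_of_ereal.simps(1))+
  then have "countable ?D" by (rule countable_subset) auto
  then have "AE t in lborel. t \<notin> ?D" by (rule AE_not_in[OF countable_imp_null_set_lborel])
  then show ?thesis
  proof eventually_elim
    case (elim t)
    show ?case
    proof
      assume t: "0 < t"
      have "isCont (\<lambda>s. intensity S s \<omega>) t"
        unfolding intensity_def
        by (intro continuous_intros isCont_jump_sum[OF J assms] isCont_jump_sum[OF J2 assms]) (use elim in auto)
      then have "((\<lambda>s. intensity S s \<omega>) \<longlongrightarrow> intensity S t \<omega>) (at_left t)"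
        unfolding isCont_def by (rule tendsto_within_subset) auto
      then show "left_lim (\<lambda>s. intensity S s \<omega>) t = intensity S t \<omega>" using t by (rule left_lim_eqI[rotated])
    qed
  qed
qed

lemma filt_cadlag: "\<omega> \<in> space M \<Longrightarrow> cadlag_on T (\<lambda>t. filt S t \<omega>)"
  and filt_adapted: "0 \<le> t \<Longrightarrow> t \<le> T \<Longrightarrow> filt S t \<in> borel_measurable (HH S t)"
  and filt_cond_exp: "0 \<le> t \<Longrightarrow> t \<le> T \<Longrightarrow> AE \<omega> in M. ennreal (filt S t \<omega>) = nn_cond_exp M (HH S t) (\<lambda>\<omega>. ennreal (intensity S t \<omega>)) \<omega>"
  and filt_nonneg: "0 \<le> t \<Longrightarrow> t \<le> T \<Longrightarrow> AE \<omega> in M. 0 \<le> filt S t \<omega>"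
proof -
  have *: "\<forall>\<omega>\<in>space M. cadlag_on T (\<lambda>t. filt S t \<omega>)"
    using model unfolding contagion_model_def by (elim conjE)
  have **: "\<forall>t\<in>{0..T}. filt S t \<in> borel_measurable (HH S t) \<and>
        (AE \<omega> in M. ennreal (filt S t \<omega>) = nn_cond_exp M (HH S t) (\<lambda>\<omega>. ennreal (intensity S t \<omega>)) \<omega>) \<and>
        (AE \<omega> in M. 0 \<le> filt S t \<omega>)"
    using model unfolding contagion_model_def by (elim conjE)
  show "\<omega> \<in> space M \<Longrightarrow> cadlag_on T (\<lambda>t. filt S t \<omega>)" using * by blast
  assume "0 \<le> t" "t \<le> T"
  then have "t \<in> {0..T}" by simp
  from bspec[OF ** this]
  show "filt S t \<in> borel_measurable (HH S t)"
    "AE \<omega> in M. ennreal (filt S t \<omega>) = nn_cond_exp M (HH S t) (\<lambda>\<omega>. ennreal (intensity S t \<omega>)) \<omega>"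
    "AE \<omega> in M. 0 \<le> filt S t \<omega>" by simp_all
qed

lemma measurable_from_HH: "0 \<le> t \<Longrightarrow> f \<in> measurable (HH S t) L \<Longrightarrow> f \<in> measurable M L"
  using measurable_from_subalg[OF subalgebra_HH] by blast

lemma left_lim_predictable:
  assumes "\<And>\<omega>. \<omega> \<in> space M \<Longrightarrow> cadlag_on T (\<lambda>t. X t \<omega>)"
    and "\<And>t. 0 \<le> t \<Longrightarrow> t \<le> T \<Longrightarrow> X t \<in> borel_measurable (HH S t)"
  shows "(\<lambda>(t, \<omega>). left_lim (\<lambda>s. X s \<omega>) t) \<in> borel_measurable P"
  using assms by (intro predictable_left_limit) (auto intro: left_lim_tendsto)

lemma filt_left_predictable: "(\<lambda>(t, \<omega>). filt_left S t \<omega>) \<in> borel_measurable P"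
  by (intro left_lim_predictable filt_cadlag filt_adapted)

text \<open>Right-continuity calls for approximation from the right: the process is evaluated at the
  next grid point strictly above \<open>t\<close>, capped at \<open>T\<close>. For fixed
  \<open>n\<close> only countably many times occur, which gives joint measurability.\<close>

lemma cadlag_joint_measurable:
  fixes X :: "real \<Rightarrow> 'a \<Rightarrow> real"
  assumes c: "\<And>\<omega>. \<omega> \<in> space M \<Longrightarrow> cadlag_on T (\<lambda>t. X t \<omega>)"
    and X: "\<And>t. 0 \<le> t \<Longrightarrow> t \<le> T \<Longrightarrow> X t \<in> borel_measurable M"
  shows "(\<lambda>x. if 0 \<le> fst x \<and> fst x \<le> T then X (fst x) (snd x) else 0) \<in> borel_measurable (borel \<Otimes>\<^sub>M M)"
proof -
  define d where "d n t = (real_of_int \<lfloor>t * real (Suc n)\<rfloor> + 1) / real (Suc n)" for n :: nat and t :: real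
  have d: "t < d n t \<and> d n t \<le> t + 1 / real (Suc n)" for n t
  proof -
    define m where "m = real (Suc n)"
    have m: "0 < m" by (simp add: m_def)
    have "t * m < real_of_int \<lfloor>t * m\<rfloor> + 1" "real_of_int \<lfloor>t * m\<rfloor> \<le> t * m" by linarith+
    moreover have "(t + 1 / m) * m = t * m + 1" using m by (simp add: algebra_simps)
    ultimately show ?thesis
      unfolding d_def m_def[symmetric] using m by (simp add: pos_less_divide_eq pos_divide_le_eq)
  qed
  show ?thesis
  proof (rule borel_measurable_LIMSEQ_metric)
  fix n
  define k where "k x = \<lfloor>fst x * real (Suc n)\<rfloor>" for x :: "real \<times> 'a"
  have km: "k \<in> measurable (borel \<Otimes>\<^sub>M M) (count_space UNIV)" unfolding k_def by measurable
  have Xm: "(\<lambda>x::real \<times> 'a. X (max 0 (min T ((real_of_int i + 1) / real (Suc n)))) (snd x)) \<in> borel_measurable (borel \<Otimes>\<^sub>M M)" for i :: int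
    using T_pos by (intro measurable_compose[OF measurable_snd X]) auto
  have "(\<lambda>x. X (max 0 (min T (d n (fst x)))) (snd x)) \<in> borel_measurable (borel \<Otimes>\<^sub>M M)"
    using measurable_compose_countable[OF Xm km] by (simp add: d_def k_def)
  then show "(\<lambda>x. if 0 \<le> fst x \<and> fst x \<le> T then X (max 0 (min T (d n (fst x)))) (snd x) else 0) \<in> borel_measurable (borel \<Otimes>\<^sub>M M)"
    by measurable
next
  fix x :: "real \<times> 'a" assume x: "x \<in> space (borel \<Otimes>\<^sub>M M)"
  have dlim: "(\<lambda>n. d n t) \<longlonglongrightarrow> t" for t
  proof -
    have lim: "(\<lambda>n. t + 1 / real (Suc n)) \<longlonglongrightarrow> t"
      using tendsto_add[OF tendsto_const LIMSEQ_inverse_real_of_nat, of t] by (simp add: divide_inverse)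
    show ?thesis
    proof (rule tendsto_sandwich[OF _ _ tendsto_const lim])
      show "\<forall>\<^sub>F n in sequentially. t \<le> d n t" by (intro always_eventually allI less_imp_le d[THEN conjunct1])
      show "\<forall>\<^sub>F n in sequentially. d n t \<le> t + 1 / real (Suc n)" by (intro always_eventually allI d[THEN conjunct2])
    qed
  qed
  show "(\<lambda>n. if 0 \<le> fst x \<and> fst x \<le> T then X (max 0 (min T (d n (fst x)))) (snd x) else 0)
      \<longlonglongrightarrow> (if 0 \<le> fst x \<and> fst x \<le> T then X (fst x) (snd x) else 0)"
  proof (cases "0 \<le> fst x \<and> fst x < T")
    case True
    have ev: "\<forall>\<^sub>F n in sequentially. d n (fst x) < T"
      using True by (intro order_tendstoD(2)[OF dlim]) auto
    have "filterlim (\<lambda>n. d n (fst x)) (at_right (fst x)) sequentially"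
      unfolding filterlim_at
      using d dlim by (auto intro!: always_eventually simp: less_imp_neq[symmetric])
    moreover have "((\<lambda>t. X t (snd x)) \<longlongrightarrow> X (fst x) (snd x)) (at_right (fst x))"
      using c[of "snd x"] x True by (auto simp: cadlag_on_def space_pair_measure)
    ultimately have "(\<lambda>n. X (d n (fst x)) (snd x)) \<longlonglongrightarrow> X (fst x) (snd x)"
      by (rule filterlim_compose[rotated])
    moreover have "\<forall>\<^sub>F n in sequentially. X (d n (fst x)) (snd x) =
        (if 0 \<le> fst x \<and> fst x \<le> T then X (max 0 (min T (d n (fst x)))) (snd x) else 0)"
      using ev
    proof eventually_elim
      case (elim n)
      have "0 \<le> d n (fst x)" using d[of "fst x" n] True by linarith
      then show ?case using elim True by (simp add: max_def min_def)
    qed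
    ultimately show ?thesis using True by (auto elim: Lim_transform_eventually)
  next
    case False
    then have "fst x < 0 \<or> T < fst x \<or> fst x = T" by linarith
    moreover have "max 0 (min T (d n T)) = T" for n using d[of T n] T_pos by auto
    ultimately show ?thesis using T_pos by auto
  qed
qed
qed

text \<open>Nonnegativity is almost sure at each time separately. Rational times give one null set,
  and a negative left limit would show at rational times just before.\<close>

lemma filt_left_nonneg: "AE \<omega> in M. \<forall>t\<in>{0..T}. 0 \<le> filt_left S t \<omega>"
proof -
  have "AE \<omega> in M. \<forall>q\<in>{q\<in>\<rat>. 0 \<le> q \<and> q \<le> T}. 0 \<le> filt S q \<omega>"
    by (subst AE_ball_countable) (auto intro: filt_nonneg countable_subset[OF _ countable_rat])
  then show ?thesis
  proof (rule AE_mp, intro AE_I2 impI ballI)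
    fix \<omega> t assume w: "\<omega> \<in> space M" and q: "\<forall>q\<in>{q\<in>\<rat>. 0 \<le> q \<and> q \<le> T}. 0 \<le> filt S q \<omega>" and t: "t \<in> {0..T}"
    show "0 \<le> filt_left S t \<omega>"
    proof (cases "t = 0")
      case True then show ?thesis using q T_pos by auto
    next
      case False
      have lim: "((\<lambda>s. filt S s \<omega>) \<longlongrightarrow> filt_left S t \<omega>) (at_left t)"
        using False t by (intro left_lim_tendsto[OF filt_cadlag[OF w]]) auto
      show ?thesis
      proof (rule ccontr)
        assume "\<not> ?thesis"
        then have "\<forall>\<^sub>F s in at_left t. filt S s \<omega> < 0" by (intro order_tendstoD(2)[OF lim]) auto
        then obtain b where b: "b < t" "\<And>s. b < s \<Longrightarrow> s < t \<Longrightarrow> filt S s \<omega> < 0"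
          unfolding eventually_at_left_field by auto
        have "max 0 b < t" using b False t by auto
        then obtain r where r: "r \<in> \<rat>" "max 0 b < r" "r < t" using Rats_dense_in_real by blast
        then have "0 \<le> filt S r \<omega>" using q t by auto
        then show False using b(2)[of r] r by auto
      qed
    qed
  qed
qed

lemma filt_left_bounded:
  assumes "\<omega> \<in> space M"
  obtains B where "\<And>t. 0 \<le> t \<Longrightarrow> t \<le> T \<Longrightarrow> filt_left S t \<omega> \<le> B"
proof -
  obtain B where "\<And>t. 0 \<le> t \<Longrightarrow> t \<le> T \<Longrightarrow> \<bar>filt S t \<omega>\<bar> \<le> B"
    using cadlag_bounded[OF filt_cadlag[OF assms]] by metis
  then show ?thesis by (intro that[of B] left_lim_upper[OF filt_cadlag[OF assms]]) (auto intro: order_trans[OF abs_ge_self])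
qed

text \<open>Transfers \<open>HH\<close>-predictable fields on \<open>[0,T]\<close> to
  \<open>FF\<close>-predictable ones on the half line, the class for which the compensator is
  assumed. Times after \<open>T\<close> are sent to 0; their part of a preimage is a rectangle over
  a set known at time 0.\<close>

lemma measurable_restrict_time:
  "(\<lambda>x. (if fst x \<le> T then fst x else 0, snd x)) \<in> measurable (predictable {0..} M (FF S)) P"
proof -
  let ?Q = "predictable {0..} M (FF S)"
  let ?G = "{{0} \<times> A | A. A \<in> sets (FF S 0)} \<union>
      {({s<..t} \<inter> {0..}) \<times> A | s t A. 0 \<le> s \<and> s < t \<and> A \<in> sets (FF S s)}"
  have FFsp: "A \<subseteq> space M" if "0 \<le> t" "A \<in> sets (FF S t)" for t A
    using that sets.sets_into_space space_FF by metis
  have gen: "?G \<subseteq> Pow ({0..} \<times> space M)" using FFsp by fastforce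
  have sp: "space ?Q = {0..} \<times> space M" unfolding predictable_def by (rule space_measure_of[OF gen])
  have basic: "X \<in> sets ?Q" if "X \<in> ?G" for X
    unfolding predictable_def sets_measure_of[OF gen] by (rule sigma_sets.Basic[OF that])
  have rect: "{s<..t} \<times> A \<in> sets ?Q" if "0 \<le> s" "A \<in> sets (HH S s)" for s t A
  proof (cases "s < t")
    case True
    have "A \<in> sets (FF S s)" using that HH_FF by auto
    then have "({s<..t} \<inter> {0..}) \<times> A \<in> sets ?Q"
      using that True by (intro basic UnI2 CollectI exI[of _ s] exI[of _ t] exI[of _ A]) auto
    moreover have "{s<..t} \<inter> {0..} = {s<..t}" using that by auto
    ultimately show ?thesis by simp
  qed auto
  show ?thesis
  proof (rule measurable_into_P)
    show "(\<lambda>x. (if fst x \<le> T then fst x else 0, snd x)) \<in> space ?Q \<rightarrow> {0..T} \<times> space M"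
      using T_pos by (auto simp: sp)
    show "(\<lambda>x. (if fst x \<le> T then fst x else 0, snd x)) -` ({0} \<times> A) \<inter> space ?Q \<in> sets ?Q"
      if A: "A \<in> sets (HH S 0)" for A
    proof -
      have "(\<lambda>x. (if fst x \<le> T then fst x else 0, snd x)) -` ({0} \<times> A) \<inter> space ?Q =
          {0} \<times> A \<union> (\<Union>n::nat. {T<..real n} \<times> A)" (is "?L = ?R")
      proof (intro set_eqI iffI)
        fix x assume "x \<in> ?L"
        then show "x \<in> ?R"
          using real_arch_simple[of "fst x"] by (cases x) (auto simp: sp not_le split: if_splits)
      next
        fix x assume "x \<in> ?R"
        then show "x \<in> ?L" using T_pos F_into_space[OF _ A] by (auto simp: sp)
      qed
      moreover have "{0} \<times> A \<in> sets ?Q" using A HH_FF[of 0] by (intro basic) auto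
      moreover have "{T<..real n} \<times> A \<in> sets ?Q" for n
        using A HH_mono[of 0 T] T_pos by (intro rect) auto
      ultimately show ?thesis by auto
    qed
    show "(\<lambda>x. (if fst x \<le> T then fst x else 0, snd x)) -` (({a<..b} \<inter> {0..T}) \<times> A) \<inter> space ?Q \<in> sets ?Q"
      if A: "0 \<le> a" "a < b" "A \<in> sets (HH S a)" for a b A
    proof -
      have "(\<lambda>x. (if fst x \<le> T then fst x else 0, snd x)) -` (({a<..b} \<inter> {0..T}) \<times> A) \<inter> space ?Q =
          {a<..min b T} \<times> A"
        using A F_into_space[OF A(1,3)] by (auto simp: sp split: if_splits)
      then show ?thesis using rect[OF A(1,3)] by simp
    qed
  qed
qed

text \<open>The compensator of the jumps with respect to the observation filtration: \<open>\<lambda>\<close> is projected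
  to \<open>\<pi>(\<lambda>)\<close> at each fixed time, using that a predictable integrand at time \<open>t\<close> is
  \<open>\<H>\<^sub>t\<close>-measurable.\<close>

lemma compensator_HH:
  fixes \<Gamma> :: "(real \<times> 'a) \<times> real \<Rightarrow> ennreal"
  assumes \<Gamma>: "\<Gamma> \<in> borel_measurable (P \<Otimes>\<^sub>M borel)"
  shows "(\<integral>\<^sup>+\<omega>. (\<Sum>n=1..N T \<omega>. \<Gamma> ((real_of_ereal (J n \<omega>), \<omega>), Z n \<omega>)) \<partial>M) =
    (\<integral>\<^sup>+\<omega>. (\<integral>\<^sup>+t\<in>{0..T}. (\<integral>\<^sup>+z. \<Gamma> ((t, \<omega>), z) \<partial>F1 S) * ennreal (filt_left S t \<omega>) \<partial>lborel) \<partial>M)"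
proof -
  interpret F1: prob_space "F1 S" by (rule F1_prob)
  \<comment> \<open>Set to 0 after \<open>T\<close>, so that the identity on the half line sees only
    \<open>[0,T]\<close>.\<close>
  define \<Gamma>' where "\<Gamma>' x = (if fst (fst x) \<le> T then \<Gamma> ((if fst (fst x) \<le> T then fst (fst x) else 0, snd (fst x)), snd x) else 0)"
    for x :: "(real \<times> 'a) \<times> real"
  let ?Q = "predictable {0..} M (FF S)"
  have fstm: "fst \<in> borel_measurable ?Q"
  proof (rule borel_measurableI_greater)
    fix a
    let ?G = "{{0} \<times> A | A. A \<in> sets (FF S 0)} \<union>
      {({s<..t} \<inter> {0..}) \<times> A | s t A. 0 \<le> s \<and> s < t \<and> A \<in> sets (FF S s)}"
    have FFsp: "A \<subseteq> space M" if "0 \<le> t" "A \<in> sets (FF S t)" for t A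
      using that sets.sets_into_space space_FF by metis
    have gen: "?G \<subseteq> Pow ({0..} \<times> space M)" using FFsp by fastforce
    have sp: "space ?Q = {0..} \<times> space M" unfolding predictable_def by (rule space_measure_of[OF gen])
    show "{x\<in>space ?Q. a < fst x} \<in> sets ?Q"
    proof (cases "a < 0")
      case True
      then have "{x\<in>space ?Q. a < fst x} = space ?Q" by (auto simp: sp)
      then show ?thesis by simp
    next
      case False
      have "{x\<in>space ?Q. a < fst x} = (\<Union>n::nat. ({a<..a + real (Suc n)} \<inter> {0..}) \<times> space M)"
      proof (intro set_eqI iffI)
        fix x assume x: "x \<in> {x\<in>space ?Q. a < fst x}"
        obtain n where "fst x - a \<le> real n" using real_arch_simple by blast
        then show "x \<in> (\<Union>n::nat. ({a<..a + real (Suc n)} \<inter> {0..}) \<times> space M)"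
          using x by (cases x) (auto simp: sp intro!: exI[of _ n])
      qed (auto simp: sp)
      moreover have "({a<..a + real (Suc n)} \<inter> {0..}) \<times> space M \<in> sets ?Q" for n
      proof -
        have "space M \<in> sets (FF S a)" using space_FF[of a] False sets.top[of "FF S a"] by simp
        then show ?thesis
          unfolding predictable_def sets_measure_of[OF gen] using False
          by (intro sigma_sets.Basic UnI2 CollectI exI[of _ a] exI[of _ "a + real (Suc n)"] exI[of _ "space M"]) auto
      qed
      ultimately show ?thesis by auto
    qed
  qed
  have "\<Gamma>' \<in> borel_measurable (?Q \<Otimes>\<^sub>M borel)"
  proof -
    have "(\<lambda>x. ((if fst (fst x) \<le> T then fst (fst x) else 0, snd (fst x)), snd x)) \<in> measurable (?Q \<Otimes>\<^sub>M borel) (P \<Otimes>\<^sub>M borel)"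
      using measurable_compose[OF measurable_fst measurable_restrict_time, of borel] by (intro measurable_Pair) auto
    from measurable_compose[OF this \<Gamma>] have m: "(\<lambda>x. \<Gamma> ((if fst (fst x) \<le> T then fst (fst x) else 0, snd (fst x)), snd x)) \<in> borel_measurable (?Q \<Otimes>\<^sub>M borel)" .
    have [measurable]: "(\<lambda>x. fst (fst x)) \<in> borel_measurable (?Q \<Otimes>\<^sub>M borel)"
      using measurable_compose[OF measurable_fst fstm] .
    show ?thesis unfolding \<Gamma>'_def by (rule measurable_If[OF m]) measurable
  qed
  note comp = m1_compensator[OF this]
  define h where "h t \<omega> = (\<integral>\<^sup>+z. \<Gamma> ((t, \<omega>), z) \<partial>F1 S)" for t \<omega>
  have hP: "(\<lambda>x. h (fst x) (snd x)) \<in> borel_measurable P"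
    unfolding h_def prod.collapse using \<Gamma>
    by (intro F1.borel_measurable_nn_integral) (simp add: case_prod_beta' cong: measurable_cong_sets)
  \<comment> \<open>Fubini needs functions measurable on all real times; values outside
    \<open>[0,T]\<close> are defaults removed by the indicator.\<close>
  define hc where "hc t \<omega> = h (if 0 \<le> t \<and> t \<le> T then t else 0) \<omega>" for t \<omega>
  have hc: "(\<lambda>x. hc (fst x) (snd x)) \<in> borel_measurable (borel \<Otimes>\<^sub>M M)"
    using measurable_compose[OF measurable_clamp hP] by (simp add: hc_def)
  define fc where "fc t \<omega> = (if 0 \<le> t \<and> t \<le> T then filt S t \<omega> else 0)" for t \<omega>
  have fc: "(\<lambda>x. fc (fst x) (snd x)) \<in> borel_measurable (borel \<Otimes>\<^sub>M M)"
    unfolding fc_def by (intro cadlag_joint_measurable filt_cadlag) (auto intro: measurable_from_HH filt_adapted)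
  have left: "(\<integral>\<^sup>+x. (case x of (t, z) \<Rightarrow> \<Gamma>' ((t, \<omega>), z) * indicator {0<..} t) \<partial>m1 S \<omega>) =
      (\<Sum>n=1..N T \<omega>. \<Gamma> ((real_of_ereal (J n \<omega>), \<omega>), Z n \<omega>))" if w: "\<omega> \<in> space M" for \<omega>
  proof -
    have "(\<lambda>x::real \<times> real. ((if 0 \<le> fst x \<and> fst x \<le> T then fst x else 0, \<omega>), snd x)) \<in> measurable (borel \<Otimes>\<^sub>M borel) (P \<Otimes>\<^sub>M borel)"
    proof (rule measurable_Pair)
      have "(\<lambda>x::real \<times> real. (if 0 \<le> fst x \<and> fst x \<le> T then fst x else 0)) \<in> measurable (borel \<Otimes>\<^sub>M borel) (restrict_space borel {0..T})"
        using T_pos by (intro measurable_restrict_space2) auto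
      from measurable_compose[OF this measurable_path[OF w]]
      show "(\<lambda>x::real \<times> real. (if 0 \<le> fst x \<and> fst x \<le> T then fst x else 0, \<omega>)) \<in> measurable (borel \<Otimes>\<^sub>M borel) P" .
    qed auto
    from measurable_compose[OF this \<Gamma>]
    have "(\<lambda>x. if 0 < fst x \<and> fst x \<le> T then \<Gamma> ((if 0 \<le> fst x \<and> fst x \<le> T then fst x else 0, \<omega>), snd x) else 0) \<in> borel_measurable (borel \<Otimes>\<^sub>M borel)"
      by (rule measurable_If) measurable
    also have "(\<lambda>x. if 0 < fst x \<and> fst x \<le> T then \<Gamma> ((if 0 \<le> fst x \<and> fst x \<le> T then fst x else 0, \<omega>), snd x) else 0) =
      (\<lambda>x. case x of (t, z) \<Rightarrow> \<Gamma>' ((t, \<omega>), z) * indicator {0<..} t)"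
      by (auto simp: \<Gamma>'_def fun_eq_iff indicator_def)
    finally have m: "(\<lambda>x. case x of (t, z) \<Rightarrow> \<Gamma>' ((t, \<omega>), z) * indicator {0<..} t) \<in> borel_measurable (borel \<Otimes>\<^sub>M borel)" .
    show ?thesis
      unfolding nn_integral_jump_measure[OF m] nn_integral_jumps_until[OF J w, symmetric]
    proof (intro nn_integral_cong)
      fix n
      show "(if 1 \<le> n \<and> J n \<omega> < \<infinity> then case (real_of_ereal (J n \<omega>), Z n \<omega>) of (t, z) \<Rightarrow> \<Gamma>' ((t, \<omega>), z) * indicator {0<..} t else 0) =
        (if 1 \<le> n \<and> J n \<omega> \<le> ereal T then \<Gamma> ((real_of_ereal (J n \<omega>), \<omega>), Z n \<omega>) else 0)"
        using jump_times_pos[OF J w, of n] by (cases "J n \<omega>") (auto simp: \<Gamma>'_def)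
    qed
  qed
  \<comment> \<open>The filter is tied to the intensity at \<open>t\<close>, not to its left limit,
    so left limits are traded for values before projecting; the opposite trade is made for the
    filter at the end.\<close>
  have right: "(\<integral>\<^sup>+t\<in>{0<..}. (\<integral>\<^sup>+z. \<Gamma>' ((t, \<omega>), z) * ennreal (left_lim (\<lambda>s. intensity S s \<omega>) t) \<partial>F1 S) \<partial>lborel) =
     (\<integral>\<^sup>+t. hc t \<omega> * ennreal (intensity S t \<omega>) * indicator {0..T} t \<partial>lborel)" if w: "\<omega> \<in> space M" for \<omega>
  proof (rule nn_integral_cong_AE)
    have "AE t in lborel. t \<noteq> 0" by (rule AE_lborel_singleton)
    with intensity_AE_left_lim[OF w]
    show "AE t in lborel. (\<integral>\<^sup>+z. \<Gamma>' ((t, \<omega>), z) * ennreal (left_lim (\<lambda>s. intensity S s \<omega>) t) \<partial>F1 S) * indicator {0<..} t =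
       hc t \<omega> * ennreal (intensity S t \<omega>) * indicator {0..T} t"
    proof eventually_elim
      case (elim t)
      show ?case
      proof (cases "0 < t \<and> t \<le> T")
        case True
        have "(\<lambda>z. ((t, \<omega>), z)) \<in> measurable borel (P \<Otimes>\<^sub>M borel)"
          using True w by (intro measurable_Pair) (auto simp: space_P)
        from measurable_compose[OF this \<Gamma>] have "(\<lambda>z. \<Gamma> ((t, \<omega>), z)) \<in> borel_measurable (F1 S)"
          by (simp cong: measurable_cong_sets)
        then show ?thesis using True elim
          by (simp add: \<Gamma>'_def hc_def h_def nn_integral_multc)
      next
        case False
        then show ?thesis using elim(2) by (auto simp: \<Gamma>'_def indicator_def)
      qed
    qed
  qed
  interpret sw: pair_sigma_finite lborel M by unfold_locales
  have meas1: "(\<lambda>(t, \<omega>). hc t \<omega> * ennreal (intensity S t \<omega>) * indicator {0..T} t) \<in> borel_measurable (lborel \<Otimes>\<^sub>M M)"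
    using hc intensity_measurable by (simp add: case_prod_beta' cong: measurable_cong_sets)
  have meas2: "(\<lambda>(t, \<omega>). hc t \<omega> * ennreal (fc t \<omega>) * indicator {0..T} t) \<in> borel_measurable (lborel \<Otimes>\<^sub>M M)"
    using hc fc by (simp add: case_prod_beta' cong: measurable_cong_sets)
  \<comment> \<open>A section of a predictable function at time \<open>t\<close> is measurable for
    \<open>HH S t\<close>, so it may multiply the conditional expectation given this
    \<sigma>-algebra.\<close>
  have proj: "(\<integral>\<^sup>+\<omega>. hc t \<omega> * ennreal (intensity S t \<omega>) * indicator {0..T} t \<partial>M) =
      (\<integral>\<^sup>+\<omega>. hc t \<omega> * ennreal (fc t \<omega>) * indicator {0..T} t \<partial>M)" for t
  proof (cases "0 \<le> t \<and> t \<le> T")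
    case True
    interpret sub: finite_measure_subalgebra M "HH S t"
      using subalgebra_HH True by unfold_locales auto
    have im: "(\<lambda>\<omega>. ennreal (intensity S t \<omega>)) \<in> borel_measurable M"
      using measurable_compose[OF measurable_Pair1' intensity_measurable, of t] by simp
    have hm: "(\<lambda>\<omega>. h t \<omega>) \<in> borel_measurable (HH S t)"
      using measurable_section[OF hP, of t] True by simp
    have "(\<integral>\<^sup>+\<omega>. h t \<omega> * ennreal (intensity S t \<omega>) \<partial>M) =
        (\<integral>\<^sup>+\<omega>. h t \<omega> * nn_cond_exp M (HH S t) (\<lambda>\<omega>. ennreal (intensity S t \<omega>)) \<omega> \<partial>M)"
      by (rule sub.nn_cond_exp_intg[OF hm im, symmetric])
    also have "\<dots> = (\<integral>\<^sup>+\<omega>. h t \<omega> * ennreal (filt S t \<omega>) \<partial>M)"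
      by (rule nn_integral_cong_AE) (use filt_cond_exp[of t] True in \<open>auto elim: eventually_mono\<close>)
    finally show ?thesis using True by (simp add: hc_def fc_def)
  qed auto
  have "(\<integral>\<^sup>+\<omega>. (\<Sum>n=1..N T \<omega>. \<Gamma> ((real_of_ereal (J n \<omega>), \<omega>), Z n \<omega>)) \<partial>M) =
      (\<integral>\<^sup>+\<omega>. (\<integral>\<^sup>+t. hc t \<omega> * ennreal (intensity S t \<omega>) * indicator {0..T} t \<partial>lborel) \<partial>M)"
    using comp by (simp add: left right cong: nn_integral_cong)
  also have "\<dots> = (\<integral>\<^sup>+t. (\<integral>\<^sup>+\<omega>. hc t \<omega> * ennreal (intensity S t \<omega>) * indicator {0..T} t \<partial>M) \<partial>lborel)"
    by (rule sw.Fubini'[OF meas1])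
  also have "\<dots> = (\<integral>\<^sup>+t. (\<integral>\<^sup>+\<omega>. hc t \<omega> * ennreal (fc t \<omega>) * indicator {0..T} t \<partial>M) \<partial>lborel)"
    unfolding proj ..
  also have "\<dots> = (\<integral>\<^sup>+\<omega>. (\<integral>\<^sup>+t. hc t \<omega> * ennreal (fc t \<omega>) * indicator {0..T} t \<partial>lborel) \<partial>M)"
    by (rule sw.Fubini'[OF meas2, symmetric])
  also have "\<dots> = (\<integral>\<^sup>+\<omega>. (\<integral>\<^sup>+t\<in>{0..T}. h t \<omega> * ennreal (filt_left S t \<omega>) \<partial>lborel) \<partial>M)"
  proof (rule nn_integral_cong, rule nn_integral_cong_AE)
    fix \<omega> assume "\<omega> \<in> space M"
    from cadlag_AE_left_lim[OF filt_cadlag[OF this]]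
    show "AE t in lborel. hc t \<omega> * ennreal (fc t \<omega>) * indicator {0..T} t = h t \<omega> * ennreal (filt_left S t \<omega>) * indicator {0..T} t"
      by eventually_elim (auto simp: hc_def fc_def indicator_def)
  qed
  finally show ?thesis by (simp add: h_def)
qed

text \<open>The upper limit \<open>N T \<omega>\<close> looks into the future, but only jumps before
  \<open>s\<close> contribute. Sums to a fixed \<open>m\<close> are predictable term by term and
  eventually constant.\<close>

lemma jump_sum_predictable:
  fixes g :: "(real \<times> 'a) \<times> real \<Rightarrow> real"
  assumes g: "g \<in> borel_measurable (P \<Otimes>\<^sub>M borel)"
  shows "(\<lambda>(s, \<omega>). \<Sum>n=1..N T \<omega>. if J n \<omega> < ereal s then g ((real_of_ereal (J n \<omega>), \<omega>), Z n \<omega>) else 0) \<in> borel_measurable P"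
proof (rule borel_measurable_LIMSEQ_metric)
  fix m :: nat
  have "(\<lambda>(s, \<omega>). if J n \<omega> < ereal s then g ((real_of_ereal (J n \<omega>), \<omega>), Z n \<omega>) else 0) \<in> borel_measurable P" if "1 \<le> n" for n
    using marked_jump.predictable_jump_before[OF marked_jump_HH[OF that] g] .
  then have "(\<lambda>x. \<Sum>n=1..m. (\<lambda>(s, \<omega>). if J n \<omega> < ereal s then g ((real_of_ereal (J n \<omega>), \<omega>), Z n \<omega>) else 0) x) \<in> borel_measurable P"
    by (intro borel_measurable_sum) auto
  then show "(\<lambda>(s, \<omega>). \<Sum>n=1..m. if J n \<omega> < ereal s then g ((real_of_ereal (J n \<omega>), \<omega>), Z n \<omega>) else 0) \<in> borel_measurable P"
    by (simp add: case_prod_beta')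
next
  fix x assume "x \<in> space P"
  then obtain s \<omega> where x: "x = (s, \<omega>)" "s \<le> T" "\<omega> \<in> space M" by (auto simp: space_P)
  have "(\<Sum>n=1..m. if J n \<omega> < ereal s then g ((real_of_ereal (J n \<omega>), \<omega>), Z n \<omega>) else 0) =
      (\<Sum>n=1..N T \<omega>. if J n \<omega> < ereal s then g ((real_of_ereal (J n \<omega>), \<omega>), Z n \<omega>) else 0)" if "N T \<omega> \<le> m" for m
  proof (rule sum.mono_neutral_right)
    show "\<forall>i\<in>{1..m} - {1..N T \<omega>}. (if J i \<omega> < ereal s then g ((real_of_ereal (J i \<omega>), \<omega>), Z i \<omega>) else 0) = 0"
    proof
      fix i assume i: "i \<in> {1..m} - {1..N T \<omega>}"
      then have "\<not> J i \<omega> \<le> ereal T" using le_counting_iff[OF J x(3), of i T] by auto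
      moreover have "ereal s \<le> ereal T" using x by simp
      ultimately have "\<not> J i \<omega> < ereal s" by (meson less_imp_le order_trans)
      then show "(if J i \<omega> < ereal s then g ((real_of_ereal (J i \<omega>), \<omega>), Z i \<omega>) else 0) = 0" by simp
    qed
  qed (use that in auto)
  then show "(\<lambda>m. case x of (s, \<omega>) \<Rightarrow> \<Sum>n=1..m. if J n \<omega> < ereal s then g ((real_of_ereal (J n \<omega>), \<omega>), Z n \<omega>) else 0)
     \<longlonglongrightarrow> (case x of (s, \<omega>) \<Rightarrow> \<Sum>n=1..N T \<omega>. if J n \<omega> < ereal s then g ((real_of_ereal (J n \<omega>), \<omega>), Z n \<omega>) else 0)"
    unfolding x(1) prod.case by (intro tendsto_eventually eventually_sequentiallyI[of "N T \<omega>"])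
qed

lemma jump_value_measurable:
  fixes g :: "(real \<times> 'a) \<times> real \<Rightarrow> real"
  assumes g: "g \<in> borel_measurable (P \<Otimes>\<^sub>M borel)"
  shows "(\<lambda>\<omega>. \<Sum>n=1..N T \<omega>. g ((real_of_ereal (J n \<omega>), \<omega>), Z n \<omega>)) \<in> borel_measurable M"
proof -
  define f where "f n \<omega> = (if 0 \<le> real_of_ereal (J n \<omega>) \<and> real_of_ereal (J n \<omega>) \<le> T then g ((real_of_ereal (J n \<omega>), \<omega>), Z n \<omega>) else 0)" for n \<omega>
  have m: "f n \<in> borel_measurable M" if n: "1 \<le> n" for n
  proof -
    have "(\<lambda>\<omega>. ((if 0 \<le> real_of_ereal (J n \<omega>) \<and> real_of_ereal (J n \<omega>) \<le> T then real_of_ereal (J n \<omega>) else 0, \<omega>), Z n \<omega>)) \<in> measurable M (P \<Otimes>\<^sub>M borel)"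
    proof (rule measurable_Pair)
      have "(\<lambda>\<omega>. (real_of_ereal (J n \<omega>), \<omega>)) \<in> measurable M (borel \<Otimes>\<^sub>M M)"
        using J_measurable[OF n] by measurable
      from measurable_compose[OF this measurable_clamp]
      show "(\<lambda>\<omega>. (if 0 \<le> real_of_ereal (J n \<omega>) \<and> real_of_ereal (J n \<omega>) \<le> T then real_of_ereal (J n \<omega>) else 0, \<omega>)) \<in> measurable M P"
        by (simp only: fst_conv snd_conv)
    qed (rule Z_measurable[OF n])
    from measurable_compose[OF this g]
    have "(\<lambda>\<omega>. if 0 \<le> real_of_ereal (J n \<omega>) \<and> real_of_ereal (J n \<omega>) \<le> T then
        g ((if 0 \<le> real_of_ereal (J n \<omega>) \<and> real_of_ereal (J n \<omega>) \<le> T then real_of_ereal (J n \<omega>) else 0, \<omega>), Z n \<omega>) else 0) \<in> borel_measurable M"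
      by (rule measurable_If) (use J_measurable[OF n] in measurable)
    also have "(\<lambda>\<omega>. if 0 \<le> real_of_ereal (J n \<omega>) \<and> real_of_ereal (J n \<omega>) \<le> T then
        g ((if 0 \<le> real_of_ereal (J n \<omega>) \<and> real_of_ereal (J n \<omega>) \<le> T then real_of_ereal (J n \<omega>) else 0, \<omega>), Z n \<omega>) else 0) = f n"
      by (simp add: f_def fun_eq_iff)
    finally show ?thesis .
  qed
  have m': "(\<lambda>x. f n (snd x)) \<in> borel_measurable ((borel :: real measure) \<Otimes>\<^sub>M M)" if "1 \<le> n" for n
    by (rule measurable_compose[OF measurable_snd m[OF that]])
  have T_path: "(\<lambda>\<omega>. (T, \<omega>)) \<in> measurable M (borel \<Otimes>\<^sub>M M)" by simp
  have fm: "(\<lambda>\<omega>. \<Sum>n=1..N T \<omega>. f n \<omega>) \<in> borel_measurable M"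
    using measurable_compose[OF T_path measurable_jump_sum[OF J J_measurable m']] by (simp only: fst_conv snd_conv)
  have eq: "(\<Sum>n=1..N T \<omega>. g ((real_of_ereal (J n \<omega>), \<omega>), Z n \<omega>)) = (\<Sum>n=1..N T \<omega>. f n \<omega>)" if w: "\<omega> \<in> space M" for \<omega>
  proof (rule sum.cong)
    fix n assume "n \<in> {1..N T \<omega>}"
    then have n: "1 \<le> n" "n \<le> N T \<omega>" by auto
    have "J n \<omega> \<le> ereal T" using le_counting_iff[OF J w n(1)] n(2) by blast
    moreover have "0 < J n \<omega>" by (rule jump_times_pos[OF J w n(1)])
    ultimately have "0 \<le> real_of_ereal (J n \<omega>)" "real_of_ereal (J n \<omega>) \<le> T" by (cases "J n \<omega>"; simp)+
    then show "g ((real_of_ereal (J n \<omega>), \<omega>), Z n \<omega>) = f n \<omega>" by (simp add: f_def)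
  qed simp
  show ?thesis using fm by (rule measurable_cong[THEN iffD2, rotated]) (rule eq)
qed

end

section \<open>The candidate strategy\<close>

text \<open>The control is approximated from below by the running maximum, over an enumeration of
  the rationals, of the admissible values not above it, starting at \<open>a\<close>. Each
  approximation takes finitely many values, selected measurably, and continuity in the control
  passes to the limit, infinite values included.\<close>

lemma caratheodory_measurable:
  fixes h :: "'b \<Rightarrow> ereal \<Rightarrow> real" and v :: "'b \<Rightarrow> ereal"
  assumes ab: "a \<le> b" and h: "\<And>u. u \<in> {a..b} \<Longrightarrow> (\<lambda>x. h x u) \<in> borel_measurable L"
    and cont: "\<And>x. x \<in> space L \<Longrightarrow> continuous_on {a..b} (h x)"
    and v: "v \<in> borel_measurable L" and vab: "\<And>x. x \<in> space L \<Longrightarrow> v x \<in> {a..b}"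
  shows "(\<lambda>x. h x (v x)) \<in> borel_measurable L"
proof -
  define d where "d n = ereal (real_of_rat (from_nat n))" for n
  define A where "A w x n \<longleftrightarrow> d n \<in> {a..b} \<and> d n \<le> v x \<and> w < d n" for w x n
  define w where "w = rec_nat (\<lambda>x. a) (\<lambda>n w x. if A (w x) x n then d n else w x)"
  have w0: "w 0 x = a" and wSuc: "w (Suc n) x = (if A (w n x) x n then d n else w n x)" for n x
    by (simp_all add: w_def)
  have w_meas: "w n \<in> borel_measurable L" for n
  proof (induction n)
    case 0 then show ?case by (simp add: w_def)
  next
    case (Suc n)
    have "(\<lambda>x. if A (w n x) x n then d n else w n x) \<in> borel_measurable L"
      unfolding A_def using Suc v by measurable
    moreover have "w (Suc n) = (\<lambda>x. if A (w n x) x n then d n else w n x)"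
      by (simp add: wSuc fun_eq_iff)
    ultimately show ?case by simp
  qed
  have hw: "(\<lambda>x. h x (w n x)) \<in> borel_measurable L" for n
  proof (induction n)
    case 0 then show ?case using h[of a] ab by (simp add: w0)
  next
    case (Suc n)
    show ?case
    proof (cases "d n \<in> {a..b}")
      case True
      have "(\<lambda>x. if A (w n x) x n then h x (d n) else h x (w n x)) \<in> borel_measurable L"
        unfolding A_def using Suc w_meas[of n] v h[OF True] by measurable
      then show ?thesis by (simp add: wSuc if_distrib cong: if_cong)
    next
      case False
      then have "\<not> A (w n x) x n" for x by (auto simp: A_def)
      then show ?thesis using Suc by (simp add: wSuc)
    qed
  qed
  have w_in: "w n x \<in> {a..b} \<and> w n x \<le> v x" if "x \<in> space L" for n x
    using vab[OF that] ab by (induction n) (auto simp: w0 wSuc A_def)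
  have w_inc: "incseq (\<lambda>n. w n x)" for x
    by (rule incseq_SucI) (auto simp: wSuc A_def)
  have "(\<lambda>n. h x (w n x)) \<longlonglongrightarrow> h x (v x)" if x: "x \<in> space L" for x
  proof (rule continuous_on_tendsto_compose[OF cont[OF x] _ vab[OF x]])
    show "(\<lambda>n. w n x) \<longlonglongrightarrow> v x"
    proof (rule order_tendstoI)
      fix y assume y: "y < v x"
      show "\<forall>\<^sub>F n in sequentially. y < w n x"
      proof (cases "y < a")
        case True
        then show ?thesis using w_in[OF x] by (intro always_eventually) (auto intro: less_le_trans)
      next
        case False
        obtain l where l: "y < ereal l" "ereal l < v x" using ereal_dense2[OF y] by auto
        obtain r where r: "ereal l < ereal r" "ereal r < v x" using ereal_dense2[OF l(2)] by auto
        obtain q where q: "l < real_of_rat q" "real_of_rat q < r"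
          using of_rat_dense[of l r] r by auto
        define n where "n = to_nat q"
        have dn: "d n = ereal (real_of_rat q)" by (simp add: d_def n_def)
        have "ereal l < d n" "d n < ereal r" using q by (simp_all add: dn)
        then have "y < d n" "d n < v x" using l(1) r(2) by (auto intro: less_trans)
        moreover from this have "d n \<in> {a..b}" using False vab[OF x] by auto
        ultimately have "y < w (Suc n) x"
          by (cases "w n x < d n") (auto simp: wSuc A_def intro: less_le_trans)
        then have "y < w m x" if "Suc n \<le> m" for m
          using incseqD[OF w_inc that, of x] by (rule less_le_trans)
        then show ?thesis by (intro eventually_sequentiallyI[of "Suc n"])
      qed
    next
      fix y assume "v x < y"
      then show "\<forall>\<^sub>F n in sequentially. w n x < y"
        using w_in[OF x] by (intro always_eventually) (auto intro: le_less_trans)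
    qed
    show "\<forall>\<^sub>F n in sequentially. w n x \<in> {a..b}" using w_in[OF x] by auto
  qed
  then show ?thesis using hw by (rule borel_measurable_LIMSEQ_metric[rotated])
qed

section \<open>Market data and the first-order condition\<close>

locale market = contagion +
  assumes market: "reinsurance_market S"
begin

lemma uM_less_uN: "uM S < uN S" and eta_pos: "0 < eta S"
  using market by (simp_all add: reinsurance_market_def)

lemma Phi_measurable: "u \<in> UU S \<Longrightarrow> (\<lambda>z. Phi S z u) \<in> borel_measurable (restrict_space borel {0..})"
proof -
  have "\<forall>u\<in>UU S. (\<lambda>z. Phi S z u) \<in> borel_measurable (restrict_space borel {0..})"
    using market unfolding reinsurance_market_def by (elim conjE)
  then show "u \<in> UU S \<Longrightarrow> (\<lambda>z. Phi S z u) \<in> borel_measurable (restrict_space borel {0..})" by blast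
qed

lemma Phi_props:
  assumes "0 \<le> z"
  shows "continuous_on (UU S) (Phi S z)" "Phi S z (uN S) = z"
    "u \<in> UU S \<Longrightarrow> 0 \<le> Phi S z u" "u \<in> UU S \<Longrightarrow> Phi S z u \<le> z"
proof -
  have "\<forall>z\<ge>0. continuous_on (UU S) (Phi S z) \<and> Phi S z (uN S) = z \<and> 0 \<le> Phi S z (uM S) \<and>
      (\<forall>u\<in>UU S. Phi S z (uM S) \<le> Phi S z u \<and> Phi S z u \<le> Phi S z (uN S))"
    using market unfolding reinsurance_market_def by (elim conjE)
  then have *: "continuous_on (UU S) (Phi S z) \<and> Phi S z (uN S) = z \<and> 0 \<le> Phi S z (uM S) \<and>
      (\<forall>u\<in>UU S. Phi S z (uM S) \<le> Phi S z u \<and> Phi S z u \<le> Phi S z (uN S))" using assms by blast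
  then show "continuous_on (UU S) (Phi S z)" "Phi S z (uN S) = z" by auto
  show "0 \<le> Phi S z u" "Phi S z u \<le> z" if "u \<in> UU S"
    using * that by (auto intro: order_trans)
qed

lemma rprem_measurable: "u \<in> UU S \<Longrightarrow> (\<lambda>x. rprem S (fst x) (snd x) u) \<in> borel_measurable P"
proof -
  have "\<forall>u\<in>UU S. (\<lambda>(t, \<omega>). rprem S t \<omega> u) \<in> borel_measurable (predH S)"
    using market unfolding reinsurance_market_def by (elim conjE)
  then show "u \<in> UU S \<Longrightarrow> (\<lambda>x. rprem S (fst x) (snd x) u) \<in> borel_measurable P"
    by (simp add: case_prod_beta')
qed

lemma rprem_props:
  assumes "0 \<le> t" "t \<le> T" "\<omega> \<in> space M"
  shows "continuous_on (UU S) (rprem S t \<omega>)" "rprem S t \<omega> (uN S) = 0"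
    "u \<in> UU S \<Longrightarrow> 0 \<le> rprem S t \<omega> u" "u \<in> UU S \<Longrightarrow> rprem S t \<omega> u \<le> rprem S t \<omega> (uM S)"
proof -
  have "\<forall>t\<in>{0..T}. \<forall>\<omega>\<in>space M.
        continuous_on (UU S) (rprem S t \<omega>) \<and>
        (\<forall>u\<in>UU S. \<exists>D. has_deriv_in (UU S) (rprem S t \<omega>) D u) \<and>
        continuous_on (UU S) (deriv_in (UU S) (rprem S t \<omega>)) \<and>
        rprem S t \<omega> (uN S) = 0 \<and>
        (\<forall>u\<in>UU S. 0 \<le> rprem S t \<omega> u \<and> rprem S t \<omega> u \<le> rprem S t \<omega> (uM S))"
    using market unfolding reinsurance_market_def by (elim conjE)
  then have *: "continuous_on (UU S) (rprem S t \<omega>)" "rprem S t \<omega> (uN S) = 0"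
      "\<forall>u\<in>UU S. 0 \<le> rprem S t \<omega> u \<and> rprem S t \<omega> u \<le> rprem S t \<omega> (uM S)" using assms by auto
  then show "continuous_on (UU S) (rprem S t \<omega>)" "rprem S t \<omega> (uN S) = 0"
    "u \<in> UU S \<Longrightarrow> 0 \<le> rprem S t \<omega> u" "u \<in> UU S \<Longrightarrow> rprem S t \<omega> u \<le> rprem S t \<omega> (uM S)" by auto
qed

lemma rprem_finite: "(\<integral>\<^sup>+\<omega>. (\<integral>\<^sup>+t\<in>{0..T}. ennreal (rprem S t \<omega> (uM S)) \<partial>lborel) \<partial>M) < \<infinity>"
  using market unfolding reinsurance_market_def by (elim conjE)

lemma prem_measurable: "(\<lambda>x. prem S (fst x) (snd x)) \<in> borel_measurable P"
proof -
  have "(\<lambda>(t, \<omega>). prem S t \<omega>) \<in> borel_measurable (predH S)"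
    using market unfolding reinsurance_market_def by (elim conjE)
  then show ?thesis by (simp add: case_prod_beta')
qed

lemma prem_finite: "(\<integral>\<^sup>+\<omega>. (\<integral>\<^sup>+t\<in>{0..T}. ennreal \<bar>prem S t \<omega>\<bar> \<partial>lborel) \<partial>M) < \<infinity>"
  using market unfolding reinsurance_market_def by (elim conjE)

lemma discount_pos: "0 < discount S t"
  using eta_pos by (simp add: discount_def)

lemma discount_measurable [measurable]: "discount S \<in> borel_measurable borel"
  unfolding discount_def by measurable

lemma uM_in: "uM S \<in> UU S" and uN_in: "uN S \<in> UU S"
  using uM_less_uN by auto

text \<open>The derivative of \<open>f_tilde\<close> in the control is a positive multiple of the defect in the
  first-order condition.\<close>

definition slope :: "'a point \<Rightarrow> ereal \<Rightarrow> real" where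
  "slope m u = (case m of (t, \<omega>, w, \<theta>) \<Rightarrow>
     discount S t * (- w * deriv_in (UU S) (rprem S t \<omega>) u - marginal_retention S (t, \<omega>, w, \<theta>) u))"

lemma slope_has_deriv:
  "differentiable_under_integral S m \<Longrightarrow> u \<in> UU S \<Longrightarrow> has_deriv_in (UU S) (f_tilde S m) (slope m u) u"
  by (cases m) (simp add: slope_def algebra_simps)

lemma first_order_iff: "first_order_condition S m u \<longleftrightarrow> slope m u = 0"
  using discount_pos by (cases m) (auto simp: slope_def less_imp_neq[symmetric])

lemma concave_control_point:
  assumes "strictly_concave_in (UU S) (f_tilde S m)" "differentiable_under_integral S m"
  shows "concave_control (uM S) (uN S) (f_tilde S m) (slope m)"
  using assms uM_less_uN slope_has_deriv by unfold_locales auto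

lemma deriv_in_slope:
  "differentiable_under_integral S m \<Longrightarrow> u \<in> UU S \<Longrightarrow> deriv_in (UU S) (f_tilde S m) u = slope m u"
  by (rule deriv_in_eqI[OF uM_less_uN _ slope_has_deriv])

lemma u_hat_eq_maximizer:
  assumes m: "m \<in> MM S" and conc: "strictly_concave_in (UU S) (f_tilde S m)"
    and diff: "differentiable_under_integral S m"
  shows "u_hat S m = concave_control.maximizer (uM S) (uN S) (slope m)"
proof -
  interpret concave_control "uM S" "uN S" "f_tilde S m" "slope m"
    by (rule concave_control_point[OF conc diff])
  show ?thesis
    using m by (simp add: u_hat_def maximizer_def R0_def R1_def u_bar_def
        deriv_in_slope[OF diff uM_in] deriv_in_slope[OF diff uN_in] first_order_iff)
qed

text \<open>Outside the two regions the slope is nonnegative at \<open>uM\<close> and nonpositive at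
  \<open>uN\<close>, the sign pattern that forces exactly one zero; it leaves the endpoints when the
  slope there is not 0.\<close>

lemma first_order_solution:
  assumes m: "m \<in> MM S - (R0 S \<union> R1 S)" and conc: "strictly_concave_in (UU S) (f_tilde S m)"
    and diff: "differentiable_under_integral S m"
  shows "(\<exists>!u. u \<in> UU S \<and> first_order_condition S m u) \<and>
    u_bar S m \<in> UU S \<and> first_order_condition S m (u_bar S m) \<and>
    (deriv_in (UU S) (f_tilde S m) (uM S) \<noteq> 0 \<and> deriv_in (UU S) (f_tilde S m) (uN S) \<noteq> 0 \<longrightarrow>
      uM S < u_bar S m \<and> u_bar S m < uN S)"
proof -
  interpret concave_control "uM S" "uN S" "f_tilde S m" "slope m"
    by (rule concave_control_point[OF conc diff])
  note d = deriv_in_slope[OF diff uM_in] deriv_in_slope[OF diff uN_in]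
  have "0 \<le> slope m (uM S)" "slope m (uN S) \<le> 0"
    using m by (auto simp: R0_def R1_def d not_less)
  from ex1_deriv_zero[OF this]
  have ex: "\<exists>!u. u \<in> UU S \<and> first_order_condition S m u" unfolding first_order_iff .
  from theI'[OF ex] have ub: "u_bar S m \<in> UU S" "first_order_condition S m (u_bar S m)"
    unfolding u_bar_def by blast+
  moreover have "uM S < u_bar S m \<and> u_bar S m < uN S"
    if "deriv_in (UU S) (f_tilde S m) (uM S) \<noteq> 0" "deriv_in (UU S) (f_tilde S m) (uN S) \<noteq> 0"
  proof -
    have "u_bar S m \<noteq> uM S" "u_bar S m \<noteq> uN S"
      using that ub(2) unfolding first_order_iff d by auto
    then show ?thesis using ub(1) by auto
  qed
  ultimately show ?thesis using ex by blast
qed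

lemma measurable_pos_part_pair:
  "(\<lambda>x. (fst x, max 0 (snd x :: real))) \<in> measurable (L \<Otimes>\<^sub>M borel) (L \<Otimes>\<^sub>M restrict_space borel {0..})"
  by (intro measurable_Pair measurable_restrict_space2) auto

lemma Phi_control_measurable:
  assumes u: "u \<in> borel_measurable L" and uU: "\<And>x. x \<in> space L \<Longrightarrow> u x \<in> UU S"
  shows "(\<lambda>x. Phi S (max 0 (snd x)) (u (fst x))) \<in> borel_measurable (L \<Otimes>\<^sub>M borel)"
proof (rule caratheodory_measurable[OF less_imp_le[OF uM_less_uN]])
  fix v assume v: "v \<in> UU S"
  have "(\<lambda>x. max 0 (snd x)) \<in> measurable (L \<Otimes>\<^sub>M borel) (restrict_space borel {0::real..})"
    by (intro measurable_restrict_space2) auto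
  from measurable_compose[OF this Phi_measurable[OF v]]
  show "(\<lambda>x. Phi S (max 0 (snd x)) v) \<in> borel_measurable (L \<Otimes>\<^sub>M borel)" .
qed (use u uU Phi_props in \<open>auto simp: space_pair_measure\<close>)

lemma rprem_control_measurable:
  assumes u: "(\<lambda>x. u (fst x) (snd x)) \<in> borel_measurable P" and uU: "\<And>t \<omega>. 0 \<le> t \<Longrightarrow> t \<le> T \<Longrightarrow> \<omega> \<in> space M \<Longrightarrow> u t \<omega> \<in> UU S"
  shows "(\<lambda>x. rprem S (fst x) (snd x) (u (fst x) (snd x))) \<in> borel_measurable P"
  by (rule caratheodory_measurable[OF less_imp_le[OF uM_less_uN] rprem_measurable _ u])
    (use uU rprem_props in \<open>auto simp: space_P\<close>)

end

section \<open>The candidate along the BSDE solution and its predictability\<close>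

locale control_problem = market +
  fixes W :: "real \<Rightarrow> 'a \<Rightarrow> real" and \<Theta> :: "real \<Rightarrow> 'a \<Rightarrow> real \<Rightarrow> real"
  assumes W_value: "value_process S W" and bsde: "bsde_solution S W \<Theta>"
    and concave: "\<And>t \<omega>. t \<in> {0..T} \<Longrightarrow> \<omega> \<in> space M \<Longrightarrow> strictly_concave_in (UU S) (f_tilde S (point_at W \<Theta> t \<omega>))"
    and diff: "\<And>t \<omega>. t \<in> {0..T} \<Longrightarrow> \<omega> \<in> space M \<Longrightarrow> differentiable_under_integral S (point_at W \<Theta> t \<omega>)"
begin

lemma W_nonneg: "0 \<le> t \<Longrightarrow> t \<le> T \<Longrightarrow> \<omega> \<in> space M \<Longrightarrow> 0 \<le> W t \<omega>"
  using W_value by (simp add: value_process_def)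

lemma W_L2: "W \<in> L2_space S" and \<Theta>_L2: "\<Theta> \<in> L2_hat S"
  using bsde by (simp_all add: bsde_solution_def)

lemma W_cadlag: "\<omega> \<in> space M \<Longrightarrow> cadlag_on T (\<lambda>t. W t \<omega>)"
  and W_adapted: "0 \<le> t \<Longrightarrow> t \<le> T \<Longrightarrow> W t \<in> borel_measurable (HH S t)"
  using W_L2 by (auto simp: L2_space_def)

definition Wm :: "real \<Rightarrow> 'a \<Rightarrow> real" where
  "Wm t \<omega> = left_lim (\<lambda>s. W s \<omega>) t"

abbreviation "\<pi> \<equiv> filt_left S"

lemma Wm_predictable [measurable]: "(\<lambda>x. Wm (fst x) (snd x)) \<in> borel_measurable P"
  using left_lim_predictable[of W, OF W_cadlag W_adapted] by (simp add: Wm_def case_prod_beta')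

lemma \<pi>_predictable [measurable]: "(\<lambda>x. \<pi> (fst x) (snd x)) \<in> borel_measurable P"
  using filt_left_predictable by (simp add: case_prod_beta')

lemma Wm_nonneg: "0 \<le> t \<Longrightarrow> t \<le> T \<Longrightarrow> \<omega> \<in> space M \<Longrightarrow> 0 \<le> Wm t \<omega>"
  unfolding Wm_def by (rule left_lim_lower[OF W_cadlag]) (auto intro: W_nonneg)

lemma \<Theta>_measurable: "(\<lambda>((t, \<omega>), z). \<Theta> t \<omega> z) \<in> borel_measurable (P \<Otimes>\<^sub>M restrict_space borel {0..})"
  using \<Theta>_L2 by (simp add: L2_hat_def)

lemma \<Theta>_predictable: "(\<lambda>x. \<Theta> (fst (fst x)) (snd (fst x)) (max 0 (snd x))) \<in> borel_measurable (P \<Otimes>\<^sub>M borel)"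
  using measurable_compose[OF measurable_pos_part_pair \<Theta>_measurable] by (simp add: case_prod_beta')

lemma \<Theta>_section:
  assumes "0 \<le> t" "t \<le> T" "\<omega> \<in> space M"
  shows "(\<lambda>z. \<Theta> t \<omega> z) \<in> borel_measurable (restrict_space borel {0..})"
proof -
  have "(\<lambda>z. ((t, \<omega>), z)) \<in> measurable (restrict_space borel {0..}) (P \<Otimes>\<^sub>M restrict_space borel {0..})"
    using assms by (intro measurable_Pair1') (simp add: space_P)
  from measurable_compose[OF this \<Theta>_measurable] show ?thesis by simp
qed

lemma point_in_MM: "0 \<le> t \<Longrightarrow> t \<le> T \<Longrightarrow> \<omega> \<in> space M \<Longrightarrow> point_at W \<Theta> t \<omega> \<in> MM S"
  using Wm_nonneg[of t \<omega>] \<Theta>_section[of t \<omega>] by (simp add: point_at_def MM_def Wm_def)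

definition us :: "real \<Rightarrow> 'a \<Rightarrow> ereal" where
  "us t \<omega> = u_hat S (point_at W \<Theta> t \<omega>)"

abbreviation ff :: "real \<Rightarrow> 'a \<Rightarrow> ereal \<Rightarrow> real" where
  "ff t \<omega> u \<equiv> f_tilde S (point_at W \<Theta> t \<omega>) u"

lemma control_point:
  assumes "0 \<le> t" "t \<le> T" "\<omega> \<in> space M"
  shows "concave_control (uM S) (uN S) (ff t \<omega>) (slope (point_at W \<Theta> t \<omega>))"
    and "us t \<omega> = concave_control.maximizer (uM S) (uN S) (slope (point_at W \<Theta> t \<omega>))"
  using assms concave[of t \<omega>] diff[of t \<omega>] unfolding us_def
  by (auto intro!: concave_control_point u_hat_eq_maximizer point_in_MM)

lemma us_in: "0 \<le> t \<Longrightarrow> t \<le> T \<Longrightarrow> \<omega> \<in> space M \<Longrightarrow> us t \<omega> \<in> UU S"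
  using concave_control.maximizer_in[OF control_point(1)] control_point(2) by simp

text \<open>\<open>\<Theta>\<close> and \<open>Phi\<close> are measurable in the mark on nonnegative
  reals only. Truncating the mark under the indicator of positive marks gives an integrand
  measurable on the whole line.\<close>

lemma ff_eq: "ff t \<omega> u = - Wm t \<omega> * discount S t * rprem S t \<omega> u
     - (LINT z|F1 S. indicator {0<..} z * ((Wm t \<omega> + \<Theta> t \<omega> (max 0 z)) * (exp (- discount S t * (z - Phi S (max 0 z) u)) - 1) * \<pi> t \<omega>))"
  unfolding point_at_def f_tilde.simps Wm_def set_lebesgue_integral_def
  by (intro arg_cong2[where f="(-)"] Bochner_Integration.integral_cong) (auto simp: indicator_def max_def)

lemma fst_fst_P [measurable]: "(\<lambda>x. fst (fst x)) \<in> borel_measurable (P \<Otimes>\<^sub>M L)"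
  using measurable_compose[OF measurable_fst measurable_fst_P] .

lemma lift_fst: "(\<lambda>x. f (fst x) (snd x)) \<in> borel_measurable P \<Longrightarrow> (\<lambda>x. f (fst (fst x)) (snd (fst x))) \<in> borel_measurable (P \<Otimes>\<^sub>M L)"
  using measurable_compose[OF measurable_fst] by fastforce

lemma ff_control_measurable:
  assumes u: "(\<lambda>x. u (fst x) (snd x)) \<in> borel_measurable P" and uU: "\<And>t \<omega>. 0 \<le> t \<Longrightarrow> t \<le> T \<Longrightarrow> \<omega> \<in> space M \<Longrightarrow> u t \<omega> \<in> UU S"
  shows "(\<lambda>x. ff (fst x) (snd x) (u (fst x) (snd x))) \<in> borel_measurable P"
proof -
  interpret F1: prob_space "F1 S" by (rule F1_prob)
  have d: "(\<lambda>x. discount S (fst x)) \<in> borel_measurable P"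
    by (rule measurable_compose[OF measurable_fst_P discount_measurable])
  have d': "(\<lambda>x. discount S (fst (fst x))) \<in> borel_measurable (P \<Otimes>\<^sub>M borel)"
    by (rule measurable_compose[OF fst_fst_P discount_measurable])
  have Ph: "(\<lambda>x. Phi S (max 0 (snd x)) (u (fst (fst x)) (snd (fst x)))) \<in> borel_measurable (P \<Otimes>\<^sub>M borel)"
    using Phi_control_measurable[OF u] uU by (auto simp: space_P)
  have "(\<lambda>x. indicator {0<..} (snd x) * ((Wm (fst (fst x)) (snd (fst x)) + \<Theta> (fst (fst x)) (snd (fst x)) (max 0 (snd x)))
      * (exp (- discount S (fst (fst x)) * (snd x - Phi S (max 0 (snd x)) (u (fst (fst x)) (snd (fst x))))) - 1)
      * \<pi> (fst (fst x)) (snd (fst x)))) \<in> borel_measurable (P \<Otimes>\<^sub>M borel)"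
    by (intro borel_measurable_times borel_measurable_add borel_measurable_diff borel_measurable_uminus
        measurable_compose[OF _ borel_measurable_exp] lift_fst[of Wm, OF Wm_predictable] lift_fst[of \<pi>, OF \<pi>_predictable]
        \<Theta>_predictable d' Ph) auto
  then have "(\<lambda>x. LINT z|F1 S. indicator {0<..} z * ((Wm (fst x) (snd x) + \<Theta> (fst x) (snd x) (max 0 z))
      * (exp (- discount S (fst x) * (z - Phi S (max 0 z) (u (fst x) (snd x)))) - 1) * \<pi> (fst x) (snd x))) \<in> borel_measurable P"
    by (intro F1.borel_measurable_lebesgue_integral) (simp add: case_prod_beta' cong: measurable_cong_sets)
  then show ?thesis
    unfolding ff_eq
    by (intro borel_measurable_diff borel_measurable_times borel_measurable_uminus Wm_predictable d
        rprem_control_measurable u uU)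
qed

text \<open>The formula for \<open>slope\<close> contains the derivative of \<open>Phi\<close> under
  an integral, whose measurability would need its own proof. The slope is instead the limit of right
  difference quotients of \<open>ff\<close> at constant controls; \<open>x < uN S\<close> leaves
  room for them up to \<open>y\<close>.\<close>

lemma slope_measurable:
  assumes x: "uM S \<le> ereal x" "ereal x < uN S"
  shows "(\<lambda>p. slope (point_at W \<Theta> (fst p) (snd p)) (ereal x)) \<in> borel_measurable P"
proof -
  obtain y where y: "x < y" "ereal y < uN S" using ereal_dense2[OF x(2)] by auto
  define h where "h n = (y - x) * inverse (real (Suc n))" for n
  have h: "0 < h n" "x + h n \<le> y" for n
  proof -
    have "inverse (real (Suc n)) \<le> 1" by (simp add: field_simps)
    then have "h n \<le> y - x" using y unfolding h_def by (intro mult_left_le) auto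
    then show "x + h n \<le> y" by linarith
  qed (use y in \<open>simp add: h_def\<close>)
  have in_U: "ereal (x + h n) \<in> UU S" for n
  proof -
    have "ereal x \<le> ereal (x + h n)" using h[of n] by simp
    moreover have "ereal (x + h n) \<le> ereal y" using h[of n] by simp
    ultimately show ?thesis
      using order_trans[OF x(1)] order_trans[OF _ less_imp_le[OF y(2)]] by (simp only: atLeastAtMost_iff)
  qed
  have x_in: "ereal x \<in> UU S" using x by auto
  show ?thesis
  proof (rule borel_measurable_LIMSEQ_metric)
    fix n
    show "(\<lambda>p. (ff (fst p) (snd p) (ereal (x + h n)) - ff (fst p) (snd p) (ereal x)) / h n) \<in> borel_measurable P"
      by (intro borel_measurable_divide borel_measurable_diff ff_control_measurable borel_measurable_const in_U x_in)
  next
    fix p assume "p \<in> space P"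
    then have p: "0 \<le> fst p" "fst p \<le> T" "snd p \<in> space M" by (auto simp: space_P)
    interpret concave_control "uM S" "uN S" "ff (fst p) (snd p)" "slope (point_at W \<Theta> (fst p) (snd p))"
      by (rule control_point(1)[OF p])
    have "((\<lambda>q. (ff (fst p) (snd p) (ereal q) - ff (fst p) (snd p) (ereal x)) / (q - x))
        \<longlongrightarrow> slope (point_at W \<Theta> (fst p) (snd p)) (ereal x)) (at x within {x..y})"
      using derivI_Icc[of x y x] x y by (simp add: has_field_derivative_iff)
    moreover have "filterlim (\<lambda>n. x + h n) (at x within {x..y}) sequentially"
      unfolding filterlim_at
    proof
      show "\<forall>\<^sub>F n in sequentially. x + h n \<in> {x..y} \<and> x + h n \<noteq> x"
        using h by (intro always_eventually allI) (auto simp: less_imp_le less_imp_neq[symmetric])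
      have "(\<lambda>n. x + (y - x) * inverse (real (Suc n))) \<longlonglongrightarrow> x + (y - x) * 0"
        by (intro tendsto_intros LIMSEQ_inverse_real_of_nat)
      then show "(\<lambda>n. x + h n) \<longlonglongrightarrow> x" by (simp add: h_def)
    qed
    ultimately have "(\<lambda>n. (ff (fst p) (snd p) (ereal (x + h n)) - ff (fst p) (snd p) (ereal x)) / (x + h n - x))
        \<longlonglongrightarrow> slope (point_at W \<Theta> (fst p) (snd p)) (ereal x)"
      by (rule filterlim_compose)
    then show "(\<lambda>n. (ff (fst p) (snd p) (ereal (x + h n)) - ff (fst p) (snd p) (ereal x)) / h n)
        \<longlonglongrightarrow> slope (point_at W \<Theta> (fst p) (snd p)) (ereal x)" by simp
  qed
qed

lemma us_predictable: "(\<lambda>x. us (fst x) (snd x)) \<in> borel_measurable P"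
proof (rule borel_measurableI_greater)
  fix y :: ereal
  have real_case: "{p\<in>space P. ereal x < us (fst p) (snd p)} \<in> sets P" if x: "uM S \<le> ereal x" "ereal x < uN S" for x
  proof -
    have "{p\<in>space P. ereal x < us (fst p) (snd p)} = {p\<in>space P. 0 < slope (point_at W \<Theta> (fst p) (snd p)) (ereal x)}"
      using concave_control.less_maximizer_iff[OF control_point(1) x] control_point(2) by (auto simp: space_P)
    then show ?thesis using slope_measurable[OF x] by simp
  qed
  show "{p\<in>space P. y < us (fst p) (snd p)} \<in> sets P"
  proof (cases "y < uM S")
    case True
    then have "{p\<in>space P. y < us (fst p) (snd p)} = space P" using us_in by (fastforce simp: space_P intro: less_le_trans)
    then show ?thesis by simp
  next
    case ge: False
    show ?thesis
    proof (cases "uN S \<le> y")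
      case True
      then have "\<not> y < us (fst p) (snd p)" if "p \<in> space P" for p
        using us_in[of "fst p" "snd p"] that by (auto simp: space_P not_less intro: order_trans)
      then have "{p\<in>space P. y < us (fst p) (snd p)} = {}" by auto
      then show ?thesis by (simp only: sets.empty_sets)
    next
      case False
      show ?thesis
      proof (cases y)
        case (real x) then show ?thesis using real_case[of x] ge False by auto
      next
        case MInf
        \<comment> \<open>The test by the slope is available at real levels only; at
          \<open>-\<infinity>\<close> the event is the union over rational levels below
          \<open>uN S\<close>.\<close>
        have "{p\<in>space P. y < us (fst p) (snd p)} =
          (\<Union>x\<in>{x\<in>\<rat>. ereal x < uN S}. {p\<in>space P. ereal x < us (fst p) (snd p)})"
        proof (intro set_eqI iffI)
          fix p assume p: "p \<in> {p\<in>space P. y < us (fst p) (snd p)}"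
          obtain l where l: "y < ereal l" "ereal l < us (fst p) (snd p)" using ereal_dense2 p by blast
          obtain q where q: "q \<in> \<rat>" "q < l" using Rats_dense_in_real[of "l - 1" l] by auto
          have "ereal q < us (fst p) (snd p)" using l q by (metis less_ereal.simps(1) less_trans)
          moreover from this have "ereal q < uN S" using us_in[of "fst p" "snd p"] p by (auto simp: space_P intro: less_le_trans)
          ultimately show "p \<in> (\<Union>x\<in>{x\<in>\<rat>. ereal x < uN S}. {p\<in>space P. ereal x < us (fst p) (snd p)})"
            using p q by auto
        next
          fix p assume "p \<in> (\<Union>x\<in>{x\<in>\<rat>. ereal x < uN S}. {p\<in>space P. ereal x < us (fst p) (snd p)})"
          then show "p \<in> {p\<in>space P. y < us (fst p) (snd p)}" using MInf by (auto intro: less_trans[of "-\<infinity>"])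
        qed
        moreover have "countable {x\<in>\<rat>. ereal x < uN S}" by (rule countable_subset[OF _ countable_rat]) auto
        moreover have "uM S = -\<infinity>" using ge MInf by (auto simp: not_less)
        ultimately show ?thesis using real_case by auto
      qed (use False in auto)
    qed
  qed
qed

text \<open>Retention never exceeds the claim, so on positive marks the exponential minus 1 lies in
  \<open>[-1,0]\<close> and the function in the hypothesis dominates. Differentiability gives
  continuity at real controls; infinite endpoints need this argument.\<close>

lemma ff_continuous:
  assumes t: "0 \<le> t" "t \<le> T" "\<omega> \<in> space M"
    and int: "integrable (F1 S) (\<lambda>z. indicator {0<..} z * ((Wm t \<omega> + \<Theta> t \<omega> (max 0 z)) * \<pi> t \<omega>))"
  shows "continuous_on (UU S) (ff t \<omega>)"
proof -
  let ?g = "\<lambda>u z. indicator {0<..} z * ((Wm t \<omega> + \<Theta> t \<omega> (max 0 z)) * (exp (- discount S t * (z - Phi S (max 0 z) u)) - 1) * \<pi> t \<omega>)"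
  have \<Theta>m: "(\<lambda>z. \<Theta> t \<omega> (max 0 z)) \<in> borel_measurable borel"
  proof -
    have "(\<lambda>z. max 0 z) \<in> measurable borel (restrict_space borel {0::real..})"
      by (intro measurable_restrict_space2) auto
    from measurable_compose[OF this \<Theta>_section[OF t]] show ?thesis .
  qed
  have Pm: "(\<lambda>z. Phi S (max 0 z) u) \<in> borel_measurable borel" if "u \<in> UU S" for u
  proof -
    have "(\<lambda>z. max 0 z) \<in> measurable borel (restrict_space borel {0::real..})"
      by (intro measurable_restrict_space2) auto
    from measurable_compose[OF this Phi_measurable[OF that]] show ?thesis .
  qed
  have gm: "?g u \<in> borel_measurable (F1 S)" if "u \<in> UU S" for u
    using \<Theta>m Pm[OF that] by (simp cong: measurable_cong_sets)
  have "continuous_on (UU S) (\<lambda>u. LINT z|F1 S. ?g u z)"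
  proof (rule continuous_on_sequentiallyI)
    fix v u assume v: "\<forall>n. v n \<in> UU S" and u: "u \<in> UU S" and lim: "v \<longlonglongrightarrow> u"
    show "(\<lambda>n. LINT z|F1 S. ?g (v n) z) \<longlonglongrightarrow> (LINT z|F1 S. ?g u z)"
    proof (rule integral_dominated_convergence)
      show "integrable (F1 S) (\<lambda>z. \<bar>indicator {0<..} z * ((Wm t \<omega> + \<Theta> t \<omega> (max 0 z)) * \<pi> t \<omega>)\<bar>)"
        using int by simp
      show "AE z in F1 S. (\<lambda>n. ?g (v n) z) \<longlonglongrightarrow> ?g u z"
      proof (intro AE_I2 tendsto_intros)
        fix z
        show "(\<lambda>n. Phi S (max 0 z) (v n)) \<longlonglongrightarrow> Phi S (max 0 z) u"
          using v by (intro continuous_on_tendsto_compose[OF Phi_props(1) lim u]) auto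
      qed
      fix n
      show "AE z in F1 S. norm (?g (v n) z) \<le> \<bar>indicator {0<..} z * ((Wm t \<omega> + \<Theta> t \<omega> (max 0 z)) * \<pi> t \<omega>)\<bar>"
      proof (intro AE_I2)
        fix z
        show "norm (?g (v n) z) \<le> \<bar>indicator {0<..} z * ((Wm t \<omega> + \<Theta> t \<omega> (max 0 z)) * \<pi> t \<omega>)\<bar>"
        proof (cases "0 < z")
          case True
          have "0 \<le> discount S t * (z - Phi S z (v n))"
            using Phi_props(4)[of z "v n"] True v discount_pos[of t] by (intro mult_nonneg_nonneg) auto
          then have "exp (- discount S t * (z - Phi S z (v n))) \<le> 1" by simp
          then have "\<bar>exp (- discount S t * (z - Phi S z (v n))) - 1\<bar> \<le> 1"
            using exp_gt_zero[of "- discount S t * (z - Phi S z (v n))"] by linarith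
          then have "\<bar>(Wm t \<omega> + \<Theta> t \<omega> z) * \<pi> t \<omega>\<bar> * \<bar>exp (- discount S t * (z - Phi S z (v n))) - 1\<bar>
              \<le> \<bar>(Wm t \<omega> + \<Theta> t \<omega> z) * \<pi> t \<omega>\<bar> * 1" by (intro mult_left_mono) auto
          then show ?thesis using True by (simp add: abs_mult mult_ac)
        qed simp
      qed
    qed (use gm v u in auto)
  qed
  then show ?thesis
    unfolding ff_eq[abs_def] by (intro continuous_intros rprem_props(1)[OF t]) 
qed

lemma us_max:
  assumes "0 \<le> t" "t \<le> T" "\<omega> \<in> space M" "u \<in> UU S"
    and "integrable (F1 S) (\<lambda>z. indicator {0<..} z * ((Wm t \<omega> + \<Theta> t \<omega> (max 0 z)) * \<pi> t \<omega>))"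
  shows "ff t \<omega> u \<le> ff t \<omega> (us t \<omega>)"
  using concave_control.maximizer_max[OF control_point(1) ff_continuous] control_point(2) assms by simp

end

section \<open>The damped density process\<close>

lemma set_integrable_nonnegI:
  fixes f :: "real \<Rightarrow> real"
  assumes m: "(\<lambda>t. indicator A t *\<^sub>R f t) \<in> borel_measurable lborel"
    and nn: "\<And>t. t \<in> A \<Longrightarrow> 0 \<le> f t" and fin: "(\<integral>\<^sup>+t\<in>A. ennreal (f t) \<partial>lborel) < \<infinity>"
  shows "set_integrable lborel A f"
  unfolding set_integrable_def
proof (rule integrableI_nonneg[OF m])
  have "(\<integral>\<^sup>+t. ennreal (indicator A t *\<^sub>R f t) \<partial>lborel) = (\<integral>\<^sup>+t\<in>A. ennreal (f t) \<partial>lborel)"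
    by (intro nn_integral_cong) (auto simp: indicator_def)
  then show "(\<integral>\<^sup>+t. ennreal (indicator A t *\<^sub>R f t) \<partial>lborel) < \<infinity>" using fin by simp
qed (use nn in \<open>auto simp: indicator_def\<close>)

lemma nn_set_integral_eq:
  fixes f :: "real \<Rightarrow> real"
  assumes f: "set_integrable lborel A f" and nn: "\<And>t. t \<in> A \<Longrightarrow> 0 \<le> f t"
  shows "(\<integral>\<^sup>+t\<in>A. ennreal (f t) \<partial>lborel) = ennreal (LBINT t:A. f t)"
proof -
  have "(\<integral>\<^sup>+t\<in>A. ennreal (f t) \<partial>lborel) = (\<integral>\<^sup>+t. ennreal (indicator A t *\<^sub>R f t) \<partial>lborel)"
    by (intro nn_integral_cong) (auto simp: indicator_def)
  also have "\<dots> = ennreal (LBINT t:A. f t)"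
    unfolding set_lebesgue_integral_def
    by (rule nn_integral_eq_integral[OF f[unfolded set_integrable_def]]) (use nn in \<open>auto simp: indicator_def\<close>)
  finally show ?thesis .
qed

text \<open>The integrals defining \<open>Cq\<close> and \<open>AA\<close> run over
  \<open>r < s\<close>, the form in which they were shown to be predictable; the missing endpoint is
  a null set.\<close>

lemma time_integral_eq:
  fixes f :: "real \<Rightarrow> real"
  assumes f: "set_integrable lborel {0..T} f" and nn: "\<And>t. 0 \<le> t \<Longrightarrow> t \<le> T \<Longrightarrow> 0 \<le> f t" and s: "s \<le> T"
  shows "(\<integral>\<^sup>+r. (if 0 \<le> r \<and> r < s then ennreal (f r) else 0) \<partial>lborel) = ennreal (LBINT r:{0..s}. f r)"
proof -
  have "(\<integral>\<^sup>+r. (if 0 \<le> r \<and> r < s then ennreal (f r) else 0) \<partial>lborel) = (\<integral>\<^sup>+r\<in>{0..s}. ennreal (f r) \<partial>lborel)"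
  proof (rule nn_integral_cong_AE)
    have "AE r in lborel. r \<noteq> s" by (rule AE_lborel_singleton)
    then show "AE r in lborel. (if 0 \<le> r \<and> r < s then ennreal (f r) else 0) = ennreal (f r) * indicator {0..s} r"
      by eventually_elim (auto simp: indicator_def)
  qed
  also have "\<dots> = ennreal (LBINT r:{0..s}. f r)"
    by (rule nn_set_integral_eq) (use s nn in \<open>auto intro: set_integrable_subset[OF f]\<close>)
  finally show ?thesis .
qed

lemma set_integrable_bounded_mult:
  fixes f g :: "real \<Rightarrow> real"
  assumes f: "set_integrable lborel A f" and g: "(\<lambda>t. indicator A t *\<^sub>R g t) \<in> borel_measurable lborel"
    and B: "\<And>t. t \<in> A \<Longrightarrow> \<bar>g t\<bar> \<le> B"
  shows "set_integrable lborel A (\<lambda>t. g t * f t)"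
  unfolding set_integrable_def
proof (rule Bochner_Integration.integrable_bound)
  show "integrable lborel (\<lambda>t. \<bar>B\<bar> * (indicator A t *\<^sub>R f t))" using f by (simp add: set_integrable_def)
  have eq: "(\<lambda>t. indicator A t *\<^sub>R (g t * f t)) = (\<lambda>t. (indicator A t *\<^sub>R g t) * (indicator A t *\<^sub>R f t))"
    by (auto simp: indicator_def)
  show "(\<lambda>t. indicator A t *\<^sub>R (g t * f t)) \<in> borel_measurable lborel"
    unfolding eq by (intro borel_measurable_times g borel_measurable_integrable[OF f[unfolded set_integrable_def]])
  show "AE t in lborel. norm (indicator A t *\<^sub>R (g t * f t)) \<le> norm (\<bar>B\<bar> * (indicator A t *\<^sub>R f t))"
  proof (intro AE_I2)
    fix t
    have "\<bar>g t\<bar> * \<bar>f t\<bar> \<le> \<bar>B\<bar> * \<bar>f t\<bar>" if "t \<in> A"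
      using B[OF that] by (intro mult_right_mono) auto
    then show "norm (indicator A t *\<^sub>R (g t * f t)) \<le> norm (\<bar>B\<bar> * (indicator A t *\<^sub>R f t))"
      by (cases "t \<in> A") (simp_all add: abs_mult)
  qed
qed

lemma set_integrable_AE_bound:
  fixes f g :: "real \<Rightarrow> real"
  assumes f: "set_integrable lborel A f" and g: "(\<lambda>t. indicator A t *\<^sub>R g t) \<in> borel_measurable lborel"
    and B: "AE t in lborel. t \<in> A \<longrightarrow> \<bar>g t\<bar> \<le> f t"
  shows "set_integrable lborel A g"
  unfolding set_integrable_def
proof (rule Bochner_Integration.integrable_bound[OF f[unfolded set_integrable_def] g])
  show "AE t in lborel. norm (indicator A t *\<^sub>R g t) \<le> norm (indicator A t *\<^sub>R f t)"
    using B by eventually_elim (auto simp: indicator_def)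
qed

context contagion
begin

lemma path_measurable:
  fixes Y :: "real \<times> 'a \<Rightarrow> real"
  assumes Y: "Y \<in> borel_measurable P" and \<omega>: "\<omega> \<in> space M"
  shows "(\<lambda>t. indicator {0..T} t *\<^sub>R Y (t, \<omega>)) \<in> borel_measurable lborel"
  using measurable_compose[OF measurable_path[OF \<omega>] Y]
  by (subst (asm) borel_measurable_restrict_space_iff) auto

lemma path_measurable_ennreal:
  fixes Y :: "real \<times> 'a \<Rightarrow> ennreal"
  assumes Y: "Y \<in> borel_measurable P" and \<omega>: "\<omega> \<in> space M"
  shows "(\<lambda>t. Y (t, \<omega>) * indicator {0..T} t) \<in> borel_measurable lborel"
  using measurable_compose[OF measurable_path[OF \<omega>] Y]
  by (subst (asm) borel_measurable_restrict_space_iff_ennreal) auto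

lemma F1_section:
  fixes Y :: "(real \<times> 'a) \<times> real \<Rightarrow> 'b::topological_space"
  assumes "Y \<in> borel_measurable (P \<Otimes>\<^sub>M borel)" "0 \<le> t" "t \<le> T" "\<omega> \<in> space M"
  shows "(\<lambda>z. Y ((t, \<omega>), z)) \<in> borel_measurable (F1 S)"
proof -
  have "(\<lambda>z. ((t, \<omega>), z)) \<in> measurable borel (P \<Otimes>\<^sub>M borel)"
    using assms by (intro measurable_Pair1') (simp add: space_P)
  from measurable_compose[OF this assms(1)] show ?thesis by (simp cong: measurable_cong_sets)
qed

lemma F1_integral_predictable:
  fixes Y :: "(real \<times> 'a) \<times> real \<Rightarrow> real"
  assumes "Y \<in> borel_measurable (P \<Otimes>\<^sub>M borel)"
  shows "(\<lambda>x. LINT z|F1 S. Y (x, z)) \<in> borel_measurable P"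
proof -
  interpret F1: prob_space "F1 S" by (rule F1_prob)
  show ?thesis using assms
    by (intro F1.borel_measurable_lebesgue_integral) (simp add: case_prod_beta' cong: measurable_cong_sets)
qed

lemma F1_nn_integral_predictable:
  fixes Y :: "(real \<times> 'a) \<times> real \<Rightarrow> ennreal"
  assumes "Y \<in> borel_measurable (P \<Otimes>\<^sub>M borel)"
  shows "(\<lambda>x. \<integral>\<^sup>+z. Y (x, z) \<partial>F1 S) \<in> borel_measurable P"
proof -
  interpret F1: prob_space "F1 S" by (rule F1_prob)
  show ?thesis using assms
    by (intro F1.borel_measurable_nn_integral) (simp add: case_prod_beta' cong: measurable_cong_sets)
qed

lemma time_integral_predictable:
  fixes Y :: "real \<times> 'a \<Rightarrow> real"
  assumes "Y \<in> borel_measurable P"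
  shows "(\<lambda>x. enn2real (\<integral>\<^sup>+r. (if 0 \<le> r \<and> r < fst x then ennreal (Y (r, snd x)) else 0) \<partial>lborel)) \<in> borel_measurable P"
proof -
  have "(\<lambda>x. ennreal (Y x)) \<in> borel_measurable P" using assms by measurable
  from predictable_time_integral[OF this]
  have "(\<lambda>x. \<integral>\<^sup>+r. (if 0 \<le> r \<and> r < fst x then ennreal (Y (r, snd x)) else 0) \<partial>lborel) \<in> borel_measurable P"
    by (simp add: case_prod_beta')
  then show ?thesis by measurable
qed

text \<open>Real jump times with \<open>tau \<omega> 0 = 0\<close> as the left end of the first
  interval. Only indices up to \<open>N T \<omega>\<close> are meaningful, since an infinite jump
  time would be mapped to 0.\<close>

definition tau :: "'a \<Rightarrow> nat \<Rightarrow> real" where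
  "tau \<omega> n = (if n = 0 then 0 else real_of_ereal (J n \<omega>))"

lemma J_eq_tau:
  assumes "\<omega> \<in> space M" "1 \<le> n" "n \<le> N T \<omega>"
  shows "J n \<omega> = ereal (tau \<omega> n)" "0 < tau \<omega> n" "tau \<omega> n \<le> T"
proof -
  have "J n \<omega> \<le> ereal T" using le_counting_iff[OF J assms(1,2), of T] assms(3) by blast
  moreover have "0 < J n \<omega>" by (rule jump_times_pos[OF J assms(1,2)])
  ultimately show "J n \<omega> = ereal (tau \<omega> n)" "0 < tau \<omega> n" "tau \<omega> n \<le> T"
    using assms(2) by (cases "J n \<omega>"; simp add: tau_def)+
qed

lemma tau_less:
  assumes "\<omega> \<in> space M" "k < N T \<omega>"
  shows "tau \<omega> k < tau \<omega> (Suc k)"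
proof (cases "k = 0")
  case True
  then show ?thesis using J_eq_tau(2)[OF assms(1), of "Suc k"] assms(2) by (simp add: tau_def)
next
  case False
  have "J k \<omega> < J (Suc k) \<omega>"
    using J_eq_tau(1)[OF assms(1), of k] False assms by (intro jump_times_strict[OF J]) auto
  then show ?thesis using J_eq_tau(1)[OF assms(1), of k] J_eq_tau(1)[OF assms(1), of "Suc k"] False assms by simp
qed

lemma tau_mono:
  assumes "\<omega> \<in> space M" "j \<le> k" "k \<le> N T \<omega>"
  shows "tau \<omega> j \<le> tau \<omega> k"
  using assms(2,3)
proof (induction k rule: dec_induct)
  case (step k) then show ?case using tau_less[OF assms(1), of k] by simp
qed simp

lemma tau_le_T: "\<omega> \<in> space M \<Longrightarrow> tau \<omega> (N T \<omega>) \<le> T"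
  using J_eq_tau(3)[of \<omega> "N T \<omega>"] T_pos by (cases "N T \<omega> = 0") (simp_all add: tau_def)

lemma le_counting_tau:
  assumes "\<omega> \<in> space M" "1 \<le> n" "n \<le> N T \<omega>"
  shows "n \<le> N t \<omega> \<longleftrightarrow> tau \<omega> n \<le> t"
  using le_counting_iff[OF J assms(1,2), of t] J_eq_tau(1)[OF assms] by simp

lemma counting_between:
  assumes \<omega>: "\<omega> \<in> space M" and k: "k \<le> N T \<omega>" and t: "tau \<omega> k \<le> t" "t \<le> T" and up: "k < N T \<omega> \<Longrightarrow> t < tau \<omega> (Suc k)"
  shows "N t \<omega> = k"
proof -
  have "k \<le> N t \<omega>" using le_counting_tau[OF \<omega>, of k t] k t by (cases "k = 0") auto
  moreover have le: "N t \<omega> \<le> N T \<omega>" using counting_mono[OF J \<omega> t(2)] .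
  moreover have "\<not> Suc k \<le> N t \<omega>"
    using le_counting_tau[OF \<omega>, of "Suc k" t] up le by (cases "k < N T \<omega>") auto
  ultimately show ?thesis by simp
qed

lemma counting_right_cont:
  assumes \<omega>: "\<omega> \<in> space M" and t: "0 \<le> t" "t < T"
  shows "\<forall>\<^sub>F s in at_right t. N s \<omega> = N t \<omega>"
proof -
  let ?k = "N t \<omega>"
  have k: "?k \<le> N T \<omega>" using counting_mono[OF J \<omega>, of t T] t by simp
  have tk: "tau \<omega> ?k \<le> t" using le_counting_tau[OF \<omega>, of ?k t] k t by (cases "?k = 0") (auto simp: tau_def)
  define b where "b = (if ?k < N T \<omega> then min T (tau \<omega> (Suc ?k)) else T)"
  have "t < b"
    using t le_counting_tau[OF \<omega>, of "Suc ?k" t] by (auto simp: b_def)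
  moreover have "N s \<omega> = ?k" if "t < s" "s < b" for s
    using that tk by (intro counting_between[OF \<omega> k]) (auto simp: b_def split: if_splits)
  ultimately show ?thesis unfolding eventually_at_right_field by blast
qed

text \<open>Along a path the integrand is known only as a section of a predictable field; clamping
  the time to \<open>[0,T]\<close> supplies the joint measurability in time and mark that
  integration against the jump measure requires.\<close>

lemma jump_measure_path_integral:
  fixes Y :: "(real \<times> 'a) \<times> real \<Rightarrow> real"
  assumes Y: "Y \<in> borel_measurable (P \<Otimes>\<^sub>M borel)" and f: "\<And>s z. 0 \<le> s \<Longrightarrow> s \<le> T \<Longrightarrow> 0 < z \<Longrightarrow> f (s, z) = Y ((s, \<omega>), z)"
    and \<omega>: "\<omega> \<in> space M" and t: "0 \<le> t" "t \<le> T"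
  shows "set_lebesgue_integral (m1 S \<omega>) ({t<..T} \<times> {0<..}) f =
    (\<Sum>n=1..N T \<omega>. if t < tau \<omega> n then Y ((tau \<omega> n, \<omega>), Z n \<omega>) else 0)"
proof -
  have mm: "(\<lambda>x. indicator ({t<..T} \<times> {0<..}) x *\<^sub>R f x) \<in> borel_measurable (borel \<Otimes>\<^sub>M borel)"
  proof -
    have "(\<lambda>x::real \<times> real. ((if 0 \<le> fst x \<and> fst x \<le> T then fst x else 0, \<omega>), snd x)) \<in> measurable (borel \<Otimes>\<^sub>M borel) (P \<Otimes>\<^sub>M borel)"
    proof (rule measurable_Pair)
      have "(\<lambda>x::real \<times> real. (if 0 \<le> fst x \<and> fst x \<le> T then fst x else 0)) \<in> measurable (borel \<Otimes>\<^sub>M borel) (restrict_space borel {0..T})"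
        using T_pos by (intro measurable_restrict_space2) auto
      from measurable_compose[OF this measurable_path[OF \<omega>]]
      show "(\<lambda>x::real \<times> real. (if 0 \<le> fst x \<and> fst x \<le> T then fst x else 0, \<omega>)) \<in> measurable (borel \<Otimes>\<^sub>M borel) P" .
    qed auto
    from measurable_compose[OF this Y]
    have "(\<lambda>x. indicator ({t<..T} \<times> {0<..}) x *\<^sub>R Y ((if 0 \<le> fst x \<and> fst x \<le> T then fst x else 0, \<omega>), snd x)) \<in> borel_measurable (borel \<Otimes>\<^sub>M borel)"
      by (intro borel_measurable_scaleR borel_measurable_indicator) auto
    moreover have "(\<lambda>x. indicator ({t<..T} \<times> {0<..}) x *\<^sub>R Y ((if 0 \<le> fst x \<and> fst x \<le> T then fst x else 0, \<omega>), snd x)) =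
        (\<lambda>x. indicator ({t<..T} \<times> {0<..}) x *\<^sub>R f x)"
      using f t by (auto simp: fun_eq_iff indicator_def)
    ultimately show ?thesis by simp
  qed
  have "set_lebesgue_integral (m1 S \<omega>) ({t<..T} \<times> {0<..}) f =
      (\<Sum>n\<in>{1..N T \<omega>}. if ereal t < J n \<omega> then f (real_of_ereal (J n \<omega>), Z n \<omega>) else 0)"
    using set_integral_jump_measure[where \<zeta>=Z, OF J \<omega> _ t(1) mm] Z_pos[OF _ \<omega>] by simp
  also have "\<dots> = (\<Sum>n=1..N T \<omega>. if t < tau \<omega> n then Y ((tau \<omega> n, \<omega>), Z n \<omega>) else 0)"
  proof (rule sum.cong)
    fix n assume n: "n \<in> {1..N T \<omega>}"
    then show "(if ereal t < J n \<omega> then f (real_of_ereal (J n \<omega>), Z n \<omega>) else 0) =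
      (if t < tau \<omega> n then Y ((tau \<omega> n, \<omega>), Z n \<omega>) else 0)"
      using J_eq_tau[OF \<omega>, of n] f[of "tau \<omega> n" "Z n \<omega>"] Z_pos[OF _ \<omega>, of n] by auto
  qed simp
  finally show ?thesis .
qed

end

section \<open>The processes entering the damped product\<close>

context control_problem
begin

text \<open>In the processes below a point of \<open>[0,T] \<times> \<Omega>\<close>, possibly with a mark, is one argument. The
  truncation \<open>max 0\<close> makes the random fields total in the mark; marks are positive, so it is harmless.
  \<open>VV\<close> is the value of \<open>W\<close> after a jump and \<open>exp (- gj)\<close> the factor by which the density of \<open>us\<close>
  against null reinsurance jumps. Along \<open>us\<close> the product of this density and \<open>W\<close> has, relative to
  the density, jumps \<open>VV * exp (- gj) - Wm\<close>, whose positive and negative parts have compensator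
  densities \<open>pp\<close> and \<open>nn\<close>; both are at most \<open>kk\<close>.\<close>

definition qs :: "real \<times> 'a \<Rightarrow> real" where
  "qs x = rprem S (fst x) (snd x) (us (fst x) (snd x))"

definition gj :: "(real \<times> 'a) \<times> real \<Rightarrow> real" where
  "gj x = discount S (fst (fst x)) * (max 0 (snd x) - Phi S (max 0 (snd x)) (us (fst (fst x)) (snd (fst x))))"

definition Th :: "(real \<times> 'a) \<times> real \<Rightarrow> real" where
  "Th x = \<Theta> (fst (fst x)) (snd (fst x)) (max 0 (snd x))"

definition VV :: "(real \<times> 'a) \<times> real \<Rightarrow> real" where
  "VV x = Wm (fst (fst x)) (snd (fst x)) + Th x"

text \<open>One \<open>Wm\<close> comes from
  \<open>\<bar>VV\<bar> \<le> \<bar>Th\<bar> + Wm\<close>, the other from the \<open>Wm\<close>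
  added in \<open>nn\<close>. The value is kept in \<open>ennreal\<close> because only its product
  with the filter is known to be finite, and that for almost every time.\<close>

definition K :: "real \<times> 'a \<Rightarrow> ennreal" where
  "K x = (\<integral>\<^sup>+z. ennreal (\<bar>Th (x, z)\<bar> + 2 * Wm (fst x) (snd x)) \<partial>F1 S)"

definition kk :: "real \<times> 'a \<Rightarrow> real" where
  "kk x = enn2real (K x) * \<pi> (fst x) (snd x)"

definition Cq :: "real \<times> 'a \<Rightarrow> real" where
  "Cq x = enn2real (\<integral>\<^sup>+r. (if 0 \<le> r \<and> r < fst x then ennreal (discount S r * qs (r, snd x)) else 0) \<partial>lborel)"

text \<open>Premiums are the only source of growth of the density, so it is at most the exponential
  of \<open>Cq\<close>, and this product dominates the compensator densities. It is the density of
  the process \<open>A\<close>.\<close>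

definition aa :: "real \<times> 'a \<Rightarrow> real" where
  "aa x = exp (Cq x) * kk x"

definition AA :: "real \<times> 'a \<Rightarrow> real" where
  "AA x = enn2real (\<integral>\<^sup>+r. (if 0 \<le> r \<and> r < fst x then ennreal (aa (r, snd x)) else 0) \<partial>lborel)"

definition Jg :: "real \<times> 'a \<Rightarrow> real" where
  "Jg x = (\<Sum>n=1..N T (snd x). if J n (snd x) < ereal (fst x) then gj ((real_of_ereal (J n (snd x)), snd x), Z n (snd x)) else 0)"

text \<open>The left limits of the density of the strategy \<open>us\<close> against null reinsurance, damped by
  \<open>exp (- \<epsilon> A)\<close>. The increasing process \<open>A\<close> dominates the variation of the compensated
  integral below, so the damping replaces localization by stopping times.\<close>

definition Ls :: "real \<Rightarrow> real \<times> 'a \<Rightarrow> real" where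
  "Ls \<epsilon> x = exp (Cq x - \<epsilon> * AA x - Jg x)"

definition BB :: "real \<times> 'a \<Rightarrow> real" where
  "BB x = (LINT z|F1 S. indicator {0<..} z * (Th (x, z) * \<pi> (fst x) (snd x)))"

definition pp :: "real \<times> 'a \<Rightarrow> real" where
  "pp x = (LINT z|F1 S. max 0 (VV (x, z)) * exp (- gj (x, z)) * \<pi> (fst x) (snd x))"

definition nn :: "real \<times> 'a \<Rightarrow> real" where
  "nn x = (LINT z|F1 S. (max 0 (- VV (x, z)) * exp (- gj (x, z)) + Wm (fst x) (snd x)) * \<pi> (fst x) (snd x))"

lemma qs_predictable [measurable]: "qs \<in> borel_measurable P"
  unfolding qs_def[abs_def] by (intro rprem_control_measurable us_predictable us_in)

lemma discount_predictable [measurable]: "(\<lambda>x. discount S (fst x)) \<in> borel_measurable P"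
  by (rule measurable_compose[OF measurable_fst_P discount_measurable])

lemma gj_measurable [measurable]: "gj \<in> borel_measurable (P \<Otimes>\<^sub>M borel)"
proof -
  have Ph: "(\<lambda>x. Phi S (max 0 (snd x)) (us (fst (fst x)) (snd (fst x)))) \<in> borel_measurable (P \<Otimes>\<^sub>M borel)"
    using Phi_control_measurable[OF us_predictable] us_in by (auto simp: space_P)
  show ?thesis unfolding gj_def[abs_def]
    by (intro borel_measurable_times borel_measurable_diff Ph measurable_compose[OF fst_fst_P discount_measurable]) auto
qed

lemma Th_measurable [measurable]: "Th \<in> borel_measurable (P \<Otimes>\<^sub>M borel)"
  unfolding Th_def[abs_def] by (rule \<Theta>_predictable)

lemma Wm_lift [measurable]: "(\<lambda>x. Wm (fst (fst x)) (snd (fst x))) \<in> borel_measurable (P \<Otimes>\<^sub>M L)"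
  by (rule lift_fst[of Wm, OF Wm_predictable])

lemma \<pi>_lift [measurable]: "(\<lambda>x. \<pi> (fst (fst x)) (snd (fst x))) \<in> borel_measurable (P \<Otimes>\<^sub>M L)"
  by (rule lift_fst[of \<pi>, OF \<pi>_predictable])

lemma VV_measurable [measurable]: "VV \<in> borel_measurable (P \<Otimes>\<^sub>M borel)"
  unfolding VV_def[abs_def] by (intro borel_measurable_add Wm_lift Th_measurable)

lemma K_predictable [measurable]: "K \<in> borel_measurable P"
proof -
  have "(\<lambda>x. ennreal (\<bar>Th x\<bar> + 2 * Wm (fst (fst x)) (snd (fst x)))) \<in> borel_measurable (P \<Otimes>\<^sub>M borel)"
    by measurable
  from F1_nn_integral_predictable[OF this] show ?thesis unfolding K_def[abs_def] by simp
qed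

lemma kk_predictable [measurable]: "kk \<in> borel_measurable P"
  unfolding kk_def[abs_def] by measurable

lemma Cq_predictable [measurable]: "Cq \<in> borel_measurable P"
proof -
  have "(\<lambda>x. discount S (fst x) * qs x) \<in> borel_measurable P" by measurable
  from time_integral_predictable[OF this] show ?thesis unfolding Cq_def[abs_def] by (simp only: fst_conv)
qed

lemma aa_predictable [measurable]: "aa \<in> borel_measurable P"
  unfolding aa_def[abs_def] by measurable

lemma AA_predictable [measurable]: "AA \<in> borel_measurable P"
  unfolding AA_def[abs_def] by (rule time_integral_predictable[OF aa_predictable])

lemma Jg_predictable [measurable]: "Jg \<in> borel_measurable P"
  using jump_sum_predictable[OF gj_measurable] by (simp add: Jg_def[abs_def] case_prod_beta')

lemma Ls_predictable [measurable]: "Ls \<epsilon> \<in> borel_measurable P"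
  unfolding Ls_def[abs_def] by measurable

lemma BB_predictable [measurable]: "BB \<in> borel_measurable P"
proof -
  have "(\<lambda>x. indicator {0<..} (snd x) * (Th x * \<pi> (fst (fst x)) (snd (fst x)))) \<in> borel_measurable (P \<Otimes>\<^sub>M borel)"
    by measurable
  from F1_integral_predictable[OF this] show ?thesis unfolding BB_def[abs_def] by simp
qed

lemma pp_predictable [measurable]: "pp \<in> borel_measurable P"
proof -
  have "(\<lambda>x. max 0 (VV x) * exp (- gj x) * \<pi> (fst (fst x)) (snd (fst x))) \<in> borel_measurable (P \<Otimes>\<^sub>M borel)"
    by measurable
  from F1_integral_predictable[OF this] show ?thesis unfolding pp_def[abs_def] by simp
qed

lemma nn_predictable [measurable]: "nn \<in> borel_measurable P"
proof -
  have "(\<lambda>x. (max 0 (- VV x) * exp (- gj x) + Wm (fst (fst x)) (snd (fst x))) * \<pi> (fst (fst x)) (snd (fst x))) \<in> borel_measurable (P \<Otimes>\<^sub>M borel)"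
    by measurable
  from F1_integral_predictable[OF this] show ?thesis unfolding nn_def[abs_def] by simp
qed

lemma gj_nonneg: "0 \<le> t \<Longrightarrow> t \<le> T \<Longrightarrow> \<omega> \<in> space M \<Longrightarrow> 0 \<le> gj ((t, \<omega>), z)"
  unfolding gj_def using Phi_props(4)[of "max 0 z" "us t \<omega>"] us_in[of t \<omega>] discount_pos[of t]
  by (intro mult_nonneg_nonneg) auto

lemma qs_nonneg: "0 \<le> t \<Longrightarrow> t \<le> T \<Longrightarrow> \<omega> \<in> space M \<Longrightarrow> 0 \<le> qs (t, \<omega>)"
  unfolding qs_def using rprem_props(3)[of t \<omega> "us t \<omega>"] us_in[of t \<omega>] by simp

lemma qs_le: "0 \<le> t \<Longrightarrow> t \<le> T \<Longrightarrow> \<omega> \<in> space M \<Longrightarrow> qs (t, \<omega>) \<le> rprem S t \<omega> (uM S)"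
  unfolding qs_def using rprem_props(4)[of t \<omega> "us t \<omega>"] us_in[of t \<omega>] by simp

lemma Jg_nonneg: "\<omega> \<in> space M \<Longrightarrow> 0 \<le> Jg (t, \<omega>)"
  unfolding Jg_def
proof (intro sum_nonneg)
  fix n assume \<omega>: "\<omega> \<in> space M" and "n \<in> {1..N T (snd (t, \<omega>))}"
  then have "0 \<le> gj ((real_of_ereal (J n \<omega>), \<omega>), Z n \<omega>)"
    using J_eq_tau[OF \<omega>, of n] by (intro gj_nonneg) auto
  then show "0 \<le> (if J n (snd (t, \<omega>)) < ereal (fst (t, \<omega>)) then
     gj ((real_of_ereal (J n (snd (t, \<omega>))), snd (t, \<omega>)), Z n (snd (t, \<omega>))) else 0)" by simp
qed

lemma AA_nonneg: "0 \<le> AA x"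
  by (simp add: AA_def)

end

section \<open>Estimates at a fixed point and integrability along a path\<close>

context control_problem
begin

text \<open>When \<open>K\<close> times the filter is finite, one integrable function dominates all
  fields. The last claim evaluates \<open>ff\<close> at the candidate: with \<open>V\<close> the
  value after a jump and \<open>e\<close> the jump factor, \<open>V * (e - 1)\<close> equals
  \<open>max 0 V * e\<close> minus \<open>max 0 (- V) * e + Wm\<close> minus \<open>Th\<close>,
  whose integrals against the filter are \<open>pp\<close>, \<open>nn\<close> and
  \<open>BB\<close>.\<close>

lemma fiber:
  assumes t: "0 \<le> t" "t \<le> T" "\<omega> \<in> space M" and \<pi>0: "0 \<le> \<pi> t \<omega>"
    and fin: "K (t, \<omega>) * ennreal (\<pi> t \<omega>) < \<infinity>"
  shows fiber_kk: "ennreal (kk (t, \<omega>)) = K (t, \<omega>) * ennreal (\<pi> t \<omega>)"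
    and fiber_VV: "integrable (F1 S) (\<lambda>z. indicator {0<..} z * (VV ((t, \<omega>), z) * \<pi> t \<omega>))"
    and fiber_BB: "\<bar>BB (t, \<omega>)\<bar> \<le> kk (t, \<omega>)"
    and fiber_pp: "0 \<le> pp (t, \<omega>)" "pp (t, \<omega>) \<le> kk (t, \<omega>)"
      "(\<integral>\<^sup>+z. ennreal (max 0 (VV ((t, \<omega>), z)) * exp (- gj ((t, \<omega>), z))) \<partial>F1 S) * ennreal (\<pi> t \<omega>) = ennreal (pp (t, \<omega>))"
    and fiber_nn: "0 \<le> nn (t, \<omega>)" "nn (t, \<omega>) \<le> kk (t, \<omega>)"
      "(\<integral>\<^sup>+z. ennreal (max 0 (- VV ((t, \<omega>), z)) * exp (- gj ((t, \<omega>), z)) + Wm t \<omega>) \<partial>F1 S) * ennreal (\<pi> t \<omega>) = ennreal (nn (t, \<omega>))"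
    and fiber_ff: "ff t \<omega> (us t \<omega>) = - Wm t \<omega> * discount S t * qs (t, \<omega>) + BB (t, \<omega>) + nn (t, \<omega>) - pp (t, \<omega>)"
proof -
  interpret F1: prob_space "F1 S" by (rule F1_prob)
  let ?x = "(t, \<omega>)"
  note W0 = Wm_nonneg[OF t]
  have Thm [measurable]: "(\<lambda>z. Th (?x, z)) \<in> borel_measurable (F1 S)" by (rule F1_section[OF Th_measurable t])
  have VVm [measurable]: "(\<lambda>z. VV (?x, z)) \<in> borel_measurable (F1 S)" by (rule F1_section[OF VV_measurable t])
  have gjm [measurable]: "(\<lambda>z. gj (?x, z)) \<in> borel_measurable (F1 S)" by (rule F1_section[OF gj_measurable t])
  have indm [measurable]: "(\<lambda>z. indicator {0<..} z :: real) \<in> borel_measurable (F1 S)"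
    by (simp cong: measurable_cong_sets)
  let ?b = "\<lambda>z. (\<bar>Th (?x, z)\<bar> + 2 * Wm t \<omega>) * \<pi> t \<omega>"
  have b0: "0 \<le> ?b z" for z using W0 \<pi>0 by simp
  have nnb: "(\<integral>\<^sup>+z. ennreal (?b z) \<partial>F1 S) = K ?x * ennreal (\<pi> t \<omega>)"
  proof -
    have "(\<integral>\<^sup>+z. ennreal (?b z) \<partial>F1 S) = (\<integral>\<^sup>+z. ennreal (\<bar>Th (?x, z)\<bar> + 2 * Wm t \<omega>) * ennreal (\<pi> t \<omega>) \<partial>F1 S)"
      using W0 \<pi>0 by (simp add: ennreal_mult)
    also have "\<dots> = K ?x * ennreal (\<pi> t \<omega>)"
      unfolding K_def by (subst nn_integral_multc) auto
    finally show ?thesis .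
  qed
  have bint: "integrable (F1 S) ?b"
    by (rule integrableI_nonneg) (use fin b0 in \<open>auto simp: nnb\<close>)
  \<comment> \<open>Where the filter vanishes \<open>K\<close> may be infinite; both sides are then
    0, as \<open>\<infinity> * 0 = 0\<close> in \<open>ennreal\<close>.\<close>
  show kk_eq: "ennreal (kk ?x) = K ?x * ennreal (\<pi> t \<omega>)"
  proof (cases "\<pi> t \<omega> = 0")
    case False
    then have "K ?x < \<infinity>" using fin \<pi>0 by (cases "K ?x") (auto simp: ennreal_top_mult)
    then show ?thesis using \<pi>0 by (simp add: kk_def ennreal_mult)
  qed (simp add: kk_def)
  have kk0: "0 \<le> kk ?x" using \<pi>0 by (simp add: kk_def)
  have bLINT: "(LINT z|F1 S. ?b z) = kk ?x"
  proof -
    have "ennreal (LINT z|F1 S. ?b z) = ennreal (kk ?x)"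
      using nn_integral_eq_integral[OF bint] b0 nnb kk_eq by simp
    then show ?thesis using kk0 Bochner_Integration.integral_nonneg[of "F1 S" ?b] b0 by simp
  qed
  have le: "\<bar>VV (?x, z)\<bar> \<le> \<bar>Th (?x, z)\<bar> + Wm t \<omega>" for z using W0 by (simp add: VV_def)
  have e1: "0 < exp (- gj (?x, z)) \<and> exp (- gj (?x, z)) \<le> 1" for z using gj_nonneg[OF t, of z] by simp
  have me: "m * exp (- gj (?x, z)) \<le> m" if "0 \<le> m" for m z
    using mult_left_mono[of "exp (- gj (?x, z))" 1 m] e1[of z] that by simp
  let ?p = "\<lambda>z. max 0 (VV (?x, z)) * exp (- gj (?x, z))"
  let ?n = "\<lambda>z. max 0 (- VV (?x, z)) * exp (- gj (?x, z)) + Wm t \<omega>"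
  have p0: "0 \<le> ?p z" and n0: "0 \<le> ?n z" for z using W0 by (auto intro!: add_nonneg_nonneg)
  have ple: "?p z \<le> \<bar>Th (?x, z)\<bar> + 2 * Wm t \<omega>" for z
    using me[of "max 0 (VV (?x, z))" z] le[of z] W0 by linarith
  have nle: "?n z \<le> \<bar>Th (?x, z)\<bar> + 2 * Wm t \<omega>" for z
    using me[of "max 0 (- VV (?x, z))" z] le[of z] W0 by linarith
  have pint: "integrable (F1 S) (\<lambda>z. ?p z * \<pi> t \<omega>)"
    by (rule Bochner_Integration.integrable_bound[OF bint])
      (use p0 ple \<pi>0 b0 in \<open>auto simp: abs_mult intro!: AE_I2 mult_right_mono order_trans[OF ple abs_ge_self]\<close>)
  have nint: "integrable (F1 S) (\<lambda>z. ?n z * \<pi> t \<omega>)"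
  proof (rule Bochner_Integration.integrable_bound[OF bint])
    show "AE z in F1 S. norm (?n z * \<pi> t \<omega>) \<le> norm (?b z)"
    proof (intro AE_I2)
      fix z
      have "?n z * \<pi> t \<omega> \<le> ?b z" by (rule mult_right_mono[OF nle \<pi>0])
      then show "norm (?n z * \<pi> t \<omega>) \<le> norm (?b z)" using n0[of z] \<pi>0 b0[of z] by simp
    qed
  qed measurable
  have Tint: "integrable (F1 S) (\<lambda>z. indicator {0<..} z * (Th (?x, z) * \<pi> t \<omega>))"
  proof (rule Bochner_Integration.integrable_bound[OF bint])
    show "AE z in F1 S. norm (indicator {0<..} z * (Th (?x, z) * \<pi> t \<omega>)) \<le> norm (?b z)"
    proof (intro AE_I2)
      fix z
      have "\<bar>Th (?x, z)\<bar> * \<pi> t \<omega> \<le> ?b z" using W0 \<pi>0 by (intro mult_right_mono) auto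
      moreover have nb: "norm (?b z) = ?b z" using b0[of z] by (simp only: real_norm_def abs_of_nonneg)
      ultimately show "norm (indicator {0<..} z * (Th (?x, z) * \<pi> t \<omega>)) \<le> norm (?b z)"
        unfolding nb using \<pi>0 b0[of z] by (auto simp: indicator_def abs_mult)
    qed
  qed measurable
  show Vint: "integrable (F1 S) (\<lambda>z. indicator {0<..} z * (VV (?x, z) * \<pi> t \<omega>))"
  proof (rule Bochner_Integration.integrable_bound[OF bint])
    show "AE z in F1 S. norm (indicator {0<..} z * (VV (?x, z) * \<pi> t \<omega>)) \<le> norm (?b z)"
    proof (intro AE_I2)
      fix z
      have "\<bar>VV (?x, z)\<bar> * \<pi> t \<omega> \<le> ?b z" using W0 \<pi>0 le[of z] by (intro mult_right_mono) auto
      moreover have nb: "norm (?b z) = ?b z" using b0[of z] by (simp only: real_norm_def abs_of_nonneg)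
      ultimately show "norm (indicator {0<..} z * (VV (?x, z) * \<pi> t \<omega>)) \<le> norm (?b z)"
        unfolding nb using \<pi>0 b0[of z] by (auto simp: indicator_def abs_mult)
    qed
  qed measurable
  show "\<bar>BB ?x\<bar> \<le> kk ?x"
  proof -
    have "\<bar>BB ?x\<bar> \<le> (LINT z|F1 S. \<bar>indicator {0<..} z * (Th (?x, z) * \<pi> t \<omega>)\<bar>)"
      unfolding BB_def fst_conv snd_conv by (rule integral_abs_bound)
    also have "\<dots> \<le> (LINT z|F1 S. ?b z)"
    proof (intro integral_mono bint)
      show "integrable (F1 S) (\<lambda>z. \<bar>indicator {0<..} z * (Th (?x, z) * \<pi> t \<omega>)\<bar>)" using Tint by simp
      fix z
      have "\<bar>Th (?x, z)\<bar> * \<pi> t \<omega> \<le> ?b z" using W0 \<pi>0 by (intro mult_right_mono) auto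
      then show "\<bar>indicator {0<..} z * (Th (?x, z) * \<pi> t \<omega>)\<bar> \<le> ?b z"
        using \<pi>0 b0[of z] by (auto simp: indicator_def abs_mult)
    qed
    finally show ?thesis using bLINT by simp
  qed
  show pp0: "0 \<le> pp ?x" unfolding pp_def using p0 \<pi>0 by (intro Bochner_Integration.integral_nonneg) simp
  show nn0: "0 \<le> nn ?x" unfolding nn_def using n0 \<pi>0 by (intro Bochner_Integration.integral_nonneg) simp
  show "pp ?x \<le> kk ?x"
    unfolding bLINT[symmetric] pp_def fst_conv snd_conv
    by (intro integral_mono bint pint mult_right_mono ple \<pi>0)
  show "nn ?x \<le> kk ?x"
    unfolding bLINT[symmetric] nn_def fst_conv snd_conv
    by (intro integral_mono bint nint mult_right_mono nle \<pi>0)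
  show "(\<integral>\<^sup>+z. ennreal (?p z) \<partial>F1 S) * ennreal (\<pi> t \<omega>) = ennreal (pp ?x)"
  proof -
    have "(\<integral>\<^sup>+z. ennreal (?p z) \<partial>F1 S) * ennreal (\<pi> t \<omega>) = (\<integral>\<^sup>+z. ennreal (?p z * \<pi> t \<omega>) \<partial>F1 S)"
      using p0 \<pi>0 by (subst nn_integral_multc[symmetric]) (auto simp: ennreal_mult)
    also have "\<dots> = ennreal (pp ?x)"
      using nn_integral_eq_integral[OF pint] p0 \<pi>0 by (simp add: pp_def)
    finally show ?thesis .
  qed
  show "(\<integral>\<^sup>+z. ennreal (?n z) \<partial>F1 S) * ennreal (\<pi> t \<omega>) = ennreal (nn ?x)"
  proof -
    have "(\<integral>\<^sup>+z. ennreal (?n z) \<partial>F1 S) * ennreal (\<pi> t \<omega>) = (\<integral>\<^sup>+z. ennreal (?n z * \<pi> t \<omega>) \<partial>F1 S)"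
    proof (subst nn_integral_multc[symmetric])
      show "(\<integral>\<^sup>+z. ennreal (?n z) * ennreal (\<pi> t \<omega>) \<partial>F1 S) = (\<integral>\<^sup>+z. ennreal (?n z * \<pi> t \<omega>) \<partial>F1 S)"
        using n0 \<pi>0 by (intro nn_integral_cong ennreal_mult[symmetric]) auto
    qed measurable
    also have "\<dots> = ennreal (nn ?x)"
      using nn_integral_eq_integral[OF nint] n0 \<pi>0 by (simp add: nn_def)
    finally show ?thesis .
  qed
  have "(LINT z|F1 S. indicator {0<..} z * ((Wm t \<omega> + \<Theta> t \<omega> (max 0 z)) * (exp (- discount S t * (z - Phi S (max 0 z) (us t \<omega>))) - 1) * \<pi> t \<omega>)) =
     (LINT z|F1 S. ?p z * \<pi> t \<omega> - ?n z * \<pi> t \<omega> - indicator {0<..} z * (Th (?x, z) * \<pi> t \<omega>))"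
  proof (rule integral_cong_AE)
    show "AE z in F1 S. indicator {0<..} z * ((Wm t \<omega> + \<Theta> t \<omega> (max 0 z)) * (exp (- discount S t * (z - Phi S (max 0 z) (us t \<omega>))) - 1) * \<pi> t \<omega>) =
      ?p z * \<pi> t \<omega> - ?n z * \<pi> t \<omega> - indicator {0<..} z * (Th (?x, z) * \<pi> t \<omega>)"
      using F1_pos
    proof eventually_elim
      case (elim z)
      have V: "max 0 (VV (?x, z)) - max 0 (- VV (?x, z)) = VV (?x, z)" by simp
      have "?p z - ?n z = (max 0 (VV (?x, z)) - max 0 (- VV (?x, z))) * exp (- gj (?x, z)) - Wm t \<omega>"
        by (simp add: algebra_simps)
      then have pn: "?p z * \<pi> t \<omega> - ?n z * \<pi> t \<omega> = (VV (?x, z) * exp (- gj (?x, z)) - Wm t \<omega>) * \<pi> t \<omega>"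
        unfolding V by (metis left_diff_distrib)
      have "exp (- gj (?x, z)) = exp (- discount S t * (z - Phi S (max 0 z) (us t \<omega>)))"
        using elim by (simp add: gj_def)
      then show ?case unfolding pn using elim by (simp add: VV_def Th_def algebra_simps)
    qed
    have "(\<lambda>z. indicator {0<..} z * ((VV (?x, z)) * (exp (- discount S t * (z - Phi S (max 0 z) (us t \<omega>))) - 1) * \<pi> t \<omega>)) =
        (\<lambda>z. indicator {0<..} z * (VV (?x, z) * (exp (- gj (?x, z)) - 1) * \<pi> t \<omega>))"
      by (auto simp: fun_eq_iff indicator_def gj_def)
    moreover have "(\<lambda>z. indicator {0<..} z * (VV (?x, z) * (exp (- gj (?x, z)) - 1) * \<pi> t \<omega>)) \<in> borel_measurable (F1 S)"
      by measurable
    ultimately show "(\<lambda>z. indicator {0<..} z * ((Wm t \<omega> + \<Theta> t \<omega> (max 0 z)) * (exp (- discount S t * (z - Phi S (max 0 z) (us t \<omega>))) - 1) * \<pi> t \<omega>)) \<in> borel_measurable (F1 S)"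
      by (simp add: VV_def Th_def)
  qed measurable
  also have "\<dots> = pp ?x - nn ?x - BB ?x"
    using pint nint Tint by (simp add: pp_def nn_def BB_def)
  finally show "ff t \<omega> (us t \<omega>) = - Wm t \<omega> * discount S t * qs ?x + BB ?x + nn ?x - pp ?x"
    unfolding ff_eq by (simp add: qs_def)
qed

lemma Wm_bounded:
  assumes "\<omega> \<in> space M"
  obtains B where "0 \<le> B" "\<And>t. 0 \<le> t \<Longrightarrow> t \<le> T \<Longrightarrow> Wm t \<omega> \<le> B"
proof -
  obtain B where B: "\<And>t. 0 \<le> t \<Longrightarrow> t \<le> T \<Longrightarrow> \<bar>W t \<omega>\<bar> \<le> B"
    using cadlag_bounded[OF W_cadlag[OF assms]] by metis
  show ?thesis
  proof (rule that[of B])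
    show "0 \<le> B" using B[of 0] T_pos by auto
    show "Wm t \<omega> \<le> B" if "0 \<le> t" "t \<le> T" for t
      unfolding Wm_def by (rule left_lim_upper[OF W_cadlag[OF assms] that]) (use B in \<open>auto intro: order_trans[OF abs_ge_self]\<close>)
  qed
qed

text \<open>Square integrability becomes integrability through
  \<open>\<bar>\<theta>\<bar> \<le> 1 + \<theta>\<^sup>2\<close>. Along one path \<open>Wm\<close>
  is bounded and the filter is bounded above, so the constant part has a finite time
  integral.\<close>

lemma K_integral_finite:
  assumes \<omega>: "\<omega> \<in> space M" and \<pi>0: "\<And>t. 0 \<le> t \<Longrightarrow> t \<le> T \<Longrightarrow> 0 \<le> \<pi> t \<omega>"
    and L2: "(\<integral>\<^sup>+t\<in>{0..T}. (\<integral>\<^sup>+z\<in>{0<..}. ennreal ((\<Theta> t \<omega> z)\<^sup>2 * \<pi> t \<omega>) \<partial>F1 S) \<partial>lborel) < \<infinity>"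
  shows "(\<integral>\<^sup>+t\<in>{0..T}. K (t, \<omega>) * ennreal (\<pi> t \<omega>) \<partial>lborel) < \<infinity>"
proof -
  interpret F1: prob_space "F1 S" by (rule F1_prob)
  obtain B where B: "0 \<le> B" "\<And>t. 0 \<le> t \<Longrightarrow> t \<le> T \<Longrightarrow> Wm t \<omega> \<le> B" using Wm_bounded[OF \<omega>] by metis
  obtain C where C: "\<And>t. 0 \<le> t \<Longrightarrow> t \<le> T \<Longrightarrow> \<pi> t \<omega> \<le> C" using filt_left_bounded[OF \<omega>] by metis
  define D where "D x = (\<integral>\<^sup>+z. ennreal ((Th (x, z))\<^sup>2 * \<pi> (fst x) (snd x)) \<partial>F1 S)" for x
  have Dm: "D \<in> borel_measurable P"
  proof -
    have "(\<lambda>x. ennreal ((Th x)\<^sup>2 * \<pi> (fst (fst x)) (snd (fst x)))) \<in> borel_measurable (P \<Otimes>\<^sub>M borel)" by measurable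
    from F1_nn_integral_predictable[OF this] show ?thesis unfolding D_def[abs_def] by simp
  qed
  have D: "D (t, \<omega>) = (\<integral>\<^sup>+z\<in>{0<..}. ennreal ((\<Theta> t \<omega> z)\<^sup>2 * \<pi> t \<omega>) \<partial>F1 S)" for t
    unfolding D_def
  proof (rule nn_integral_cong_AE)
    show "AE z in F1 S. ennreal ((Th ((t, \<omega>), z))\<^sup>2 * \<pi> (fst (t, \<omega>)) (snd (t, \<omega>))) = ennreal ((\<Theta> t \<omega> z)\<^sup>2 * \<pi> t \<omega>) * indicator {0<..} z"
      using F1_pos by eventually_elim (simp add: Th_def)
  qed
  have bound: "K (t, \<omega>) * ennreal (\<pi> t \<omega>) \<le> ennreal ((1 + 2 * B) * C) + D (t, \<omega>)" if t: "0 \<le> t" "t \<le> T" for t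
  proof -
    have [measurable]: "(\<lambda>z. Th ((t, \<omega>), z)) \<in> borel_measurable (F1 S)" by (rule F1_section[OF Th_measurable t \<omega>])
    have "K (t, \<omega>) * ennreal (\<pi> t \<omega>) = (\<integral>\<^sup>+z. ennreal (\<bar>Th ((t, \<omega>), z)\<bar> + 2 * Wm t \<omega>) * ennreal (\<pi> t \<omega>) \<partial>F1 S)"
      unfolding K_def by (subst nn_integral_multc) auto
    also have "\<dots> \<le> (\<integral>\<^sup>+z. ennreal ((1 + 2 * B) * C) + ennreal ((Th ((t, \<omega>), z))\<^sup>2 * \<pi> t \<omega>) \<partial>F1 S)"
    proof (rule nn_integral_mono)
      fix z
      define \<theta> where "\<theta> = Th ((t, \<omega>), z)"
      have sq: "\<bar>\<theta>\<bar> \<le> 1 + \<theta>\<^sup>2"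
      proof -
        have "0 \<le> (\<bar>\<theta>\<bar> - 1)\<^sup>2" by simp
        then have "2 * \<bar>\<theta>\<bar> \<le> 1 + \<theta>\<^sup>2" by (simp add: power2_diff)
        then show ?thesis by linarith
      qed
      have "ennreal (\<bar>\<theta>\<bar> + 2 * Wm t \<omega>) * ennreal (\<pi> t \<omega>) = ennreal ((\<bar>\<theta>\<bar> + 2 * Wm t \<omega>) * \<pi> t \<omega>)"
        using \<pi>0[OF t] Wm_nonneg[OF t \<omega>] by (simp add: ennreal_mult)
      also have "\<dots> \<le> ennreal ((1 + 2 * B) * C + \<theta>\<^sup>2 * \<pi> t \<omega>)"
      proof (rule ennreal_leI)
        have "(\<bar>\<theta>\<bar> + 2 * Wm t \<omega>) * \<pi> t \<omega> \<le> ((1 + 2 * B) + \<theta>\<^sup>2) * \<pi> t \<omega>"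
          using sq B(2)[OF t] \<pi>0[OF t] by (intro mult_right_mono) auto
        moreover have "(1 + 2 * B) * \<pi> t \<omega> \<le> (1 + 2 * B) * C" using C[OF t] B(1) by (intro mult_left_mono) auto
        ultimately show "(\<bar>\<theta>\<bar> + 2 * Wm t \<omega>) * \<pi> t \<omega> \<le> (1 + 2 * B) * C + \<theta>\<^sup>2 * \<pi> t \<omega>"
          by (simp add: algebra_simps)
      qed
      also have "\<dots> = ennreal ((1 + 2 * B) * C) + ennreal (\<theta>\<^sup>2 * \<pi> t \<omega>)"
        using B(1) C[OF t] \<pi>0[OF t] by (intro ennreal_plus) (auto intro: order_trans[OF \<pi>0[OF t]])
      finally show "ennreal (\<bar>Th ((t, \<omega>), z)\<bar> + 2 * Wm t \<omega>) * ennreal (\<pi> t \<omega>) \<le>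
          ennreal ((1 + 2 * B) * C) + ennreal ((Th ((t, \<omega>), z))\<^sup>2 * \<pi> t \<omega>)" unfolding \<theta>_def .
    qed
    also have "\<dots> = ennreal ((1 + 2 * B) * C) + D (t, \<omega>)"
      by (subst nn_integral_add) (auto simp: D_def F1.emeasure_space_1)
    finally show ?thesis .
  qed
  have "(\<integral>\<^sup>+t\<in>{0..T}. K (t, \<omega>) * ennreal (\<pi> t \<omega>) \<partial>lborel) \<le>
      (\<integral>\<^sup>+t. ennreal ((1 + 2 * B) * C) * indicator {0..T} t + D (t, \<omega>) * indicator {0..T} t \<partial>lborel)"
    using bound by (intro nn_integral_mono) (auto simp: indicator_def)
  also have "\<dots> = (\<integral>\<^sup>+t. ennreal ((1 + 2 * B) * C) * indicator {0..T} t \<partial>lborel) + (\<integral>\<^sup>+t. D (t, \<omega>) * indicator {0..T} t \<partial>lborel)"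
    by (intro nn_integral_add path_measurable_ennreal[OF Dm \<omega>]) auto
  also have "\<dots> < \<infinity>"
  proof -
    have "(\<integral>\<^sup>+t. ennreal ((1 + 2 * B) * C) * indicator {0..T} t \<partial>lborel) = ennreal ((1 + 2 * B) * C) * ennreal T"
      using T_pos by (simp add: nn_integral_cmult_indicator)
    also have "\<dots> < \<infinity>" by (simp add: ennreal_mult_less_top)
    finally have "(\<integral>\<^sup>+t. ennreal ((1 + 2 * B) * C) * indicator {0..T} t \<partial>lborel) < \<infinity>" .
    moreover have "(\<integral>\<^sup>+t. D (t, \<omega>) * indicator {0..T} t \<partial>lborel) < \<infinity>" using L2 by (simp add: D)
    ultimately show ?thesis by (simp add: ennreal_add_less_top)
  qed
  finally show ?thesis .
qed

end

lemma LBINT_singleton: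
  fixes f :: "real \<Rightarrow> real"
  shows "(LBINT x:{a..a}. f x) = 0"
proof -
  have "AE x in lborel. x \<noteq> a" by (rule AE_lborel_singleton)
  then have "AE x in lborel. indicator {a..a} x *\<^sub>R f x = 0" by eventually_elim (auto simp: indicator_def)
  then show ?thesis unfolding set_lebesgue_integral_def by (rule integral_eq_zero_AE)
qed

lemma LBINT_mono_nonneg:
  fixes f :: "real \<Rightarrow> real"
  assumes f: "set_integrable lborel {0..T} f" and nn: "\<And>t. 0 \<le> t \<Longrightarrow> t \<le> T \<Longrightarrow> 0 \<le> f t" and st: "0 \<le> s" "s \<le> t" "t \<le> T"
  shows "(LBINT r:{0..s}. f r) \<le> (LBINT r:{0..t}. f r)"
proof -
  have "0 \<le> (LBINT r:{s..t}. f r)"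
    unfolding set_lebesgue_integral_def using nn st by (intro Bochner_Integration.integral_nonneg) (auto simp: indicator_def)
  then show ?thesis using LBINT_combine[OF f st] by simp
qed

context contagion
begin

lemma time_integral_measurable:
  fixes Y :: "real \<times> 'a \<Rightarrow> ennreal"
  assumes Y: "Y \<in> borel_measurable P"
  shows "(\<lambda>\<omega>. \<integral>\<^sup>+t\<in>{0..T}. Y (t, \<omega>) \<partial>lborel) \<in> borel_measurable M"
proof -
  have "(\<lambda>x. Y (if 0 \<le> fst x \<and> fst x \<le> T then fst x else 0, snd x)) \<in> borel_measurable (borel \<Otimes>\<^sub>M M)"
    by (rule measurable_compose[OF measurable_clamp Y])
  then have m: "(\<lambda>x. Y (if 0 \<le> fst x \<and> fst x \<le> T then fst x else 0, snd x) * indicator {0..T} (fst x)) \<in> borel_measurable (borel \<Otimes>\<^sub>M M)"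
    by (intro borel_measurable_times_ennreal borel_measurable_indicator') auto
  have "(\<lambda>x. (snd x, fst x)) \<in> measurable (M \<Otimes>\<^sub>M lborel) (borel \<Otimes>\<^sub>M M)" by measurable
  from measurable_compose[OF this m]
  have "(\<lambda>x. Y (if 0 \<le> snd x \<and> snd x \<le> T then snd x else 0, fst x) * indicator {0..T} (snd x)) \<in> borel_measurable (M \<Otimes>\<^sub>M lborel)"
    by (simp only: fst_conv snd_conv)
  then have "(\<lambda>\<omega>. \<integral>\<^sup>+t. Y (if 0 \<le> t \<and> t \<le> T then t else 0, \<omega>) * indicator {0..T} t \<partial>lborel) \<in> borel_measurable M"
    by (intro lborel.borel_measurable_nn_integral) (simp add: case_prod_beta')
  also have "(\<lambda>\<omega>. \<integral>\<^sup>+t. Y (if 0 \<le> t \<and> t \<le> T then t else 0, \<omega>) * indicator {0..T} t \<partial>lborel) = (\<lambda>\<omega>. \<integral>\<^sup>+t\<in>{0..T}. Y (t, \<omega>) \<partial>lborel)"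
    by (intro ext nn_integral_cong) (auto simp: indicator_def)
  finally show ?thesis .
qed

lemma AE_time_integral_finite:
  fixes Y :: "real \<times> 'a \<Rightarrow> ennreal"
  assumes Y: "Y \<in> borel_measurable P" and fin: "(\<integral>\<^sup>+\<omega>. (\<integral>\<^sup>+t\<in>{0..T}. Y (t, \<omega>) \<partial>lborel) \<partial>M) < \<infinity>"
  shows "AE \<omega> in M. (\<integral>\<^sup>+t\<in>{0..T}. Y (t, \<omega>) \<partial>lborel) < \<infinity>"
proof -
  have "AE \<omega> in M. (\<integral>\<^sup>+t\<in>{0..T}. Y (t, \<omega>) \<partial>lborel) \<noteq> \<infinity>"
    using fin by (intro nn_integral_noteq_infinite time_integral_measurable Y) auto
  then show ?thesis by eventually_elim (simp add: less_top)
qed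

end

section \<open>Paths of the BSDE solution\<close>

locale driven = control_problem +
  fixes G :: "real \<Rightarrow> 'a \<Rightarrow> real"
  assumes G_driver: "driver S W \<Theta> G"
    and G_bsde: "\<And>t. 0 \<le> t \<Longrightarrow> t \<le> T \<Longrightarrow> AE \<omega> in M. W t \<omega> = disutility S (\<lambda>_ _. uN S) \<omega>
        - compensated_integral S \<Theta> t T \<omega> - (LBINT s:{t..T}. G s \<omega>)"
begin

text \<open>Collects the almost sure properties once, after which the argument is deterministic. The
  BSDE is asked for at the rationals and at \<open>T\<close> only, so that countably many null sets
  suffice; cadlag paths supply the other times.\<close>

definition good :: "'a \<Rightarrow> bool" where
  "good \<omega> \<longleftrightarrow> \<omega> \<in> space M \<and> (\<forall>t\<in>{0..T}. 0 \<le> \<pi> t \<omega>) \<and> set_integrable lborel {0..T} (\<lambda>t. G t \<omega>) \<and>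
    (\<integral>\<^sup>+t\<in>{0..T}. K (t, \<omega>) * ennreal (\<pi> t \<omega>) \<partial>lborel) < \<infinity> \<and>
    (\<integral>\<^sup>+t\<in>{0..T}. ennreal (rprem S t \<omega> (uM S)) \<partial>lborel) < \<infinity> \<and>
    (\<integral>\<^sup>+t\<in>{0..T}. ennreal \<bar>prem S t \<omega>\<bar> \<partial>lborel) < \<infinity> \<and>
    (\<forall>t\<in>insert T {q\<in>\<rat>. 0 \<le> q \<and> q \<le> T}. W t \<omega> = disutility S (\<lambda>_ _. uN S) \<omega>
        - compensated_integral S \<Theta> t T \<omega> - (LBINT s:{t..T}. G s \<omega>)) \<and>
    (AE t in lborel. t \<in> {0..T} \<longrightarrow> G t \<omega> \<le> ff t \<omega> (us t \<omega>))"

lemma K_AE: "AE \<omega> in M. (\<integral>\<^sup>+t\<in>{0..T}. K (t, \<omega>) * ennreal (\<pi> t \<omega>) \<partial>lborel) < \<infinity>"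
proof -
  define D where "D x = (\<integral>\<^sup>+z. ennreal ((Th (x, z))\<^sup>2 * \<pi> (fst x) (snd x)) * indicator {0<..} z \<partial>F1 S)" for x
  have Dm: "D \<in> borel_measurable P"
  proof -
    have "(\<lambda>x. ennreal ((Th x)\<^sup>2 * \<pi> (fst (fst x)) (snd (fst x))) * indicator {0<..} (snd x)) \<in> borel_measurable (P \<Otimes>\<^sub>M borel)"
      by measurable
    from F1_nn_integral_predictable[OF this] show ?thesis unfolding D_def[abs_def] by simp
  qed
  have D: "D (t, \<omega>) = (\<integral>\<^sup>+z\<in>{0<..}. ennreal ((\<Theta> t \<omega> z)\<^sup>2 * \<pi> t \<omega>) \<partial>F1 S)" for t \<omega>
    unfolding D_def by (intro nn_integral_cong) (auto simp: Th_def indicator_def)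
  have "(\<integral>\<^sup>+\<omega>. (\<integral>\<^sup>+t\<in>{0..T}. D (t, \<omega>) \<partial>lborel) \<partial>M) < \<infinity>"
    unfolding D using \<Theta>_L2 by (simp add: L2_hat_def)
  from AE_time_integral_finite[OF Dm this] filt_left_nonneg AE_space
  show ?thesis
    by eventually_elim (rule K_integral_finite, auto simp: D)
qed

lemma swap_AE:
  assumes m: "{x\<in>space (borel \<Otimes>\<^sub>M M). Q (fst x) (snd x)} \<in> sets (borel \<Otimes>\<^sub>M M)"
  shows "(AE t in lborel. AE \<omega> in M. Q t \<omega>) \<longleftrightarrow> (AE \<omega> in M. AE t in lborel. Q t \<omega>)"
proof -
  interpret sw: pair_sigma_finite lborel M by unfold_locales
  have "sets (lborel \<Otimes>\<^sub>M M) = sets (borel \<Otimes>\<^sub>M M)" by (intro sets_pair_measure_cong) auto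
  then show ?thesis
    using m by (intro sw.AE_commute) (simp add: space_pair_measure)
qed

text \<open>The essential supremum is taken at each fixed time, whereas the path argument needs one
  path and almost every time. Null sets are swapped twice: once to bring the integrability required
  by \<open>us_max\<close> to fixed times, once to take the inequality back. At fixed times
  \<open>ff\<close> at \<open>us\<close> is an upper bound of the family, and \<open>us\<close> is
  not yet known to belong to it.\<close>

lemma G_le_ff: "AE \<omega> in M. AE t in lborel. t \<in> {0..T} \<longrightarrow> G t \<omega> \<le> ff t \<omega> (us t \<omega>)"
proof -
  define cl where "cl t = (if 0 \<le> t \<and> t \<le> T then t else 0)" for t
  have ffm: "(\<lambda>x. ff (fst x) (snd x) (us (fst x) (snd x))) \<in> borel_measurable P"
    by (intro ff_control_measurable us_predictable us_in)
  have Gm: "(\<lambda>(s, \<omega>). G s \<omega>) \<in> borel_measurable (restrict_space borel {0..T} \<Otimes>\<^sub>M M)"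
    and ess: "\<And>s. s \<in> {0..T} \<Longrightarrow> is_ess_sup M {\<lambda>\<omega>. ff s \<omega> (u s \<omega>) | u. u \<in> admissible S} (G s)"
    using G_driver by (auto simp: driver_def)
  have clm: "(\<lambda>x. (cl (fst x), snd x)) \<in> measurable (borel \<Otimes>\<^sub>M M) (restrict_space borel {0..T} \<Otimes>\<^sub>M M)"
    unfolding cl_def using T_pos by (intro measurable_Pair measurable_restrict_space2) auto
  have Gm': "(\<lambda>x. G (cl (fst x)) (snd x)) \<in> borel_measurable (borel \<Otimes>\<^sub>M M)"
    using measurable_compose[OF clm Gm] by simp
  have clP: "(\<lambda>x. (cl (fst x), snd x)) \<in> measurable (borel \<Otimes>\<^sub>M M) P"
    unfolding cl_def by (rule measurable_clamp)
  have ffm': "(\<lambda>x. ff (cl (fst x)) (snd x) (us (cl (fst x)) (snd x))) \<in> borel_measurable (borel \<Otimes>\<^sub>M M)"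
    using measurable_compose[OF clP ffm] by simp
  define Q where "Q t \<omega> \<longleftrightarrow> 0 \<le> \<pi> (cl t) \<omega> \<and> K (cl t, \<omega>) * ennreal (\<pi> (cl t) \<omega>) < \<infinity>" for t \<omega>
  have Qm: "{x\<in>space (borel \<Otimes>\<^sub>M M). Q (fst x) (snd x)} \<in> sets (borel \<Otimes>\<^sub>M M)"
  proof -
    have [measurable]: "(\<lambda>x. \<pi> (cl (fst x)) (snd x)) \<in> borel_measurable (borel \<Otimes>\<^sub>M M)"
      "(\<lambda>x. K (cl (fst x), snd x)) \<in> borel_measurable (borel \<Otimes>\<^sub>M M)"
      using measurable_compose[OF clP \<pi>_predictable] measurable_compose[OF clP K_predictable] by simp_all
    show ?thesis unfolding Q_def by measurable
  qed
  have "AE \<omega> in M. AE t in lborel. t \<in> {0..T} \<longrightarrow> Q t \<omega>"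
    using K_AE filt_left_nonneg AE_space
  proof eventually_elim
    case (elim \<omega>)
    have HP: "(\<lambda>x. K x * ennreal (\<pi> (fst x) (snd x))) \<in> borel_measurable P" by measurable
    have "AE t in lborel. K (t, \<omega>) * ennreal (\<pi> t \<omega>) * indicator {0..T} t \<noteq> \<infinity>"
      using elim path_measurable_ennreal[OF HP, of \<omega>] by (intro nn_integral_noteq_infinite) auto
    then show ?case
      by eventually_elim (use elim in \<open>auto simp: Q_def cl_def less_top\<close>)
  qed
  then have "AE t in lborel. AE \<omega> in M. t \<in> {0..T} \<longrightarrow> Q t \<omega>"
  proof (subst swap_AE)
    have "{x\<in>space (borel \<Otimes>\<^sub>M M). fst x \<in> {0..T} \<longrightarrow> Q (fst x) (snd x)} =
        {x\<in>space (borel \<Otimes>\<^sub>M M). fst x \<notin> {0..T}} \<union> {x\<in>space (borel \<Otimes>\<^sub>M M). Q (fst x) (snd x)}" by auto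
    moreover have "{x\<in>space (borel \<Otimes>\<^sub>M M). fst x \<notin> {0..T}} \<in> sets (borel \<Otimes>\<^sub>M M)" by measurable
    ultimately show "{x\<in>space (borel \<Otimes>\<^sub>M M). fst x \<in> {0..T} \<longrightarrow> Q (fst x) (snd x)} \<in> sets (borel \<Otimes>\<^sub>M M)"
      using Qm by simp
  qed
  then have "AE t in lborel. AE \<omega> in M. t \<in> {0..T} \<longrightarrow> G (cl t) \<omega> \<le> ff (cl t) \<omega> (us (cl t) \<omega>)"
  proof eventually_elim
    case (elim t)
    show ?case
    proof (cases "t \<in> {0..T}")
      case True
      then have t: "0 \<le> t" "t \<le> T" "cl t = t" by (auto simp: cl_def)
      have "(\<lambda>\<omega>. ff t \<omega> (us t \<omega>)) \<in> borel_measurable M"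
        using measurable_section[OF ffm t(1,2)] measurable_from_HH[OF t(1)] by simp
      moreover have "AE \<omega> in M. X \<omega> \<le> ff t \<omega> (us t \<omega>)"
        if X: "X \<in> {\<lambda>\<omega>. ff t \<omega> (u t \<omega>) | u. u \<in> admissible S}" for X
      proof -
        obtain u where u: "X = (\<lambda>\<omega>. ff t \<omega> (u t \<omega>))" "u \<in> admissible S" using X by auto
        have uU: "u t \<omega> \<in> UU S" if "\<omega> \<in> space M" for \<omega>
          using u(2) that True by (auto simp: admissible_def)
        show ?thesis using elim AE_space
        proof eventually_elim
          case (elim \<omega>)
          have "0 \<le> \<pi> t \<omega>" "K (t, \<omega>) * ennreal (\<pi> t \<omega>) < \<infinity>" using elim True t by (auto simp: Q_def)
          from fiber_VV[OF t(1,2) elim(2) this]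
          have "integrable (F1 S) (\<lambda>z. indicator {0<..} z * ((Wm t \<omega> + \<Theta> t \<omega> (max 0 z)) * \<pi> t \<omega>))"
            by (simp add: VV_def Th_def)
          then show ?case unfolding u(1) by (intro us_max t elim uU)
        qed
      qed
      ultimately have "AE \<omega> in M. G t \<omega> \<le> ff t \<omega> (us t \<omega>)"
        by (intro ess[OF True, unfolded is_ess_sup_def, THEN conjunct2, THEN conjunct2, THEN bspec, THEN mp] ballI)
      then show ?thesis using t by auto
    qed auto
  qed
  then have "AE \<omega> in M. AE t in lborel. t \<in> {0..T} \<longrightarrow> G (cl t) \<omega> \<le> ff (cl t) \<omega> (us (cl t) \<omega>)"
  proof (subst swap_AE[symmetric])
    have "{x\<in>space (borel \<Otimes>\<^sub>M M). fst x \<in> {0..T} \<longrightarrow> G (cl (fst x)) (snd x) \<le> ff (cl (fst x)) (snd x) (us (cl (fst x)) (snd x))} =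
        {x\<in>space (borel \<Otimes>\<^sub>M M). fst x \<notin> {0..T}} \<union>
        {x\<in>space (borel \<Otimes>\<^sub>M M). G (cl (fst x)) (snd x) \<le> ff (cl (fst x)) (snd x) (us (cl (fst x)) (snd x))}" by auto
    moreover have "{x\<in>space (borel \<Otimes>\<^sub>M M). fst x \<notin> {0..T}} \<in> sets (borel \<Otimes>\<^sub>M M)" by measurable
    moreover have "{x\<in>space (borel \<Otimes>\<^sub>M M). G (cl (fst x)) (snd x) \<le> ff (cl (fst x)) (snd x) (us (cl (fst x)) (snd x))} \<in> sets (borel \<Otimes>\<^sub>M M)"
      by (rule borel_measurable_le[OF Gm' ffm'])
    ultimately show "{x\<in>space (borel \<Otimes>\<^sub>M M). fst x \<in> {0..T} \<longrightarrow> G (cl (fst x)) (snd x) \<le> ff (cl (fst x)) (snd x) (us (cl (fst x)) (snd x))} \<in> sets (borel \<Otimes>\<^sub>M M)"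
      by simp
  qed
  then show ?thesis
    by eventually_elim (erule eventually_mono, auto simp: cl_def)
qed

lemma AE_good: "AE \<omega> in M. good \<omega>"
proof -
  have 1: "AE \<omega> in M. set_integrable lborel {0..T} (\<lambda>t. G t \<omega>)"
    using G_driver by (simp add: driver_def)
  have rm: "(\<lambda>x. ennreal (rprem S (fst x) (snd x) (uM S))) \<in> borel_measurable P"
    using rprem_measurable[OF uM_in] by measurable
  have 2: "AE \<omega> in M. (\<integral>\<^sup>+t\<in>{0..T}. ennreal (rprem S t \<omega> (uM S)) \<partial>lborel) < \<infinity>"
    using AE_time_integral_finite[OF rm] rprem_finite by simp
  have pm: "(\<lambda>x. ennreal \<bar>prem S (fst x) (snd x)\<bar>) \<in> borel_measurable P"
    using prem_measurable by measurable
  have 3: "AE \<omega> in M. (\<integral>\<^sup>+t\<in>{0..T}. ennreal \<bar>prem S t \<omega>\<bar> \<partial>lborel) < \<infinity>"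
    using AE_time_integral_finite[OF pm] prem_finite by simp
  have 4: "AE \<omega> in M. \<forall>t\<in>insert T {q\<in>\<rat>. 0 \<le> q \<and> q \<le> T}. W t \<omega> = disutility S (\<lambda>_ _. uN S) \<omega>
        - compensated_integral S \<Theta> t T \<omega> - (LBINT s:{t..T}. G s \<omega>)"
  proof (subst AE_ball_countable)
    show "countable (insert T {q\<in>\<rat>. 0 \<le> q \<and> q \<le> T})"
      by (rule countable_subset[of _ "insert T \<rat>"]) (auto intro: countable_rat)
    show "\<forall>t\<in>insert T {q\<in>\<rat>. 0 \<le> q \<and> q \<le> T}. AE \<omega> in M. W t \<omega> = disutility S (\<lambda>_ _. uN S) \<omega>
        - compensated_integral S \<Theta> t T \<omega> - (LBINT s:{t..T}. G s \<omega>)"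
      using T_pos by (intro ballI G_bsde) auto
  qed
  show ?thesis
    using 1 2 3 4 K_AE G_le_ff filt_left_nonneg AE_space
    by eventually_elim (unfold good_def, intro conjI)
qed

section \<open>One good path: integrability and the forward equation\<close>

context
  fixes \<omega> assumes good: "good \<omega>"
begin

lemma in_space: "\<omega> \<in> space M" and \<pi>_nonneg: "0 \<le> t \<Longrightarrow> t \<le> T \<Longrightarrow> 0 \<le> \<pi> t \<omega>"
  and G_integrable: "set_integrable lborel {0..T} (\<lambda>t. G t \<omega>)"
  and K_finite: "(\<integral>\<^sup>+t\<in>{0..T}. K (t, \<omega>) * ennreal (\<pi> t \<omega>) \<partial>lborel) < \<infinity>"
  and rprem_path_finite: "(\<integral>\<^sup>+t\<in>{0..T}. ennreal (rprem S t \<omega> (uM S)) \<partial>lborel) < \<infinity>"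
  and prem_path_finite: "(\<integral>\<^sup>+t\<in>{0..T}. ennreal \<bar>prem S t \<omega>\<bar> \<partial>lborel) < \<infinity>"
  and G_le: "AE t in lborel. t \<in> {0..T} \<longrightarrow> G t \<omega> \<le> ff t \<omega> (us t \<omega>)"
  using good unfolding good_def by simp_all

lemma bsde_path: "t \<in> insert T {q\<in>\<rat>. 0 \<le> q \<and> q \<le> T} \<Longrightarrow> W t \<omega> = disutility S (\<lambda>_ _. uN S) \<omega>
        - compensated_integral S \<Theta> t T \<omega> - (LBINT s:{t..T}. G s \<omega>)"
proof -
  have "\<forall>t\<in>insert T {q\<in>\<rat>. 0 \<le> q \<and> q \<le> T}. W t \<omega> = disutility S (\<lambda>_ _. uN S) \<omega>
        - compensated_integral S \<Theta> t T \<omega> - (LBINT s:{t..T}. G s \<omega>)"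
    using good unfolding good_def by (elim conjE)
  then show "t \<in> insert T {q\<in>\<rat>. 0 \<le> q \<and> q \<le> T} \<Longrightarrow> W t \<omega> = disutility S (\<lambda>_ _. uN S) \<omega>
        - compensated_integral S \<Theta> t T \<omega> - (LBINT s:{t..T}. G s \<omega>)" by (rule bspec)
qed

lemma AE_K_finite: "AE t in lborel. t \<in> {0..T} \<longrightarrow> K (t, \<omega>) * ennreal (\<pi> t \<omega>) < \<infinity>"
proof -
  have HP: "(\<lambda>x. K x * ennreal (\<pi> (fst x) (snd x))) \<in> borel_measurable P" by measurable
  have "AE t in lborel. K (t, \<omega>) * ennreal (\<pi> t \<omega>) * indicator {0..T} t \<noteq> \<infinity>"
    using K_finite path_measurable_ennreal[OF HP in_space] by (intro nn_integral_noteq_infinite) auto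
  then show ?thesis by eventually_elim (auto simp: less_top)
qed

lemma kk_nonneg: "0 \<le> t \<Longrightarrow> t \<le> T \<Longrightarrow> 0 \<le> kk (t, \<omega>)"
  using \<pi>_nonneg by (simp add: kk_def)

lemma kk_integrable: "set_integrable lborel {0..T} (\<lambda>t. kk (t, \<omega>))"
proof (rule set_integrable_nonnegI[OF path_measurable[OF kk_predictable in_space]])
  have "(\<integral>\<^sup>+t\<in>{0..T}. ennreal (kk (t, \<omega>)) \<partial>lborel) = (\<integral>\<^sup>+t\<in>{0..T}. K (t, \<omega>) * ennreal (\<pi> t \<omega>) \<partial>lborel)"
  proof (rule nn_integral_cong_AE)
    show "AE t in lborel. ennreal (kk (t, \<omega>)) * indicator {0..T} t = K (t, \<omega>) * ennreal (\<pi> t \<omega>) * indicator {0..T} t"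
      using AE_K_finite
      by eventually_elim (use fiber_kk[OF _ _ in_space \<pi>_nonneg] in \<open>auto simp: indicator_def\<close>)
  qed
  then show "(\<integral>\<^sup>+t\<in>{0..T}. ennreal (kk (t, \<omega>)) \<partial>lborel) < \<infinity>" using K_finite by simp
qed (use kk_nonneg in auto)

lemma BB_integrable: "set_integrable lborel {0..T} (\<lambda>t. BB (t, \<omega>))"
proof (rule set_integrable_AE_bound[OF kk_integrable path_measurable[OF BB_predictable in_space]])
  show "AE t in lborel. t \<in> {0..T} \<longrightarrow> \<bar>BB (t, \<omega>)\<bar> \<le> kk (t, \<omega>)"
    using AE_K_finite by eventually_elim (use fiber_BB[OF _ _ in_space \<pi>_nonneg] in auto)
qed

lemma pp_integrable: "set_integrable lborel {0..T} (\<lambda>t. pp (t, \<omega>))"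
proof (rule set_integrable_AE_bound[OF kk_integrable path_measurable[OF pp_predictable in_space]])
  show "AE t in lborel. t \<in> {0..T} \<longrightarrow> \<bar>pp (t, \<omega>)\<bar> \<le> kk (t, \<omega>)"
    using AE_K_finite
    by eventually_elim (use fiber_pp(1,2)[OF _ _ in_space \<pi>_nonneg] in auto)
qed

lemma nn_integrable: "set_integrable lborel {0..T} (\<lambda>t. nn (t, \<omega>))"
proof (rule set_integrable_AE_bound[OF kk_integrable path_measurable[OF nn_predictable in_space]])
  show "AE t in lborel. t \<in> {0..T} \<longrightarrow> \<bar>nn (t, \<omega>)\<bar> \<le> kk (t, \<omega>)"
    using AE_K_finite
    by eventually_elim (use fiber_nn(1,2)[OF _ _ in_space \<pi>_nonneg] in auto)
qed

lemma rprem_integrable: "set_integrable lborel {0..T} (\<lambda>t. rprem S t \<omega> (uM S))"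
  using path_measurable[OF rprem_measurable[OF uM_in] in_space] rprem_props(3)[OF _ _ in_space uM_in] rprem_path_finite
  by (intro set_integrable_nonnegI) auto

lemma qs_integrable: "set_integrable lborel {0..T} (\<lambda>t. qs (t, \<omega>))"
  using qs_nonneg[OF _ _ in_space] qs_le[OF _ _ in_space]
  by (intro set_integrable_AE_bound[OF rprem_integrable path_measurable[OF qs_predictable in_space]] AE_I2) auto

lemma prem_integrable: "set_integrable lborel {0..T} (\<lambda>t. prem S t \<omega>)"
proof -
  have pm: "(\<lambda>x. \<bar>prem S (fst x) (snd x)\<bar>) \<in> borel_measurable P" using prem_measurable by measurable
  have "set_integrable lborel {0..T} (\<lambda>t. \<bar>prem S t \<omega>\<bar>)"
    using path_measurable[OF pm in_space] prem_path_finite by (intro set_integrable_nonnegI) auto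
  moreover have "(\<lambda>t. indicator {0..T} t *\<^sub>R prem S t \<omega>) \<in> borel_measurable lborel"
    using path_measurable[OF prem_measurable in_space] by (simp only: fst_conv snd_conv)
  ultimately show ?thesis by (rule set_integrable_AE_bound) simp
qed

lemma dq_integrable: "set_integrable lborel {0..T} (\<lambda>t. discount S t * qs (t, \<omega>))"
proof -
  have "continuous_on {0..T} (discount S)" unfolding discount_def by (intro continuous_intros)
  from set_integrable_mult_continuous[OF qs_integrable this] show ?thesis by (simp add: mult.commute)
qed

lemma dq_nonneg: "0 \<le> t \<Longrightarrow> t \<le> T \<Longrightarrow> 0 \<le> discount S t * qs (t, \<omega>)"
  using qs_nonneg[OF _ _ in_space] discount_pos[of t] by (intro mult_nonneg_nonneg) (auto intro: less_imp_le)

lemma Cq_eq: "0 \<le> t \<Longrightarrow> t \<le> T \<Longrightarrow> Cq (t, \<omega>) = (LBINT r:{0..t}. discount S r * qs (r, \<omega>))"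
proof -
  assume t: "0 \<le> t" "t \<le> T"
  have "0 \<le> (LBINT r:{0..t}. discount S r * qs (r, \<omega>))"
    unfolding set_lebesgue_integral_def using dq_nonneg t by (intro Bochner_Integration.integral_nonneg) (auto simp: indicator_def)
  then show ?thesis
    unfolding Cq_def fst_conv snd_conv using time_integral_eq[OF dq_integrable dq_nonneg t(2)] by simp
qed

lemma Cq_le: "0 \<le> t \<Longrightarrow> t \<le> T \<Longrightarrow> Cq (t, \<omega>) \<le> Cq (T, \<omega>)"
  using LBINT_mono_nonneg[OF dq_integrable dq_nonneg, of t T] T_pos by (simp add: Cq_eq)

lemma aa_nonneg: "0 \<le> t \<Longrightarrow> t \<le> T \<Longrightarrow> 0 \<le> aa (t, \<omega>)"
  using kk_nonneg by (simp add: aa_def)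

lemma aa_integrable: "set_integrable lborel {0..T} (\<lambda>t. aa (t, \<omega>))"
proof -
  have "(\<lambda>x. exp (Cq x)) \<in> borel_measurable P" by measurable
  from path_measurable[OF this in_space] show ?thesis
    unfolding aa_def using Cq_le
    by (intro set_integrable_bounded_mult[OF kk_integrable, where B="exp (Cq (T, \<omega>))"]) auto
qed

lemma AA_eq: "0 \<le> t \<Longrightarrow> t \<le> T \<Longrightarrow> AA (t, \<omega>) = (LBINT r:{0..t}. aa (r, \<omega>))"
proof -
  assume t: "0 \<le> t" "t \<le> T"
  have "0 \<le> (LBINT r:{0..t}. aa (r, \<omega>))"
    unfolding set_lebesgue_integral_def using aa_nonneg t by (intro Bochner_Integration.integral_nonneg) (auto simp: indicator_def)
  then show ?thesis
    unfolding AA_def fst_conv snd_conv using time_integral_eq[OF aa_integrable aa_nonneg t(2)] by simp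
qed

lemma W_terminal: "W T \<omega> = disutility S (\<lambda>_ _. uN S) \<omega>"
proof -
  have "compensated_integral S \<Theta> T T \<omega> = 0"
    unfolding compensated_integral_def LBINT_singleton by (simp add: set_lebesgue_integral_def)
  then show ?thesis using bsde_path[of T] unfolding LBINT_singleton by simp
qed

text \<open>Forward form of the backward equation. Subtracting the equation at \<open>0\<close> from
  the one at \<open>s\<close> removes the terminal value and leaves the jumps up to and including
  \<open>s\<close>; right-continuity then reaches all times.\<close>

lemma W_path:
  assumes "0 \<le> t" "t \<le> T"
  shows "W t \<omega> = W 0 \<omega> + (\<Sum>n=1..N t \<omega>. Th ((tau \<omega> n, \<omega>), Z n \<omega>)) + (LBINT s:{0..t}. G s \<omega> - BB (s, \<omega>))"
proof -
  let ?th = "\<lambda>n. Th ((tau \<omega> n, \<omega>), Z n \<omega>)"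
  define g where "g t = W 0 \<omega> + (\<Sum>n=1..N t \<omega>. ?th n) + (LBINT s:{0..t}. G s \<omega> - BB (s, \<omega>))" for t
  have a_int: "set_integrable lborel {0..T} (\<lambda>s. G s \<omega> - BB (s, \<omega>))"
    by (intro set_integral_diff G_integrable BB_integrable)
  have BBeq: "(LINT z:{0<..}|F1 S. \<Theta> s \<omega> z * \<pi> s \<omega>) = BB (s, \<omega>)" for s
    unfolding set_lebesgue_integral_def BB_def
    by (intro Bochner_Integration.integral_cong) (auto simp: Th_def indicator_def)
  have sub: "set_integrable lborel {a..b} f" if "set_integrable lborel {0..T} f" "0 \<le> a" "b \<le> T" for f :: "real \<Rightarrow> real" and a b
    using that by (intro set_integrable_subset[OF that(1)]) auto
  have eqn: "W s \<omega> = disutility S (\<lambda>_ _. uN S) \<omega> - (\<Sum>n=1..N T \<omega>. if s < tau \<omega> n then ?th n else 0)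
      - (LBINT r:{s..T}. G r \<omega> - BB (r, \<omega>))" if s: "s \<in> insert T {q\<in>\<rat>. 0 \<le> q \<and> q \<le> T}" for s
  proof -
    have s': "0 \<le> s" "s \<le> T" using s T_pos by auto
    have "set_lebesgue_integral (m1 S \<omega>) ({s<..T} \<times> {0<..}) (\<lambda>(s, z). \<Theta> s \<omega> z) =
        (\<Sum>n=1..N T \<omega>. if s < tau \<omega> n then ?th n else 0)"
      by (rule jump_measure_path_integral[OF Th_measurable _ in_space s']) (simp add: Th_def)
    then have "compensated_integral S \<Theta> s T \<omega> =
        (\<Sum>n=1..N T \<omega>. if s < tau \<omega> n then ?th n else 0) - (LBINT r:{s..T}. BB (r, \<omega>))"
      unfolding compensated_integral_def BBeq by (simp only:)
    then show ?thesis
      using bsde_path[OF s] set_integral_diff(2)[OF sub[OF G_integrable s'(1) order_refl] sub[OF BB_integrable s'(1) order_refl]]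
      by simp
  qed
  have fg: "W s \<omega> = g s" if s: "s \<in> insert T {q\<in>\<rat>. 0 \<le> q \<and> q \<le> T}" for s
  proof -
    have s': "0 \<le> s" "s \<le> T" using s T_pos by auto
    have "(\<Sum>n=1..N T \<omega>. if 0 < tau \<omega> n then ?th n else 0) - (\<Sum>n=1..N T \<omega>. if s < tau \<omega> n then ?th n else 0)
        = (\<Sum>n=1..N T \<omega>. if n \<le> N s \<omega> then ?th n else 0)"
      unfolding sum_subtractf[symmetric]
    proof (rule sum.cong)
      fix n assume n: "n \<in> {1..N T \<omega>}"
      then have "0 < tau \<omega> n" using J_eq_tau(2)[OF in_space, of n] by auto
      moreover have "n \<le> N s \<omega> \<longleftrightarrow> tau \<omega> n \<le> s" using le_counting_tau[OF in_space, of n s] n by auto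
      ultimately show "(if 0 < tau \<omega> n then ?th n else 0) - (if s < tau \<omega> n then ?th n else 0) = (if n \<le> N s \<omega> then ?th n else 0)"
        by auto
    qed simp
    also have "\<dots> = (\<Sum>n=1..N s \<omega>. ?th n)"
    proof -
      have "N s \<omega> \<le> N T \<omega>" using counting_mono[OF J in_space s'(2)] .
      then have "(\<Sum>n=1..N T \<omega>. if n \<le> N s \<omega> then ?th n else 0) = (\<Sum>n=1..N s \<omega>. if n \<le> N s \<omega> then ?th n else 0)"
        by (intro sum.mono_neutral_right) auto
      then show ?thesis by simp
    qed
    finally show ?thesis
      using eqn[OF s] eqn[of 0] T_pos LBINT_combine[OF a_int order_refl s'(1) order_trans[OF s'(2) order_refl]]
        LBINT_combine[OF a_int, of s T] s' by (simp add: g_def)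
  qed
  have "(g \<longlongrightarrow> g s) (at_right s)" if s: "0 \<le> s" "s < T" for s
  proof -
    have "continuous_on {0..T} (\<lambda>r. LBINT v:{0..r}. G v \<omega> - BB (v, \<omega>))" by (rule continuous_on_LBINT[OF a_int])
    then have "((\<lambda>r. LBINT v:{0..r}. G v \<omega> - BB (v, \<omega>)) \<longlongrightarrow> (LBINT v:{0..s}. G v \<omega> - BB (v, \<omega>))) (at s within {0..T})"
      using s by (auto simp: continuous_on_def)
    then have "((\<lambda>r. LBINT v:{0..r}. G v \<omega> - BB (v, \<omega>)) \<longlongrightarrow> (LBINT v:{0..s}. G v \<omega> - BB (v, \<omega>))) (at s within {s..T})"
      by (rule tendsto_within_subset) (use s in auto)
    then have lim: "((\<lambda>r. LBINT v:{0..r}. G v \<omega> - BB (v, \<omega>)) \<longlongrightarrow> (LBINT v:{0..s}. G v \<omega> - BB (v, \<omega>))) (at_right s)"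
      using s by (simp add: at_within_Icc_at_right)
    have "((\<lambda>r. \<Sum>n=1..N r \<omega>. ?th n) \<longlongrightarrow> (\<Sum>n=1..N s \<omega>. ?th n)) (at_right s)"
      using counting_right_cont[OF in_space s] by (intro tendsto_eventually) (auto elim: eventually_mono)
    then show ?thesis unfolding g_def by (intro tendsto_intros lim)
  qed
  then have "W t \<omega> = g t"
    using fg T_pos by (intro cadlag_eqI[OF W_cadlag[OF in_space] _ _ _ assms]) auto
  then show ?thesis by (simp add: g_def)
qed

end

end

section \<open>Measurable time integrals and the trivial initial information\<close>

context contagion
begin

lemma LBINT_measurable:
  fixes Y :: "real \<times> 'a \<Rightarrow> real"
  assumes Y: "Y \<in> borel_measurable P"
  shows "(\<lambda>\<omega>. LBINT t:{0..T}. Y (t, \<omega>)) \<in> borel_measurable M"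
proof -
  have "(\<lambda>x. Y (if 0 \<le> fst x \<and> fst x \<le> T then fst x else 0, snd x)) \<in> borel_measurable (borel \<Otimes>\<^sub>M M)"
    by (rule measurable_compose[OF measurable_clamp Y])
  then have m: "(\<lambda>x. indicator {0..T} (fst x) * Y (if 0 \<le> fst x \<and> fst x \<le> T then fst x else 0, snd x)) \<in> borel_measurable (borel \<Otimes>\<^sub>M M)"
    by (intro borel_measurable_times borel_measurable_indicator') auto
  have "(\<lambda>x. (snd x, fst x)) \<in> measurable (M \<Otimes>\<^sub>M lborel) (borel \<Otimes>\<^sub>M M)" by measurable
  from measurable_compose[OF this m]
  have "(\<lambda>x. indicator {0..T} (snd x) * Y (if 0 \<le> snd x \<and> snd x \<le> T then snd x else 0, fst x)) \<in> borel_measurable (M \<Otimes>\<^sub>M lborel)"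
    by (simp only: fst_conv snd_conv)
  then have "(\<lambda>\<omega>. LINT t|lborel. indicator {0..T} t * Y (if 0 \<le> t \<and> t \<le> T then t else 0, \<omega>)) \<in> borel_measurable M"
    by (intro lborel.borel_measurable_lebesgue_integral) (simp add: case_prod_beta')
  also have "(\<lambda>\<omega>. LINT t|lborel. indicator {0..T} t * Y (if 0 \<le> t \<and> t \<le> T then t else 0, \<omega>)) = (\<lambda>\<omega>. LBINT t:{0..T}. Y (t, \<omega>))"
    unfolding set_lebesgue_integral_def by (intro ext Bochner_Integration.integral_cong) (auto simp: indicator_def)
  finally show ?thesis .
qed

text \<open>Jump times are positive, so the loss at 0 vanishes identically and generates the trivial
  \<sigma>-algebra. This makes \<open>W 0\<close> a constant on the whole space.\<close>

lemma sets_HH_0: "sets (HH S 0) \<subseteq> {{}, space M}"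
proof -
  have J_gt: "N 0 \<omega> = 0" if "\<omega> \<in> space M" for \<omega>
    using jump_times_pos[OF J that, of 1] le_counting_iff[OF J that, of 1 0] by (cases "N 0 \<omega> = 0") (auto simp: zero_ereal_def)
  have "sets (HH S 0) \<subseteq> sets (sigma (space M) {})"
  proof (rule HH_least)
    fix r :: real assume "0 \<le> r" "r \<le> 0"
    then have r: "r = 0" by simp
    have "loss S r \<in> borel_measurable (sigma (space M) {}) \<longleftrightarrow> (\<lambda>_. 0::real) \<in> borel_measurable (sigma (space M) {})"
      by (rule measurable_cong) (simp add: r loss_def J_gt)
    then show "loss S r \<in> borel_measurable (sigma (space M) {})" by simp
  qed simp
  also have "\<dots> = {{}, space M}" by (simp add: sigma_sets_empty_eq)
  finally show ?thesis .
qed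

lemma HH_0_constant:
  fixes f :: "'a \<Rightarrow> real"
  assumes f: "f \<in> borel_measurable (HH S 0)"
  obtains c where "\<And>\<omega>. \<omega> \<in> space M \<Longrightarrow> f \<omega> = c"
proof -
  obtain \<omega>0 where \<omega>0: "\<omega>0 \<in> space M" using not_empty by blast
  have "f -` {f \<omega>0} \<inter> space (HH S 0) \<in> sets (HH S 0)" using f by (rule measurable_sets) simp
  then have "f -` {f \<omega>0} \<inter> space M \<in> {{}, space M}" using sets_HH_0 by (auto simp: space_HH)
  moreover have "\<omega>0 \<in> f -` {f \<omega>0} \<inter> space M" using \<omega>0 by simp
  ultimately have "f -` {f \<omega>0} \<inter> space M = space M" by blast
  then show ?thesis by (intro that[of "f \<omega>0"]) blast
qed

end

section \<open>Wealth, admissible strategies and the value at time 0\<close>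

context market
begin

lemma wealth_jump_part:
  assumes u: "(\<lambda>x. u (fst x) (snd x)) \<in> borel_measurable P" and uU: "\<And>t \<omega>. 0 \<le> t \<Longrightarrow> t \<le> T \<Longrightarrow> \<omega> \<in> space M \<Longrightarrow> u t \<omega> \<in> UU S"
  defines "Y \<equiv> \<lambda>x. exp (rate S * (T - fst (fst x))) * Phi S (max 0 (snd x)) (u (fst (fst x)) (snd (fst x)))"
  shows "Y \<in> borel_measurable (P \<Otimes>\<^sub>M borel)"
    and "\<omega> \<in> space M \<Longrightarrow> set_lebesgue_integral (m1 S \<omega>) ({0<..T} \<times> {0<..}) (\<lambda>(s, z). exp (rate S * (T - s)) * Phi S z (u s \<omega>)) =
      (\<Sum>n=1..N T \<omega>. Y ((tau \<omega> n, \<omega>), Z n \<omega>))"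
proof -
  have Ph: "(\<lambda>x. Phi S (max 0 (snd x)) (u (fst (fst x)) (snd (fst x)))) \<in> borel_measurable (P \<Otimes>\<^sub>M borel)"
    using Phi_control_measurable[OF u] uU by (auto simp: space_P)
  have [measurable]: "(\<lambda>x. fst (fst x)) \<in> borel_measurable (P \<Otimes>\<^sub>M borel)"
    using measurable_compose[OF measurable_fst measurable_fst_P] .
  show Ym: "Y \<in> borel_measurable (P \<Otimes>\<^sub>M borel)"
    unfolding Y_def using Ph by measurable
  assume \<omega>: "\<omega> \<in> space M"
  have "set_lebesgue_integral (m1 S \<omega>) ({0<..T} \<times> {0<..}) (\<lambda>(s, z). exp (rate S * (T - s)) * Phi S z (u s \<omega>)) =
      (\<Sum>n=1..N T \<omega>. if 0 < tau \<omega> n then Y ((tau \<omega> n, \<omega>), Z n \<omega>) else 0)"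
    by (rule jump_measure_path_integral[OF Ym _ \<omega>]) (use T_pos in \<open>auto simp: Y_def\<close>)
  also have "\<dots> = (\<Sum>n=1..N T \<omega>. Y ((tau \<omega> n, \<omega>), Z n \<omega>))"
    using J_eq_tau(2)[OF \<omega>] by (intro sum.cong) auto
  finally show "set_lebesgue_integral (m1 S \<omega>) ({0<..T} \<times> {0<..}) (\<lambda>(s, z). exp (rate S * (T - s)) * Phi S z (u s \<omega>)) =
      (\<Sum>n=1..N T \<omega>. Y ((tau \<omega> n, \<omega>), Z n \<omega>))" .
qed

lemma wealth_eq:
  assumes u: "(\<lambda>x. u (fst x) (snd x)) \<in> borel_measurable P" and uU: "\<And>t \<omega>. 0 \<le> t \<Longrightarrow> t \<le> T \<Longrightarrow> \<omega> \<in> space M \<Longrightarrow> u t \<omega> \<in> UU S"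
    and \<omega>: "\<omega> \<in> space M"
  shows "wealth S u T \<omega> = wealth0 S * exp (rate S * T)
    + (LBINT s:{0..T}. exp (rate S * (T - s)) * (prem S s \<omega> - rprem S s \<omega> (u s \<omega>)))
    - (\<Sum>n=1..N T \<omega>. exp (rate S * (T - tau \<omega> n)) * Phi S (max 0 (Z n \<omega>)) (u (tau \<omega> n) \<omega>))"
proof -
  have "set_lebesgue_integral (m1 S \<omega>) ({0<..T} \<times> {0<..}) (\<lambda>(s, z). exp (rate S * (T - s)) * Phi S z (u s \<omega>)) =
      (\<Sum>n=1..N T \<omega>. exp (rate S * (T - tau \<omega> n)) * Phi S (max 0 (Z n \<omega>)) (u (tau \<omega> n) \<omega>))"
    using wealth_jump_part(2)[of u \<omega>] u uU \<omega> by simp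
  then show ?thesis by (simp add: wealth_def)
qed

lemma cash_flow_predictable:
  assumes u: "(\<lambda>x. u (fst x) (snd x)) \<in> borel_measurable P" and uU: "\<And>t \<omega>. 0 \<le> t \<Longrightarrow> t \<le> T \<Longrightarrow> \<omega> \<in> space M \<Longrightarrow> u t \<omega> \<in> UU S"
  shows "(\<lambda>x. exp (rate S * (T - fst x)) * (prem S (fst x) (snd x) - rprem S (fst x) (snd x) (u (fst x) (snd x)))) \<in> borel_measurable P"
  using prem_measurable rprem_control_measurable[of u, OF u uU] by measurable

lemma disutility_measurable:
  assumes u: "(\<lambda>x. u (fst x) (snd x)) \<in> borel_measurable P" and uU: "\<And>t \<omega>. 0 \<le> t \<Longrightarrow> t \<le> T \<Longrightarrow> \<omega> \<in> space M \<Longrightarrow> u t \<omega> \<in> UU S"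
  shows "disutility S u \<in> borel_measurable M"
proof -
  have 1: "(\<lambda>\<omega>. LBINT s:{0..T}. exp (rate S * (T - s)) * (prem S s \<omega> - rprem S s \<omega> (u s \<omega>))) \<in> borel_measurable M"
    using LBINT_measurable[OF cash_flow_predictable[of u, OF u uU]] by (simp only: fst_conv snd_conv)
  let ?Y = "\<lambda>x. exp (rate S * (T - fst (fst x))) * Phi S (max 0 (snd x)) (u (fst (fst x)) (snd (fst x)))"
  have "(\<lambda>\<omega>. \<Sum>n=1..N T \<omega>. ?Y ((real_of_ereal (J n \<omega>), \<omega>), Z n \<omega>)) \<in> borel_measurable M"
    by (rule jump_value_measurable[OF wealth_jump_part(1)]) (use u uU in auto)
  then have 2: "(\<lambda>\<omega>. \<Sum>n=1..N T \<omega>. exp (rate S * (T - tau \<omega> n)) * Phi S (max 0 (Z n \<omega>)) (u (tau \<omega> n) \<omega>)) \<in> borel_measurable M"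
    by (rule measurable_cong[THEN iffD1, rotated]) (auto simp: tau_def intro!: sum.cong)
  have "(\<lambda>\<omega>. exp (- eta S * (wealth0 S * exp (rate S * T)
    + (LBINT s:{0..T}. exp (rate S * (T - s)) * (prem S s \<omega> - rprem S s \<omega> (u s \<omega>)))
    - (\<Sum>n=1..N T \<omega>. exp (rate S * (T - tau \<omega> n)) * Phi S (max 0 (Z n \<omega>)) (u (tau \<omega> n) \<omega>))))) \<in> borel_measurable M"
    using 1 2 by measurable
  then show ?thesis
  proof (rule measurable_cong[THEN iffD1, rotated])
    fix \<omega> assume "\<omega> \<in> space M"
    from wealth_eq[of u, OF u _ this] uU
    show "exp (- eta S * (wealth0 S * exp (rate S * T)
      + (LBINT s:{0..T}. exp (rate S * (T - s)) * (prem S s \<omega> - rprem S s \<omega> (u s \<omega>)))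
      - (\<Sum>n=1..N T \<omega>. exp (rate S * (T - tau \<omega> n)) * Phi S (max 0 (Z n \<omega>)) (u (tau \<omega> n) \<omega>)))) = disutility S u \<omega>"
      by (simp add: disutility_def)
  qed
qed

lemma admissible_predictable:
  "u \<in> admissible S \<Longrightarrow> (\<lambda>x. u (fst x) (snd x)) \<in> borel_measurable P"
  "u \<in> admissible S \<Longrightarrow> 0 \<le> t \<Longrightarrow> t \<le> T \<Longrightarrow> \<omega> \<in> space M \<Longrightarrow> u t \<omega> \<in> UU S"
  by (simp_all add: admissible_def case_prod_beta' del: atLeastAtMost_iff) (simp add: admissible_def)

text \<open>Changing a strategy at time 0 does not change the wealth, so the value process at time 0
  is the value of the unconstrained problem.\<close>

lemma admissible_initial:
  assumes v: "v \<in> admissible S"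
  defines "v' \<equiv> \<lambda>t \<omega>. if t = 0 then uN S else v t \<omega>"
  shows "v' \<in> admissible S" and "\<omega> \<in> space M \<Longrightarrow> disutility S v' \<omega> = disutility S v \<omega>"
proof -
  have vm: "(\<lambda>x. v (fst x) (snd x)) \<in> borel_measurable P"
    and vU: "\<And>t \<omega>. 0 \<le> t \<Longrightarrow> t \<le> T \<Longrightarrow> \<omega> \<in> space M \<Longrightarrow> v t \<omega> \<in> UU S"
    using admissible_predictable[OF v] by blast+
  have v'm: "(\<lambda>x. v' (fst x) (snd x)) \<in> borel_measurable P"
    unfolding v'_def using vm by measurable
  have v'U: "\<And>t \<omega>. 0 \<le> t \<Longrightarrow> t \<le> T \<Longrightarrow> \<omega> \<in> space M \<Longrightarrow> v' t \<omega> \<in> UU S"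
    unfolding v'_def using vU uN_in by auto
  have eq: "disutility S v' \<omega> = disutility S v \<omega>" if \<omega>: "\<omega> \<in> space M" for \<omega>
  proof -
    have "(LBINT s:{0..T}. exp (rate S * (T - s)) * (prem S s \<omega> - rprem S s \<omega> (v' s \<omega>))) =
        (LBINT s:{0..T}. exp (rate S * (T - s)) * (prem S s \<omega> - rprem S s \<omega> (v s \<omega>)))"
      unfolding set_lebesgue_integral_def
    proof (rule integral_cong_AE)
      show "(\<lambda>s. indicator {0..T} s *\<^sub>R (exp (rate S * (T - s)) * (prem S s \<omega> - rprem S s \<omega> (v' s \<omega>)))) \<in> borel_measurable lborel"
        using path_measurable[OF cash_flow_predictable[of v', OF v'm v'U] \<omega>] by (simp only: fst_conv snd_conv)
      show "(\<lambda>s. indicator {0..T} s *\<^sub>R (exp (rate S * (T - s)) * (prem S s \<omega> - rprem S s \<omega> (v s \<omega>)))) \<in> borel_measurable lborel"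
        using path_measurable[OF cash_flow_predictable[of v, OF vm vU] \<omega>] by (simp only: fst_conv snd_conv)
      have "AE s in lborel. s \<noteq> (0::real)" by (rule AE_lborel_singleton)
      then show "AE s in lborel. indicator {0..T} s *\<^sub>R (exp (rate S * (T - s)) * (prem S s \<omega> - rprem S s \<omega> (v' s \<omega>))) =
          indicator {0..T} s *\<^sub>R (exp (rate S * (T - s)) * (prem S s \<omega> - rprem S s \<omega> (v s \<omega>)))"
        by eventually_elim (simp add: v'_def)
    qed
    moreover have "set_lebesgue_integral (m1 S \<omega>) ({0<..T} \<times> {0<..}) (\<lambda>(s, z). exp (rate S * (T - s)) * Phi S z (v' s \<omega>)) =
        set_lebesgue_integral (m1 S \<omega>) ({0<..T} \<times> {0<..}) (\<lambda>(s, z). exp (rate S * (T - s)) * Phi S z (v s \<omega>))"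
      unfolding set_lebesgue_integral_def
      by (intro Bochner_Integration.integral_cong) (auto simp: v'_def indicator_def)
    ultimately show ?thesis by (simp add: disutility_def wealth_def)
  qed
  then show "\<omega> \<in> space M \<Longrightarrow> disutility S v' \<omega> = disutility S v \<omega>" .
  have "integrable M (disutility S v)" using v by (simp add: admissible_def)
  then have "integrable M (disutility S v')"
    by (subst Bochner_Integration.integrable_cong[OF refl, of _ _ "disutility S v"]) (auto intro: eq)
  then show "v' \<in> admissible S"
    using v'm v'U by (auto simp: admissible_def case_prod_beta')
qed

text \<open>The essential infimum lies below a conditional expectation, whose mean is the plain
  expectation; \<open>W 0\<close>, being constant, is its own mean.\<close>

lemma value_process_initial_le:
  assumes W: "value_process S W" and c: "\<And>\<omega>. \<omega> \<in> space M \<Longrightarrow> W 0 \<omega> = c" and v: "v \<in> admissible S"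
  shows "c \<le> (\<integral>\<omega>. disutility S v \<omega> \<partial>M)"
proof -
  let ?v = "\<lambda>t \<omega>. if t = 0 then uN S else v t \<omega>"
  have vi: "integrable M (disutility S ?v)" using admissible_initial(1)[OF v] by (simp add: admissible_def)
  interpret sub: finite_measure_subalgebra M "HH S 0"
    using subalgebra_HH[of 0] by unfold_locales auto
  have "real_cond_exp M (HH S 0) (disutility S ?v) \<in>
      {real_cond_exp M (HH S 0) (disutility S u) | u. u \<in> admissible S \<and> (\<forall>s\<in>{0..0}. AE \<omega> in M. u s \<omega> = uN S)}"
    using admissible_initial(1)[OF v] by (intro CollectI exI[of _ ?v]) auto
  moreover have "is_ess_inf M {real_cond_exp M (HH S 0) (disutility S u) | u.
      u \<in> admissible S \<and> (\<forall>s\<in>{0..0}. AE \<omega> in M. u s \<omega> = uN S)} (W 0)"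
    using bspec[OF W[unfolded value_process_def], of 0] T_pos by simp
  ultimately have "AE \<omega> in M. W 0 \<omega> \<le> real_cond_exp M (HH S 0) (disutility S ?v) \<omega>"
    unfolding is_ess_inf_def by (elim conjE) (erule bspec)
  then have ae: "AE \<omega> in M. c \<le> real_cond_exp M (HH S 0) (disutility S ?v) \<omega>"
    using AE_space by eventually_elim (simp add: c)
  have "c = (\<integral>\<omega>. c \<partial>M)" by (simp add: prob_space)
  also have "\<dots> \<le> (\<integral>\<omega>. real_cond_exp M (HH S 0) (disutility S ?v) \<omega> \<partial>M)"
    by (intro integral_mono_AE ae sub.real_cond_exp_int(1)[OF vi]) simp
  also have "\<dots> = (\<integral>\<omega>. disutility S ?v \<omega> \<partial>M)" by (rule sub.real_cond_exp_int(2)[OF vi])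
  also have "\<dots> = (\<integral>\<omega>. disutility S v \<omega> \<partial>M)"
    by (intro Bochner_Integration.integral_cong refl admissible_initial(2)[OF v])
  finally show ?thesis .
qed

end

section \<open>The damped product along one path\<close>

context driven
begin

definition Yp :: "real \<Rightarrow> (real \<times> 'a) \<times> real \<Rightarrow> real" where
  "Yp \<epsilon> x = Ls \<epsilon> (fst x) * (max 0 (VV x) * exp (- gj x))"

definition Yn :: "real \<Rightarrow> (real \<times> 'a) \<times> real \<Rightarrow> real" where
  "Yn \<epsilon> x = Ls \<epsilon> (fst x) * (max 0 (- VV x) * exp (- gj x) + Wm (fst (fst x)) (snd (fst x)))"

text \<open>The undamped density at the terminal time itself: the sum includes a jump at
  \<open>T\<close>, which \<open>Jg (T, \<omega>)\<close> leaves out.\<close>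

definition EE :: "'a \<Rightarrow> real" where
  "EE \<omega> = exp (Cq (T, \<omega>) - (\<Sum>n=1..N T \<omega>. gj ((real_of_ereal (J n \<omega>), \<omega>), Z n \<omega>)))"

lemma Ls_lift [measurable]: "(\<lambda>x. Ls \<epsilon> (fst x)) \<in> borel_measurable (P \<Otimes>\<^sub>M L)"
  by (rule measurable_compose[OF measurable_fst Ls_predictable])

lemma Yp_measurable [measurable]: "Yp \<epsilon> \<in> borel_measurable (P \<Otimes>\<^sub>M borel)"
  unfolding Yp_def[abs_def] by measurable

lemma Yn_measurable [measurable]: "Yn \<epsilon> \<in> borel_measurable (P \<Otimes>\<^sub>M borel)"
  unfolding Yn_def[abs_def] by measurable

lemma Yp_nonneg: "0 \<le> Yp \<epsilon> x"
  by (simp add: Yp_def Ls_def)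

lemma Yn_nonneg: "0 \<le> t \<Longrightarrow> t \<le> T \<Longrightarrow> \<omega> \<in> space M \<Longrightarrow> 0 \<le> Yn \<epsilon> ((t, \<omega>), z)"
  using Wm_nonneg[of t \<omega>] by (auto simp: Yn_def Ls_def intro!: mult_nonneg_nonneg add_nonneg_nonneg)

context
  fixes \<omega> :: 'a and \<epsilon> :: real
  assumes good: "good \<omega>" and eps: "0 < \<epsilon>"
begin

lemmas \<omega>_space = in_space[OF good]

text \<open>The logarithmic drift of the damped density: premiums raise it, damping lowers it. Jump
  factors are kept apart, as in \<open>product_formula_jumps\<close>.\<close>

definition cc :: "real \<Rightarrow> real" where
  "cc t = discount S t * qs (t, \<omega>) - \<epsilon> * aa (t, \<omega>)"

lemma cc_integrable: "set_integrable lborel {0..T} cc"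
  unfolding cc_def by (intro set_integral_diff dq_integrable[OF good] set_integrable_mult_right aa_integrable[OF good])

lemma LBINT_cc:
  assumes "0 \<le> t" "t \<le> T"
  shows "(LBINT r:{0..t}. cc r) = Cq (t, \<omega>) - \<epsilon> * AA (t, \<omega>)"
proof -
  have sub: "set_integrable lborel {0..t} f" if "set_integrable lborel {0..T} f" for f :: "real \<Rightarrow> real"
    using assms by (intro set_integrable_subset[OF that]) auto
  show ?thesis
    unfolding cc_def Cq_eq[OF good assms] AA_eq[OF good assms]
    using set_integral_diff(2)[OF sub[OF dq_integrable[OF good]] sub[OF set_integrable_mult_right[OF aa_integrable[OF good]]], of \<epsilon>]
    by simp
qed

lemma Ls_le: "0 \<le> t \<Longrightarrow> t \<le> T \<Longrightarrow> Ls \<epsilon> (t, \<omega>) \<le> exp (Cq (t, \<omega>) - \<epsilon> * AA (t, \<omega>))"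
  using Jg_nonneg[OF \<omega>_space, of t] by (simp add: Ls_def)

lemma Ls_bound: "0 \<le> t \<Longrightarrow> t \<le> T \<Longrightarrow> \<bar>Ls \<epsilon> (t, \<omega>)\<bar> \<le> exp (Cq (T, \<omega>))"
proof -
  assume t: "0 \<le> t" "t \<le> T"
  have "0 \<le> \<epsilon> * AA (t, \<omega>)" using eps AA_nonneg by simp
  then show ?thesis
    using Cq_le[OF good t] Jg_nonneg[OF \<omega>_space, of t] by (simp add: Ls_def)
qed

lemma Ls_pos: "0 < Ls \<epsilon> x"
  by (simp add: Ls_def)

text \<open>The strict inequality in \<open>Jg\<close> makes \<open>Ls\<close> left-continuous: up
  to and including the next jump time exactly the first \<open>k\<close> factors are
  present.\<close>

lemma Ls_between:
  assumes k: "k \<le> N T \<omega>" and r: "tau \<omega> k < r" "r \<le> T" "k < N T \<omega> \<Longrightarrow> r \<le> tau \<omega> (Suc k)"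
  shows "Ls \<epsilon> (r, \<omega>) = exp (LBINT v:{0..r}. cc v) * (\<Prod>n=1..k. exp (- gj ((tau \<omega> n, \<omega>), Z n \<omega>)))"
proof -
  have r0: "0 \<le> r" using tau_mono[OF \<omega>_space, of 0 k] k r(1) by (simp add: tau_def split: if_splits)
  have before: "J n \<omega> < ereal r \<longleftrightarrow> n \<le> k" if n: "n \<in> {1..N T \<omega>}" for n
  proof -
    have "J n \<omega> = ereal (tau \<omega> n)" using J_eq_tau(1)[OF \<omega>_space, of n] n by auto
    moreover have "tau \<omega> n < r \<longleftrightarrow> n \<le> k"
    proof
      assume "n \<le> k"
      then show "tau \<omega> n < r" using tau_mono[OF \<omega>_space, of n k] k r by simp
    next
      assume nr: "tau \<omega> n < r"
      show "n \<le> k"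
      proof (rule ccontr)
        assume "\<not> n \<le> k"
        then have "Suc k \<le> n" "k < N T \<omega>" using n by auto
        then show False using tau_mono[OF \<omega>_space, of "Suc k" n] r(3) nr n by auto
      qed
    qed
    ultimately show ?thesis by simp
  qed
  have "Jg (r, \<omega>) = (\<Sum>n=1..N T \<omega>. if n \<le> k then gj ((tau \<omega> n, \<omega>), Z n \<omega>) else 0)"
    unfolding Jg_def fst_conv snd_conv by (intro sum.cong refl) (use before in \<open>auto simp: tau_def\<close>)
  also have "\<dots> = (\<Sum>n=1..k. if n \<le> k then gj ((tau \<omega> n, \<omega>), Z n \<omega>) else 0)"
    using k by (intro sum.mono_neutral_right) auto
  also have "\<dots> = (\<Sum>n=1..k. gj ((tau \<omega> n, \<omega>), Z n \<omega>))" by (intro sum.cong) auto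
  finally have "exp (- Jg (r, \<omega>)) = (\<Prod>n=1..k. exp (- gj ((tau \<omega> n, \<omega>), Z n \<omega>)))"
    by (simp add: sum_negf[symmetric] exp_sum)
  then show ?thesis
    using LBINT_cc[OF r0 r(2)] by (simp add: Ls_def exp_diff exp_minus divide_inverse)
qed

lemma Wm_between:
  assumes k: "k \<le> N T \<omega>" and r: "tau \<omega> k < r" "r \<le> T" "k < N T \<omega> \<Longrightarrow> r \<le> tau \<omega> (Suc k)"
  shows "Wm r \<omega> = W 0 \<omega> + (\<Sum>n=1..k. Th ((tau \<omega> n, \<omega>), Z n \<omega>)) + (LBINT v:{0..r}. G v \<omega> - BB (v, \<omega>))"
proof -
  have t0: "0 \<le> tau \<omega> k" using tau_mono[OF \<omega>_space, of 0 k] k by (simp add: tau_def split: if_splits)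
  have a_int: "set_integrable lborel {0..T} (\<lambda>s. G s \<omega> - BB (s, \<omega>))"
    by (intro set_integral_diff G_integrable[OF good] BB_integrable[OF good])
  have "continuous_on {0..T} (\<lambda>s. LBINT v:{0..s}. G v \<omega> - BB (v, \<omega>))" by (rule continuous_on_LBINT[OF a_int])
  then have "((\<lambda>s. LBINT v:{0..s}. G v \<omega> - BB (v, \<omega>)) \<longlongrightarrow> (LBINT v:{0..r}. G v \<omega> - BB (v, \<omega>))) (at r within {0..T})"
    using r t0 by (auto simp: continuous_on_def)
  then have "((\<lambda>s. LBINT v:{0..s}. G v \<omega> - BB (v, \<omega>)) \<longlongrightarrow> (LBINT v:{0..r}. G v \<omega> - BB (v, \<omega>))) (at r within {0..r})"
    by (rule tendsto_within_subset) (use r in auto)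
  then have lim: "((\<lambda>s. LBINT v:{0..s}. G v \<omega> - BB (v, \<omega>)) \<longlongrightarrow> (LBINT v:{0..r}. G v \<omega> - BB (v, \<omega>))) (at_left r)"
    using r t0 by (simp add: at_within_Icc_at_left)
  have "((\<lambda>s. W 0 \<omega> + (\<Sum>n=1..k. Th ((tau \<omega> n, \<omega>), Z n \<omega>)) + (LBINT v:{0..s}. G v \<omega> - BB (v, \<omega>))) \<longlongrightarrow>
      W 0 \<omega> + (\<Sum>n=1..k. Th ((tau \<omega> n, \<omega>), Z n \<omega>)) + (LBINT v:{0..r}. G v \<omega> - BB (v, \<omega>))) (at_left r)"
    by (intro tendsto_intros lim)
  moreover have "\<forall>\<^sub>F s in at_left r. W 0 \<omega> + (\<Sum>n=1..k. Th ((tau \<omega> n, \<omega>), Z n \<omega>)) + (LBINT v:{0..s}. G v \<omega> - BB (v, \<omega>)) = W s \<omega>"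
    unfolding eventually_at_left_field
  proof (intro exI[of _ "tau \<omega> k"] conjI allI impI r(1))
    fix s assume s: "tau \<omega> k < s" "s < r"
    have "N s \<omega> = k" using s r by (intro counting_between[OF \<omega>_space k]) auto
    then show "W 0 \<omega> + (\<Sum>n=1..k. Th ((tau \<omega> n, \<omega>), Z n \<omega>)) + (LBINT v:{0..s}. G v \<omega> - BB (v, \<omega>)) = W s \<omega>"
      using W_path[OF good, of s] s r t0 by simp
  qed
  ultimately have "((\<lambda>s. W s \<omega>) \<longlongrightarrow> W 0 \<omega> + (\<Sum>n=1..k. Th ((tau \<omega> n, \<omega>), Z n \<omega>)) + (LBINT v:{0..r}. G v \<omega> - BB (v, \<omega>))) (at_left r)"
    by (rule Lim_transform_eventually)
  then show ?thesis unfolding Wm_def using r t0 by (intro left_lim_eqI) auto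
qed

lemma EE_eq: "EE \<omega> * exp (- \<epsilon> * AA (T, \<omega>)) = exp (LBINT v:{0..T}. cc v) * (\<Prod>n=1..N T \<omega>. exp (- gj ((tau \<omega> n, \<omega>), Z n \<omega>)))"
proof -
  have "(\<Sum>n=1..N T \<omega>. gj ((real_of_ereal (J n \<omega>), \<omega>), Z n \<omega>)) = (\<Sum>n=1..N T \<omega>. gj ((tau \<omega> n, \<omega>), Z n \<omega>))"
    by (intro sum.cong) (auto simp: tau_def)
  moreover have "exp (- (\<Sum>n=1..N T \<omega>. gj ((tau \<omega> n, \<omega>), Z n \<omega>))) = (\<Prod>n=1..N T \<omega>. exp (- gj ((tau \<omega> n, \<omega>), Z n \<omega>)))"
    by (simp add: sum_negf[symmetric] exp_sum)
  ultimately show ?thesis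
    using LBINT_cc[of T] T_pos by (simp add: EE_def exp_diff exp_minus divide_inverse exp_add[symmetric])
qed

lemma Ls_mult_integrable:
  assumes "set_integrable lborel {0..T} f"
  shows "set_integrable lborel {0..T} (\<lambda>t. Ls \<epsilon> (t, \<omega>) * f t)"
  using Ls_bound by (intro set_integrable_bounded_mult[OF assms path_measurable[OF Ls_predictable \<omega>_space]]) auto

text \<open>The product formula with drift \<open>G - BB\<close> for \<open>W\<close> and rate
  \<open>cc\<close> for the density. By \<open>fiber_ff\<close> the bound on \<open>G\<close>
  cancels the premium and \<open>BB\<close> terms, and the damping contributes
  \<open>- \<epsilon> * aa * Wm\<close>, which is not positive. The terms are arranged to be
  nonnegative on both sides, ready for integration in \<open>ennreal\<close>.\<close>

lemma pathwise_real:
  "EE \<omega> * exp (- \<epsilon> * AA (T, \<omega>)) * W T \<omega> + (\<Sum>n=1..N T \<omega>. Yn \<epsilon> ((tau \<omega> n, \<omega>), Z n \<omega>))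
      + (LBINT t:{0..T}. Ls \<epsilon> (t, \<omega>) * pp (t, \<omega>))
    \<le> W 0 \<omega> + (\<Sum>n=1..N T \<omega>. Yp \<epsilon> ((tau \<omega> n, \<omega>), Z n \<omega>)) + (LBINT t:{0..T}. Ls \<epsilon> (t, \<omega>) * nn (t, \<omega>))"
proof -
  let ?e = "\<lambda>n. exp (- gj ((tau \<omega> n, \<omega>), Z n \<omega>))"
  let ?th = "\<lambda>n. Th ((tau \<omega> n, \<omega>), Z n \<omega>)"
  have a_int: "set_integrable lborel {0..T} (\<lambda>s. G s \<omega> - BB (s, \<omega>))"
    by (intro set_integral_diff G_integrable[OF good] BB_integrable[OF good])
  note pf = product_formula_jumps[OF a_int cc_integrable, of "tau \<omega>" "N T \<omega>" "\<lambda>r. Wm r \<omega>" "W 0 \<omega>" ?th "\<lambda>r. Ls \<epsilon> (r, \<omega>)" ?e,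
      OF _ tau_less[OF \<omega>_space] tau_le_T[OF \<omega>_space] Wm_between Ls_between]
  have tau0: "tau \<omega> 0 = 0" by (simp add: tau_def)
  have int: "set_integrable lborel {0..T} (\<lambda>r. Ls \<epsilon> (r, \<omega>) * (G r \<omega> - BB (r, \<omega>) + cc r * Wm r \<omega>))"
    by (rule pf(1)[OF tau0])
  have WT: "W T \<omega> = W 0 \<omega> + (\<Sum>n=1..N T \<omega>. ?th n) + (LBINT v:{0..T}. G v \<omega> - BB (v, \<omega>))"
    using W_path[OF good, of T] T_pos by simp
  have eq: "EE \<omega> * exp (- \<epsilon> * AA (T, \<omega>)) * W T \<omega> = W 0 \<omega>
      + (\<Sum>n=1..N T \<omega>. Ls \<epsilon> (tau \<omega> n, \<omega>) * ((Wm (tau \<omega> n) \<omega> + ?th n) * ?e n - Wm (tau \<omega> n) \<omega>))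
      + (LBINT r:{0..T}. Ls \<epsilon> (r, \<omega>) * (G r \<omega> - BB (r, \<omega>) + cc r * Wm r \<omega>))"
    unfolding EE_eq WT by (rule pf(2)[OF tau0])
  have jump: "Ls \<epsilon> (tau \<omega> n, \<omega>) * ((Wm (tau \<omega> n) \<omega> + ?th n) * ?e n - Wm (tau \<omega> n) \<omega>) =
      Yp \<epsilon> ((tau \<omega> n, \<omega>), Z n \<omega>) - Yn \<epsilon> ((tau \<omega> n, \<omega>), Z n \<omega>)" for n
  proof -
    define V where "V = VV ((tau \<omega> n, \<omega>), Z n \<omega>)"
    have V: "Wm (tau \<omega> n) \<omega> + ?th n = max 0 V - max 0 (- V)" by (simp add: V_def VV_def)
    show ?thesis unfolding V by (simp add: Yp_def Yn_def V_def algebra_simps)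
  qed
  have "(LBINT r:{0..T}. Ls \<epsilon> (r, \<omega>) * (G r \<omega> - BB (r, \<omega>) + cc r * Wm r \<omega>)) \<le>
      (LBINT r:{0..T}. Ls \<epsilon> (r, \<omega>) * nn (r, \<omega>) - Ls \<epsilon> (r, \<omega>) * pp (r, \<omega>))"
  proof (rule set_integral_mono_AE[OF int])
    show "set_integrable lborel {0..T} (\<lambda>r. Ls \<epsilon> (r, \<omega>) * nn (r, \<omega>) - Ls \<epsilon> (r, \<omega>) * pp (r, \<omega>))"
      by (intro set_integral_diff Ls_mult_integrable nn_integrable[OF good] pp_integrable[OF good])
    show "AE r\<in>{0..T} in lborel. Ls \<epsilon> (r, \<omega>) * (G r \<omega> - BB (r, \<omega>) + cc r * Wm r \<omega>) \<le>
        Ls \<epsilon> (r, \<omega>) * nn (r, \<omega>) - Ls \<epsilon> (r, \<omega>) * pp (r, \<omega>)"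
      using AE_K_finite[OF good] G_le[OF good]
    proof eventually_elim
      case (elim r)
      show ?case
      proof
        assume r: "r \<in> {0..T}"
        then have r': "0 \<le> r" "r \<le> T" by auto
        have "G r \<omega> \<le> - Wm r \<omega> * discount S r * qs (r, \<omega>) + BB (r, \<omega>) + nn (r, \<omega>) - pp (r, \<omega>)"
          using elim r fiber_ff[OF r' \<omega>_space \<pi>_nonneg[OF good r']] by simp
        moreover have "0 \<le> \<epsilon> * aa (r, \<omega>) * Wm r \<omega>"
          using eps aa_nonneg[OF good r'] Wm_nonneg[OF r' \<omega>_space] by simp
        ultimately have "G r \<omega> - BB (r, \<omega>) + cc r * Wm r \<omega> \<le> nn (r, \<omega>) - pp (r, \<omega>)"
          by (simp add: cc_def algebra_simps)
        from mult_left_mono[OF this less_imp_le[OF Ls_pos[of "(r, \<omega>)"]]]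
        show "Ls \<epsilon> (r, \<omega>) * (G r \<omega> - BB (r, \<omega>) + cc r * Wm r \<omega>) \<le>
            Ls \<epsilon> (r, \<omega>) * nn (r, \<omega>) - Ls \<epsilon> (r, \<omega>) * pp (r, \<omega>)"
          by (simp add: right_diff_distrib)
      qed
    qed
  qed
  also have "\<dots> = (LBINT r:{0..T}. Ls \<epsilon> (r, \<omega>) * nn (r, \<omega>)) - (LBINT r:{0..T}. Ls \<epsilon> (r, \<omega>) * pp (r, \<omega>))"
    by (intro set_integral_diff(2) Ls_mult_integrable nn_integrable[OF good] pp_integrable[OF good])
  finally show ?thesis
    using eq unfolding jump sum_subtractf by linarith
qed

text \<open>Jumps only lower the density, so the integrand is at most
  \<open>exp (- \<epsilon> * AA) * aa\<close>. Up to the factor \<open>- \<epsilon>\<close> this is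
  the derivative of \<open>exp (- \<epsilon> * AA)\<close>, which decreases from 1 and stays
  positive.\<close>

lemma Ls_kk_integral: "(LBINT t:{0..T}. Ls \<epsilon> (t, \<omega>) * kk (t, \<omega>)) \<le> 1 / \<epsilon>"
proof -
  have ai: "set_integrable lborel {0..T} (\<lambda>t. - \<epsilon> * aa (t, \<omega>))"
    by (intro set_integrable_mult_right aa_integrable[OF good])
  have L: "(LBINT v:{0..r}. - \<epsilon> * aa (v, \<omega>)) = - \<epsilon> * AA (r, \<omega>)" if "0 \<le> r" "r \<le> T" for r
    unfolding AA_eq[OF good that] by (rule set_integral_mult_right)
  have "exp (- \<epsilon> * AA (T, \<omega>)) = 1 + (LBINT r:{0..T}. - \<epsilon> * aa (r, \<omega>) * exp (LBINT v:{0..r}. - \<epsilon> * aa (v, \<omega>)))"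
    using LBINT_exp[OF _ ai] T_pos L[of T] by simp
  also have "(LBINT r:{0..T}. - \<epsilon> * aa (r, \<omega>) * exp (LBINT v:{0..r}. - \<epsilon> * aa (v, \<omega>))) =
      (LBINT r:{0..T}. - \<epsilon> * (exp (- \<epsilon> * AA (r, \<omega>)) * aa (r, \<omega>)))"
  proof (rule set_lebesgue_integral_cong)
    show "\<forall>r. r \<in> {0..T} \<longrightarrow> - \<epsilon> * aa (r, \<omega>) * exp (LBINT v:{0..r}. - \<epsilon> * aa (v, \<omega>)) =
        - \<epsilon> * (exp (- \<epsilon> * AA (r, \<omega>)) * aa (r, \<omega>))"
    proof (intro allI impI)
      fix r assume "r \<in> {0..T}"
      then have r: "0 \<le> r" "r \<le> T" by auto
      show "- \<epsilon> * aa (r, \<omega>) * exp (LBINT v:{0..r}. - \<epsilon> * aa (v, \<omega>)) =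
          - \<epsilon> * (exp (- \<epsilon> * AA (r, \<omega>)) * aa (r, \<omega>))"
        unfolding L[OF r] by (simp only: mult_ac)
    qed
  qed simp
  also have "\<dots> = - \<epsilon> * (LBINT r:{0..T}. exp (- \<epsilon> * AA (r, \<omega>)) * aa (r, \<omega>))" by (rule set_integral_mult_right)
  finally have "\<epsilon> * (LBINT r:{0..T}. exp (- \<epsilon> * AA (r, \<omega>)) * aa (r, \<omega>)) = 1 - exp (- \<epsilon> * AA (T, \<omega>))" by simp
  then have "\<epsilon> * (LBINT r:{0..T}. exp (- \<epsilon> * AA (r, \<omega>)) * aa (r, \<omega>)) \<le> 1" by simp
  then have 1: "(LBINT r:{0..T}. exp (- \<epsilon> * AA (r, \<omega>)) * aa (r, \<omega>)) \<le> 1 / \<epsilon>"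
    using eps by (simp add: pos_le_divide_eq mult.commute)
  have "(LBINT t:{0..T}. Ls \<epsilon> (t, \<omega>) * kk (t, \<omega>)) \<le> (LBINT r:{0..T}. exp (- \<epsilon> * AA (r, \<omega>)) * aa (r, \<omega>))"
  proof (rule set_integral_mono[OF Ls_mult_integrable[OF kk_integrable[OF good]]])
    have "(\<lambda>x. exp (- \<epsilon> * AA x)) \<in> borel_measurable P" by measurable
    from path_measurable[OF this \<omega>_space]
    show "set_integrable lborel {0..T} (\<lambda>r. exp (- \<epsilon> * AA (r, \<omega>)) * aa (r, \<omega>))"
      using AA_nonneg eps by (intro set_integrable_bounded_mult[OF aa_integrable[OF good], where B=1]) auto
    fix t assume "t \<in> {0..T}"
    then have t: "0 \<le> t" "t \<le> T" by auto
    have "Ls \<epsilon> (t, \<omega>) * kk (t, \<omega>) \<le> exp (Cq (t, \<omega>) - \<epsilon> * AA (t, \<omega>)) * kk (t, \<omega>)"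
      by (intro mult_right_mono Ls_le t kk_nonneg[OF good])
    also have "\<dots> = exp (- \<epsilon> * AA (t, \<omega>)) * aa (t, \<omega>)"
      by (simp add: aa_def exp_diff exp_minus field_simps)
    finally show "Ls \<epsilon> (t, \<omega>) * kk (t, \<omega>) \<le> exp (- \<epsilon> * AA (t, \<omega>)) * aa (t, \<omega>)" .
  qed
  with 1 show ?thesis by linarith
qed

text \<open>Shared by \<open>pp\<close> and \<open>nn\<close>: \<open>y\<close> is a field over the
  marks, \<open>f\<close> its integral times the filter, and \<open>f \<le> kk\<close> brings in the
  bound \<open>1 / \<epsilon>\<close>. Everything is asked for at almost every time, as the
  estimates of \<open>fiber\<close> hold only there.\<close>

lemma damped_time_integral:
  assumes f: "set_integrable lborel {0..T} f"
    and ae: "AE t in lborel. t \<in> {0..T} \<longrightarrow> 0 \<le> f t \<and> f t \<le> kk (t, \<omega>) \<and>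
      (\<lambda>z. ennreal (y t z)) \<in> borel_measurable (F1 S) \<and> (\<integral>\<^sup>+z. ennreal (y t z) \<partial>F1 S) * ennreal (\<pi> t \<omega>) = ennreal (f t)"
  shows "(\<integral>\<^sup>+t\<in>{0..T}. (\<integral>\<^sup>+z. ennreal (Ls \<epsilon> (t, \<omega>) * y t z) \<partial>F1 S) * ennreal (\<pi> t \<omega>) \<partial>lborel) =
      ennreal (LBINT t:{0..T}. Ls \<epsilon> (t, \<omega>) * f t)"
    and "(LBINT t:{0..T}. Ls \<epsilon> (t, \<omega>) * f t) \<le> 1 / \<epsilon>"
    and "0 \<le> (LBINT t:{0..T}. Ls \<epsilon> (t, \<omega>) * f t)"
proof -
  have int: "set_integrable lborel {0..T} (\<lambda>t. Ls \<epsilon> (t, \<omega>) * f t)" by (rule Ls_mult_integrable[OF f])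
  have ae': "AE t in lborel. t \<in> {0..T} \<longrightarrow> 0 \<le> f t \<and> f t \<le> kk (t, \<omega>) \<and>
     (\<integral>\<^sup>+z. ennreal (Ls \<epsilon> (t, \<omega>) * y t z) \<partial>F1 S) * ennreal (\<pi> t \<omega>) = ennreal (Ls \<epsilon> (t, \<omega>) * f t)"
    using ae
  proof eventually_elim
    case (elim t)
    show ?case
    proof
      assume "t \<in> {0..T}"
      with elim have e: "0 \<le> f t" "f t \<le> kk (t, \<omega>)" "(\<lambda>z. ennreal (y t z)) \<in> borel_measurable (F1 S)"
        "(\<integral>\<^sup>+z. ennreal (y t z) \<partial>F1 S) * ennreal (\<pi> t \<omega>) = ennreal (f t)" by auto
      have "(\<integral>\<^sup>+z. ennreal (Ls \<epsilon> (t, \<omega>) * y t z) \<partial>F1 S) = ennreal (Ls \<epsilon> (t, \<omega>)) * (\<integral>\<^sup>+z. ennreal (y t z) \<partial>F1 S)"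
        using Ls_pos[of "(t, \<omega>)"] e(3) by (subst nn_integral_cmult[symmetric]) (simp_all add: ennreal_mult')
      then show "0 \<le> f t \<and> f t \<le> kk (t, \<omega>) \<and>
        (\<integral>\<^sup>+z. ennreal (Ls \<epsilon> (t, \<omega>) * y t z) \<partial>F1 S) * ennreal (\<pi> t \<omega>) = ennreal (Ls \<epsilon> (t, \<omega>) * f t)"
        using e Ls_pos[of "(t, \<omega>)"] by (simp add: mult.assoc ennreal_mult)
    qed
  qed
  have nonneg: "AE t in lborel. 0 \<le> indicator {0..T} t *\<^sub>R (Ls \<epsilon> (t, \<omega>) * f t)"
    using ae' by eventually_elim (use Ls_pos in \<open>auto simp: indicator_def less_imp_le\<close>)
  have "(\<integral>\<^sup>+t\<in>{0..T}. (\<integral>\<^sup>+z. ennreal (Ls \<epsilon> (t, \<omega>) * y t z) \<partial>F1 S) * ennreal (\<pi> t \<omega>) \<partial>lborel) =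
      (\<integral>\<^sup>+t. ennreal (indicator {0..T} t *\<^sub>R (Ls \<epsilon> (t, \<omega>) * f t)) \<partial>lborel)"
    by (rule nn_integral_cong_AE) (use ae' in eventually_elim, auto simp: indicator_def)
  also have "\<dots> = ennreal (LBINT t:{0..T}. Ls \<epsilon> (t, \<omega>) * f t)"
    unfolding set_lebesgue_integral_def by (rule nn_integral_eq_integral[OF int[unfolded set_integrable_def] nonneg])
  finally show "(\<integral>\<^sup>+t\<in>{0..T}. (\<integral>\<^sup>+z. ennreal (Ls \<epsilon> (t, \<omega>) * y t z) \<partial>F1 S) * ennreal (\<pi> t \<omega>) \<partial>lborel) =
      ennreal (LBINT t:{0..T}. Ls \<epsilon> (t, \<omega>) * f t)" .
  have "(LBINT t:{0..T}. Ls \<epsilon> (t, \<omega>) * f t) \<le> (LBINT t:{0..T}. Ls \<epsilon> (t, \<omega>) * kk (t, \<omega>))"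
    by (rule set_integral_mono_AE[OF int Ls_mult_integrable[OF kk_integrable[OF good]]])
      (use ae' in eventually_elim, use Ls_pos in \<open>auto intro!: mult_left_mono less_imp_le\<close>)
  then show "(LBINT t:{0..T}. Ls \<epsilon> (t, \<omega>) * f t) \<le> 1 / \<epsilon>" using Ls_kk_integral by linarith
  show "0 \<le> (LBINT t:{0..T}. Ls \<epsilon> (t, \<omega>) * f t)"
    unfolding set_lebesgue_integral_def by (rule integral_nonneg_AE[OF nonneg])
qed

lemma time_Yp: "(\<integral>\<^sup>+t\<in>{0..T}. (\<integral>\<^sup>+z. ennreal (Yp \<epsilon> ((t, \<omega>), z)) \<partial>F1 S) * ennreal (\<pi> t \<omega>) \<partial>lborel) =
    ennreal (LBINT t:{0..T}. Ls \<epsilon> (t, \<omega>) * pp (t, \<omega>))"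
  and time_Yp_le: "(LBINT t:{0..T}. Ls \<epsilon> (t, \<omega>) * pp (t, \<omega>)) \<le> 1 / \<epsilon>"
  and time_Yp_nonneg: "0 \<le> (LBINT t:{0..T}. Ls \<epsilon> (t, \<omega>) * pp (t, \<omega>))"
proof -
  let ?y = "\<lambda>t z. max 0 (VV ((t, \<omega>), z)) * exp (- gj ((t, \<omega>), z))"
  have "AE t in lborel. t \<in> {0..T} \<longrightarrow> 0 \<le> pp (t, \<omega>) \<and> pp (t, \<omega>) \<le> kk (t, \<omega>) \<and>
     (\<lambda>z. ennreal (?y t z)) \<in> borel_measurable (F1 S) \<and> (\<integral>\<^sup>+z. ennreal (?y t z) \<partial>F1 S) * ennreal (\<pi> t \<omega>) = ennreal (pp (t, \<omega>))"
    using AE_K_finite[OF good]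
  proof eventually_elim
    case (elim t)
    show ?case
    proof
      assume "t \<in> {0..T}"
      then have t: "0 \<le> t" "t \<le> T" and fin: "K (t, \<omega>) * ennreal (\<pi> t \<omega>) < \<infinity>" using elim by auto
      have "(\<lambda>z. ennreal (?y t z)) \<in> borel_measurable (F1 S)"
        using F1_section[OF VV_measurable t \<omega>_space] F1_section[OF gj_measurable t \<omega>_space] by measurable
      then show "0 \<le> pp (t, \<omega>) \<and> pp (t, \<omega>) \<le> kk (t, \<omega>) \<and>
        (\<lambda>z. ennreal (?y t z)) \<in> borel_measurable (F1 S) \<and> (\<integral>\<^sup>+z. ennreal (?y t z) \<partial>F1 S) * ennreal (\<pi> t \<omega>) = ennreal (pp (t, \<omega>))"
        using fiber_pp[OF t \<omega>_space \<pi>_nonneg[OF good t] fin] by simp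
    qed
  qed
  from damped_time_integral[OF pp_integrable[OF good] this]
  show "(\<integral>\<^sup>+t\<in>{0..T}. (\<integral>\<^sup>+z. ennreal (Yp \<epsilon> ((t, \<omega>), z)) \<partial>F1 S) * ennreal (\<pi> t \<omega>) \<partial>lborel) =
    ennreal (LBINT t:{0..T}. Ls \<epsilon> (t, \<omega>) * pp (t, \<omega>))"
    "(LBINT t:{0..T}. Ls \<epsilon> (t, \<omega>) * pp (t, \<omega>)) \<le> 1 / \<epsilon>"
    "0 \<le> (LBINT t:{0..T}. Ls \<epsilon> (t, \<omega>) * pp (t, \<omega>))"
    by (simp_all only: Yp_def fst_conv snd_conv)
qed

lemma time_Yn: "(\<integral>\<^sup>+t\<in>{0..T}. (\<integral>\<^sup>+z. ennreal (Yn \<epsilon> ((t, \<omega>), z)) \<partial>F1 S) * ennreal (\<pi> t \<omega>) \<partial>lborel) =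
    ennreal (LBINT t:{0..T}. Ls \<epsilon> (t, \<omega>) * nn (t, \<omega>))"
  and time_Yn_le: "(LBINT t:{0..T}. Ls \<epsilon> (t, \<omega>) * nn (t, \<omega>)) \<le> 1 / \<epsilon>"
  and time_Yn_nonneg: "0 \<le> (LBINT t:{0..T}. Ls \<epsilon> (t, \<omega>) * nn (t, \<omega>))"
proof -
  let ?y = "\<lambda>t z. max 0 (- VV ((t, \<omega>), z)) * exp (- gj ((t, \<omega>), z)) + Wm t \<omega>"
  have "AE t in lborel. t \<in> {0..T} \<longrightarrow> 0 \<le> nn (t, \<omega>) \<and> nn (t, \<omega>) \<le> kk (t, \<omega>) \<and>
     (\<lambda>z. ennreal (?y t z)) \<in> borel_measurable (F1 S) \<and> (\<integral>\<^sup>+z. ennreal (?y t z) \<partial>F1 S) * ennreal (\<pi> t \<omega>) = ennreal (nn (t, \<omega>))"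
    using AE_K_finite[OF good]
  proof eventually_elim
    case (elim t)
    show ?case
    proof
      assume "t \<in> {0..T}"
      then have t: "0 \<le> t" "t \<le> T" and fin: "K (t, \<omega>) * ennreal (\<pi> t \<omega>) < \<infinity>" using elim by auto
      have "(\<lambda>z. ennreal (?y t z)) \<in> borel_measurable (F1 S)"
        using F1_section[OF VV_measurable t \<omega>_space] F1_section[OF gj_measurable t \<omega>_space] by measurable
      then show "0 \<le> nn (t, \<omega>) \<and> nn (t, \<omega>) \<le> kk (t, \<omega>) \<and>
        (\<lambda>z. ennreal (?y t z)) \<in> borel_measurable (F1 S) \<and> (\<integral>\<^sup>+z. ennreal (?y t z) \<partial>F1 S) * ennreal (\<pi> t \<omega>) = ennreal (nn (t, \<omega>))"
        using fiber_nn[OF t \<omega>_space \<pi>_nonneg[OF good t] fin] by simp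
    qed
  qed
  from damped_time_integral[OF nn_integrable[OF good] this]
  show "(\<integral>\<^sup>+t\<in>{0..T}. (\<integral>\<^sup>+z. ennreal (Yn \<epsilon> ((t, \<omega>), z)) \<partial>F1 S) * ennreal (\<pi> t \<omega>) \<partial>lborel) =
    ennreal (LBINT t:{0..T}. Ls \<epsilon> (t, \<omega>) * nn (t, \<omega>))"
    "(LBINT t:{0..T}. Ls \<epsilon> (t, \<omega>) * nn (t, \<omega>)) \<le> 1 / \<epsilon>"
    "0 \<le> (LBINT t:{0..T}. Ls \<epsilon> (t, \<omega>) * nn (t, \<omega>))"
    by (simp_all only: Yn_def fst_conv snd_conv)
qed

text \<open>Wealth is linear in premiums and retained claims, so the exponents for \<open>us\<close>
  and for null reinsurance differ by \<open>Cq\<close> and the sum of the jump exponents, while the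
  income \<open>prem\<close> cancels. The disutility of null reinsurance is the terminal value of
  \<open>W\<close>.\<close>

lemma disutility_us: "disutility S us \<omega> = EE \<omega> * W T \<omega>"
proof -
  note \<omega> = \<omega>_space
  have uNU: "\<And>t \<omega>. 0 \<le> t \<Longrightarrow> t \<le> T \<Longrightarrow> \<omega> \<in> space M \<Longrightarrow> uN S \<in> UU S" by (rule uN_in)
  define D where "D s = exp (rate S * (T - s))" for s
  have d: "discount S s = eta S * D s" for s by (simp add: discount_def D_def)
  have D_cont: "continuous_on {0..T} D" unfolding D_def by (intro continuous_intros)
  have Dp: "set_integrable lborel {0..T} (\<lambda>s. D s * prem S s \<omega>)"
    using set_integrable_mult_continuous[OF prem_integrable[OF good] D_cont] by (simp add: mult.commute)
  have Dq: "set_integrable lborel {0..T} (\<lambda>s. D s * qs (s, \<omega>))"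
    using set_integrable_mult_continuous[OF qs_integrable[OF good] D_cont] by (simp add: mult.commute)
  have flow_us: "(LBINT s:{0..T}. D s * (prem S s \<omega> - rprem S s \<omega> (us s \<omega>))) =
      (LBINT s:{0..T}. D s * prem S s \<omega>) - (LBINT s:{0..T}. D s * qs (s, \<omega>))"
    using set_integral_diff(2)[OF Dp Dq] by (simp add: qs_def right_diff_distrib)
  have flow_uN: "(LBINT s:{0..T}. D s * (prem S s \<omega> - rprem S s \<omega> (uN S))) = (LBINT s:{0..T}. D s * prem S s \<omega>)"
    using rprem_props(2)[OF _ _ \<omega>] by (intro set_lebesgue_integral_cong) auto
  have Cq_flow: "Cq (T, \<omega>) = eta S * (LBINT s:{0..T}. D s * qs (s, \<omega>))"
  proof -
    have "Cq (T, \<omega>) = (LBINT s:{0..T}. eta S * (D s * qs (s, \<omega>)))"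
      using Cq_eq[OF good, of T] T_pos by (simp add: d mult.assoc)
    then show ?thesis by simp
  qed
  have jumps: "eta S * (\<Sum>n=1..N T \<omega>. D (tau \<omega> n) * Phi S (max 0 (Z n \<omega>)) (uN S))
      - eta S * (\<Sum>n=1..N T \<omega>. D (tau \<omega> n) * Phi S (max 0 (Z n \<omega>)) (us (tau \<omega> n) \<omega>))
      = (\<Sum>n=1..N T \<omega>. gj ((real_of_ereal (J n \<omega>), \<omega>), Z n \<omega>))"
    unfolding sum_distrib_left sum_subtractf[symmetric]
  proof (rule sum.cong)
    fix n assume n: "n \<in> {1..N T \<omega>}"
    then have "real_of_ereal (J n \<omega>) = tau \<omega> n" by (simp add: tau_def)
    moreover have "Phi S (max 0 (Z n \<omega>)) (uN S) = max 0 (Z n \<omega>)" by (rule Phi_props(2)) simp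
    ultimately show "eta S * (D (tau \<omega> n) * Phi S (max 0 (Z n \<omega>)) (uN S)) - eta S * (D (tau \<omega> n) * Phi S (max 0 (Z n \<omega>)) (us (tau \<omega> n) \<omega>))
        = gj ((real_of_ereal (J n \<omega>), \<omega>), Z n \<omega>)"
      by (simp add: gj_def d algebra_simps)
  qed simp
  have wu: "wealth S us T \<omega> = wealth0 S * exp (rate S * T) + ((LBINT s:{0..T}. D s * prem S s \<omega>) - (LBINT s:{0..T}. D s * qs (s, \<omega>)))
      - (\<Sum>n=1..N T \<omega>. D (tau \<omega> n) * Phi S (max 0 (Z n \<omega>)) (us (tau \<omega> n) \<omega>))"
    using wealth_eq[of us, OF us_predictable us_in \<omega>] unfolding flow_us[symmetric] by (simp add: D_def)
  have wN: "wealth S (\<lambda>_ _. uN S) T \<omega> = wealth0 S * exp (rate S * T) + (LBINT s:{0..T}. D s * prem S s \<omega>)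
      - (\<Sum>n=1..N T \<omega>. D (tau \<omega> n) * Phi S (max 0 (Z n \<omega>)) (uN S))"
    using wealth_eq[of "\<lambda>_ _. uN S", OF borel_measurable_const uNU \<omega>] unfolding flow_uN[symmetric] by (simp add: D_def)
  have "- eta S * wealth S us T \<omega> = Cq (T, \<omega>) - (\<Sum>n=1..N T \<omega>. gj ((real_of_ereal (J n \<omega>), \<omega>), Z n \<omega>)) + - eta S * wealth S (\<lambda>_ _. uN S) T \<omega>"
    unfolding wu wN Cq_flow jumps[symmetric] by (simp add: algebra_simps)
  then show ?thesis
    unfolding W_terminal[OF good] disutility_def EE_def by (simp only: exp_add)
qed

end

end

section \<open>Expectation, removal of the damping and optimality\<close>

context driven
begin

lemma jump_sum_ennreal:
  assumes \<omega>: "\<omega> \<in> space M" and Y: "\<And>t z. 0 \<le> t \<Longrightarrow> t \<le> T \<Longrightarrow> 0 \<le> Y ((t, \<omega>), z)"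
  shows "(\<Sum>n=1..N T \<omega>. ennreal (Y ((real_of_ereal (J n \<omega>), \<omega>), Z n \<omega>))) =
    ennreal (\<Sum>n=1..N T \<omega>. Y ((tau \<omega> n, \<omega>), Z n \<omega>))"
    and "0 \<le> (\<Sum>n=1..N T \<omega>. Y ((tau \<omega> n, \<omega>), Z n \<omega>))"
proof -
  have nonneg: "0 \<le> Y ((tau \<omega> n, \<omega>), Z n \<omega>)" if "n \<in> {1..N T \<omega>}" for n
    using J_eq_tau(2,3)[OF \<omega>, of n] that by (intro Y) auto
  have "(\<Sum>n=1..N T \<omega>. ennreal (Y ((real_of_ereal (J n \<omega>), \<omega>), Z n \<omega>))) = (\<Sum>n=1..N T \<omega>. ennreal (Y ((tau \<omega> n, \<omega>), Z n \<omega>)))"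
    by (intro sum.cong) (auto simp: tau_def)
  also have "\<dots> = ennreal (\<Sum>n=1..N T \<omega>. Y ((tau \<omega> n, \<omega>), Z n \<omega>))"
    by (rule sum_ennreal) (use nonneg in auto)
  finally show "(\<Sum>n=1..N T \<omega>. ennreal (Y ((real_of_ereal (J n \<omega>), \<omega>), Z n \<omega>))) =
    ennreal (\<Sum>n=1..N T \<omega>. Y ((tau \<omega> n, \<omega>), Z n \<omega>))" .
  show "0 \<le> (\<Sum>n=1..N T \<omega>. Y ((tau \<omega> n, \<omega>), Z n \<omega>))" by (rule sum_nonneg) (use nonneg in auto)
qed

lemma jump_sum_ennreal_measurable:
  assumes Ym: "Y \<in> borel_measurable (P \<Otimes>\<^sub>M borel)"
    and Y: "\<And>t \<omega> z. 0 \<le> t \<Longrightarrow> t \<le> T \<Longrightarrow> \<omega> \<in> space M \<Longrightarrow> 0 \<le> Y ((t, \<omega>), z)"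
  shows "(\<lambda>\<omega>. \<Sum>n=1..N T \<omega>. ennreal (Y ((real_of_ereal (J n \<omega>), \<omega>), Z n \<omega>))) \<in> borel_measurable M"
proof -
  have "(\<lambda>\<omega>. ennreal (\<Sum>n=1..N T \<omega>. Y ((real_of_ereal (J n \<omega>), \<omega>), Z n \<omega>))) \<in> borel_measurable M"
    using jump_value_measurable[OF Ym] by measurable
  then show ?thesis
  proof (rule measurable_cong[THEN iffD1, rotated])
    fix \<omega> assume \<omega>: "\<omega> \<in> space M"
    have "(\<Sum>n=1..N T \<omega>. Y ((real_of_ereal (J n \<omega>), \<omega>), Z n \<omega>)) = (\<Sum>n=1..N T \<omega>. Y ((tau \<omega> n, \<omega>), Z n \<omega>))"
      by (intro sum.cong) (auto simp: tau_def)
    then show "ennreal (\<Sum>n=1..N T \<omega>. Y ((real_of_ereal (J n \<omega>), \<omega>), Z n \<omega>)) =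
        (\<Sum>n=1..N T \<omega>. ennreal (Y ((real_of_ereal (J n \<omega>), \<omega>), Z n \<omega>)))"
      using jump_sum_ennreal(1)[OF \<omega>, of Y] Y \<omega> by simp
  qed
qed

lemma damped_measurable:
  "(\<lambda>\<omega>. ennreal (EE \<omega> * exp (- \<epsilon> * AA (T, \<omega>)) * W T \<omega>)) \<in> borel_measurable M"
proof -
  have "(\<lambda>\<omega>. Cq (T, \<omega>)) \<in> borel_measurable M" "(\<lambda>\<omega>. AA (T, \<omega>)) \<in> borel_measurable M" "W T \<in> borel_measurable M"
    using measurable_section[OF Cq_predictable, of T] measurable_section[OF AA_predictable, of T] W_adapted[of T] T_pos
    by (auto intro: measurable_from_HH[of T])
  moreover have "(\<lambda>\<omega>. \<Sum>n=1..N T \<omega>. gj ((real_of_ereal (J n \<omega>), \<omega>), Z n \<omega>)) \<in> borel_measurable M"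
    by (rule jump_value_measurable[OF gj_measurable])
  ultimately show ?thesis unfolding EE_def by measurable
qed

text \<open>Both compensated integrals have finite mean, because \<open>exp (- \<epsilon> A) dA\<close> has total mass at most
  \<open>1 / \<epsilon>\<close>; hence they cancel in expectation.\<close>

lemma damped_expectation:
  assumes eps: "0 < \<epsilon>" and c: "\<And>\<omega>. \<omega> \<in> space M \<Longrightarrow> W 0 \<omega> = c"
  shows "(\<integral>\<^sup>+\<omega>. ennreal (EE \<omega> * exp (- \<epsilon> * AA (T, \<omega>)) * W T \<omega>) \<partial>M) \<le> ennreal c"
proof -
  define X where "X \<omega> = ennreal (EE \<omega> * exp (- \<epsilon> * AA (T, \<omega>)) * W T \<omega>)" for \<omega>
  define Sp where "Sp \<omega> = (\<Sum>n=1..N T \<omega>. ennreal (Yp \<epsilon> ((real_of_ereal (J n \<omega>), \<omega>), Z n \<omega>)))" for \<omega>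
  define Sn where "Sn \<omega> = (\<Sum>n=1..N T \<omega>. ennreal (Yn \<epsilon> ((real_of_ereal (J n \<omega>), \<omega>), Z n \<omega>)))" for \<omega>
  define Tp where "Tp \<omega> = (\<integral>\<^sup>+t\<in>{0..T}. (\<integral>\<^sup>+z. ennreal (Yp \<epsilon> ((t, \<omega>), z)) \<partial>F1 S) * ennreal (\<pi> t \<omega>) \<partial>lborel)" for \<omega>
  define Tn where "Tn \<omega> = (\<integral>\<^sup>+t\<in>{0..T}. (\<integral>\<^sup>+z. ennreal (Yn \<epsilon> ((t, \<omega>), z)) \<partial>F1 S) * ennreal (\<pi> t \<omega>) \<partial>lborel)" for \<omega>
  have Xm: "X \<in> borel_measurable M" unfolding X_def[abs_def] by (rule damped_measurable)
  have Spm: "Sp \<in> borel_measurable M" unfolding Sp_def[abs_def]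
    by (rule jump_sum_ennreal_measurable[OF Yp_measurable Yp_nonneg])
  have Snm: "Sn \<in> borel_measurable M" unfolding Sn_def[abs_def]
    by (rule jump_sum_ennreal_measurable[OF Yn_measurable Yn_nonneg])
  have Tm: "(\<lambda>\<omega>. \<integral>\<^sup>+t\<in>{0..T}. (\<integral>\<^sup>+z. ennreal (Y ((t, \<omega>), z)) \<partial>F1 S) * ennreal (\<pi> t \<omega>) \<partial>lborel) \<in> borel_measurable M"
    if Y: "Y \<in> borel_measurable (P \<Otimes>\<^sub>M borel)" for Y :: "(real \<times> 'a) \<times> real \<Rightarrow> real"
  proof -
    have "(\<lambda>x. ennreal (Y x)) \<in> borel_measurable (P \<Otimes>\<^sub>M borel)" using Y by measurable
    from F1_nn_integral_predictable[OF this]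
    have "(\<lambda>x. (\<integral>\<^sup>+z. ennreal (Y (x, z)) \<partial>F1 S) * ennreal (\<pi> (fst x) (snd x))) \<in> borel_measurable P" by measurable
    from time_integral_measurable[OF this] show ?thesis by (simp only: fst_conv snd_conv)
  qed
  have Tpm: "Tp \<in> borel_measurable M" unfolding Tp_def[abs_def] by (rule Tm[OF Yp_measurable])
  have Tnm: "Tn \<in> borel_measurable M" unfolding Tn_def[abs_def] by (rule Tm[OF Yn_measurable])
  \<comment> \<open>An equality in \<open>[0,\<infinity>]\<close>. Finiteness is checked later on
    the compensator side alone, where a pathwise bound is available, and carries over to the jump
    sums.\<close>
  have comp_p: "(\<integral>\<^sup>+\<omega>. Sp \<omega> \<partial>M) = (\<integral>\<^sup>+\<omega>. Tp \<omega> \<partial>M)"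
    unfolding Sp_def Tp_def by (rule compensator_HH) measurable
  have comp_n: "(\<integral>\<^sup>+\<omega>. Sn \<omega> \<partial>M) = (\<integral>\<^sup>+\<omega>. Tn \<omega> \<partial>M)"
    unfolding Sn_def Tn_def by (rule compensator_HH) measurable
  have path: "X \<omega> + (Sn \<omega> + Tp \<omega>) \<le> ennreal c + (Sp \<omega> + Tn \<omega>) \<and> Tp \<omega> \<le> ennreal (1 / \<epsilon>) \<and> Tn \<omega> \<le> ennreal (1 / \<epsilon>)"
    if good: "good \<omega>" for \<omega>
  proof -
    have \<omega>: "\<omega> \<in> space M" by (rule in_space[OF good])
    define ip where "ip = (LBINT t:{0..T}. Ls \<epsilon> (t, \<omega>) * pp (t, \<omega>))"
    define im where "im = (LBINT t:{0..T}. Ls \<epsilon> (t, \<omega>) * nn (t, \<omega>))"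
    define sp where "sp = (\<Sum>n=1..N T \<omega>. Yp \<epsilon> ((tau \<omega> n, \<omega>), Z n \<omega>))"
    define sn where "sn = (\<Sum>n=1..N T \<omega>. Yn \<epsilon> ((tau \<omega> n, \<omega>), Z n \<omega>))"
    have p: "Tp \<omega> = ennreal ip" "0 \<le> ip" "ip \<le> 1 / \<epsilon>"
      unfolding Tp_def ip_def using time_Yp[OF good eps] time_Yp_nonneg[OF good eps] time_Yp_le[OF good eps] by auto
    have n: "Tn \<omega> = ennreal im" "0 \<le> im" "im \<le> 1 / \<epsilon>"
      unfolding Tn_def im_def using time_Yn[OF good eps] time_Yn_nonneg[OF good eps] time_Yn_le[OF good eps] by auto
    have sp: "Sp \<omega> = ennreal sp" "0 \<le> sp"
      unfolding Sp_def sp_def using jump_sum_ennreal[OF \<omega>, of "Yp \<epsilon>"] Yp_nonneg by auto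
    have sn: "Sn \<omega> = ennreal sn" "0 \<le> sn"
      unfolding Sn_def sn_def using jump_sum_ennreal[OF \<omega>, of "Yn \<epsilon>"] Yn_nonneg[OF _ _ \<omega>] by auto
    define x where "x = EE \<omega> * exp (- \<epsilon> * AA (T, \<omega>)) * W T \<omega>"
    have x0: "0 \<le> x" using W_nonneg[of T \<omega>] T_pos \<omega> by (simp add: x_def EE_def)
    have c0: "0 \<le> c" using W_nonneg[of 0 \<omega>] T_pos \<omega> c[OF \<omega>] by simp
    have "x + sn + ip \<le> c + sp + im"
      using pathwise_real[OF good eps] c[OF \<omega>] by (simp add: x_def sn_def sp_def ip_def im_def)
    then have "ennreal (x + (sn + ip)) \<le> ennreal (c + (sp + im))" by (intro ennreal_leI) simp
    moreover have "X \<omega> = ennreal x" by (simp only: X_def x_def)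
    ultimately show ?thesis
      using p n sp sn x0 c0 by (simp add: ennreal_plus ennreal_leI)
  qed
  have ae: "AE \<omega> in M. X \<omega> + (Sn \<omega> + Tp \<omega>) \<le> ennreal c + (Sp \<omega> + Tn \<omega>) \<and> Tp \<omega> \<le> ennreal (1 / \<epsilon>) \<and> Tn \<omega> \<le> ennreal (1 / \<epsilon>)"
    using AE_good by eventually_elim (rule path)
  have Tp_fin: "(\<integral>\<^sup>+\<omega>. Tp \<omega> \<partial>M) < \<infinity>" and Tn_fin: "(\<integral>\<^sup>+\<omega>. Tn \<omega> \<partial>M) < \<infinity>"
  proof -
    have "(\<integral>\<^sup>+\<omega>. Tp \<omega> \<partial>M) \<le> (\<integral>\<^sup>+\<omega>. ennreal (1 / \<epsilon>) \<partial>M)"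
      by (rule nn_integral_mono_AE) (use ae in eventually_elim, elim conjE)
    then show "(\<integral>\<^sup>+\<omega>. Tp \<omega> \<partial>M) < \<infinity>" by (simp add: emeasure_space_1 le_less_trans)
    have "(\<integral>\<^sup>+\<omega>. Tn \<omega> \<partial>M) \<le> (\<integral>\<^sup>+\<omega>. ennreal (1 / \<epsilon>) \<partial>M)"
      by (rule nn_integral_mono_AE) (use ae in eventually_elim, elim conjE)
    then show "(\<integral>\<^sup>+\<omega>. Tn \<omega> \<partial>M) < \<infinity>" by (simp add: emeasure_space_1 le_less_trans)
  qed
  \<comment> \<open>Once jump sums are replaced by their compensators, both sides of the pathwise
    inequality contain the same \<open>R\<close>; cancelling it in \<open>ennreal\<close> requires
    it to be finite.\<close>
  define R where "R = (\<integral>\<^sup>+\<omega>. Tn \<omega> \<partial>M) + (\<integral>\<^sup>+\<omega>. Tp \<omega> \<partial>M)"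
  have "(\<integral>\<^sup>+\<omega>. X \<omega> \<partial>M) + R = (\<integral>\<^sup>+\<omega>. X \<omega> + (Sn \<omega> + Tp \<omega>) \<partial>M)"
    using Xm Snm Tpm by (simp add: nn_integral_add comp_n R_def)
  also have "\<dots> \<le> (\<integral>\<^sup>+\<omega>. ennreal c + (Sp \<omega> + Tn \<omega>) \<partial>M)"
    by (rule nn_integral_mono_AE) (use ae in eventually_elim, elim conjE)
  also have "\<dots> = ennreal c + R"
    using Spm Tnm by (simp add: nn_integral_add comp_p R_def emeasure_space_1 add.commute)
  finally have "(\<integral>\<^sup>+\<omega>. X \<omega> \<partial>M) + R \<le> ennreal c + R" .
  moreover have "R < \<infinity>" using Tp_fin Tn_fin by (simp add: R_def ennreal_add_less_top)
  ultimately show ?thesis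
    unfolding X_def by (auto simp: ennreal_add_left_cancel_le add.commute[of _ R])
qed

lemma disutility_us_le:
  assumes c: "\<And>\<omega>. \<omega> \<in> space M \<Longrightarrow> W 0 \<omega> = c"
  shows "(\<integral>\<^sup>+\<omega>. ennreal (disutility S us \<omega>) \<partial>M) \<le> ennreal c"
proof -
  define X where "X n \<omega> = ennreal (EE \<omega> * exp (- inverse (real (Suc n)) * AA (T, \<omega>)) * W T \<omega>)" for n \<omega>
  have lim: "(\<lambda>n. X n \<omega>) \<longlonglongrightarrow> ennreal (EE \<omega> * W T \<omega>)" for \<omega>
  proof -
    have "(\<lambda>n. EE \<omega> * exp (- inverse (real (Suc n)) * AA (T, \<omega>)) * W T \<omega>) \<longlonglongrightarrow> EE \<omega> * exp (- 0 * AA (T, \<omega>)) * W T \<omega>"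
      by (intro tendsto_intros LIMSEQ_inverse_real_of_nat)
    then show ?thesis unfolding X_def by (intro tendsto_ennrealI) simp
  qed
  have "(\<integral>\<^sup>+\<omega>. ennreal (disutility S us \<omega>) \<partial>M) = (\<integral>\<^sup>+\<omega>. liminf (\<lambda>n. X n \<omega>) \<partial>M)"
  proof (rule nn_integral_cong_AE)
    show "AE \<omega> in M. ennreal (disutility S us \<omega>) = liminf (\<lambda>n. X n \<omega>)"
      using AE_good
    proof eventually_elim
      case (elim \<omega>)
      have "liminf (\<lambda>n. X n \<omega>) = ennreal (EE \<omega> * W T \<omega>)"
        by (rule lim_imp_Liminf[OF _ lim]) simp
      \<comment> \<open>\<open>disutility_us\<close> was proved with a positive
        \<open>\<epsilon>\<close> fixed that does not occur in its equation; 1 is an arbitrary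
        choice.\<close>
      then show ?case using disutility_us[OF elim, of 1] by simp
    qed
  qed
  also have "\<dots> \<le> liminf (\<lambda>n. \<integral>\<^sup>+\<omega>. X n \<omega> \<partial>M)"
    by (rule nn_integral_liminf) (unfold X_def[abs_def], rule damped_measurable)
  also have "\<dots> \<le> ennreal c"
    unfolding X_def by (rule Liminf_le) (simp_all only: trivial_limit_sequentially not_False_eq_True, intro always_eventually allI damped_expectation c, simp_all)
  finally show ?thesis .
qed

text \<open>Admissibility becomes available only here: the bound by \<open>c\<close> makes the
  disutility integrable. The same constant lies below the expected disutility of every admissible
  strategy, so the infimum is attained.\<close>

lemma optimal_us: "optimal S us"
proof -
  obtain c where c: "\<And>\<omega>. \<omega> \<in> space M \<Longrightarrow> W 0 \<omega> = c"
    using HH_0_constant[OF W_adapted[of 0]] T_pos by auto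
  have c0: "0 \<le> c" using W_nonneg[of 0] T_pos not_empty c by force
  have m: "disutility S us \<in> borel_measurable M" by (rule disutility_measurable[OF us_predictable us_in])
  have pos: "0 \<le> disutility S u \<omega>" for u \<omega> by (simp add: disutility_def)
  have le: "(\<integral>\<^sup>+\<omega>. ennreal (disutility S us \<omega>) \<partial>M) \<le> ennreal c" by (rule disutility_us_le[OF c])
  have int: "integrable M (disutility S us)"
    by (rule integrableI_nonneg[OF m]) (use pos le in \<open>auto intro: le_less_trans\<close>)
  have adm: "us \<in> admissible S"
    using us_predictable us_in int by (auto simp: admissible_def case_prod_beta')
  have "ennreal (\<integral>\<omega>. disutility S us \<omega> \<partial>M) \<le> ennreal c"
    using le nn_integral_eq_integral[OF int] pos by simp
  then have us_le: "(\<integral>\<omega>. disutility S us \<omega> \<partial>M) \<le> c" using c0 by simp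
  have "(\<integral>\<omega>. disutility S us \<omega> \<partial>M) \<le> (\<integral>\<omega>. disutility S v \<omega> \<partial>M)" if "v \<in> admissible S" for v
    using us_le value_process_initial_le[OF W_value c that] by linarith
  then have "(\<integral>\<omega>. disutility S us \<omega> \<partial>M) = (INF v\<in>admissible S. \<integral>\<omega>. disutility S v \<omega> \<partial>M)"
    by (intro cInf_eq_minimum[symmetric]) (use adm in auto)
  then show ?thesis using adm by (simp add: optimal_def)
qed

end

theorem proposition6p1:
  fixes S :: "'a reinsurance_model"
    and W :: "real \<Rightarrow> 'a \<Rightarrow> real"
    and \<Theta> :: "real \<Rightarrow> 'a \<Rightarrow> real \<Rightarrow> real"
  assumes "contagion_model S" and "reinsurance_market S"
    and "value_process S W" and "bsde_solution S W \<Theta>"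
    and "\<And>a. 0 < a \<Longrightarrow> integrable (PP S) (\<lambda>\<omega>. exp (a * ell S (Z1 S 1 \<omega>)))"
    and "\<And>a. 0 < a \<Longrightarrow> integrable (PP S) (\<lambda>\<omega>. exp (a * Z1 S 1 \<omega>))"
    and "\<And>a. 0 < a \<Longrightarrow> integrable (PP S) (\<lambda>\<omega>. exp (a * Z2 S 1 \<omega>))"
    and "\<And>a. 0 < a \<Longrightarrow> integrable (PP S) (\<lambda>\<omega>. exp (a * (LBINT t:{0..horizon S}. rprem S t \<omega> (uM S))))"
    and "\<And>z. 0 \<le> z \<Longrightarrow> mono_on (UU S) (Phi S z)"
    and "\<And>u. u \<in> UU S \<Longrightarrow> AE z in F1 S. \<exists>D. has_deriv_in (UU S) (Phi S z) D u"
    and "\<And>t \<omega>. t \<in> {0..horizon S} \<Longrightarrow> \<omega> \<in> space (PP S) \<Longrightarrow>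
           strictly_concave_in (UU S) (f_tilde S (point_at W \<Theta> t \<omega>))"
    and "\<And>t \<omega>. t \<in> {0..horizon S} \<Longrightarrow> \<omega> \<in> space (PP S) \<Longrightarrow>
           differentiable_under_integral S (point_at W \<Theta> t \<omega>)"
  shows "optimal S (\<lambda>t \<omega>. u_hat S (point_at W \<Theta> t \<omega>)) \<and>
         (\<forall>m \<in> MM S - (R0 S \<union> R1 S).
           strictly_concave_in (UU S) (f_tilde S m) \<and> differentiable_under_integral S m \<longrightarrow>
             (\<exists>!u. u \<in> UU S \<and> first_order_condition S m u) \<and>
             u_bar S m \<in> UU S \<and> first_order_condition S m (u_bar S m) \<and>
             (deriv_in (UU S) (f_tilde S m) (uM S) \<noteq> 0 \<and> deriv_in (UU S) (f_tilde S m) (uN S) \<noteq> 0 \<longrightarrow>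
                uM S < u_bar S m \<and> u_bar S m < uN S))"
proof (intro conjI ballI impI)
  interpret control_problem S W \<Theta>
    using assms(1-4,11,12) by unfold_locales
  obtain G where G: "driver S W \<Theta> G" "\<forall>t\<in>{0..horizon S}. AE \<omega> in PP S.
      W t \<omega> = disutility S (\<lambda>_ _. uN S) \<omega> - compensated_integral S \<Theta> t (horizon S) \<omega> - (LBINT s:{t..horizon S}. G s \<omega>)"
    using assms(4) unfolding bsde_solution_def by blast
  interpret driven S W \<Theta> G
    by unfold_locales (use G in auto)
  have "us = (\<lambda>t \<omega>. u_hat S (point_at W \<Theta> t \<omega>))" by (simp add: us_def fun_eq_iff)
  then show "optimal S (\<lambda>t \<omega>. u_hat S (point_at W \<Theta> t \<omega>))" using optimal_us by simp
  fix m assume m: "m \<in> MM S - (R0 S \<union> R1 S)"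
    and "strictly_concave_in (UU S) (f_tilde S m) \<and> differentiable_under_integral S m"
  then have sol: "(\<exists>!u. u \<in> UU S \<and> first_order_condition S m u) \<and>
    u_bar S m \<in> UU S \<and> first_order_condition S m (u_bar S m) \<and>
    (deriv_in (UU S) (f_tilde S m) (uM S) \<noteq> 0 \<and> deriv_in (UU S) (f_tilde S m) (uN S) \<noteq> 0 \<longrightarrow>
      uM S < u_bar S m \<and> u_bar S m < uN S)"
    by (intro first_order_solution) auto
  show "\<exists>!u. u \<in> UU S \<and> first_order_condition S m u" using sol by (elim conjE)
  show "u_bar S m \<in> UU S" using sol by (elim conjE)
  show "first_order_condition S m (u_bar S m)" using sol by (elim conjE)
  assume ne: "deriv_in (UU S) (f_tilde S m) (uM S) \<noteq> 0 \<and> deriv_in (UU S) (f_tilde S m) (uN S) \<noteq> 0"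
  from sol have "deriv_in (UU S) (f_tilde S m) (uM S) \<noteq> 0 \<and> deriv_in (UU S) (f_tilde S m) (uN S) \<noteq> 0 \<longrightarrow>
      uM S < u_bar S m \<and> u_bar S m < uN S" by (elim conjE)
  from mp[OF this ne] have "uM S < u_bar S m \<and> u_bar S m < uN S" .
  then show "uM S < u_bar S m" "u_bar S m < uN S" by auto
qed

end
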